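(* Let $n\ge2$, and let $1<p_0<2$ be such that for every $0<\epsilon<1$ there is a constant $C_\epsilon$ with $$\lVert S_\tau\rVert_{L^{p_0}(\mathbb R^n)\to L^{p_0}(\mathbb R^n)}\le C_\epsilon\,\tau^{-\epsilon}\qquad\text{for all }0<\tau<1.$$ Then, for all $0<\delta<\tfrac{n-1}2$, the Bochner-Riesz operator $B_\delta$ on $\mathbb R^n$ satisfies $$\lVert B_\delta:(r,s)\rVert<\infty\qquad\text{whenever }\left(\tfrac1r,\tfrac1s\right)\in\mathbf R(n,p_0,\delta).$$ Moreover, with the critical value $p_\delta$ given by $\tfrac{n}{p_\delta}=\tfrac{n+1}2+\delta$, the property $\lVert B_\delta:(r,s)\rVert<\infty$ fails whenever $\tfrac1r+\tfrac1s>1$ and $\left(\tfrac1r,\tfrac1s\right)$ is not in the closure of $\mathbf R(n,p_\delta,\delta)$.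
   Context: For $\delta>0$, the Bochner-Riesz operator $B_\delta$ on $\mathbb R^n$ is the Fourier multiplier operator with symbol $(1-|\xi|^2)_+^\delta$, i.e. $\mathcal F B_\delta f(\xi)=(1-|\xi|^2)_+^\delta\,\mathcal F f(\xi)$, where $\mathcal F$ is a choice of Fourier transform. Fix a Schwartz function $\chi$ on $\mathbb R$ with $\mathbf 1_{[-1/4,1/4]}\le\chi\le\mathbf 1_{[-1/2,1/2]}$. For $0<\tau<1$, $S_\tau$ is the Fourier multiplier operator on $\mathbb R^n$ with symbol $\chi\left((|\xi|-1)/\tau\right)$. For $1<p<2$ with conjugate exponent $p'$ and $0<\delta<\tfrac{n-1}2$, $\mathbf R(n,p,\delta)\subset\mathbb R^2$ is the open trapezoid with vertices $$v_1=\left(\tfrac1{p'}\left(1-\tfrac{2\delta}{n-1}\right),\ \tfrac1{p}+\tfrac1{p'}\tfrac{2\delta}{n-1}\right),\qquad v_2=\left(\tfrac1{p'}+\tfrac1{p}\tfrac{2\delta}{n-1},\ \tfrac1{p}+\tfrac1{p'}\tfrac{2\delta}{n-1}\right),$$ $v_3=\overline{v_2}$ and $v_4=\overline{v_1}$, where $\overline{(a,b)}=(b,a)$. A collection $\mathcal S$ of cubes in $\mathbb R^n$ is called sparse if there are pairwise disjoint sets $\{E_S: S\in\mathcal S\}$ with $E_S\subset S$ and $|E_S|>\tfrac14|S|$ for all $S\in\mathcal S$. For a cube $Q$ and $1\le r<\infty$, set $\langle f\rangle_{Q,r}=\left(|Q|^{-1}\int_Q|f|^r\,dx\right)^{1/r}$.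 For a sparse collection $\mathcal S$, the $(r,s)$-sparse form is $$\Lambda_{\mathcal S,r,s}(f,g)=\sum_{S\in\mathcal S}|S|\,\langle f\rangle_{S,r}\langle g\rangle_{S,s}.$$ For a sublinear operator $T$ and $1\le r,s<\infty$, $\lVert T:(r,s)\rVert$ denotes the infimum of the constants $C$ such that for all bounded compactly supported functions $f,g$, $$|\langle Tf,g\rangle|\le C\sup_{\mathcal S}\Lambda_{\mathcal S,r,s}(f,g),$$ the supremum being over all sparse collections $\mathcal S$ (it is $+\infty$ if there is no such constant). *)

theory Defs
  imports "HOL-Analysis.Analysis"
begin

section \<open>Fourier multipliers\<close>

text \<open>
  The Fourier transform is normalised with \<open>2 \<pi>\<close> in the exponent, so that no constants occur in
  the inversion formula.
\<close>

definition fourier :: "(real ^ 'n \<Rightarrow> complex) \<Rightarrow> real ^ 'n \<Rightarrow> complex" where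
  "fourier f \<xi> = (\<integral>x. cis (- (2 * pi * (x \<bullet> \<xi>))) * f x \<partial>lebesgue)"

definition inverse_fourier :: "(real ^ 'n \<Rightarrow> complex) \<Rightarrow> real ^ 'n \<Rightarrow> complex" where
  "inverse_fourier F x = (\<integral>\<xi>. cis (2 * pi * (x \<bullet> \<xi>)) * F \<xi> \<partial>lebesgue)"

text \<open>
  All symbols used below are bounded and compactly supported. Hence for integrable \<open>f\<close> both
  integrals converge absolutely, and the operator is given pointwise by a bounded continuous
  function.
\<close>

definition multiplier_op ::
    "(real ^ 'n \<Rightarrow> real) \<Rightarrow> (real ^ 'n \<Rightarrow> complex) \<Rightarrow> real ^ 'n \<Rightarrow> complex" where
  "multiplier_op m f = inverse_fourier (\<lambda>\<xi>. of_real (m \<xi>) * fourier f \<xi>)"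

definition bochner_riesz :: "real \<Rightarrow> (real ^ 'n \<Rightarrow> complex) \<Rightarrow> real ^ 'n \<Rightarrow> complex" where
  "bochner_riesz \<delta> = multiplier_op (\<lambda>\<xi>. max 0 (1 - (norm \<xi>)\<^sup>2) powr \<delta>)"

definition schwartz :: "(real \<Rightarrow> real) \<Rightarrow> bool" where
  "schwartz f \<longleftrightarrow>
     (\<forall>m x. (deriv ^^ m) f field_differentiable (at x)) \<and>
     (\<forall>k m. bounded (range (\<lambda>x. x ^ k * (deriv ^^ m) f x)))"

definition annular_op ::
    "(real \<Rightarrow> real) \<Rightarrow> real \<Rightarrow> (real ^ 'n \<Rightarrow> complex) \<Rightarrow> real ^ 'n \<Rightarrow> complex" where
  "annular_op chi \<tau> = multiplier_op (\<lambda>\<xi>. chi ((norm \<xi> - 1) / \<tau>))"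


section \<open>Operator norms on Lebesgue spaces\<close>

definition Lp_fun :: "real \<Rightarrow> (real ^ 'n \<Rightarrow> complex) \<Rightarrow> bool" where
  "Lp_fun p f \<longleftrightarrow>
     f \<in> borel_measurable lebesgue \<and> integrable lebesgue (\<lambda>x. norm (f x) powr p)"

definition Lp_norm :: "real \<Rightarrow> (real ^ 'n \<Rightarrow> complex) \<Rightarrow> real" where
  "Lp_norm p f = (\<integral>x. norm (f x) powr p \<partial>lebesgue) powr (1 / p)"

text \<open>
  The norm of \<open>T\<close> from \<open>L\<^sup>p\<close> to \<open>L\<^sup>p\<close>, for \<open>1 \<le> p < \<infinity>\<close>, is computed on the dense subspace
  \<open>L\<^sup>1 \<inter> L\<^sup>p\<close>, where the integrals defining a multiplier operator make sense. It is \<open>\<infinity>\<close> if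
  \<open>T\<close> has no bounded extension.
\<close>

definition Lp_op_norm ::
    "real \<Rightarrow> ((real ^ 'n \<Rightarrow> complex) \<Rightarrow> real ^ 'n \<Rightarrow> complex) \<Rightarrow> ennreal" where
  "Lp_op_norm p T = Inf {ennreal C | C. 0 \<le> C \<and>
     (\<forall>f. Lp_fun 1 f \<and> Lp_fun p f \<longrightarrow>
        Lp_fun p (T f) \<and> Lp_norm p (T f) \<le> C * Lp_norm p f)}"


section \<open>Sparse forms\<close>

text \<open>Cubes are closed, nondegenerate and have sides parallel to the axes.\<close>

definition cube :: "(real ^ 'n) set \<Rightarrow> bool" where
  "cube Q \<longleftrightarrow> (\<exists>a l. 0 < l \<and> Q = cbox a (\<chi> i. a $ i + l))"

definition sparse :: "(real ^ 'n) set set \<Rightarrow> bool" where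
  "sparse \<S> \<longleftrightarrow> (\<forall>S\<in>\<S>. cube S) \<and>
     (\<exists>E. disjoint_family_on E \<S> \<and>
        (\<forall>S\<in>\<S>. E S \<in> sets lebesgue \<and> E S \<subseteq> S \<and>
                measure lebesgue (E S) > 1 / 4 * measure lebesgue S))"

definition cube_avg :: "(real ^ 'n) set \<Rightarrow> real \<Rightarrow> (real ^ 'n \<Rightarrow> complex) \<Rightarrow> real" where
  "cube_avg Q r f =
     (inverse (measure lebesgue Q) * (LINT x:Q|lebesgue. norm (f x) powr r)) powr (1 / r)"

definition sparse_form ::
    "(real ^ 'n) set set \<Rightarrow> real \<Rightarrow> real \<Rightarrow>
     (real ^ 'n \<Rightarrow> complex) \<Rightarrow> (real ^ 'n \<Rightarrow> complex) \<Rightarrow> ennreal" where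
  "sparse_form \<S> r s f g =
     (\<Sum>\<^sub>\<infinity>S\<in>\<S>. ennreal (measure lebesgue S * cube_avg S r f * cube_avg S s g))"

definition bounded_compact_support :: "(real ^ 'n \<Rightarrow> complex) \<Rightarrow> bool" where
  "bounded_compact_support f \<longleftrightarrow>
     f \<in> borel_measurable lebesgue \<and> bounded (range f) \<and> compact (closure {x. f x \<noteq> 0})"

definition pairing :: "(real ^ 'n \<Rightarrow> complex) \<Rightarrow> (real ^ 'n \<Rightarrow> complex) \<Rightarrow> complex" where
  "pairing f g = (\<integral>x. f x * cnj (g x) \<partial>lebesgue)"

text \<open>
  The supremum of the sparse forms may be \<open>\<infinity>\<close>, in which case the bound is void for \<open>C > 0\<close>.
  The norm itself is \<open>\<infinity>\<close> if there is no admissible \<open>C\<close>.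
\<close>

definition sparse_norm ::
    "((real ^ 'n \<Rightarrow> complex) \<Rightarrow> real ^ 'n \<Rightarrow> complex) \<Rightarrow> real \<Rightarrow> real \<Rightarrow> ennreal" where
  "sparse_norm T r s = Inf {ennreal C | C. 0 \<le> C \<and>
     (\<forall>f g. bounded_compact_support f \<and> bounded_compact_support g \<longrightarrow>
        ennreal (cmod (pairing (T f) g))
          \<le> ennreal C * (SUP \<S>\<in>{\<S>. sparse \<S>}. sparse_form \<S> r s f g))}"


section \<open>The trapezoid\<close>

definition conj_exponent :: "real \<Rightarrow> real" where
  "conj_exponent p = p / (p - 1)"

definition trapezoid_v1 :: "nat \<Rightarrow> real \<Rightarrow> real \<Rightarrow> real \<times> real" where
  "trapezoid_v1 n p \<delta> =
     (1 / conj_exponent p * (1 - 2 * \<delta> / (real n - 1)),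
      1 / p + 1 / conj_exponent p * (2 * \<delta> / (real n - 1)))"

definition trapezoid_v2 :: "nat \<Rightarrow> real \<Rightarrow> real \<Rightarrow> real \<times> real" where
  "trapezoid_v2 n p \<delta> =
     (1 / conj_exponent p + 1 / p * (2 * \<delta> / (real n - 1)),
      1 / p + 1 / conj_exponent p * (2 * \<delta> / (real n - 1)))"

definition trapezoid :: "nat \<Rightarrow> real \<Rightarrow> real \<Rightarrow> (real \<times> real) set" where
  "trapezoid n p \<delta> = interior (convex hull
     {trapezoid_v1 n p \<delta>, trapezoid_v2 n p \<delta>,
      prod.swap (trapezoid_v2 n p \<delta>), prod.swap (trapezoid_v1 n p \<delta>)})"

end

theory Submission
  imports Defs "HOL-Complex_Analysis.Complex_Analysis" "HOL-Real_Asymp.Real_Asymp"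
begin

text \<open>
  Sufficiency. At distance about \<open>L = 2\<^sup>k\<close> from the diagonal the kernel of \<open>B\<^sub>\<delta>\<close> is of size
  \<open>L\<close> to the power \<open>- (n + 1) / 2 - \<delta>\<close>. Writing \<open>(1 - |\<xi>|\<^sup>2)\<^sub>+\<^sup>\<delta>\<close> near the sphere as an integral of
  \<open>\<sigma>\<^sup>\<delta>\<close> times annular bumps of width \<open>\<sigma>\<close> with respect to \<open>d\<sigma> / \<sigma>\<close>, the bumps with \<open>\<sigma>\<close> much larger
  than \<open>1 / L\<close> are negligible there, and the hypothesis on \<open>S\<^sub>\<tau>\<close> bounds the others on \<open>L\<^sup>p\<close> by almost
  \<open>L\<close> to the power \<open>- \<delta>\<close>. Interpolating on cubes of side \<open>L\<close> between \<open>(p, p')\<close>, \<open>(p', p)\<close> and \<open>(1, 1)\<close>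
  gives geometric decay in \<open>k\<close> exactly in the open trapezoid. The cubes of one scale form boundedly
  many sparse families, and because the bound allows the supremum over all sparse families, the
  scales can simply be added.

  Necessity. The asymptotics of the kernel show that it does not oscillate on differences of two
  sets at mutual distance about \<open>R\<close> whose distances are confined to small neighbourhoods of
  a translate of the integers. Any cube meeting both sets has side at least a multiple of \<open>R\<close>, so
  all sparse forms of their indicators are bounded by one power of \<open>R\<close>. A union of thin shells against
  a small ball yields \<open>1 / s, 1 / r \<le> 1 / p\<^sub>\<delta>\<close>, and two stacks of planks of width \<open>R\<^sup>1\<^sup>/\<^sup>2\<close> yield
  \<open>1 / r + 1 / s \<le> 1 + 2 \<delta> / (n - 1)\<close>.
\<close>

no_notation fps_nth (infixl "$" 75)


section \<open>Forms and kernels of Fourier multipliers\<close>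

text \<open>The cutoff \<open>chi\<close> in the hypothesis is prescribed, so it cannot be replaced
  by a convenient partition of unity; the same bump is averaged over all widths, which reproduces
  powers of the distance to the sphere exactly. The hypothesis concerns annuli centred on the unit
  sphere, while the bumps must lie inside the ball, so each is centred at radius
  \<open>1 - \<sigma>\<close> and dilated back. The number \<open>2 * \<delta> / (n - 1)\<close>
  comes from one comparison. Normalised by averages over a cube of side \<open>L\<close>, the (p,
  p') bound gains almost \<open>L powr - \<delta>\<close>, while the kernel bound times the volume
  loses \<open>L powr ((n - 1) / 2 - \<delta>)\<close>. A geometric mean with weight
  \<open>\<theta>\<close> on the second decays iff \<open>\<theta> < 2 * \<delta> / (n - 1)\<close>.
  The room left by an open region pays for the \<epsilon> of the hypothesis and for summing over
  dyadic level sets. In the converse direction cubes of infinitely many scales may meet both test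
  sets; \<open>1 / r + 1 / s > 1\<close> makes the large ones contribute no more than the smallest
  admissible scale.\<close>

lemma sigma_finite_lebesgue: "sigma_finite_measure (lebesgue :: 'a::euclidean_space measure)"
proof
  obtain A :: "'a set set" where A: "countable A" "A \<subseteq> sets lborel" "\<Union>A = space lborel"
    "\<forall>a\<in>A. emeasure lborel a \<noteq> \<infinity>"
    using lborel.sigma_finite_countable by blast
  then show "\<exists>A::'a set set. countable A \<and> A \<subseteq> sets lebesgue \<and> \<Union>A = space lebesgue \<and>
      (\<forall>a\<in>A. emeasure lebesgue a \<noteq> \<infinity>)"
    by (intro exI[of _ A]) (auto simp: subset_iff)
qed

interpretation lebesgue: sigma_finite_measure "lebesgue :: 'a::euclidean_space measure"
  by (rule sigma_finite_lebesgue)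

interpretation lebesgue_pair: pair_sigma_finite "lebesgue :: 'a::euclidean_space measure"
  "lebesgue :: 'b::euclidean_space measure" ..

lemma id_borel_measurable_lebesgue:
  "(\<lambda>x::'a::euclidean_space. x) \<in> borel_measurable lebesgue"
  by (simp add: measurable_completion)

lemma fst_borel_measurable_lebesgue:
  "fst \<in> borel_measurable ((lebesgue :: 'a::euclidean_space measure) \<Otimes>\<^sub>M M)"
  by (rule measurable_compose[OF measurable_fst id_borel_measurable_lebesgue])

lemma snd_borel_measurable_lebesgue:
  "snd \<in> borel_measurable (M \<Otimes>\<^sub>M (lebesgue :: 'a::euclidean_space measure))"
  by (rule measurable_compose[OF measurable_snd id_borel_measurable_lebesgue])

lemma measurable_cis [measurable (raw)]:
  "f \<in> borel_measurable M \<Longrightarrow> (\<lambda>x. cis (f x)) \<in> borel_measurable M"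
  by (rule borel_measurable_continuous_on[OF continuous_on_cis[OF continuous_on_id]])

text \<open>Fubini is applied three times below to integrands of this shape: integrable functions of
  separate variables times a factor of modulus at most 1, which is an exponential or a truncated
  symbol.\<close>

lemma integrable_product:
  fixes f :: "'a::euclidean_space \<Rightarrow> complex" and g :: "'b::euclidean_space \<Rightarrow> complex"
  assumes f: "integrable lebesgue f" and g: "integrable lebesgue g"
    and k [measurable]: "(\<lambda>p. k (fst p) (snd p)) \<in> borel_measurable (lebesgue \<Otimes>\<^sub>M lebesgue)"
    and k1: "\<And>x y. cmod (k x y) \<le> 1"
  shows "integrable (lebesgue \<Otimes>\<^sub>M lebesgue) (\<lambda>(x, y). k x y * f x * g y)"
proof (rule lebesgue_pair.Fubini_integrable)
  have [measurable]: "f \<in> borel_measurable lebesgue" "g \<in> borel_measurable lebesgue"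
    using f g by auto
  have km: "k x \<in> borel_measurable lebesgue" for x
    using measurable_compose[OF measurable_Pair1' k, of x] by simp
  show m: "(\<lambda>(x, y). k x y * f x * g y) \<in> borel_measurable (lebesgue \<Otimes>\<^sub>M lebesgue)"
    unfolding case_prod_beta by measurable
  have int: "integrable lebesgue (\<lambda>y. k x y * f x * g y)" for x
  proof (rule Bochner_Integration.integrable_bound)
    show "integrable lebesgue (\<lambda>y. f x * g y)" using g by simp
    show "(\<lambda>y. k x y * f x * g y) \<in> borel_measurable lebesgue"
      using km[of x] by measurable
    show "AE y in lebesgue. norm (k x y * f x * g y) \<le> norm (f x * g y)"
      using mult_right_mono[OF k1[of x], of "norm (f x * g y)" for y]
      by (auto simp: norm_mult mult.assoc)
  qed
  show "AE x in lebesgue. integrable lebesgue (\<lambda>y. case (x, y) of (x, y) \<Rightarrow> k x y * f x * g y)"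
    using int by simp
  have nm: "(\<lambda>(x, y). norm (k x y * f x * g y)) \<in> borel_measurable (lebesgue \<Otimes>\<^sub>M lebesgue)"
    unfolding case_prod_beta by measurable
  show "integrable lebesgue (\<lambda>x. \<integral>y. norm (case (x, y) of (x, y) \<Rightarrow> k x y * f x * g y) \<partial>lebesgue)"
  proof (rule Bochner_Integration.integrable_bound)
    show "integrable lebesgue (\<lambda>x. norm (f x) * (\<integral>y. norm (g y) \<partial>lebesgue))"
      using f by (intro integrable_mult_left integrable_norm)
    show "(\<lambda>x. \<integral>y. norm (case (x, y) of (x, y) \<Rightarrow> k x y * f x * g y) \<partial>lebesgue) \<in> borel_measurable lebesgue"
      using lebesgue.borel_measurable_lebesgue_integral[OF nm] by simp
    have "(\<integral>y. norm (k x y * f x * g y) \<partial>lebesgue) \<le> norm (f x) * (\<integral>y. norm (g y) \<partial>lebesgue)" for x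
    proof -
      have "(\<integral>y. norm (k x y * f x * g y) \<partial>lebesgue) \<le> (\<integral>y. norm (f x) * norm (g y) \<partial>lebesgue)"
      proof (rule integral_mono)
        show "integrable lebesgue (\<lambda>y. norm (k x y * f x * g y))" using int[of x] by (rule integrable_norm)
        show "integrable lebesgue (\<lambda>y. norm (f x) * norm (g y))" using g by simp
        show "norm (k x y * f x * g y) \<le> norm (f x) * norm (g y)" for y
          using mult_right_mono[OF k1[of x y], of "norm (f x) * norm (g y)"] by (simp add: norm_mult mult.assoc)
      qed
      then show ?thesis by simp
    qed
    then show "AE x in lebesgue. norm (\<integral>y. norm (case (x, y) of (x, y) \<Rightarrow> k x y * f x * g y) \<partial>lebesgue)
        \<le> norm (norm (f x) * (\<integral>y. norm (g y) \<partial>lebesgue))"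
      by (auto intro!: AE_I2 simp: abs_mult integral_nonneg_AE)
  qed
qed

lemma measurable_fourier:
  assumes [measurable]: "f \<in> borel_measurable lebesgue"
  shows "fourier f \<in> borel_measurable lebesgue"
proof -
  note [measurable] = fst_borel_measurable_lebesgue snd_borel_measurable_lebesgue
  have "(\<lambda>(\<xi>, x). cis (- (2 * pi * (x \<bullet> \<xi>))) * f x) \<in> borel_measurable (lebesgue \<Otimes>\<^sub>M lebesgue)"
    unfolding case_prod_beta by measurable
  from lebesgue.borel_measurable_lebesgue_integral[OF this]
  show ?thesis by (simp add: fourier_def[abs_def])
qed

lemma integrable_fourier_integrand:
  assumes "integrable lebesgue (f :: real ^ 'n \<Rightarrow> complex)"
  shows "integrable lebesgue (\<lambda>x. cis (c * (x \<bullet> \<xi>)) * f x)"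
proof (rule Bochner_Integration.integrable_bound[OF assms])
  note [measurable] = id_borel_measurable_lebesgue borel_measurable_integrable[OF assms]
  show "(\<lambda>x. cis (c * (x \<bullet> \<xi>)) * f x) \<in> borel_measurable lebesgue" by measurable
qed (auto simp: norm_mult)

lemma fourier_add:
  "integrable lebesgue f \<Longrightarrow> integrable lebesgue g \<Longrightarrow>
   fourier (\<lambda>x. f x + g x) \<xi> = fourier f \<xi> + fourier g \<xi>"
  using integrable_fourier_integrand[of f "-2*pi" \<xi>] integrable_fourier_integrand[of g "-2*pi" \<xi>]
  by (simp add: fourier_def distrib_left mult.assoc)

lemma norm_fourier_le:
  "cmod (fourier f \<xi>) \<le> (\<integral>x. cmod (f x) \<partial>lebesgue)"
  unfolding fourier_def using integral_norm_bound[of lebesgue "\<lambda>x. cis (- (2 * pi * (x \<bullet> \<xi>))) * f x"]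
  by (simp add: norm_mult)

definition kernel :: "(real ^ 'n \<Rightarrow> real) \<Rightarrow> real ^ 'n \<Rightarrow> complex" where
  "kernel m = inverse_fourier (\<lambda>\<xi>. of_real (m \<xi>))"

lemma integrable_mult_fourier:
  assumes m: "integrable lebesgue (m :: real ^ 'n \<Rightarrow> real)" and f: "integrable lebesgue f"
  shows "integrable lebesgue (\<lambda>\<xi>. of_real (m \<xi>) * fourier f \<xi>)"
proof (rule Bochner_Integration.integrable_bound)
  show "integrable lebesgue (\<lambda>\<xi>. m \<xi> * (\<integral>x. cmod (f x) \<partial>lebesgue))" using m by simp
  show "(\<lambda>\<xi>. complex_of_real (m \<xi>) * fourier f \<xi>) \<in> borel_measurable lebesgue"
    using m measurable_fourier[of f] f by (auto intro!: borel_measurable_times)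
  show "AE \<xi> in lebesgue. norm (complex_of_real (m \<xi>) * fourier f \<xi>)
      \<le> norm (m \<xi> * (\<integral>x. cmod (f x) \<partial>lebesgue))"
    using norm_fourier_le[of f]
    by (auto intro!: AE_I2 mult_left_mono order_trans[OF norm_fourier_le] simp: norm_mult abs_mult)
qed

text \<open>Parseval's identity for integrable functions, by Fubini: an integrable symbol makes the
  double integral absolutely convergent. On the frequency side the form is visibly linear in the
  symbol, which allows the symbol to be split and superposed.\<close>

theorem pairing_multiplier_op:
  assumes m: "integrable lebesgue (m :: real ^ 'n \<Rightarrow> real)"
    and f: "integrable lebesgue f" and g: "integrable lebesgue g"
  shows "pairing (multiplier_op m f) g = (\<integral>\<xi>. of_real (m \<xi>) * fourier f \<xi> * cnj (fourier g \<xi>) \<partial>lebesgue)"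
proof -
  note [measurable] = fst_borel_measurable_lebesgue snd_borel_measurable_lebesgue
  define h where "h \<xi> = of_real (m \<xi>) * fourier f \<xi>" for \<xi>
  have h: "integrable lebesgue h" using integrable_mult_fourier[OF m f] by (simp add: h_def[abs_def])
  have "pairing (multiplier_op m f) g =
      (\<integral>x. (\<integral>\<xi>. cis (2 * pi * (x \<bullet> \<xi>)) * cnj (g x) * h \<xi> \<partial>lebesgue) \<partial>lebesgue)"
    unfolding pairing_def multiplier_op_def inverse_fourier_def h_def[symmetric]
    by (subst integral_mult_left_zero[symmetric]) (simp add: mult_ac)
  also have "\<dots> = (\<integral>\<xi>. (\<integral>x. cis (2 * pi * (x \<bullet> \<xi>)) * cnj (g x) * h \<xi> \<partial>lebesgue) \<partial>lebesgue)"
  proof (rule lebesgue_pair.Fubini_integral[symmetric])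
    have gc: "integrable lebesgue (\<lambda>x. cnj (g x))" using g by simp
    have k: "(\<lambda>p :: (real ^ 'n) \<times> (real ^ 'n). cis (2 * pi * (fst p \<bullet> snd p))) \<in> borel_measurable (lebesgue \<Otimes>\<^sub>M lebesgue)"
      by measurable
    show "integrable (lebesgue \<Otimes>\<^sub>M lebesgue) (\<lambda>(x, \<xi>). cis (2 * pi * (x \<bullet> \<xi>)) * cnj (g x) * h \<xi>)"
      by (rule integrable_product[OF gc h k]) simp
  qed
  also have "\<dots> = (\<integral>\<xi>. h \<xi> * cnj (fourier g \<xi>) \<partial>lebesgue)"
  proof (rule Bochner_Integration.integral_cong[OF refl])
    fix \<xi>
    have "cnj (fourier g \<xi>) = (\<integral>x. cis (2 * pi * (x \<bullet> \<xi>)) * cnj (g x) \<partial>lebesgue)"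
      unfolding fourier_def
      by (rule trans[OF Bochner_Integration.integral_cnj[symmetric]]) (simp add: cis_cnj)
    then show "(\<integral>x. cis (2 * pi * (x \<bullet> \<xi>)) * cnj (g x) * h \<xi> \<partial>lebesgue) = h \<xi> * cnj (fourier g \<xi>)"
      by (simp add: mult_ac)
  qed
  finally show ?thesis by (simp add: h_def)
qed

text \<open>The same interchange of integrals, applied to the inner Fourier transform. It is the
  passage from pointwise bounds for the kernel to bounds for the form.\<close>

theorem multiplier_op_kernel:
  assumes m: "integrable lebesgue (m :: real ^ 'n \<Rightarrow> real)" and f: "integrable lebesgue f"
  shows "multiplier_op m f x = (\<integral>y. kernel m (x - y) * f y \<partial>lebesgue)"
proof -
  note [measurable] = fst_borel_measurable_lebesgue snd_borel_measurable_lebesgue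
  have mc: "integrable lebesgue (\<lambda>\<xi>. complex_of_real (m \<xi>))" using m by simp
  have "multiplier_op m f x =
      (\<integral>\<xi>. (\<integral>y. cis (2 * pi * ((x - y) \<bullet> \<xi>)) * of_real (m \<xi>) * f y \<partial>lebesgue) \<partial>lebesgue)"
    unfolding multiplier_op_def inverse_fourier_def
  proof (rule Bochner_Integration.integral_cong[OF refl])
    fix \<xi>
    have "cis (2 * pi * (x \<bullet> \<xi>)) * (of_real (m \<xi>) * fourier f \<xi>) =
        (\<integral>y. cis (2 * pi * (x \<bullet> \<xi>)) * of_real (m \<xi>) * (cis (- (2 * pi * (y \<bullet> \<xi>))) * f y) \<partial>lebesgue)"
      by (simp add: fourier_def mult.assoc)
    also have "\<dots> = (\<integral>y. cis (2 * pi * ((x - y) \<bullet> \<xi>)) * of_real (m \<xi>) * f y \<partial>lebesgue)"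
    proof (rule Bochner_Integration.integral_cong[OF refl])
      fix y
      have "cis (2 * pi * ((x - y) \<bullet> \<xi>)) = cis (2 * pi * (x \<bullet> \<xi>)) * cis (- (2 * pi * (y \<bullet> \<xi>)))"
        unfolding cis_mult by (simp add: inner_diff_left algebra_simps)
      then show "cis (2 * pi * (x \<bullet> \<xi>)) * of_real (m \<xi>) * (cis (- (2 * pi * (y \<bullet> \<xi>))) * f y) =
          cis (2 * pi * ((x - y) \<bullet> \<xi>)) * of_real (m \<xi>) * f y" by (simp only: mult_ac)
    qed
    finally show "cis (2 * pi * (x \<bullet> \<xi>)) * (of_real (m \<xi>) * fourier f \<xi>) =
        (\<integral>y. cis (2 * pi * ((x - y) \<bullet> \<xi>)) * of_real (m \<xi>) * f y \<partial>lebesgue)" .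
  qed
  also have "\<dots> = (\<integral>y. (\<integral>\<xi>. cis (2 * pi * ((x - y) \<bullet> \<xi>)) * of_real (m \<xi>) * f y \<partial>lebesgue) \<partial>lebesgue)"
  proof (rule lebesgue_pair.Fubini_integral[symmetric])
    have k: "(\<lambda>p :: (real ^ 'n) \<times> (real ^ 'n). cis (2 * pi * ((x - snd p) \<bullet> fst p))) \<in> borel_measurable (lebesgue \<Otimes>\<^sub>M lebesgue)"
      by measurable
    show "integrable (lebesgue \<Otimes>\<^sub>M lebesgue) (\<lambda>(\<xi>, y). cis (2 * pi * ((x - y) \<bullet> \<xi>)) * of_real (m \<xi>) * f y)"
      by (rule integrable_product[OF mc f k]) simp
  qed
  also have "\<dots> = (\<integral>y. kernel m (x - y) * f y \<partial>lebesgue)"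
    by (simp add: kernel_def inverse_fourier_def)
  finally show ?thesis .
qed

text \<open>Only differences between the two supports enter, so for separated supports
  \<open>B\<close> may be the size of the kernel at that distance. This is the (1, 1) endpoint of
  the interpolation.\<close>

lemma norm_pairing_le_kernel:
  assumes m: "integrable lebesgue (m :: real ^ 'n \<Rightarrow> real)"
    and f: "integrable lebesgue f" and g: "integrable lebesgue g" and "0 \<le> B"
    and B: "\<And>x y. g x \<noteq> 0 \<Longrightarrow> f y \<noteq> 0 \<Longrightarrow> cmod (kernel m (x - y)) \<le> B"
  shows "cmod (pairing (multiplier_op m f) g) \<le>
    B * (\<integral>x. cmod (f x) \<partial>lebesgue) * (\<integral>x. cmod (g x) \<partial>lebesgue)"
proof -
  have *: "cmod (multiplier_op m f x) \<le> B * (\<integral>x. cmod (f x) \<partial>lebesgue)" if "g x \<noteq> 0" for x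
  proof -
    have le: "cmod (kernel m (x - y) * f y) \<le> B * cmod (f y)" for y
      using B[OF that, of y] by (cases "f y = 0") (auto simp: norm_mult intro: mult_right_mono)
    have "cmod (multiplier_op m f x) \<le> (\<integral>y. B * cmod (f y) \<partial>lebesgue)"
      unfolding multiplier_op_kernel[OF m f]
    proof (rule order_trans[OF integral_norm_bound], rule integral_mono')
      show "integrable lebesgue (\<lambda>y. B * cmod (f y))" using f by simp
    qed (use le \<open>0 \<le> B\<close> in auto)
    then show ?thesis by simp
  qed
  have "cmod (pairing (multiplier_op m f) g) \<le> (\<integral>x. (B * (\<integral>x. cmod (f x) \<partial>lebesgue)) * cmod (g x) \<partial>lebesgue)"
    unfolding pairing_def
  proof (rule order_trans[OF integral_norm_bound], rule integral_mono')
    show "integrable lebesgue (\<lambda>x. B * (\<integral>x. cmod (f x) \<partial>lebesgue) * cmod (g x))" using g by simp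
    fix x
    show "cmod (multiplier_op m f x * cnj (g x)) \<le> B * (\<integral>x. cmod (f x) \<partial>lebesgue) * cmod (g x)"
      using *[of x] by (cases "g x = 0") (auto simp: norm_mult intro!: mult_right_mono)
    show "0 \<le> B * (\<integral>x. cmod (f x) \<partial>lebesgue) * cmod (g x)"
      using \<open>0 \<le> B\<close> by (auto intro!: mult_nonneg_nonneg integral_nonneg_AE)
  qed
  then show ?thesis by simp
qed

text \<open>Real symbols give self-adjoint operators. Later this yields the bound with exponents
  (p', p) from the one with (p, p').\<close>

lemma pairing_multiplier_op_commute:
  assumes "integrable lebesgue (m :: real ^ 'n \<Rightarrow> real)" "integrable lebesgue f" "integrable lebesgue g"
  shows "pairing (multiplier_op m g) f = cnj (pairing (multiplier_op m f) g)"
  unfolding pairing_multiplier_op[OF assms(1,3,2)] pairing_multiplier_op[OF assms]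
  by (rule trans[OF _ Bochner_Integration.integral_cnj]) (simp add: mult_ac)

lemma pairing_multiplier_op_add_left:
  assumes m: "integrable lebesgue (m :: real ^ 'n \<Rightarrow> real)" and f: "integrable lebesgue f" "integrable lebesgue f'"
    and g: "integrable lebesgue g"
  shows "pairing (multiplier_op m (\<lambda>x. f x + f' x)) g = pairing (multiplier_op m f) g + pairing (multiplier_op m f') g"
proof -
  have int: "integrable lebesgue (\<lambda>\<xi>. of_real (m \<xi>) * fourier f \<xi> * cnj (fourier g \<xi>))"
    if f: "integrable lebesgue f" for f :: "real ^ 'n \<Rightarrow> complex"
  proof (rule Bochner_Integration.integrable_bound)
    show "integrable lebesgue (\<lambda>\<xi>. of_real (m \<xi>) * fourier f \<xi> * of_real (\<integral>x. cmod (g x) \<partial>lebesgue))"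
      using integrable_mult_fourier[OF m f] by simp
    show "(\<lambda>\<xi>. complex_of_real (m \<xi>) * fourier f \<xi> * cnj (fourier g \<xi>)) \<in> borel_measurable lebesgue"
      using borel_measurable_integrable[OF integrable_mult_fourier[OF m f]] measurable_fourier[of g] g
      by (intro borel_measurable_times[of "\<lambda>\<xi>. of_real (m \<xi>) * fourier f \<xi>"]
          borel_measurable_continuous_on[of cnj "fourier g"] continuous_intros) auto
    show "AE \<xi> in lebesgue. norm (of_real (m \<xi>) * fourier f \<xi> * cnj (fourier g \<xi>))
       \<le> norm (of_real (m \<xi>) * fourier f \<xi> * complex_of_real (\<integral>x. cmod (g x) \<partial>lebesgue))"
      by (auto intro!: AE_I2 mult_left_mono order_trans[OF norm_fourier_le] simp: norm_mult abs_mult)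
  qed
  show ?thesis
    using int[OF f(1)] int[OF f(2)]
    by (simp add: pairing_multiplier_op[OF m _ g] f fourier_add[OF f] distrib_left distrib_right)
qed

lemma pairing_multiplier_op_zero_left: "pairing (multiplier_op m (\<lambda>x. 0)) g = 0"
  by (simp add: pairing_def multiplier_op_def fourier_def inverse_fourier_def)

lemma pairing_multiplier_op_sum_left:
  assumes m: "integrable lebesgue (m :: real ^ 'n \<Rightarrow> real)"
    and f: "\<And>i. i \<in> I \<Longrightarrow> integrable lebesgue (f i)" and g: "integrable lebesgue g"
  shows "pairing (multiplier_op m (\<lambda>x. \<Sum>i\<in>I. f i x)) g = (\<Sum>i\<in>I. pairing (multiplier_op m (f i)) g)"
  using f
proof (induction I rule: infinite_finite_induct)
  case (insert i I)
  then show ?case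
    using pairing_multiplier_op_add_left[OF m, of "f i" "\<lambda>x. \<Sum>i\<in>I. f i x" g] g by auto
qed (auto simp: pairing_multiplier_op_zero_left)

lemma pairing_multiplier_op_sum_right:
  assumes m: "integrable lebesgue (m :: real ^ 'n \<Rightarrow> real)"
    and f: "\<And>i. i \<in> I \<Longrightarrow> integrable lebesgue (f i)" and g: "integrable lebesgue g"
  shows "pairing (multiplier_op m g) (\<lambda>x. \<Sum>i\<in>I. f i x) = (\<Sum>i\<in>I. pairing (multiplier_op m g) (f i))"
proof -
  have "integrable lebesgue (\<lambda>x. \<Sum>i\<in>I. f i x)" using f by auto
  from pairing_multiplier_op_commute[OF m this g]
  have "pairing (multiplier_op m g) (\<lambda>x. \<Sum>i\<in>I. f i x) = (\<Sum>i\<in>I. cnj (pairing (multiplier_op m (f i)) g))"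
    by (simp add: pairing_multiplier_op_sum_left[OF m f g])
  also have "\<dots> = (\<Sum>i\<in>I. pairing (multiplier_op m g) (f i))"
    using f by (intro sum.cong refl) (simp add: pairing_multiplier_op_commute[OF m _ g])
  finally show ?thesis .
qed

lemma integrable_bounded_compact_support:
  assumes "bounded_compact_support f"
  shows "integrable lebesgue f"
proof -
  obtain B where B: "\<And>x. cmod (f x) \<le> B" using assms
    by (auto simp: bounded_compact_support_def bounded_iff)
  define K where "K = closure {x. f x \<noteq> 0}"
  have K: "compact K" using assms by (simp add: K_def bounded_compact_support_def)
  have "integrable lebesgue (\<lambda>x. B * indicator K x)"
    using lmeasurable_compact[OF K]
    by (intro integrable_mult_right integrable_real_indicator) (auto simp: fmeasurable_def)
  then show ?thesis
  proof (rule Bochner_Integration.integrable_bound)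
    show "f \<in> borel_measurable lebesgue" using assms by (simp add: bounded_compact_support_def)
    show "AE x in lebesgue. norm (f x) \<le> norm (B * indicator K x)"
    proof (intro AE_I2)
      fix x show "norm (f x) \<le> norm (B * indicator K x)"
      proof (cases "f x = 0")
        case False
        then have "x \<in> K" unfolding K_def by (intro subsetD[OF closure_subset]) simp
        then show ?thesis using B[of x] by auto
      qed auto
    qed
  qed
qed


section \<open>An oscillatory integral\<close>

text \<open>Poisson's integral: up to a constant this is the Bessel function of order
  \<open>a + 1 / 2\<close> at \<open>2 * pi * \<rho>\<close>, divided by
  \<open>\<rho> powr (a + 1 / 2)\<close>.\<close>

definition osc :: "real \<Rightarrow> real \<Rightarrow> complex" where
  "osc a \<rho> = (\<integral>s. cis (2 * pi * \<rho> * s) * of_real (max 0 (1 - s\<^sup>2) powr a) \<partial>lborel)"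

text \<open>
  On the side \<open>z = 1 + \<i> t\<close> of the rectangle above \<open>{-1..1}\<close> one has \<open>1 - z\<^sup>2 = t (t - 2 \<i>)\<close>.
\<close>

definition osc_leg :: "real \<Rightarrow> real \<Rightarrow> complex" where
  "osc_leg a \<rho> = integral {0..1} (\<lambda>t. of_real (exp (- 2 * pi * \<rho> * t) * t powr a) * (of_real t - 2 * \<i>) powr of_real a)"

lemma integrable_osc:
  assumes "a > 0"
  shows "integrable lborel (\<lambda>s. cis (2 * pi * \<rho> * s) * complex_of_real (max 0 (1 - s\<^sup>2) powr a))"
    and "osc a \<rho> = integral {-1..1} (\<lambda>s. cis (2 * pi * \<rho> * s) * complex_of_real ((1 - s\<^sup>2) powr a))"
proof -
  let ?f = "\<lambda>s. cis (2 * pi * \<rho> * s) * complex_of_real ((1 - s\<^sup>2) powr a)"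
  have sq: "1 - s\<^sup>2 \<ge> 0 \<longleftrightarrow> s \<in> {-1..1}" for s :: real
    by (auto simp: abs_square_le_1 abs_le_iff)
  have "continuous_on {-1..1} ?f"
    using assms sq by (intro continuous_intros continuous_on_powr' ) auto
  then have int: "set_integrable lborel {-1..1} ?f"
    by (rule borel_integrable_atLeastAtMost')
  have eq: "cis (2 * pi * \<rho> * s) * complex_of_real (max 0 (1 - s\<^sup>2) powr a) = indicator {-1..1} s *\<^sub>R ?f s" for s
    using sq[of s] by (auto simp: indicator_def max_def)
  show "integrable lborel (\<lambda>s. cis (2 * pi * \<rho> * s) * complex_of_real (max 0 (1 - s\<^sup>2) powr a))"
    using int unfolding eq set_integrable_def .
  show "osc a \<rho> = integral {-1..1} ?f"
    using set_borel_integral_eq_integral(2)[OF int]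
    by (simp add: osc_def eq set_lebesgue_integral_def)
qed

text \<open>Cauchy's theorem on the rectangle with opposite corners -1 and \<open>1 + \<i>\<close>.
  The reflection of \<open>z\<close> to minus its conjugate maps the right leg to the left one and
  conjugates the integrand, so the legs combine to twice a real part; the top side is exponentially
  small.\<close>

lemma osc_contour:
  assumes a: "a > 0" and l: "\<rho> > 0"
  shows "cmod (osc a \<rho> - of_real (2 * Re (- \<i> * cis (2 * pi * \<rho>) * osc_leg a \<rho>))) \<le> 2 * 3 powr a * exp (- 2 * pi * \<rho>)"
proof -
  define f where "f z = exp (2 * pi * \<i> * \<rho> * z) * (1 - z\<^sup>2) powr of_real a" for z :: complex
  define S where "S = cbox (-1) (1 + \<i>)"
  have Re1: "Re (1 - z\<^sup>2) = 1 - (Re z)\<^sup>2 + (Im z)\<^sup>2" for z by (simp add: power2_eq_square)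
  have ReS: "Re (1 - z\<^sup>2) \<ge> (Im z)\<^sup>2" "Im z \<ge> 0" "Im z \<le> 1" "\<bar>Re z\<bar> \<le> 1" if "z \<in> S" for z
  proof -
    have "\<bar>Re z\<bar> \<le> 1" "0 \<le> Im z" "Im z \<le> 1" using that by (auto simp: S_def in_cbox_complex_iff abs_le_iff)
    then show "Re (1 - z\<^sup>2) \<ge> (Im z)\<^sup>2" "Im z \<ge> 0" "Im z \<le> 1" "\<bar>Re z\<bar> \<le> 1"
      unfolding Re1 by (auto simp: abs_square_le_1)
  qed
  \<comment> \<open>On the closed rectangle \<open>1 - z\<^sup>2\<close> stays in the closed right
    half-plane, off the cut of the principal power. Its zeros at -1 and 1 are harmless because the
    exponent is positive.\<close>
  have cont: "continuous_on S f" unfolding f_def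
  proof (intro continuous_intros)
    show "S \<subseteq> {z. 0 \<le> Re (1 - z\<^sup>2) \<or> Im (1 - z\<^sup>2) \<noteq> 0}"
      using ReS(1) order_trans[OF zero_le_power2] by blast
  qed (use a in auto)
  have "f field_differentiable at z" if z: "z \<in> interior S" for z
  proof -
    have "z \<in> box (-1) (1 + \<i>)" using z by (simp add: S_def interior_cbox)
    then have "\<bar>Re z\<bar> < 1" "0 < Im z" by (auto simp: in_box_complex_iff abs_less_iff)
    then have "Re (1 - z\<^sup>2) > 0" unfolding Re1 using abs_square_less_1[of "Re z"] zero_le_power2[of "Im z"] by linarith
    then have "1 - z\<^sup>2 \<notin> \<real>\<^sub>\<le>\<^sub>0" by (auto simp: complex_nonpos_Reals_iff simp del: minus_complex.simps)
    then show ?thesis unfolding f_def field_differentiable_def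
      by (auto intro!: derivative_eq_intros exI)
  qed
  note df = this
  have Sconv: "convex S" by (simp add: S_def)
  let ?g = "linepath (-1) 1 +++ linepath 1 (1 + \<i>) +++ linepath (1 + \<i>) (-1 + \<i>) +++ linepath (-1 + \<i>) (-1)"
  have inS: "-1 \<in> S" "1 \<in> S" "1 + \<i> \<in> S" "-1 + \<i> \<in> S" by (auto simp: S_def in_cbox_complex_iff)
  have seg: "closed_segment u v \<subseteq> S" if "u \<in> S" "v \<in> S" for u v
    using that Sconv by (simp add: closed_segment_subset)
  have ci: "f contour_integrable_on linepath u v" if "u \<in> S" "v \<in> S" for u v
    by (intro contour_integrable_continuous_linepath continuous_on_subset[OF cont] seg that)
  have "(f has_contour_integral 0) ?g"
  proof (rule Cauchy_theorem_convex[OF cont Sconv, of "{}"])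
    show "path_image ?g \<subseteq> S" using inS seg by (auto simp: path_image_join)
  qed (use df in auto)
  then have "contour_integral ?g f = 0" by (rule contour_integral_unique)
  moreover have "contour_integral ?g f = contour_integral (linepath (-1) 1) f + (contour_integral (linepath 1 (1 + \<i>)) f +
      (contour_integral (linepath (1 + \<i>) (-1 + \<i>)) f + contour_integral (linepath (-1 + \<i>) (-1)) f))"
    using ci inS by (simp add: contour_integrable_joinI)
  moreover have "contour_integral (linepath (-1 + \<i>) (-1)) f = - contour_integral (linepath (-1) (-1 + \<i>)) f"
    by (intro contour_integral_reverse_linepath continuous_on_subset[OF cont] seg inS)
  ultimately have sum: "contour_integral (linepath (-1) 1) f =
      contour_integral (linepath (-1) (-1 + \<i>)) f - contour_integral (linepath 1 (1 + \<i>)) f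
      - contour_integral (linepath (1 + \<i>) (-1 + \<i>)) f"
    by (simp add: algebra_simps)
  have base: "contour_integral (linepath (-1) 1) f = osc a \<rho>"
  proof -
    have "contour_integral (linepath (-1) 1) f = integral {-1..1} (\<lambda>x. f (of_real x))"
      by (subst contour_integral_linepath_Reals_eq) auto
    also have "\<dots> = osc a \<rho>"
      unfolding integrable_osc(2)[OF a]
    proof (rule integral_cong)
      fix s :: real assume "s \<in> {-1..1}"
      then have "1 - s\<^sup>2 \<ge> 0" by (auto simp: abs_square_le_1 abs_le_iff)
      then have "(1 - (complex_of_real s)\<^sup>2) powr of_real a = of_real ((1 - s\<^sup>2) powr a)"
        using powr_of_real[of "1 - s\<^sup>2" a] by simp
      then show "f (of_real s) = cis (2 * pi * \<rho> * s) * complex_of_real ((1 - s\<^sup>2) powr a)"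
        by (simp add: f_def cis_conv_exp mult_ac)
    qed
    finally show ?thesis .
  qed
  define F where "F t = of_real (exp (- 2 * pi * \<rho> * t) * t powr a) * (of_real t - 2 * \<i>) powr of_real a" for t :: real
  have fr: "f (1 + \<i> * t) = cis (2 * pi * \<rho>) * F t" if "t \<in> {0..1}" for t :: real
  proof -
    have "1 - (1 + \<i> * t)\<^sup>2 = of_real t * (of_real t - 2 * \<i>)" by (simp add: power2_eq_square algebra_simps)
    moreover have "(of_real t * (of_real t - 2 * \<i>)) powr of_real a = of_real (t powr a) * (of_real t - 2 * \<i>) powr of_real a"
    proof (cases "t = 0")
      case False
      then have "t > 0" using that by auto
      moreover have "of_real t - 2 * \<i> \<noteq> 0" by (auto simp: complex_eq_iff)
      ultimately show ?thesis
        by (simp add: powr_def Ln_times_of_real Ln_of_real exp_add distrib_left flip: exp_of_real)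
    qed auto
    moreover have "exp (2 * pi * \<i> * \<rho> * (1 + \<i> * t)) = cis (2 * pi * \<rho>) * of_real (exp (- 2 * pi * \<rho> * t))"
    proof -
      have "2 * pi * \<i> * \<rho> * (1 + \<i> * t) = \<i> * of_real (2 * pi * \<rho>) + of_real (- 2 * pi * \<rho> * t)"
        by (simp add: complex_eq_iff)
      then show ?thesis by (simp only: cis_conv_exp exp_of_real[symmetric] exp_add)
    qed
    ultimately show ?thesis by (simp add: f_def F_def)
  qed
  have fl: "f (-1 + \<i> * t) = cnj (f (1 + \<i> * t))" if "t \<in> {0..1}" for t :: real
  proof -
    have e: "1 - (-1 + \<i> * t)\<^sup>2 = cnj (1 - (1 + \<i> * t)\<^sup>2)" by (simp add: power2_eq_square algebra_simps)
    have "(cnj w) powr of_real a = cnj (w powr of_real a)" if "w \<notin> \<real>\<^sub>\<le>\<^sub>0 \<or> w = 0" for w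
      using that by (cases "w = 0") (auto simp: powr_def exp_cnj cnj_Ln)
    moreover have "1 - (1 + \<i> * t)\<^sup>2 \<notin> \<real>\<^sub>\<le>\<^sub>0 \<or> 1 - (1 + \<i> * t)\<^sup>2 = 0"
      using that by (auto simp: complex_nonpos_Reals_iff power2_eq_square complex_eq_iff)
    ultimately have "(1 - (-1 + \<i> * t)\<^sup>2) powr of_real a = cnj ((1 - (1 + \<i> * t)\<^sup>2) powr of_real a)"
      unfolding e by blast
    moreover have "exp (2 * pi * \<i> * \<rho> * (-1 + \<i> * t)) = cnj (exp (2 * pi * \<i> * \<rho> * (1 + \<i> * t)))"
    proof -
      have "2 * pi * \<i> * \<rho> * (-1 + \<i> * t) = cnj (2 * pi * \<i> * \<rho> * (1 + \<i> * t))"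
        by (simp add: complex_eq_iff)
      then show ?thesis by (simp only: exp_cnj)
    qed
    ultimately show ?thesis by (simp add: f_def)
  qed
  have line: "contour_integral (linepath u (u + \<i>)) f = integral {0..1} (\<lambda>t. f (u + \<i> * of_real t) * \<i>)" for u
    unfolding contour_integral_integral
    by (intro integral_cong) (auto simp: vector_derivative_linepath_at linepath_def algebra_simps scaleR_conv_of_real
        vector_derivative_linepath_within vector_derivative_at_within_ivl)
  have right: "contour_integral (linepath 1 (1 + \<i>)) f = \<i> * cis (2 * pi * \<rho>) * osc_leg a \<rho>"
  proof -
    have "contour_integral (linepath 1 (1 + \<i>)) f = integral {0..1} (\<lambda>t. (\<i> * cis (2 * pi * \<rho>)) * F t)"
      unfolding line by (intro integral_cong) (simp add: fr)
    then show ?thesis by (simp add: osc_leg_def F_def)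
  qed
  have left: "contour_integral (linepath (-1) (-1 + \<i>)) f = cnj (- contour_integral (linepath 1 (1 + \<i>)) f)"
  proof -
    have "contour_integral (linepath (-1) (-1 + \<i>)) f = integral {0..1} (\<lambda>t. cnj (- (f (1 + \<i> * of_real t) * \<i>)))"
      unfolding line
    proof (rule integral_cong)
      fix t :: real assume t: "t \<in> {0..1}"
      show "f (-1 + \<i> * of_real t) * \<i> = cnj (- (f (1 + \<i> * of_real t) * \<i>))"
        unfolding fl[OF t] by simp
    qed
    also have "\<dots> = cnj (integral {0..1} (\<lambda>t. - (f (1 + \<i> * of_real t) * \<i>)))"
      by (rule integral_cnj[symmetric])
    finally show ?thesis unfolding line by simp
  qed
  \<comment> \<open>On this side \<open>cmod z \<le> sqrt 2\<close>, so \<open>1 - z\<^sup>2\<close>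
    has modulus at most 3, and \<open>Im z = 1\<close> gives the exponential. The segment has length
    2.\<close>
  have top: "cmod (contour_integral (linepath (1 + \<i>) (-1 + \<i>)) f) \<le> (3 powr a * exp (- 2 * pi * \<rho>)) * cmod ((-1 + \<i>) - (1 + \<i>))"
  proof (rule contour_integral_bound_linepath)
    fix z assume z: "z \<in> closed_segment (1 + \<i>) (-1 + \<i>)"
    then have "z \<in> S" using seg inS by blast
    have "Im z = 1" using z by (auto simp: closed_segment_def)
    have "cmod z \<le> sqrt 2"
    proof -
      have "(Re z)\<^sup>2 \<le> 1" using ReS(4)[OF \<open>z \<in> S\<close>] by (simp add: abs_square_le_1)
      then show ?thesis using \<open>Im z = 1\<close> by (simp add: cmod_def)
    qed
    then have "(cmod z)\<^sup>2 \<le> 2" using power_mono[of "cmod z" "sqrt 2" 2] by simp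
    then have "cmod (1 - z\<^sup>2) \<le> 3" using norm_triangle_ineq4[of 1 "z\<^sup>2"] by (simp add: norm_power)
    then have "cmod ((1 - z\<^sup>2) powr of_real a) \<le> 3 powr a"
      using a by (subst norm_powr_real_powr') (auto intro: powr_mono2)
    moreover have "cmod (exp (2 * pi * \<i> * \<rho> * z)) = exp (- 2 * pi * \<rho>)"
      using \<open>Im z = 1\<close> by (simp add: norm_exp_eq_Re)
    ultimately show "cmod (f z) \<le> 3 powr a * exp (- 2 * pi * \<rho>)"
      unfolding f_def norm_mult by (simp only: mult.commute[of _ "exp (- 2 * pi * \<rho>)"] mult_left_mono exp_ge_zero)
  qed (use ci inS in auto)
  have "osc a \<rho> - of_real (2 * Re (- \<i> * cis (2 * pi * \<rho>) * osc_leg a \<rho>)) = - contour_integral (linepath (1 + \<i>) (-1 + \<i>)) f"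
    using sum unfolding base left right
    by (simp add: complex_eq_iff)
  then show ?thesis using top by (simp add: norm_minus_cancel)
qed

lemma integrable_powr_exp:
  assumes a: "a > 0" and c: "c \<ge> 1"
  shows "integrable lborel (\<lambda>u::real. indicator {0..} u * (u powr a * exp (- (c * u))))"
proof (rule Bochner_Integration.integrable_bound)
  have "(\<integral>\<^sup>+ t. ennreal (indicator {0..} t * t powr (a + 1 - 1) / exp t) \<partial>lborel) = Gamma (a + 1)"
    using Gamma_conv_nn_integral_real[of "a + 1"] a by simp
  then show "integrable lborel (\<lambda>u::real. indicator {0..} u * u powr (a + 1 - 1) / exp u)"
    by (intro integrableI_nonneg) auto
  show "AE u in lborel. norm (indicator {0..} u * (u powr a * exp (- (c * u)))) \<le> norm (indicator {0..} u * u powr (a + 1 - 1) / exp u)"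
  proof (intro AE_I2)
    fix u :: real
    show "norm (indicator {0..} u * (u powr a * exp (- (c * u)))) \<le> norm (indicator {0..} u * u powr (a + 1 - 1) / exp u)"
    proof (cases "u \<ge> 0")
      case True
      then have "exp (- (c * u)) \<le> exp (- u)" using c mult_right_mono[of 1 c u] by simp
      then show ?thesis using True by (simp add: exp_minus divide_inverse mult_left_mono)
    qed auto
  qed
qed auto

text \<open>Laplace's method: after the substitution \<open>u = \<rho> * t\<close> the weight
  \<open>u powr a * exp (- (2 * pi * u))\<close> is fixed, and the other factor tends to
  \<open>(- 2 * \<i>) powr a\<close>. The limit is therefore a positive Gamma integral times a
  nonzero number.\<close>

lemma osc_leg_asymp:
  assumes a: "a > 0"
  shows "\<exists>w. w \<noteq> 0 \<and> ((\<lambda>\<rho>. of_real (\<rho> powr (a + 1)) * osc_leg a \<rho>) \<longlongrightarrow> w) at_top"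
proof -
  define s where "s \<rho> u = of_real (indicator {0..\<rho>} u * (u powr a * exp (- (2 * pi * u)))) *
      (of_real (u / \<rho>) - 2 * \<i>) powr of_real a" for \<rho> u :: real
  define l where "l u = of_real (indicator {0..} u * (u powr a * exp (- (2 * pi * u)))) * (- 2 * \<i>) powr of_real a" for u :: real
  have nz: "of_real t - 2 * \<i> \<notin> \<real>\<^sub>\<le>\<^sub>0" for t by (simp add: complex_nonpos_Reals_iff)
  have int: "integrable lborel (\<lambda>u::real. indicator {0..} u * (u powr a * exp (- (2 * pi * u))))"
    using pi_gt3 by (intro integrable_powr_exp a) linarith
  have pm: "(\<lambda>u. (complex_of_real (u / \<rho>) - 2 * \<i>) powr of_real a) \<in> borel_measurable borel" for \<rho>
  proof -
    have "(\<lambda>z. (complex_of_real z - 2 * \<i>) powr of_real a) \<in> borel_measurable borel"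
      using nz a by (intro borel_measurable_continuous_onI continuous_intros) auto
    then show ?thesis by (rule measurable_compose[rotated]) measurable
  qed
  have sm: "s \<rho> \<in> borel_measurable borel" for \<rho>
    unfolding s_def by (intro borel_measurable_times[OF _ pm]) measurable
  have lim: "((\<lambda>\<rho>. integral\<^sup>L lborel (s \<rho>)) \<longlongrightarrow> integral\<^sup>L lborel l) at_top"
  proof (rule integral_dominated_convergence_at_top)
    show "integrable lborel (\<lambda>u. 3 powr a * (indicator {0..} u * (u powr a * exp (- (2 * pi * u)))))"
      using int by simp
    show "\<forall>\<^sub>F i in at_top. AE x in lborel. norm (s i x) \<le> 3 powr a * (indicator {0..} x * (x powr a * exp (- (2 * pi * x))))"
    proof (rule eventually_mono[OF eventually_gt_at_top[of 0]], intro AE_I2)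
      fix \<rho> u :: real assume l: "\<rho> > 0"
      show "norm (s \<rho> u) \<le> 3 powr a * (indicator {0..} u * (u powr a * exp (- (2 * pi * u))))"
      proof (cases "u \<in> {0..\<rho>}")
        case True
        have "cmod (of_real (u / \<rho>) - 2 * \<i>) \<le> 3"
          using True l norm_triangle_ineq4[of "of_real (u / \<rho>)" "2 * \<i>"] by (simp add: norm_mult norm_divide field_simps)
        then have "cmod ((of_real (u / \<rho>) - 2 * \<i>) powr of_real a) \<le> 3 powr a"
          using a by (subst norm_powr_real_powr') (auto intro!: powr_mono2 simp del: of_real_divide)
        then show ?thesis using True mult_left_mono[of "cmod ((of_real (u / \<rho>) - 2 * \<i>) powr of_real a)" "3 powr a" "u powr a * exp (- (2 * pi * u))"]
          by (simp add: s_def norm_mult abs_mult mult_ac del: of_real_divide)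
      qed (simp add: s_def)
    qed
    show "AE x in lborel. ((\<lambda>i. s i x) \<longlongrightarrow> l x) at_top"
    proof (intro AE_I2)
      fix u :: real
      have "((\<lambda>\<rho>. of_real (u / \<rho>) - 2 * \<i>) \<longlongrightarrow> of_real 0 - 2 * \<i>) at_top"
        by (intro tendsto_intros tendsto_divide_0[OF tendsto_const] filterlim_at_top_imp_at_infinity filterlim_ident)
      then have "((\<lambda>\<rho>. (of_real (u / \<rho>) - 2 * \<i>) powr of_real a) \<longlongrightarrow> (of_real 0 - 2 * \<i>) powr of_real a) at_top"
        using nz[of 0] by (intro tendsto_powr_complex tendsto_const) auto
      moreover have "\<forall>\<^sub>F \<rho> in at_top. indicator {0..\<rho>} u = (indicator {0..} u :: real)"
        by (rule eventually_mono[OF eventually_ge_at_top[of u]]) (auto simp: indicator_def)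
      ultimately show "((\<lambda>i. s i u) \<longlongrightarrow> l u) at_top"
        unfolding s_def l_def
        by (intro tendsto_mult tendsto_of_real tendsto_const) (auto intro: tendsto_eventually)
    qed
    show "s i \<in> borel_measurable lborel" for i using sm by simp
    show "l \<in> borel_measurable lborel" unfolding l_def by measurable
  qed
  have eq: "of_real (\<rho> powr (a + 1)) * osc_leg a \<rho> = integral\<^sup>L lborel (s \<rho>)" if l: "\<rho> > 0" for \<rho>
  proof -
    define g where "g t = of_real (exp (- 2 * pi * \<rho> * t) * t powr a) * (of_real t - 2 * \<i>) powr of_real a" for t :: real
    have "continuous_on {0..1} g"
      unfolding g_def using a nz by (intro continuous_intros continuous_on_powr') auto
    then have int: "set_integrable lborel {0..1} g" by (rule borel_integrable_atLeastAtMost')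
    have "osc_leg a \<rho> = (\<integral>t. indicator {0..1} t *\<^sub>R g t \<partial>lborel)"
    proof -
      have "osc_leg a \<rho> = integral {0..1} g" by (simp add: osc_leg_def g_def[abs_def])
      then show ?thesis using set_borel_integral_eq_integral(2)[OF int] by (simp add: set_lebesgue_integral_def)
    qed
    also have "\<dots> = \<bar>1 / \<rho>\<bar> *\<^sub>R (\<integral>u. indicator {0..1} (0 + 1 / \<rho> * u) *\<^sub>R g (0 + 1 / \<rho> * u) \<partial>lborel)"
      using l by (intro lborel_integral_real_affine) auto
    finally have "of_real (\<rho> powr (a + 1)) * osc_leg a \<rho> =
        (\<integral>u. of_real (\<rho> powr a) * (indicator {0..1} (u / \<rho>) *\<^sub>R g (u / \<rho>)) \<partial>lborel)"
      using l by (simp add: powr_add scaleR_conv_of_real field_simps)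
    also have "\<dots> = integral\<^sup>L lborel (s \<rho>)"
    proof (rule Bochner_Integration.integral_cong[OF refl])
      fix u :: real
      show "of_real (\<rho> powr a) * (indicator {0..1} (u / \<rho>) *\<^sub>R g (u / \<rho>)) = s \<rho> u"
      proof (cases "u \<in> {0..\<rho>}")
        case True
        then show ?thesis using l
          by (simp add: s_def g_def powr_divide field_simps)
      next
        case False
        then show ?thesis using l by (auto simp: s_def indicator_def field_simps)
      qed
    qed
    finally show ?thesis .
  qed
  have "((\<lambda>\<rho>. of_real (\<rho> powr (a + 1)) * osc_leg a \<rho>) \<longlongrightarrow> integral\<^sup>L lborel l) at_top"
    using lim by (rule Lim_transform_eventually) (auto intro: eventually_mono[OF eventually_gt_at_top[of 0]] simp: eq)
  moreover have "integral\<^sup>L lborel l \<noteq> 0"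
  proof -
    have eq: "integral\<^sup>L lborel l = of_real (\<integral>u. indicator {0..} u * (u powr a * exp (- (2 * pi * u))) \<partial>lborel) * (- 2 * \<i>) powr of_real a"
      unfolding l_def[abs_def]
      by (simp only: Bochner_Integration.integral_mult_left_zero integral_complex_of_real)
    \<comment> \<open>On \<open>{1..2}\<close> the power is at least 1 and the exponential at least
      \<open>exp (- (4 * pi))\<close>, which keeps the limit away from zero.\<close>
    have "(\<integral>u. indicator {1..2} (u::real) * exp (- (4 * pi)) \<partial>lborel) \<le> (\<integral>u. indicator {0..} u * (u powr a * exp (- (2 * pi * u))) \<partial>(lborel :: real measure))"
    proof (rule integral_mono[OF _ int])
      fix u :: real
      show "indicator {1..2} u * exp (- (4 * pi)) \<le> indicator {0..} u * (u powr a * exp (- (2 * pi * u)))"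
      proof (cases "u \<in> {1..2}")
        case True
        then have "1 \<le> u powr a" "exp (- (4 * pi)) \<le> exp (- (2 * pi * u))" using a by (auto simp: ge_one_powr_ge_zero)
        then show ?thesis using True mult_mono[of 1 "u powr a" "exp (- (4 * pi))" "exp (- (2 * pi * u))"] by simp
      qed (auto intro!: mult_nonneg_nonneg)
    qed (auto intro!: integrable_mult_left integrable_real_indicator)
    then have "(\<integral>u. indicator {0..} u * (u powr a * exp (- (2 * pi * u))) \<partial>(lborel :: real measure)) > 0"
      by (intro less_le_trans[OF exp_gt_zero[of "- (4 * pi)"]]) simp
    moreover have "(- 2 * \<i>) powr complex_of_real a \<noteq> 0" by (simp add: powr_def)
    ultimately show ?thesis unfolding eq by simp
  qed
  ultimately show ?thesis by blast
qed

text \<open>The two ends 1 and -1 of the interval contribute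
  \<open>cis (2 * pi * \<rho>) * w\<close> and its conjugate. This leading term serves both
  directions of the theorem: its size gives the decay of the kernel, its phase the lower
  bound.\<close>

lemma osc_asymp:
  assumes a: "a > 0"
  shows "\<exists>w. w \<noteq> 0 \<and> ((\<lambda>\<rho>. of_real (\<rho> powr (a + 1)) * osc a \<rho> - of_real (2 * Re (cis (2 * pi * \<rho>) * w))) \<longlongrightarrow> 0) at_top"
proof -
  obtain v where v: "v \<noteq> 0" "((\<lambda>\<rho>. of_real (\<rho> powr (a + 1)) * osc_leg a \<rho>) \<longlongrightarrow> v) at_top"
    using osc_leg_asymp[OF a] by blast
  have exp0: "((\<lambda>\<rho>. \<rho> powr (a + 1) * (2 * 3 powr a * exp (- 2 * pi * \<rho>)) + 2 * cmod (of_real (\<rho> powr (a + 1)) * osc_leg a \<rho> - v)) \<longlongrightarrow> 0) at_top"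
  proof -
    have "((\<lambda>\<rho>::real. \<rho> powr (a + 1) * exp (- 2 * pi * \<rho>)) \<longlongrightarrow> 0) at_top"
      by real_asymp
    from tendsto_add[OF tendsto_mult_left[OF this, of "2 * 3 powr a"]
      tendsto_mult_left[OF tendsto_norm_zero[OF LIM_zero[OF v(2)]], of 2]]
    show ?thesis by (simp add: mult_ac)
  qed
  have "((\<lambda>\<rho>. of_real (\<rho> powr (a + 1)) * osc a \<rho> - of_real (2 * Re (cis (2 * pi * \<rho>) * (- \<i> * v)))) \<longlongrightarrow> 0) at_top"
  proof (rule Lim_null_comparison[OF eventually_mono[OF eventually_gt_at_top[of 0]] exp0])
    fix \<rho> :: real assume l: "\<rho> > 0"
    let ?p = "\<rho> powr (a + 1)"
    let ?A = "of_real ?p * (osc a \<rho> - of_real (2 * Re (- \<i> * cis (2 * pi * \<rho>) * osc_leg a \<rho>)))"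
    let ?B = "of_real (2 * Re (- \<i> * cis (2 * pi * \<rho>) * (of_real ?p * osc_leg a \<rho> - v))) :: complex"
    have eq: "of_real ?p * osc a \<rho> - of_real (2 * Re (cis (2 * pi * \<rho>) * (- \<i> * v))) = ?A + ?B"
      by (simp add: complex_eq_iff algebra_simps)
    have "cmod ?A \<le> ?p * (2 * 3 powr a * exp (- 2 * pi * \<rho>))"
      using osc_contour[OF a l] unfolding norm_mult by (intro mult_mono) auto
    moreover have "cmod ?B \<le> 2 * cmod (of_real ?p * osc_leg a \<rho> - v)"
      using abs_Re_le_cmod[of "- \<i> * cis (2 * pi * \<rho>) * (of_real ?p * osc_leg a \<rho> - v)"]
      unfolding norm_of_real by (simp add: norm_mult abs_mult)
    ultimately show "cmod (of_real ?p * osc a \<rho> - of_real (2 * Re (cis (2 * pi * \<rho>) * (- \<i> * v))))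
        \<le> ?p * (2 * 3 powr a * exp (- 2 * pi * \<rho>)) + 2 * cmod (of_real ?p * osc_leg a \<rho> - v)"
      unfolding eq using norm_triangle_ineq[of ?A ?B] by linarith
  qed
  then show ?thesis using v(1) by (intro exI[of _ "- \<i> * v"]) auto
qed

lemma norm_osc_le: "a > 0 \<Longrightarrow> cmod (osc a \<rho>) \<le> 2"
proof -
  assume a: "a > 0"
  have "cmod (osc a \<rho>) \<le> (\<integral>s. indicator {-1..1} (s::real) \<partial>lborel)"
    unfolding osc_def
  proof (rule order_trans[OF Bochner_Integration.integral_norm_bound], rule Bochner_Integration.integral_mono)
    show "integrable lborel (\<lambda>s. cmod (cis (2 * pi * \<rho> * s) * complex_of_real (max 0 (1 - s\<^sup>2) powr a)))"
      using integrable_osc(1)[OF a] by (rule integrable_norm)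
    fix s :: real
    have "max 0 (1 - s\<^sup>2) powr a \<le> 1 powr a" using a by (intro powr_mono2) auto
    then show "cmod (cis (2 * pi * \<rho> * s) * complex_of_real (max 0 (1 - s\<^sup>2) powr a)) \<le> indicator {-1..1} s"
      using abs_square_le_1[of s] by (auto simp: norm_mult indicator_def max_def abs_le_iff)
  qed auto
  then show ?thesis by simp
qed

lemma osc_decay:
  assumes a: "a > 0"
  shows "\<exists>C>0. \<forall>\<rho>>0. cmod (osc a \<rho>) \<le> C * \<rho> powr - (a + 1)"
proof -
  obtain w where w: "w \<noteq> 0" "((\<lambda>\<rho>. of_real (\<rho> powr (a + 1)) * osc a \<rho> - of_real (2 * Re (cis (2 * pi * \<rho>) * w))) \<longlongrightarrow> 0) at_top"
    using osc_asymp[OF a] by blast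
  have "\<forall>\<^sub>F \<rho> in at_top. cmod (of_real (\<rho> powr (a + 1)) * osc a \<rho> - of_real (2 * Re (cis (2 * pi * \<rho>) * w))) < 1"
    using w(2) by (auto simp: tendsto_iff dist_norm)
  then obtain N where N: "\<And>\<rho>. \<rho> \<ge> N \<Longrightarrow> cmod (of_real (\<rho> powr (a + 1)) * osc a \<rho> - of_real (2 * Re (cis (2 * pi * \<rho>) * w))) < 1"
    by (auto simp: eventually_at_top_linorder)
  define C where "C = 1 + 2 * cmod w + 2 * (max 1 N) powr (a + 1)"
  have "cmod (osc a \<rho>) \<le> C * \<rho> powr - (a + 1)" if l: "\<rho> > 0" for \<rho>
  proof -
    have "\<rho> powr (a + 1) * cmod (osc a \<rho>) \<le> C"
    proof (cases "\<rho> \<ge> N")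
      case True
      have "\<rho> powr (a + 1) * cmod (osc a \<rho>) = cmod (of_real (\<rho> powr (a + 1)) * osc a \<rho>)" by (simp add: norm_mult)
      also have "\<dots> \<le> 1 + cmod (of_real (2 * Re (cis (2 * pi * \<rho>) * w)))"
        using N[OF True] norm_triangle_ineq2[of "of_real (\<rho> powr (a + 1)) * osc a \<rho>" "of_real (2 * Re (cis (2 * pi * \<rho>) * w))"] by linarith
      also have "cmod (of_real (2 * Re (cis (2 * pi * \<rho>) * w))) \<le> 2 * cmod w"
        unfolding norm_of_real using abs_Re_le_cmod[of "cis (2 * pi * \<rho>) * w"] by (simp add: norm_mult abs_mult)
      finally show ?thesis unfolding C_def using powr_ge_zero[of "max 1 N" "a + 1"] by linarith
    next
      case False
      have "\<rho> powr (a + 1) * cmod (osc a \<rho>) \<le> (max 1 N) powr (a + 1) * 2"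
        using False l a norm_osc_le[OF a] by (intro mult_mono powr_mono2) auto
      then show ?thesis unfolding C_def using norm_ge_zero[of w] by linarith
    qed
    then show ?thesis unfolding powr_minus using l by (simp add: field_simps)
  qed
  moreover have "C > 0" unfolding C_def using powr_ge_zero[of "max 1 N" "a + 1"] norm_ge_zero[of w] by linarith
  ultimately show ?thesis by blast
qed

text \<open>With \<open>\<phi>\<close> the argument of \<open>w\<close>, the leading term is
  \<open>2 * cmod w * cos (2 * pi * \<rho> + \<phi>)\<close>. Distance at most 1/6 from the integers
  shifted by \<open>\<theta> = - \<phi> / (2 * pi)\<close> means an angle of at most
  \<open>pi / 3\<close>, where the cosine is at least 1/2. So the leading term is at least
  \<open>cmod w\<close>, and an error below \<open>cmod w / 2\<close> leaves half of it.\<close>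

lemma osc_lower_bound:
  assumes a: "a > 0"
  shows "\<exists>\<theta> c \<rho>0. c > 0 \<and> \<rho>0 > 0 \<and> (\<forall>\<rho>\<ge>\<rho>0. \<forall>m::int. \<bar>\<rho> - \<theta> - m\<bar> \<le> 1 / 6 \<longrightarrow> Re (osc a \<rho>) \<ge> c * \<rho> powr - (a + 1))"
proof -
  obtain w where w: "w \<noteq> 0" "((\<lambda>\<rho>. of_real (\<rho> powr (a + 1)) * osc a \<rho> - of_real (2 * Re (cis (2 * pi * \<rho>) * w))) \<longlongrightarrow> 0) at_top"
    using osc_asymp[OF a] by blast
  have "\<forall>\<^sub>F \<rho> in at_top. cmod (of_real (\<rho> powr (a + 1)) * osc a \<rho> - of_real (2 * Re (cis (2 * pi * \<rho>) * w))) < cmod w / 2"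
    using tendstoD[OF w(2), of "cmod w / 2"] w(1) by (simp add: dist_norm del: Re_complex_of_real times_complex.simps of_real_mult)
  then obtain N where N: "\<And>\<rho>. \<rho> \<ge> N \<Longrightarrow> cmod (of_real (\<rho> powr (a + 1)) * osc a \<rho> - of_real (2 * Re (cis (2 * pi * \<rho>) * w))) < cmod w / 2"
    by (auto simp: eventually_at_top_linorder)
  define \<phi> where "\<phi> = Arg w"
  have wr: "w = of_real (cmod w) * cis \<phi>" using rcis_cmod_Arg[of w] by (simp add: rcis_def \<phi>_def)
  have "Re (osc a \<rho>) \<ge> cmod w / 2 * \<rho> powr - (a + 1)" if l: "\<rho> \<ge> max 1 N" and m: "\<bar>\<rho> - (- \<phi> / (2 * pi)) - real_of_int m\<bar> \<le> 1 / 6" for \<rho> m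
  proof -
    have e1: "Re (cis (2 * pi * \<rho>) * w) = cmod w * cos (2 * pi * \<rho> + \<phi>)"
      by (subst wr) (simp add: cos_add algebra_simps)
    have e2: "cos (2 * pi * \<rho> + \<phi>) = cos (2 * pi * (\<rho> - (- \<phi> / (2 * pi)) - real_of_int m))"
    proof -
      have "2 * pi * (\<rho> - (- \<phi> / (2 * pi)) - real_of_int m) = (2 * pi * \<rho> + \<phi>) - 2 * pi * real_of_int m"
        by (simp add: field_simps)
      then show ?thesis unfolding cos_diff by (simp only: cos_diff sin_int_2pin cos_int_2pin mult_1_right mult_zero_right add_0_right)
    qed
    have e3: "cos (2 * pi * (\<rho> - (- \<phi> / (2 * pi)) - real_of_int m)) \<ge> 1 / 2"
    proof -
      have "cos (pi / 3) \<le> cos \<bar>2 * pi * (\<rho> - (- \<phi> / (2 * pi)) - real_of_int m)\<bar>"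
        using m pi_gt_zero mult_left_mono[OF m, of "2 * pi"] by (intro cos_monotone_0_pi_le) (auto simp: abs_mult)
      then show ?thesis by (simp add: cos_60)
    qed
    have c: "Re (cis (2 * pi * \<rho>) * w) \<ge> cmod w / 2"
      unfolding e1 e2 using mult_left_mono[OF e3, of "cmod w"] by simp
    have "\<bar>Re (of_real (\<rho> powr (a + 1)) * osc a \<rho> - of_real (2 * Re (cis (2 * pi * \<rho>) * w)))\<bar> < cmod w / 2"
      using N[of \<rho>] l abs_Re_le_cmod order_le_less_trans by (metis max.bounded_iff)
    moreover have "Re (of_real p * z - of_real (2 * X)) = p * Re z - 2 * X" for p X z by simp
    ultimately have "\<rho> powr (a + 1) * Re (osc a \<rho>) \<ge> cmod w / 2"
      using c by (simp only:)
    then show ?thesis unfolding powr_minus using l by (simp add: field_simps)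
  qed
  then show ?thesis using w(1) by (intro exI[of _ "- \<phi> / (2 * pi)"] exI[of _ "cmod w / 2"] exI[of _ "max 1 N"]) auto
qed


section \<open>The Bochner-Riesz kernel\<close>

text \<open>Scaling by \<open>sqrt q\<close>: the power contributes the exponent
  \<open>\<beta>\<close> and the length element 1/2. The constant is a Beta integral, of which only
  finiteness and positivity matter.\<close>

lemma nn_integral_powr_slice:
  fixes \<beta> :: real
  assumes \<beta>: "\<beta> \<ge> 0"
  shows "\<exists>c>0. \<forall>q. (\<integral>\<^sup>+y. ennreal (max 0 (q - y\<^sup>2) powr \<beta>) \<partial>lborel) = ennreal (c * max 0 q powr (\<beta> + 1 / 2))"
proof -
  define I where "I = (\<integral>\<^sup>+y. ennreal (max 0 (1 - y\<^sup>2) powr \<beta>) \<partial>(lborel :: real measure))"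
  have "I \<le> (\<integral>\<^sup>+y. indicator {-1..1} y \<partial>(lborel :: real measure))"
    unfolding I_def
  proof (rule nn_integral_mono)
    fix y :: real
    have "max 0 (1 - y\<^sup>2) powr \<beta> \<le> 1 powr \<beta>" using \<beta> by (intro powr_mono2) auto
    then show "ennreal (max 0 (1 - y\<^sup>2) powr \<beta>) \<le> indicator {-1..1} y"
      using abs_square_le_1[of y] by (auto simp: indicator_def max_def abs_le_iff)
  qed
  also have "\<dots> = 2" by simp
  finally have fin: "I \<noteq> \<infinity>" by (auto simp: top_unique)
  have "(\<integral>\<^sup>+y. ennreal ((3 / 4) powr \<beta>) * indicator {-1/2..1/2} y \<partial>(lborel :: real measure)) \<le> I"
    unfolding I_def
  proof (rule nn_integral_mono)
    fix y :: real
    show "ennreal ((3 / 4) powr \<beta>) * indicator {-1/2..1/2} y \<le> ennreal (max 0 (1 - y\<^sup>2) powr \<beta>)"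
    proof (cases "y \<in> {-1/2..1/2}")
      case True
      then have "y\<^sup>2 \<le> (1/2)\<^sup>2" by (intro abs_le_square_iff[THEN iffD1]) auto
      then have "(3 / 4) powr \<beta> \<le> max 0 (1 - y\<^sup>2) powr \<beta>"
        using \<beta> by (intro powr_mono2) (auto simp: power2_eq_square)
      then show ?thesis using True by (simp add: ennreal_leI)
    qed auto
  qed
  then have "ennreal ((3 / 4) powr \<beta>) \<le> I" by (simp add: nn_integral_cmult)
  moreover have "0 < ennreal ((3 / 4) powr \<beta>)" by simp
  ultimately have "I > 0" by (rule less_le_trans[rotated])
  define c where "c = enn2real I"
  have Ic: "I = ennreal c" using fin by (simp add: c_def ennreal_enn2real_if)
  have c: "c > 0" using \<open>I > 0\<close> unfolding Ic by simp
  have "(\<integral>\<^sup>+y. ennreal (max 0 (q - y\<^sup>2) powr \<beta>) \<partial>lborel) = ennreal (c * max 0 q powr (\<beta> + 1 / 2))" for q :: real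
  proof (cases "q > 0")
    case False
    then have "max 0 (q - y\<^sup>2) = 0" for y by (smt (verit) zero_le_power2)
    then show ?thesis using False by (simp add: max_def)
  next
    case True
    have "(\<integral>\<^sup>+y. ennreal (max 0 (q - y\<^sup>2) powr \<beta>) \<partial>lborel) =
        ennreal \<bar>sqrt q\<bar> * (\<integral>\<^sup>+y. ennreal (max 0 (q - (0 + sqrt q * y)\<^sup>2) powr \<beta>) \<partial>lborel)"
      using True by (intro nn_integral_real_affine) auto
    also have "(\<lambda>y. ennreal (max 0 (q - (0 + sqrt q * y)\<^sup>2) powr \<beta>)) = (\<lambda>y. ennreal (q powr \<beta>) * ennreal (max 0 (1 - y\<^sup>2) powr \<beta>))"
    proof
      fix y :: real
      have "q - (0 + sqrt q * y)\<^sup>2 = q * (1 - y\<^sup>2)" using True by (simp add: power_mult_distrib algebra_simps)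
      then have "max 0 (q - (0 + sqrt q * y)\<^sup>2) = q * max 0 (1 - y\<^sup>2)"
        using True by (auto simp: max_def zero_le_mult_iff mult_le_0_iff)
      then show "ennreal (max 0 (q - (0 + sqrt q * y)\<^sup>2) powr \<beta>) = ennreal (q powr \<beta>) * ennreal (max 0 (1 - y\<^sup>2) powr \<beta>)"
        using True by (simp add: powr_mult ennreal_mult')
    qed
    also have "(\<integral>\<^sup>+y. ennreal (q powr \<beta>) * ennreal (max 0 (1 - y\<^sup>2) powr \<beta>) \<partial>lborel) = ennreal (q powr \<beta>) * I"
      unfolding I_def by (rule nn_integral_cmult) measurable
    also have "ennreal \<bar>sqrt q\<bar> * (ennreal (q powr \<beta>) * I) = ennreal (sqrt q * (q powr \<beta> * c))"
      using True c unfolding Ic by (simp add: ennreal_mult)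
    also have "sqrt q * (q powr \<beta> * c) = c * max 0 q powr (\<beta> + 1 / 2)"
      using True by (simp add: powr_add powr_half_sqrt)
    finally show ?thesis .
  qed
  then show ?thesis using c by blast
qed

text \<open>Every coordinate integrated out adds 1/2 to the exponent. The claim is for all
  \<open>q\<close> because splitting off a coordinate \<open>y\<close> replaces \<open>q\<close> by
  \<open>q - y\<^sup>2\<close> in the induction hypothesis.\<close>

lemma nn_integral_PiM_powr:
  fixes \<delta> :: real and A :: "'i set"
  assumes "finite A" and \<delta>: "\<delta> \<ge> 0"
  shows "\<exists>c>0. \<forall>q. (\<integral>\<^sup>+f. ennreal (max 0 (q - (\<Sum>i\<in>A. (f i)\<^sup>2)) powr \<delta>) \<partial>(Pi\<^sub>M A (\<lambda>_. lborel))) =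
    ennreal (c * max 0 q powr (\<delta> + real (card A) / 2))"
  using assms(1)
proof (induction A rule: finite_induct)
  case empty
  show ?case by (intro exI[of _ 1]) (simp add: PiM_empty nn_integral_count_space_finite)
next
  case (insert i A)
  interpret product_sigma_finite "\<lambda>_. lborel :: real measure" by standard
  obtain c where c: "c > 0" "\<And>q. (\<integral>\<^sup>+f. ennreal (max 0 (q - (\<Sum>i\<in>A. (f i)\<^sup>2)) powr \<delta>) \<partial>(Pi\<^sub>M A (\<lambda>_. lborel))) =
    ennreal (c * max 0 q powr (\<delta> + real (card A) / 2))" using insert.IH by blast
  obtain d where d: "d > 0" "\<And>q. (\<integral>\<^sup>+y. ennreal (max 0 (q - y\<^sup>2) powr (\<delta> + real (card A) / 2)) \<partial>lborel) =
      ennreal (d * max 0 q powr (\<delta> + real (card A) / 2 + 1 / 2))"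
    using nn_integral_powr_slice[of "\<delta> + real (card A) / 2"] \<delta> by auto
  have "(\<integral>\<^sup>+f. ennreal (max 0 (q - (\<Sum>i\<in>insert i A. (f i)\<^sup>2)) powr \<delta>) \<partial>(Pi\<^sub>M (insert i A) (\<lambda>_. lborel))) =
    ennreal (c * d * max 0 q powr (\<delta> + real (card (insert i A)) / 2))" for q
  proof -
    have "(\<integral>\<^sup>+f. ennreal (max 0 (q - (\<Sum>i\<in>insert i A. (f i)\<^sup>2)) powr \<delta>) \<partial>(Pi\<^sub>M (insert i A) (\<lambda>_. lborel))) =
      (\<integral>\<^sup>+y. \<integral>\<^sup>+f. ennreal (max 0 (q - (\<Sum>j\<in>insert i A. ((f(i := y)) j)\<^sup>2)) powr \<delta>) \<partial>(Pi\<^sub>M A (\<lambda>_. lborel)) \<partial>lborel)"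
      by (rule product_nn_integral_insert_rev[OF insert.hyps]) measurable
    also have "\<dots> = (\<integral>\<^sup>+y. \<integral>\<^sup>+f. ennreal (max 0 ((q - y\<^sup>2) - (\<Sum>j\<in>A. (f j)\<^sup>2)) powr \<delta>) \<partial>(Pi\<^sub>M A (\<lambda>_. lborel)) \<partial>lborel)"
    proof (intro nn_integral_cong)
      fix y :: real and f :: "'i \<Rightarrow> real"
      have "(\<Sum>j\<in>A. ((f(i := y)) j)\<^sup>2) = (\<Sum>j\<in>A. (f j)\<^sup>2)" using insert.hyps by (intro sum.cong) auto
      then show "ennreal (max 0 (q - (\<Sum>j\<in>insert i A. ((f(i := y)) j)\<^sup>2)) powr \<delta>) = ennreal (max 0 ((q - y\<^sup>2) - (\<Sum>j\<in>A. (f j)\<^sup>2)) powr \<delta>)"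
        using insert.hyps by (simp add: algebra_simps)
    qed
    also have "\<dots> = (\<integral>\<^sup>+y. ennreal c * ennreal (max 0 (q - y\<^sup>2) powr (\<delta> + real (card A) / 2)) \<partial>lborel)"
      using c by (simp add: ennreal_mult)
    also have "\<dots> = ennreal c * ennreal (d * max 0 q powr (\<delta> + real (card A) / 2 + 1 / 2))"
      by (subst nn_integral_cmult) (auto simp: d)
    also have "\<dots> = ennreal (c * d * max 0 q powr (\<delta> + real (card (insert i A)) / 2))"
      using c d insert.hyps by (simp add: ennreal_mult[symmetric] mult.assoc add_divide_distrib add_ac)
    finally show ?thesis .
  qed
  then show ?case using c(1) d(1) by (intro exI[of _ "c * d"]) auto
qed

text \<open>All coordinates but the one along \<open>e\<close> are integrated out, which raises the
  exponent by half their number. This is the origin of the exponent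
  \<open>\<delta> + (n - 1) / 2\<close> at which \<open>osc\<close> is used.\<close>

lemma nn_integral_radial_projection:
  fixes e :: "'a::euclidean_space"
  assumes e: "e \<in> Basis" and \<delta>: "\<delta> \<ge> 0"
  shows "\<exists>c>0. \<forall>h \<in> borel_measurable borel. (\<integral>\<^sup>+(\<xi>::'a). h (\<xi> \<bullet> e) * ennreal (max 0 (1 - (norm \<xi>)\<^sup>2) powr \<delta>) \<partial>lborel) =
    (\<integral>\<^sup>+s. h s * ennreal (c * max 0 (1 - s\<^sup>2) powr (\<delta> + real (DIM('a) - 1) / 2)) \<partial>lborel)"
proof -
  interpret product_sigma_finite "\<lambda>_. lborel :: real measure" by standard
  let ?A = "Basis - {e}"
  have ins: "Basis = insert e ?A" and card: "card ?A = DIM('a) - 1" using e by (auto simp: card_Diff_singleton)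
  obtain c where c: "c > 0" "\<And>q. (\<integral>\<^sup>+f. ennreal (max 0 (q - (\<Sum>i\<in>?A. (f i)\<^sup>2)) powr \<delta>) \<partial>(Pi\<^sub>M ?A (\<lambda>_. lborel))) =
    ennreal (c * max 0 q powr (\<delta> + real (card ?A) / 2))" using nn_integral_PiM_powr[of ?A \<delta>] \<delta> by auto
  have "(\<integral>\<^sup>+(\<xi>::'a). h (\<xi> \<bullet> e) * ennreal (max 0 (1 - (norm \<xi>)\<^sup>2) powr \<delta>) \<partial>lborel) =
    (\<integral>\<^sup>+s. h s * ennreal (c * max 0 (1 - s\<^sup>2) powr (\<delta> + real (DIM('a) - 1) / 2)) \<partial>lborel)"
    if h [measurable]: "h \<in> borel_measurable borel" for h
  proof -
    have "(\<integral>\<^sup>+(\<xi>::'a). h (\<xi> \<bullet> e) * ennreal (max 0 (1 - (norm \<xi>)\<^sup>2) powr \<delta>) \<partial>lborel) =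
      (\<integral>\<^sup>+f. h ((\<Sum>b\<in>Basis. f b *\<^sub>R b) \<bullet> e) * ennreal (max 0 (1 - (norm (\<Sum>b\<in>Basis. f b *\<^sub>R (b::'a)))\<^sup>2) powr \<delta>) \<partial>(Pi\<^sub>M Basis (\<lambda>_. lborel)))"
      by (subst lborel_eq, rule nn_integral_distr) measurable
    also have "\<dots> = (\<integral>\<^sup>+f. h (f e) * ennreal (max 0 (1 - (\<Sum>b\<in>Basis. (f b)\<^sup>2)) powr \<delta>) \<partial>(Pi\<^sub>M (Basis :: 'a set) (\<lambda>_. lborel)))"
    proof (intro nn_integral_cong)
      fix f :: "'a \<Rightarrow> real"
      have "(norm (\<Sum>b\<in>Basis. f b *\<^sub>R b))\<^sup>2 = (\<Sum>b\<in>Basis. (f b)\<^sup>2)"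
        unfolding dot_square_norm[symmetric] by (subst euclidean_inner) (simp add: power2_eq_square)
      then show "h ((\<Sum>b\<in>Basis. f b *\<^sub>R b) \<bullet> e) * ennreal (max 0 (1 - (norm (\<Sum>b\<in>Basis. f b *\<^sub>R (b::'a)))\<^sup>2) powr \<delta>) =
        h (f e) * ennreal (max 0 (1 - (\<Sum>b\<in>Basis. (f b)\<^sup>2)) powr \<delta>)" using e by simp
    qed
    also have "\<dots> = (\<integral>\<^sup>+s. \<integral>\<^sup>+f. h ((f(e := s)) e) * ennreal (max 0 (1 - (\<Sum>b\<in>Basis. ((f(e := s)) b)\<^sup>2)) powr \<delta>) \<partial>(Pi\<^sub>M ?A (\<lambda>_. lborel)) \<partial>lborel)"
    proof -
      have "(\<integral>\<^sup>+f. F f \<partial>(Pi\<^sub>M (insert e ?A) (\<lambda>_. lborel))) = (\<integral>\<^sup>+s. \<integral>\<^sup>+f. F (f(e := s)) \<partial>(Pi\<^sub>M ?A (\<lambda>_. lborel)) \<partial>lborel)"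
        if "F \<in> borel_measurable (Pi\<^sub>M (insert e ?A) (\<lambda>_. lborel))" for F :: "('a \<Rightarrow> real) \<Rightarrow> ennreal"
        by (rule product_nn_integral_insert_rev[OF _ _ that]) auto
      note * = this[unfolded ins[symmetric]]
      show ?thesis by (rule *) (use e in measurable)
    qed
    also have "\<dots> = (\<integral>\<^sup>+s. h s * (\<integral>\<^sup>+f. ennreal (max 0 ((1 - s\<^sup>2) - (\<Sum>b\<in>?A. (f b)\<^sup>2)) powr \<delta>) \<partial>(Pi\<^sub>M ?A (\<lambda>_. lborel))) \<partial>lborel)"
    proof (intro nn_integral_cong)
      fix s :: real
      have "(\<Sum>b\<in>?A. ((f(e := s)) b)\<^sup>2) = (\<Sum>b\<in>?A. (f b)\<^sup>2)" for f :: "'a \<Rightarrow> real" by (intro sum.cong) auto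
      then have "(\<Sum>b\<in>Basis. ((f(e := s)) b)\<^sup>2) = s\<^sup>2 + (\<Sum>b\<in>?A. (f b)\<^sup>2)" for f :: "'a \<Rightarrow> real"
        using sum.remove[OF finite_Basis e, of "\<lambda>b. ((f(e := s)) b)\<^sup>2"] by simp
      then have *: "max 0 (1 - (\<Sum>b\<in>Basis. ((f(e := s)) b)\<^sup>2)) = max 0 ((1 - s\<^sup>2) - (\<Sum>b\<in>?A. (f b)\<^sup>2))" for f :: "'a \<Rightarrow> real"
        by (simp only: diff_diff_eq)
      show "(\<integral>\<^sup>+f. h ((f(e := s)) e) * ennreal (max 0 (1 - (\<Sum>b\<in>Basis. ((f(e := s)) b)\<^sup>2)) powr \<delta>) \<partial>(Pi\<^sub>M ?A (\<lambda>_. lborel))) =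
        h s * (\<integral>\<^sup>+f. ennreal (max 0 ((1 - s\<^sup>2) - (\<Sum>b\<in>?A. (f b)\<^sup>2)) powr \<delta>) \<partial>(Pi\<^sub>M ?A (\<lambda>_. lborel)))"
        unfolding * fun_upd_same by (rule nn_integral_cmult) measurable
    qed
    finally show ?thesis unfolding c(2) card .
  qed
  then show ?thesis using c(1) by blast
qed

section \<open>Rotation invariance of Lebesgue measure\<close>

lemma nn_integral_lborel_translate:
  fixes f :: "'a::euclidean_space \<Rightarrow> ennreal"
  assumes [measurable]: "f \<in> borel_measurable borel"
  shows "(\<integral>\<^sup>+x. f (t + x) \<partial>lborel) = (\<integral>\<^sup>+x. f x \<partial>lborel)"
    and "(\<integral>\<^sup>+x. f (t - x) \<partial>lborel) = (\<integral>\<^sup>+x. f x \<partial>lborel)"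
proof -
  have "(\<integral>\<^sup>+x. f (t + c *\<^sub>R x) \<partial>lborel) = (\<integral>\<^sup>+x. f x \<partial>lborel)" if "c = 1 \<or> c = -1" for c :: real
    using that lborel_affine[of c t] by (subst (2) lborel_affine[of c t])
      (auto simp: nn_integral_density nn_integral_distr)
  from this[of 1] this[of "-1"]
  show "(\<integral>\<^sup>+x. f (t + x) \<partial>lborel) = (\<integral>\<^sup>+x. f x \<partial>lborel)"
    and "(\<integral>\<^sup>+x. f (t - x) \<partial>lborel) = (\<integral>\<^sup>+x. f x \<partial>lborel)" by simp_all
qed

text \<open>
  Compared with a rotation invariant set such as the unit ball, every translation invariant
  measure is a multiple of Lebesgue measure; the library determines the measure of a linear image
  only over a well-ordered index type.
\<close>

lemma lborel_distr_orthogonal: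
  fixes A :: "'a::euclidean_space \<Rightarrow> 'a"
  assumes A: "orthogonal_transformation A"
  shows "distr lborel borel A = lborel"
proof -
  have lin: "linear A" and bij: "bij A" using A by (auto simp: orthogonal_transformation_linear orthogonal_transformation_bij)
  have [measurable]: "A \<in> borel_measurable borel"
    using lin by (intro borel_measurable_continuous_onI linear_continuous_on linear_conv_bounded_linear[THEN iffD1])
  define B where "B = ball (0 :: 'a) 1"
  have [measurable]: "B \<in> sets borel" by (simp add: B_def)
  have IB: "indicator B (A x) = (indicator B x :: ennreal)" for x
    using A by (simp add: B_def indicator_def orthogonal_transformation_norm)
  have B: "emeasure lborel B \<noteq> 0" "emeasure lborel B \<noteq> \<infinity>"
    by (auto simp: B_def emeasure_ball ennreal_eq_0_iff not_le)
  \<comment> \<open>Integrating \<open>indicator B y * indicator S (A x + y)\<close> in the two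
    orders gives the two sides; in the second, the invariance of the ball \<open>B\<close> under
    \<open>A\<close> removes \<open>A\<close> from the result.\<close>
  have key: "emeasure lborel B * (\<integral>\<^sup>+x. indicator S (A x) \<partial>lborel) = emeasure lborel B * emeasure lborel S"
    if S [measurable]: "S \<in> sets borel" for S
  proof -
    have "emeasure lborel B * (\<integral>\<^sup>+x. indicator S (A x) \<partial>lborel) =
        (\<integral>\<^sup>+y. indicator B y * (\<integral>\<^sup>+x. indicator S (A x) \<partial>lborel) \<partial>lborel)"
      by (simp add: nn_integral_multc)
    also have "\<dots> = (\<integral>\<^sup>+y. (\<integral>\<^sup>+x. indicator B y * indicator S (A x + y) \<partial>lborel) \<partial>lborel)"
    proof (intro nn_integral_cong)
      fix y
      have "A (inv A y + x) = A x + y" for x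
        using bij lin by (simp add: linear_add bij_is_surj surj_f_inv_f add.commute)
      then have "(\<integral>\<^sup>+x. indicator S (A x) \<partial>lborel) = (\<integral>\<^sup>+x. indicator S (A x + y) \<partial>lborel :: ennreal)"
        using nn_integral_lborel_translate(1)[of "\<lambda>x. indicator S (A x)" "inv A y"] by simp
      then show "indicator B y * (\<integral>\<^sup>+x. indicator S (A x) \<partial>lborel) = (\<integral>\<^sup>+x. indicator B y * indicator S (A x + y) \<partial>lborel :: ennreal)"
        by (simp add: nn_integral_cmult)
    qed
    also have "\<dots> = (\<integral>\<^sup>+x. (\<integral>\<^sup>+y. indicator B y * indicator S (A x + y) \<partial>lborel) \<partial>lborel)"
      by (rule lborel_pair.Fubini') measurable
    also have "\<dots> = (\<integral>\<^sup>+x. (\<integral>\<^sup>+y. indicator B (y - A x) * indicator S y \<partial>lborel) \<partial>lborel)"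
    proof (rule nn_integral_cong)
      fix x
      show "(\<integral>\<^sup>+y. indicator B y * indicator S (A x + y) \<partial>lborel) = (\<integral>\<^sup>+y. indicator B (y - A x) * indicator S y \<partial>lborel :: ennreal)"
        using nn_integral_lborel_translate(1)[of "\<lambda>y. indicator B (y - A x) * indicator S y" "A x"] by simp
    qed
    also have "\<dots> = (\<integral>\<^sup>+y. (\<integral>\<^sup>+x. indicator B (y - A x) * indicator S y \<partial>lborel) \<partial>lborel)"
      by (rule lborel_pair.Fubini') measurable
    also have "\<dots> = (\<integral>\<^sup>+y. emeasure lborel B * indicator S y \<partial>lborel)"
    proof (intro nn_integral_cong)
      fix y
      have "y - A x = A (inv A y - x)" for x
        using bij lin by (simp add: linear_diff bij_is_surj surj_f_inv_f)
      then have "(\<integral>\<^sup>+x. indicator B (y - A x) \<partial>lborel) = (\<integral>\<^sup>+x. indicator B (inv A y - x) \<partial>lborel :: ennreal)"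
        by (simp add: IB)
      also have "\<dots> = emeasure lborel B"
        using nn_integral_lborel_translate(2)[of "indicator B" "inv A y"] by simp
      finally show "(\<integral>\<^sup>+x. indicator B (y - A x) * indicator S y \<partial>lborel) = emeasure lborel B * indicator S y"
        by (simp add: nn_integral_multc)
    qed
    also have "\<dots> = emeasure lborel B * emeasure lborel S" by (simp add: nn_integral_cmult)
    finally show ?thesis .
  qed
  show ?thesis
  proof (rule measure_eqI)
    fix S assume "S \<in> sets (distr lborel borel A)"
    then have S [measurable]: "S \<in> sets borel" by simp
    have "emeasure (distr lborel borel A) S = (\<integral>\<^sup>+x. indicator S (A x) \<partial>lborel)"
      by (subst nn_integral_distr[symmetric, of A lborel borel "indicator S"]) auto
    then show "emeasure (distr lborel borel A) S = emeasure lborel S"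
      using key[OF S] B by (simp add: ennreal_mult_cancel_left)
  qed simp
qed

definition br_symbol :: "real \<Rightarrow> real ^ 'n \<Rightarrow> real" where
  "br_symbol \<delta> \<xi> = max 0 (1 - (norm \<xi>)\<^sup>2) powr \<delta>"

lemma integrable_compact_support:
  fixes m :: "real ^ 'n \<Rightarrow> real"
  assumes "m \<in> borel_measurable lebesgue" "\<And>\<xi>. \<bar>m \<xi>\<bar> \<le> B" "\<And>\<xi>. m \<xi> \<noteq> 0 \<Longrightarrow> norm \<xi> \<le> R"
  shows "integrable lebesgue m"
proof (rule Bochner_Integration.integrable_bound)
  show "integrable lebesgue (\<lambda>\<xi>. B * indicator (cball (0 :: real ^ 'n) R) \<xi>)"
    using lmeasurable_compact[of "cball (0 :: real ^ 'n) R"]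
    by (intro integrable_mult_right integrable_real_indicator) (auto simp: fmeasurable_def)
  show "AE \<xi> in lebesgue. norm (m \<xi>) \<le> norm (B * indicator (cball 0 R) \<xi>)"
  proof (intro AE_I2)
    fix \<xi> show "norm (m \<xi>) \<le> norm (B * indicator (cball 0 R) \<xi>)"
      using assms(2)[of \<xi>] assms(3)[of \<xi>] by (cases "m \<xi> = 0") auto
  qed
qed (use assms in auto)

lemma br_symbol_borel [measurable]: "br_symbol \<delta> \<in> borel_measurable borel"
  unfolding br_symbol_def by measurable

lemma integrable_br_symbol: "\<delta> > 0 \<Longrightarrow> integrable lebesgue (br_symbol \<delta> :: real ^ 'n \<Rightarrow> real)"
proof (rule integrable_compact_support[where B = 1 and R = 1])
  assume \<delta>: "\<delta> > 0"
  show "br_symbol \<delta> \<in> borel_measurable lebesgue" by (rule measurable_completion) simp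
  fix \<xi> :: "real ^ 'n"
  have "max 0 (1 - (norm \<xi>)\<^sup>2) powr \<delta> \<le> 1 powr \<delta>" using \<delta> by (intro powr_mono2) auto
  then show "\<bar>br_symbol \<delta> \<xi>\<bar> \<le> 1" by (simp add: br_symbol_def)
  assume "br_symbol \<delta> \<xi> \<noteq> 0"
  then have "(norm \<xi>)\<^sup>2 < 1" by (simp add: br_symbol_def max_def split: if_splits)
  then show "norm \<xi> \<le> 1" by (simp add: abs_square_less_1)
qed

text \<open>After a rotation \<open>x\<close> points along \<open>e\<close>. Then the phase depends
  on the coordinate \<open>\<xi> \<bullet> e\<close> alone, and the projected weight turns the
  integral into \<open>osc\<close>.\<close>

lemma kernel_br_symbol:
  assumes \<delta>: "\<delta> > 0"
  shows "\<exists>c>0. \<forall>x :: real ^ 'n. kernel (br_symbol \<delta>) x = of_real c * osc (\<delta> + real (CARD('n) - 1) / 2) (norm x)"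
proof -
  define e :: "real ^ 'n" where "e = axis undefined 1"
  have e: "e \<in> Basis" "norm e = 1" by (auto simp: e_def axis_in_Basis_iff)
  define a where "a = \<delta> + real (CARD('n) - 1) / 2"
  obtain c where c: "c > 0" "\<And>h. h \<in> borel_measurable borel \<Longrightarrow>
      (\<integral>\<^sup>+(\<xi>::real^'n). h (\<xi> \<bullet> e) * ennreal (max 0 (1 - (norm \<xi>)\<^sup>2) powr \<delta>) \<partial>lborel) =
      (\<integral>\<^sup>+s. h s * ennreal (c * max 0 (1 - s\<^sup>2) powr a) \<partial>lborel)"
    using nn_integral_radial_projection[OF e(1), of \<delta>] \<delta> by (auto simp: a_def)
  \<comment> \<open>Stated as an equality of measures so that it can be applied to the complex
    exponential; the projection formula itself is about nonnegative functions.\<close>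
  have push: "distr (density lborel (\<lambda>\<xi>. ennreal (br_symbol \<delta> \<xi>))) borel (\<lambda>\<xi>. \<xi> \<bullet> e) =
      density lborel (\<lambda>s. ennreal (c * max 0 (1 - s\<^sup>2) powr a))" (is "?M = ?N")
  proof (rule measure_eqI)
    fix X assume "X \<in> sets ?M"
    then have X: "X \<in> sets borel" by simp
    have "emeasure ?M X = (\<integral>\<^sup>+\<xi>. ennreal (br_symbol \<delta> \<xi>) * indicator ((\<lambda>\<xi>. \<xi> \<bullet> e) -` X) \<xi> \<partial>lborel)"
    proof -
      have "(\<lambda>\<xi>. \<xi> \<bullet> e) -` X \<in> sets borel" using X measurable_sets_borel[of "\<lambda>\<xi>. \<xi> \<bullet> e" borel X] by simp
      then show ?thesis using X by (simp add: emeasure_distr emeasure_density)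
    qed
    also have "\<dots> = (\<integral>\<^sup>+\<xi>. indicator X (\<xi> \<bullet> e) * ennreal (max 0 (1 - (norm \<xi>)\<^sup>2) powr \<delta>) \<partial>lborel)"
      by (simp add: br_symbol_def mult.commute indicator_def)
    also have "\<dots> = emeasure ?N X" using X by (simp add: c(2) emeasure_density mult.commute)
    finally show "emeasure ?M X = emeasure ?N X" .
  qed simp
  have "kernel (br_symbol \<delta>) x = of_real c * osc a (norm x)" for x :: "real ^ 'n"
  proof -
    obtain A where A: "orthogonal_transformation A" "A (norm x *\<^sub>R e) = x"
    proof -
      have "norm (norm x *\<^sub>R e) = norm x" using e by simp
      then show ?thesis using that orthogonal_transformation_exists[of "norm x *\<^sub>R e" x] by metis
    qed
    have Am [measurable]: "A \<in> borel_measurable borel"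
      using orthogonal_transformation_linear[OF A(1)]
      by (intro borel_measurable_continuous_onI linear_continuous_on linear_conv_bounded_linear[THEN iffD1])
    have "kernel (br_symbol \<delta>) x = (\<integral>\<xi>. cis (2 * pi * (x \<bullet> \<xi>)) * of_real (br_symbol \<delta> \<xi>) \<partial>lborel)"
      unfolding kernel_def inverse_fourier_def by (rule integral_completion) measurable
    also have "\<dots> = (\<integral>\<xi>. cis (2 * pi * (x \<bullet> A \<xi>)) * of_real (br_symbol \<delta> (A \<xi>)) \<partial>lborel)"
    proof -
      have "(\<integral>\<xi>. cis (2 * pi * (x \<bullet> \<xi>)) * of_real (br_symbol \<delta> \<xi>) \<partial>(distr lborel borel A)) =
          (\<integral>\<xi>. cis (2 * pi * (x \<bullet> A \<xi>)) * of_real (br_symbol \<delta> (A \<xi>)) \<partial>lborel)"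
        by (rule integral_distr) measurable
      then show ?thesis unfolding lborel_distr_orthogonal[OF A(1)] .
    qed
    also have "\<dots> = (\<integral>\<xi>. br_symbol \<delta> \<xi> *\<^sub>R cis (2 * pi * norm x * (\<xi> \<bullet> e)) \<partial>lborel)"
    proof (rule Bochner_Integration.integral_cong[OF refl])
      fix \<xi>
      have "x \<bullet> A \<xi> = norm x * (\<xi> \<bullet> e)"
        using A unfolding orthogonal_transformation_def by (metis inner_commute inner_scaleR_left)
      moreover have "br_symbol \<delta> (A \<xi>) = br_symbol \<delta> \<xi>"
        using A(1) by (simp add: br_symbol_def orthogonal_transformation_norm)
      ultimately show "cis (2 * pi * (x \<bullet> A \<xi>)) * of_real (br_symbol \<delta> (A \<xi>)) = br_symbol \<delta> \<xi> *\<^sub>R cis (2 * pi * norm x * (\<xi> \<bullet> e))"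
        by (simp add: scaleR_conv_of_real mult_ac)
    qed
    also have "\<dots> = (\<integral>s. cis (2 * pi * norm x * s) \<partial>?M)"
    proof -
      have "(\<integral>s. cis (2 * pi * norm x * s) \<partial>?M) = (\<integral>\<xi>. cis (2 * pi * norm x * (\<xi> \<bullet> e)) \<partial>density lborel (\<lambda>\<xi>. ennreal (br_symbol \<delta> \<xi>)))"
        by (rule integral_distr) measurable
      also have "\<dots> = (\<integral>\<xi>. br_symbol \<delta> \<xi> *\<^sub>R cis (2 * pi * norm x * (\<xi> \<bullet> e)) \<partial>lborel)"
        by (rule integral_density) (auto simp: br_symbol_def)
      finally show ?thesis by simp
    qed
    also have "\<dots> = (\<integral>s. (c * max 0 (1 - s\<^sup>2) powr a) *\<^sub>R cis (2 * pi * norm x * s) \<partial>lborel)"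
      unfolding push by (rule integral_density) (use c(1) in auto)
    also have "\<dots> = of_real c * osc a (norm x)"
    proof -
      have "of_real c * osc a (norm x) = (\<integral>s. of_real c * (cis (2 * pi * norm x * s) * of_real (max 0 (1 - s\<^sup>2) powr a)) \<partial>lborel)"
        unfolding osc_def by (rule Bochner_Integration.integral_mult_right_zero[symmetric])
      also have "\<dots> = (\<integral>s. (c * max 0 (1 - s\<^sup>2) powr a) *\<^sub>R cis (2 * pi * norm x * s) \<partial>lborel)"
        by (rule Bochner_Integration.integral_cong[OF refl]) (simp add: scaleR_conv_of_real mult_ac)
      finally show ?thesis by (rule sym)
    qed
    finally show ?thesis .
  qed
  then show ?thesis using c(1) by (auto simp: a_def)
qed


section \<open>Decay of kernels of smooth radial symbols\<close>

text \<open>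
  The \<open>j\<close>-th derivative of \<open>f \<sigma>\<close> is bounded by a multiple of \<open>\<sigma>\<close> to the power \<open>- j\<close> for \<open>j \<le> M\<close>,
  uniformly in \<open>\<sigma> \<in> P\<close>.
\<close>

fun smooth_family :: "nat \<Rightarrow> real set \<Rightarrow> real set \<Rightarrow> (real \<Rightarrow> real \<Rightarrow> real) \<Rightarrow> bool" where
  "smooth_family 0 U P f \<longleftrightarrow>
     (\<exists>C. \<forall>\<sigma>\<in>P. \<forall>t\<in>U. \<bar>f \<sigma> t\<bar> \<le> C) \<and> (\<forall>\<sigma>\<in>P. continuous_on U (f \<sigma>))"
| "smooth_family (Suc M) U P f \<longleftrightarrow>
     (\<exists>C. \<forall>\<sigma>\<in>P. \<forall>t\<in>U. \<bar>f \<sigma> t\<bar> \<le> C) \<and> (\<forall>\<sigma>\<in>P. continuous_on U (f \<sigma>)) \<and>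
     (\<exists>f'. (\<forall>\<sigma>\<in>P. \<forall>t\<in>U. (f \<sigma> has_real_derivative f' \<sigma> t / \<sigma>) (at t)) \<and> smooth_family M U P f')"

lemma smooth_family_0: "smooth_family M U P f \<Longrightarrow> smooth_family 0 U P f"
  by (cases M) auto

lemma smooth_family_SucD: "smooth_family (Suc M) U P f \<Longrightarrow> smooth_family M U P f"
proof (induction M arbitrary: f)
  case (Suc M)
  from Suc.prems obtain f' where f': "\<forall>\<sigma>\<in>P. \<forall>t\<in>U. (f \<sigma> has_real_derivative f' \<sigma> t / \<sigma>) (at t)" "smooth_family (Suc M) U P f'"
    by (subst (asm) smooth_family.simps(2)) blast
  have "smooth_family M U P f'" by (rule Suc.IH[OF f'(2)])
  with f'(1) smooth_family_0[OF Suc.prems] show ?case by (subst smooth_family.simps(2)) auto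
qed auto

lemma smooth_family_SucI:
  assumes "smooth_family 0 U P f" "smooth_family M U P f'"
    "\<And>\<sigma> t. \<sigma> \<in> P \<Longrightarrow> t \<in> U \<Longrightarrow> (f \<sigma> has_real_derivative f' \<sigma> t / \<sigma>) (at t)"
  shows "smooth_family (Suc M) U P f"
  using assms by (subst smooth_family.simps(2)) auto

lemma smooth_family_SucE:
  assumes "smooth_family (Suc M) U P f"
  obtains f' where "smooth_family M U P f'"
    "\<forall>\<sigma>\<in>P. \<forall>t\<in>U. (f \<sigma> has_real_derivative f' \<sigma> t / \<sigma>) (at t)"
  using assms by (subst (asm) smooth_family.simps(2)) blast

lemma smooth_family_cong:
  assumes "open U" "\<And>\<sigma> t. \<sigma> \<in> P \<Longrightarrow> t \<in> U \<Longrightarrow> f \<sigma> t = g \<sigma> t" "smooth_family M U P f"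
  shows "smooth_family M U P g"
proof -
  have z: "smooth_family 0 U P g"
  proof -
    have "continuous_on U (f \<sigma>) \<longleftrightarrow> continuous_on U (g \<sigma>)" if "\<sigma> \<in> P" for \<sigma>
      using assms(2) that by (intro continuous_on_cong) auto
    then show ?thesis using smooth_family_0[OF assms(3)] assms(2) by auto
  qed
  show ?thesis
  proof (cases M)
    case (Suc N)
    from assms(3)[unfolded Suc] obtain f' where f': "smooth_family N U P f'"
      "\<And>\<sigma> t. \<sigma> \<in> P \<Longrightarrow> t \<in> U \<Longrightarrow> (f \<sigma> has_real_derivative f' \<sigma> t / \<sigma>) (at t)" by (rule smooth_family_SucE) blast
    show ?thesis unfolding Suc
    proof (rule smooth_family_SucI[OF z f'(1)])
      fix \<sigma> t assume "\<sigma> \<in> P" "t \<in> U"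
      then show "(g \<sigma> has_real_derivative f' \<sigma> t / \<sigma>) (at t)"
        using has_field_derivative_transform_within_open[OF f'(2)[of \<sigma> t] assms(1), of "g \<sigma>"] assms(2) by auto
    qed
  qed (use z in simp)
qed

lemma smooth_family_add:
  "smooth_family M U P f \<Longrightarrow> smooth_family M U P g \<Longrightarrow> smooth_family M U P (\<lambda>\<sigma> t. f \<sigma> t + g \<sigma> t)"
proof (induction M arbitrary: f g)
  case 0
  then obtain C D where "\<forall>\<sigma>\<in>P. \<forall>t\<in>U. \<bar>f \<sigma> t\<bar> \<le> C" "\<forall>\<sigma>\<in>P. \<forall>t\<in>U. \<bar>g \<sigma> t\<bar> \<le> D" by auto
  then have "\<forall>\<sigma>\<in>P. \<forall>t\<in>U. \<bar>f \<sigma> t + g \<sigma> t\<bar> \<le> C + D" by (meson abs_triangle_ineq add_mono order_trans)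
  with 0 show ?case by (auto intro: continuous_on_add)
next
  case (Suc M)
  obtain f' where f': "smooth_family M U P f'"
    "\<forall>\<sigma>\<in>P. \<forall>t\<in>U. (f \<sigma> has_real_derivative f' \<sigma> t / \<sigma>) (at t)"
    by (rule smooth_family_SucE[OF Suc.prems(1)])
  note f' = f'(1) f'(2)[rule_format]
  obtain g' where g': "smooth_family M U P g'"
    "\<forall>\<sigma>\<in>P. \<forall>t\<in>U. (g \<sigma> has_real_derivative g' \<sigma> t / \<sigma>) (at t)"
    by (rule smooth_family_SucE[OF Suc.prems(2)])
  note g' = g'(1) g'(2)[rule_format]
  have z: "smooth_family 0 U P (\<lambda>\<sigma> t. f \<sigma> t + g \<sigma> t)"
    by (rule smooth_family_0[OF Suc.IH[OF smooth_family_SucD[OF Suc.prems(1)] smooth_family_SucD[OF Suc.prems(2)]]])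
  show ?case
  proof (rule smooth_family_SucI[OF z Suc.IH[OF f'(1) g'(1)]])
    fix \<sigma> t assume *: "\<sigma> \<in> P" "t \<in> U"
    show "((\<lambda>t. f \<sigma> t + g \<sigma> t) has_real_derivative (f' \<sigma> t + g' \<sigma> t) / \<sigma>) (at t)"
      using DERIV_add[OF f'(2)[OF *] g'(2)[OF *]] by (simp add: add_divide_distrib)
  qed
qed

lemma smooth_family_mult:
  "smooth_family M U P f \<Longrightarrow> smooth_family M U P g \<Longrightarrow> smooth_family M U P (\<lambda>\<sigma> t. f \<sigma> t * g \<sigma> t)"
proof (induction M arbitrary: f g)
  case 0
  then obtain C D where CD: "\<forall>\<sigma>\<in>P. \<forall>t\<in>U. \<bar>f \<sigma> t\<bar> \<le> C" "\<forall>\<sigma>\<in>P. \<forall>t\<in>U. \<bar>g \<sigma> t\<bar> \<le> D" by auto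
  have "\<bar>f \<sigma> t * g \<sigma> t\<bar> \<le> C * D" if "\<sigma> \<in> P" "t \<in> U" for \<sigma> t
  proof -
    have "\<bar>f \<sigma> t\<bar> \<le> C" "\<bar>g \<sigma> t\<bar> \<le> D" using CD that by auto
    then show ?thesis unfolding abs_mult using order_trans[OF abs_ge_zero] by (intro mult_mono) auto
  qed
  with 0 show ?case by (auto intro: continuous_on_mult)
next
  case (Suc M)
  obtain f' where f': "smooth_family M U P f'"
    "\<forall>\<sigma>\<in>P. \<forall>t\<in>U. (f \<sigma> has_real_derivative f' \<sigma> t / \<sigma>) (at t)"
    by (rule smooth_family_SucE[OF Suc.prems(1)])
  note f' = f'(1) f'(2)[rule_format]
  obtain g' where g': "smooth_family M U P g'"
    "\<forall>\<sigma>\<in>P. \<forall>t\<in>U. (g \<sigma> has_real_derivative g' \<sigma> t / \<sigma>) (at t)"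
    by (rule smooth_family_SucE[OF Suc.prems(2)])
  note g' = g'(1) g'(2)[rule_format]
  have fg: "smooth_family M U P f" "smooth_family M U P g"
    using smooth_family_SucD[OF Suc.prems(1)] smooth_family_SucD[OF Suc.prems(2)] .
  have z: "smooth_family 0 U P (\<lambda>\<sigma> t. f \<sigma> t * g \<sigma> t)" by (rule smooth_family_0[OF Suc.IH[OF fg]])
  show ?case
  proof (rule smooth_family_SucI[OF z smooth_family_add[OF Suc.IH[OF f'(1) fg(2)] Suc.IH[OF fg(1) g'(1)]]])
    fix \<sigma> t assume *: "\<sigma> \<in> P" "t \<in> U"
    have "(f' \<sigma> t * g \<sigma> t + f \<sigma> t * g' \<sigma> t) / \<sigma> = f' \<sigma> t / \<sigma> * g \<sigma> t + g' \<sigma> t / \<sigma> * f \<sigma> t"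
      by (simp add: add_divide_distrib)
    then show "((\<lambda>t. f \<sigma> t * g \<sigma> t) has_real_derivative (f' \<sigma> t * g \<sigma> t + f \<sigma> t * g' \<sigma> t) / \<sigma>) (at t)"
      using DERIV_mult[OF f'(2)[OF *] g'(2)[OF *]] by simp
  qed
qed

lemma smooth_family_const:
  assumes "\<And>\<sigma>. \<sigma> \<in> P \<Longrightarrow> \<bar>c \<sigma>\<bar> \<le> K"
  shows "smooth_family M U P (\<lambda>\<sigma> t. c \<sigma>)"
proof -
  have *: "smooth_family M U P (\<lambda>\<sigma> t. 0)" for M
  proof (induction M)
    case (Suc M)
    show ?case by (rule smooth_family_SucI[OF _ Suc]) auto
  qed auto
  have z: "smooth_family 0 U P (\<lambda>\<sigma> t. c \<sigma>)" using assms by auto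
  show ?thesis
  proof (cases M)
    case (Suc N)
    show ?thesis unfolding Suc by (rule smooth_family_SucI[OF z *]) auto
  qed (use z in simp)
qed

text \<open>On the open set \<open>V\<close> the derivatives vanish along with the functions, so the
  induction applies to the derived family. It serves to extend a profile by zero across a point
  where its formula is singular.\<close>

lemma smooth_family_glue:
  assumes "open U" "open V"
  shows "smooth_family M U P f \<Longrightarrow> (\<And>\<sigma> t. \<sigma> \<in> P \<Longrightarrow> t \<in> V \<Longrightarrow> f \<sigma> t = 0) \<Longrightarrow> smooth_family M (U \<union> V) P f"
proof (induction M arbitrary: f)
  case 0
  then obtain C where C: "\<forall>\<sigma>\<in>P. \<forall>t\<in>U. \<bar>f \<sigma> t\<bar> \<le> C" by auto
  have "\<bar>f \<sigma> t\<bar> \<le> max C 0" if "\<sigma> \<in> P" "t \<in> U \<union> V" for \<sigma> t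
    using that C 0(2)[OF that(1), of t] by (auto simp: le_max_iff_disj)
  moreover have "continuous_on (U \<union> V) (f \<sigma>)" if "\<sigma> \<in> P" for \<sigma>
  proof (rule continuous_on_open_Un[OF assms])
    show "continuous_on V (f \<sigma>)" using 0(2)[OF that] by (subst continuous_on_cong[OF refl, of _ _ "\<lambda>_. 0"]) auto
  qed (use 0 that in auto)
  ultimately show ?case by auto
next
  case (Suc M)
  obtain f' where f': "smooth_family M U P f'"
    "\<forall>\<sigma>\<in>P. \<forall>t\<in>U. (f \<sigma> has_real_derivative f' \<sigma> t / \<sigma>) (at t)"
    by (rule smooth_family_SucE[OF Suc.prems(1)])
  note f' = f'(1) f'(2)[rule_format]
  define h where "h \<sigma> t = (if t \<in> U then f' \<sigma> t else 0)" for \<sigma> t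
  have h: "smooth_family M U P h"
    by (rule smooth_family_cong[OF assms(1) _ f'(1)]) (auto simp: h_def)
  have d0: "(f \<sigma> has_real_derivative 0) (at t)" if "\<sigma> \<in> P" "t \<in> V" for \<sigma> t
    by (rule has_field_derivative_transform_within_open[OF DERIV_const[of 0] assms(2) that(2)])
       (use Suc.prems(2) that in auto)
  have h0: "h \<sigma> t / \<sigma> = 0" if "\<sigma> \<in> P" "t \<in> V" for \<sigma> t
    using DERIV_unique[OF d0[OF that] f'(2)[OF that(1)]] by (auto simp: h_def)
  have z: "smooth_family 0 (U \<union> V) P f"
    by (rule smooth_family_0[OF Suc.IH[OF smooth_family_SucD[OF Suc.prems(1)] Suc.prems(2)]])
  \<comment> \<open>At \<open>\<sigma> = 0\<close> the quotient
    \<open>h \<sigma> t / \<sigma>\<close> is 0 by convention and carries no information on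
    \<open>h\<close>. Setting the family to 0 there makes it vanish on \<open>V\<close> for every
    parameter.\<close>
  define k where "k \<sigma> t = (if \<sigma> = 0 then 0 else h \<sigma> t)" for \<sigma> t
  have k: "smooth_family M U P k"
  proof -
    have "smooth_family M U P (\<lambda>\<sigma> t. (if \<sigma> = 0 then 0 else 1) * h \<sigma> t)"
      by (rule smooth_family_mult[OF smooth_family_const[of _ _ 1] h]) auto
    also have "(\<lambda>\<sigma> t. (if \<sigma> = 0 then 0 else 1) * h \<sigma> t) = k" by (auto simp: k_def fun_eq_iff)
    finally show ?thesis .
  qed
  have kh: "k \<sigma> t / \<sigma> = h \<sigma> t / \<sigma>" for \<sigma> t by (simp add: k_def)
  show ?case
  proof (rule smooth_family_SucI[OF z Suc.IH[OF k]])
    show "k \<sigma> t = 0" if "\<sigma> \<in> P" "t \<in> V" for \<sigma> t using h0[OF that] by (auto simp: k_def)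
    fix \<sigma> t assume *: "\<sigma> \<in> P" "t \<in> U \<union> V"
    show "(f \<sigma> has_real_derivative k \<sigma> t / \<sigma>) (at t)"
    proof (cases "t \<in> U")
      case True
      then show ?thesis using f'(2)[OF *(1) True] unfolding kh by (simp add: h_def)
    next
      case False
      then have V: "t \<in> V" using * by auto
      show ?thesis using d0[OF *(1) V] unfolding kh h0[OF *(1) V] .
    qed
  qed
qed

text \<open>The functions do not depend on \<open>\<sigma>\<close>. Their derivative is written as
  \<open>\<sigma>\<close> times a power, divided by \<open>\<sigma>\<close>, to fit the format, and
  \<open>\<sigma> \<le> 1\<close> keeps the extra factor bounded. Each derivative lowers the
  exponent by one, hence the bound for all \<open>k\<close>.\<close>

lemma smooth_family_powr:
  assumes P: "P \<subseteq> {0<..1}" and U: "U \<subseteq> {t. 0 < t}"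
    and bd: "\<And>k. \<exists>C. \<forall>t\<in>U. t powr (\<beta> - real k) \<le> C"
  shows "smooth_family M U P (\<lambda>\<sigma> t. t powr (\<beta> - real k))"
proof (induction M arbitrary: k)
  case 0
  obtain C where "\<forall>t\<in>U. t powr (\<beta> - real k) \<le> C" using bd by blast
  moreover have "continuous_on U (\<lambda>t. t powr (\<beta> - real k))"
    using U by (intro continuous_intros) auto
  ultimately show ?case by auto
next
  case (Suc M)
  have z: "smooth_family 0 U P (\<lambda>\<sigma> t. t powr (\<beta> - real k))" by (rule smooth_family_0[OF Suc.IH])
  have "smooth_family M U P (\<lambda>\<sigma> t. (\<sigma> * (\<beta> - real k)) * t powr (\<beta> - real (Suc k)))"
    by (rule smooth_family_mult[OF smooth_family_const[where K = "\<bar>\<beta> - real k\<bar>"] Suc.IH])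
       (use P in \<open>auto simp: abs_mult mult_left_le_one_le subset_iff\<close>)
  then show ?case
  proof (rule smooth_family_SucI[OF z])
    fix \<sigma> t assume "\<sigma> \<in> P" "t \<in> U"
    then have "\<sigma> > 0" "t > 0" using P U by auto
    then show "((\<lambda>t. t powr (\<beta> - real k)) has_real_derivative \<sigma> * (\<beta> - real k) * t powr (\<beta> - real (Suc k)) / \<sigma>) (at t)"
    proof -
      have e: "\<beta> - real (Suc k) = (\<beta> - real k) - 1" by simp
      show ?thesis unfolding e using has_real_derivative_powr[OF \<open>t > 0\<close>, of "\<beta> - real k"] \<open>\<sigma> > 0\<close> by simp
    qed
  qed
qed

lemma smooth_family_compose_affine:
  assumes "smooth_family M U P f" "\<And>t. t \<in> V \<Longrightarrow> 1 - t \<in> U"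
  shows "smooth_family M V P (\<lambda>\<sigma> t. f \<sigma> (1 - t))"
  using assms(1)
proof (induction M arbitrary: f)
  case 0
  have "continuous_on V (\<lambda>t. f \<sigma> (1 - t))" if "\<sigma> \<in> P" for \<sigma>
    by (rule continuous_on_compose2[of U "f \<sigma>"]) (use 0 that assms(2) in \<open>auto intro!: continuous_intros\<close>)
  moreover obtain C where "\<forall>\<sigma>\<in>P. \<forall>t\<in>U. \<bar>f \<sigma> t\<bar> \<le> C" using 0 by auto
  then have "\<forall>\<sigma>\<in>P. \<forall>t\<in>V. \<bar>f \<sigma> (1 - t)\<bar> \<le> C" using assms(2) by blast
  ultimately show ?case by auto
next
  case (Suc M)
  obtain f' where f': "smooth_family M U P f'"
    "\<forall>\<sigma>\<in>P. \<forall>t\<in>U. (f \<sigma> has_real_derivative f' \<sigma> t / \<sigma>) (at t)"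
    by (rule smooth_family_SucE[OF Suc.prems])
  note f' = f'(1) f'(2)[rule_format]
  have z: "smooth_family 0 V P (\<lambda>\<sigma> t. f \<sigma> (1 - t))"
    by (rule smooth_family_0[OF Suc.IH[OF smooth_family_SucD[OF Suc.prems]]])
  have m: "smooth_family M V P (\<lambda>\<sigma> t. (- 1) * f' \<sigma> (1 - t))"
    by (rule smooth_family_mult[OF smooth_family_const[where K = 1] Suc.IH[OF f'(1)]]) auto
  show ?case
  proof (rule smooth_family_SucI[OF z m])
    fix \<sigma> t assume "\<sigma> \<in> P" "t \<in> V"
    then have "(f \<sigma> has_real_derivative f' \<sigma> (1 - t) / \<sigma>) (at (1 - t))" using f'(2) assms(2) by blast
    from DERIV_chain2[where f = "f \<sigma>" and g = "\<lambda>t. 1 - t" and x = t and s = UNIV and Db = "-1", OF this]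
    have "((\<lambda>t. 1 - t) has_real_derivative -1) (at t) \<Longrightarrow> ((\<lambda>t. f \<sigma> (1 - t)) has_real_derivative f' \<sigma> (1 - t) / \<sigma> * (-1)) (at t)" .
    moreover have "((\<lambda>t. 1 - t) has_real_derivative -1) (at t)" by (auto intro!: derivative_eq_intros)
    ultimately show "((\<lambda>t. f \<sigma> (1 - t)) has_real_derivative (- 1) * f' \<sigma> (1 - t) / \<sigma>) (at t)"
      by simp
  qed
qed

section \<open>The cutoff and its compositions as smooth families\<close>

lemma schwartz_deriv:
  assumes "schwartz chi"
  shows "((deriv ^^ i) chi has_real_derivative (deriv ^^ Suc i) chi t) (at t)" "\<exists>C. \<forall>t. \<bar>(deriv ^^ i) chi t\<bar> \<le> C"
proof -
  have "(deriv ^^ i) chi field_differentiable at t" using assms by (auto simp: schwartz_def)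
  then show "((deriv ^^ i) chi has_real_derivative (deriv ^^ Suc i) chi t) (at t)"
    by (simp add: field_differentiable_derivI)
  have "bounded (range (\<lambda>x. x ^ 0 * (deriv ^^ i) chi x))" using assms unfolding schwartz_def by blast
  then show "\<exists>C. \<forall>t. \<bar>(deriv ^^ i) chi t\<bar> \<le> C" by (auto simp: bounded_iff)
qed

lemma smooth_family_schwartz:
  assumes chi: "schwartz chi" and P: "P \<subseteq> {0<..1}"
  shows "smooth_family M U P (\<lambda>\<sigma>. (deriv ^^ i) chi)"
proof (induction M arbitrary: i)
  case 0
  have "continuous_on U ((deriv ^^ i) chi)"
    using schwartz_deriv(1)[OF chi, of i] DERIV_isCont continuous_at_imp_continuous_on by blast
  then show ?case using schwartz_deriv(2)[OF chi, of i] by auto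
next
  case (Suc M)
  have z: "smooth_family 0 U P (\<lambda>\<sigma>. (deriv ^^ i) chi)" by (rule smooth_family_0[OF Suc.IH])
  have "smooth_family M U P (\<lambda>\<sigma> t. \<sigma> * (deriv ^^ Suc i) chi t)"
    by (rule smooth_family_mult[OF smooth_family_const[where K = 1] Suc.IH]) (use P in \<open>auto simp: subset_iff\<close>)
  then show ?case
  proof (rule smooth_family_SucI[OF z])
    fix \<sigma> t assume "\<sigma> \<in> P" "t \<in> U"
    then have "\<sigma> \<noteq> 0" using P by auto
    then show "((deriv ^^ i) chi has_real_derivative \<sigma> * (deriv ^^ Suc i) chi t / \<sigma>) (at t)"
      using schwartz_deriv(1)[OF chi, of i t] by simp
  qed
qed

text \<open>The inner function has derivative \<open>1/2 * t powr (-1/2) / \<sigma>\<close>, which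
  is exactly the loss that a smooth family may have. Keeping \<open>t\<close> above 1/16 bounds the
  powers of \<open>t\<close>; the order \<open>i\<close> is arbitrary so that the induction can pass
  to the next derivative of \<open>chi\<close>.\<close>

lemma smooth_family_annulus:
  assumes chi: "schwartz chi" and P: "P \<subseteq> {0<..1}"
  shows "smooth_family M {1/16<..} P (\<lambda>\<sigma> t. (deriv ^^ i) chi ((sqrt t - 1 + \<sigma>) / \<sigma>))"
proof (induction M arbitrary: i)
  case 0
  have c: "continuous_on UNIV ((deriv ^^ i) chi)"
    using schwartz_deriv(1)[OF chi, of i] DERIV_isCont continuous_at_imp_continuous_on by blast
  have "continuous_on {1/16<..} (\<lambda>t. (deriv ^^ i) chi ((sqrt t - 1 + \<sigma>) / \<sigma>))" if "\<sigma> \<in> P" for \<sigma>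
    by (rule continuous_on_compose2[OF c]) (use that P in \<open>auto intro!: continuous_intros\<close>)
  then show ?case using schwartz_deriv(2)[OF chi, of i] by auto
next
  case (Suc M)
  have z: "smooth_family 0 {1/16<..} P (\<lambda>\<sigma> t. (deriv ^^ i) chi ((sqrt t - 1 + \<sigma>) / \<sigma>))" by (rule smooth_family_0[OF Suc.IH])
  have pw: "smooth_family M {1/16<..} P (\<lambda>\<sigma> t. t powr (-1/2 - real 0))"
  proof (rule smooth_family_powr[OF P])
    fix k
    have "t powr (-1/2 - real k) \<le> (1/16) powr (-1/2 - real k)" if "t \<in> {1/16<..}" for t :: real
      using that by (intro powr_mono2') auto
    then show "\<exists>C. \<forall>t\<in>{1/16<..}. t powr (-1/2 - real k) \<le> C" by blast
  qed auto
  have "smooth_family M {1/16<..} P (\<lambda>\<sigma> t. (deriv ^^ Suc i) chi ((sqrt t - 1 + \<sigma>) / \<sigma>) * (1/2 * t powr (-1/2 - real 0)))"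
    by (rule smooth_family_mult[OF Suc.IH smooth_family_mult[OF smooth_family_const[where K = "1/2"] pw]]) auto
  then show ?case
  proof (rule smooth_family_SucI[OF z])
    fix \<sigma> t :: real assume "\<sigma> \<in> P" "t \<in> {1/16<..}"
    then have st: "\<sigma> > 0" "t > 0" using P by auto
    have d: "((\<lambda>t. (sqrt t - 1 + \<sigma>) / \<sigma>) has_real_derivative (1/2 * t powr (-1/2)) / \<sigma>) (at t)"
      using st by (auto intro!: derivative_eq_intros simp: powr_minus powr_half_sqrt divide_simps)
    show "((\<lambda>t. (deriv ^^ i) chi ((sqrt t - 1 + \<sigma>) / \<sigma>)) has_real_derivative
      (deriv ^^ Suc i) chi ((sqrt t - 1 + \<sigma>) / \<sigma>) * (1/2 * t powr (-1/2 - real 0)) / \<sigma>) (at t)"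
      using DERIV_chain2[OF schwartz_deriv(1)[OF chi, of i] d] by simp
  qed
qed

text \<open>\<open>M\<close> integrations by parts. Each gains a factor \<open>c\<close> and costs
  at most \<open>1 / \<sigma>\<close>. Differentiating \<open>f \<sigma> (s\<^sup>2 + q)\<close>
  produces a factor \<open>2 * s\<close>, which is why an arbitrary power \<open>s ^ a\<close> is
  carried along.\<close>

lemma line_integral_tail:
  assumes P: "P \<subseteq> {0<..1}"
  shows "smooth_family M UNIV P f \<Longrightarrow> (\<And>\<sigma> t. \<sigma> \<in> P \<Longrightarrow> t > 9 \<Longrightarrow> f \<sigma> t = 0) \<Longrightarrow>
    \<exists>D. \<forall>\<sigma>\<in>P. \<forall>c q. q \<ge> 0 \<longrightarrow>
      (\<bar>c\<bar> * \<sigma>) ^ M * cmod (integral {-4..4} (\<lambda>s. cis (c * s) * of_real (s ^ a * f \<sigma> (s\<^sup>2 + q)))) \<le> D"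
proof (induction M arbitrary: f a)
  case 0
  then have "\<exists>C. \<forall>\<sigma>\<in>P. \<forall>t. \<bar>f \<sigma> t\<bar> \<le> C" by simp
  then obtain C where C: "\<And>\<sigma> t. \<sigma> \<in> P \<Longrightarrow> \<bar>f \<sigma> t\<bar> \<le> C" by blast
  have "cmod (integral {-4..4} (\<lambda>s. cis (c * s) * of_real (s ^ a * f \<sigma> (s\<^sup>2 + q)))) \<le> 4 ^ a * C * (4 - (-4))"
    if s: "\<sigma> \<in> P" for \<sigma> c q
  proof (rule integral_bound)
    have cf: "continuous_on UNIV (f \<sigma>)" using 0 s by auto
    show "continuous_on {-4..4} (\<lambda>s. cis (c * s) * of_real (s ^ a * f \<sigma> (s\<^sup>2 + q)))"
      by (intro continuous_intros continuous_on_compose2[OF cf]) auto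
    fix t :: real assume t: "t \<in> {-4..4}"
    have "\<bar>t\<bar> ^ a \<le> 4 ^ a" using t by (intro power_mono) auto
    then show "cmod (cis (c * t) * of_real (t ^ a * f \<sigma> (t\<^sup>2 + q))) \<le> 4 ^ a * C"
      using C[OF s, of "t\<^sup>2 + q"] by (auto simp: norm_mult abs_mult power_abs norm_power intro!: mult_mono)
  qed simp
  then show ?case by auto
next
  case (Suc M)
  let ?I = "\<lambda>a f \<sigma> c q. integral {-4..4} (\<lambda>s. cis (c * s) * of_real (s ^ a * f \<sigma> (s\<^sup>2 + q)))"
  obtain f' where f': "smooth_family M UNIV P f'"
    "\<forall>\<sigma>\<in>P. \<forall>t\<in>UNIV. (f \<sigma> has_real_derivative f' \<sigma> t / \<sigma>) (at t)"
    by (rule smooth_family_SucE[OF Suc.prems(1)])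
  note f' = f'(1) f'(2)[rule_format]
  have f0: "f' \<sigma> t = 0" if "\<sigma> \<in> P" "t > 9" for \<sigma> t
  proof -
    have "(f \<sigma> has_real_derivative 0) (at t)"
      by (rule has_field_derivative_transform_within_open[OF DERIV_const[of 0], of "{9<..}"])
         (use Suc.prems(2) that in auto)
    from DERIV_unique[OF this f'(2)[OF that(1)]] show ?thesis using that P by auto
  qed
  \<comment> \<open>For \<open>a = 0\<close> the exponent \<open>a - 1\<close> is again 0, but this
    term occurs below with the coefficient \<open>a\<close>.\<close>
  obtain D1 where D1: "\<And>\<sigma> c q. \<sigma> \<in> P \<Longrightarrow> q \<ge> 0 \<Longrightarrow> (\<bar>c\<bar> * \<sigma>) ^ M * cmod (?I (a - 1) f \<sigma> c q) \<le> D1"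
    using Suc.IH[OF smooth_family_SucD[OF Suc.prems(1)] Suc.prems(2), of "a - 1"] by blast
  obtain D2 where D2: "\<And>\<sigma> c q. \<sigma> \<in> P \<Longrightarrow> q \<ge> 0 \<Longrightarrow> (\<bar>c\<bar> * \<sigma>) ^ M * cmod (?I (a + 1) f' \<sigma> c q) \<le> D2"
    using Suc.IH[OF f'(1) f0, of "a + 1"] by blast
  have "(\<bar>c\<bar> * \<sigma>) ^ Suc M * cmod (?I a f \<sigma> c q) \<le> a * D1 + 2 * D2" if s: "\<sigma> \<in> P" and q: "q \<ge> 0" for \<sigma> c q
  proof -
    have s1: "0 < \<sigma>" "\<sigma> \<le> 1" using s P by auto
    have cf: "continuous_on UNIV (f \<sigma>)" "continuous_on UNIV (f' \<sigma>)"
      using smooth_family_0[OF Suc.prems(1)] smooth_family_0[OF f'(1)] s by auto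
    have int: "(\<lambda>s. cis (c * s) * of_real (s ^ b * g (s\<^sup>2 + q))) integrable_on {-4..4}" if "continuous_on UNIV g" for b and g :: "real \<Rightarrow> real"
      by (intro integrable_continuous_real continuous_intros continuous_on_compose2[OF that]) auto
    have ftc: "((\<lambda>s. (\<i> * c) * (cis (c * s) * of_real (s ^ a * f \<sigma> (s\<^sup>2 + q))) +
          (of_nat a * (cis (c * s) * of_real (s ^ (a - 1) * f \<sigma> (s\<^sup>2 + q))) +
           (2 / \<sigma>) * (cis (c * s) * of_real (s ^ (a + 1) * f' \<sigma> (s\<^sup>2 + q))))) has_integral
        (cis (c * 4) * of_real (4 ^ a * f \<sigma> (4\<^sup>2 + q)) - cis (c * (-4)) * of_real ((-4) ^ a * f \<sigma> ((-4)\<^sup>2 + q)))) {-4..4}"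
    proof (rule fundamental_theorem_of_calculus)
      fix s :: real assume "s \<in> {-4..4}"
      have e1: "((\<lambda>s. s ^ a * f \<sigma> (s\<^sup>2 + q)) has_real_derivative
          (a * s ^ (a - 1) * f \<sigma> (s\<^sup>2 + q) + s ^ a * (f' \<sigma> (s\<^sup>2 + q) / \<sigma> * (2 * s)))) (at s)"
      proof -
        have "((\<lambda>s. f \<sigma> (s\<^sup>2 + q)) has_real_derivative f' \<sigma> (s\<^sup>2 + q) / \<sigma> * (2 * s)) (at s)"
          by (rule DERIV_chain2[OF f'(2)[OF \<open>\<sigma> \<in> P\<close> UNIV_I]]) (auto intro!: derivative_eq_intros)
        then show ?thesis by (auto intro!: derivative_eq_intros)
      qed
      have e2: "((\<lambda>s. cis (c * s)) has_vector_derivative (\<i> * c) * cis (c * s)) (at s)"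
        unfolding cis_conv_exp by (auto intro!: derivative_eq_intros has_vector_derivative_real_field simp: field_simps)
      have e3: "((\<lambda>s. complex_of_real (s ^ a * f \<sigma> (s\<^sup>2 + q))) has_vector_derivative
          of_real (a * s ^ (a - 1) * f \<sigma> (s\<^sup>2 + q) + s ^ a * (f' \<sigma> (s\<^sup>2 + q) / \<sigma> * (2 * s)))) (at s)"
        using e1 by (intro has_vector_derivative_of_real) (simp add: has_real_derivative_iff_has_vector_derivative)
      show "((\<lambda>s. cis (c * s) * of_real (s ^ a * f \<sigma> (s\<^sup>2 + q))) has_vector_derivative
          (\<i> * c) * (cis (c * s) * of_real (s ^ a * f \<sigma> (s\<^sup>2 + q))) +
          (of_nat a * (cis (c * s) * of_real (s ^ (a - 1) * f \<sigma> (s\<^sup>2 + q))) +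
           (2 / \<sigma>) * (cis (c * s) * of_real (s ^ (a + 1) * f' \<sigma> (s\<^sup>2 + q))))) (at s within {-4..4})"
        by (rule has_vector_derivative_at_within, rule has_vector_derivative_eq_rhs[OF has_vector_derivative_mult[OF e2 e3]])
           (use s1 in \<open>simp add: algebra_simps\<close>)
    qed simp
    \<comment> \<open>The boundary terms vanish because \<open>4\<^sup>2 + q\<close> exceeds
      9.\<close>
    have z0: "f \<sigma> (4\<^sup>2 + q) = 0" "f \<sigma> ((-4)\<^sup>2 + q) = 0" using Suc.prems(2)[OF s] q by auto
    have "(\<i> * c) * ?I a f \<sigma> c q + (of_nat a * ?I (a - 1) f \<sigma> c q + (2 / \<sigma>) * ?I (a + 1) f' \<sigma> c q) = 0"
    proof -
      have hi: "((\<lambda>s. cis (c * s) * of_real (s ^ b * g (s\<^sup>2 + q))) has_integral ?I b (\<lambda>_. g) \<sigma> c q) {-4..4}"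
        if "continuous_on UNIV g" for b and g :: "real \<Rightarrow> real"
        using int[OF that] by (rule integrable_integral)
      note * = has_integral_add[OF has_integral_mult_right[OF hi[OF cf(1), of a], of "\<i> * c"]
          has_integral_add[OF has_integral_mult_right[OF hi[OF cf(1), of "a - 1"], of "of_nat a"]
            has_integral_mult_right[OF hi[OF cf(2), of "a + 1"], of "2 / \<sigma>"]]]
      from has_integral_unique[OF * ftc] z0 show ?thesis by simp
    qed
    then have "(\<i> * c) * ?I a f \<sigma> c q = - (of_nat a * ?I (a - 1) f \<sigma> c q + (2 / \<sigma>) * ?I (a + 1) f' \<sigma> c q)"
      by (simp add: add_eq_0_iff)
    then have "cmod ((\<i> * c) * ?I a f \<sigma> c q) = cmod (of_nat a * ?I (a - 1) f \<sigma> c q + (2 / \<sigma>) * ?I (a + 1) f' \<sigma> c q)"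
      by (simp only: norm_minus_cancel)
    then have "\<bar>c\<bar> * cmod (?I a f \<sigma> c q) = cmod (of_nat a * ?I (a - 1) f \<sigma> c q + (2 / \<sigma>) * ?I (a + 1) f' \<sigma> c q)"
      unfolding norm_mult norm_ii norm_of_real by simp
    also have "\<dots> \<le> a * cmod (?I (a - 1) f \<sigma> c q) + (2 / \<sigma>) * cmod (?I (a + 1) f' \<sigma> c q)"
      using s1 by (intro order_trans[OF norm_triangle_ineq]) (simp add: norm_mult norm_divide)
    finally have "\<sigma> * (\<bar>c\<bar> * cmod (?I a f \<sigma> c q)) \<le> \<sigma> * (a * cmod (?I (a - 1) f \<sigma> c q) + (2 / \<sigma>) * cmod (?I (a + 1) f' \<sigma> c q))"
      using s1 by (intro mult_left_mono) auto
    also have "\<dots> \<le> a * cmod (?I (a - 1) f \<sigma> c q) + 2 * cmod (?I (a + 1) f' \<sigma> c q)"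
      using s1 mult_right_mono[OF s1(2), of "a * cmod (?I (a - 1) f \<sigma> c q)"] by (simp add: field_simps)
    finally have "(\<bar>c\<bar> * \<sigma>) ^ M * (\<sigma> * (\<bar>c\<bar> * cmod (?I a f \<sigma> c q))) \<le>
        (\<bar>c\<bar> * \<sigma>) ^ M * (a * cmod (?I (a - 1) f \<sigma> c q) + 2 * cmod (?I (a + 1) f' \<sigma> c q))"
      using s1 by (intro mult_left_mono) auto
    also have "\<dots> = a * ((\<bar>c\<bar> * \<sigma>) ^ M * cmod (?I (a - 1) f \<sigma> c q)) + 2 * ((\<bar>c\<bar> * \<sigma>) ^ M * cmod (?I (a + 1) f' \<sigma> c q))"
      by (simp add: distrib_left mult_ac)
    also have "\<dots> \<le> a * D1 + 2 * D2"
      using D1[OF s q, of c] D2[OF s q, of c] by (intro add_mono mult_left_mono) auto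
    finally show ?thesis by (simp add: mult_ac)
  qed
  then show ?case by blast
qed

text \<open>Fubini with the frequency coordinate \<open>k\<close> innermost: the other coordinates
  enter only through their squared length \<open>q\<close> and a unimodular factor. If one of them
  lies outside \<open>{-4..4}\<close>, then \<open>q \<ge> 16\<close> and the slice vanishes, so the
  outer integral is over a cube of side 8.\<close>

lemma kernel_radial_slice:
  fixes m :: "real ^ 'n \<Rightarrow> real"
  assumes h: "continuous_on UNIV h" and h0: "\<And>t. t > 9 \<Longrightarrow> h t = 0"
    and B: "\<And>q. q \<ge> 0 \<Longrightarrow> cmod (integral {-4..4} (\<lambda>s. cis (2 * pi * (x $ k) * s) * of_real (h (s\<^sup>2 + q)))) \<le> B"
  shows "cmod (kernel (\<lambda>\<xi>. h ((norm \<xi>)\<^sup>2)) (x :: real ^ 'n)) \<le> B * 8 ^ (CARD('n) - 1)"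
proof -
  interpret product_sigma_finite "\<lambda>_. lborel :: real measure" by standard
  define e where "e = axis k (1::real)"
  have e: "e \<in> Basis" by (auto simp: e_def axis_in_Basis_iff)
  have xe: "x \<bullet> e = x $ k" by (simp add: e_def inner_axis)
  let ?A = "Basis - {e}"
  have ins: "insert e ?A = Basis" and card: "card ?A = CARD('n) - 1" using e by (auto simp: card_Diff_singleton)
  define G where "G \<xi> = cis (2 * pi * (x \<bullet> \<xi>)) * of_real (h ((norm \<xi>)\<^sup>2))" for \<xi>
  define E where "E f = (\<Sum>b\<in>Basis. f b *\<^sub>R b)" for f :: "real ^ 'n \<Rightarrow> real"
  have Gc: "continuous_on UNIV G" unfolding G_def
    by (intro continuous_intros continuous_on_compose2[OF h]) auto
  have G0: "G \<xi> = 0" if "\<xi> \<notin> cball 0 3" for \<xi>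
  proof -
    have "norm \<xi> > 3" using that by auto
    then have "(norm \<xi>)\<^sup>2 > 3\<^sup>2" by (intro power_strict_mono) auto
    then show ?thesis using h0 by (simp add: G_def)
  qed
  have Gi: "integrable lborel G"
  proof -
    have "integrable lborel (\<lambda>\<xi>. indicator (cball 0 3) \<xi> *\<^sub>R G \<xi>)"
      using Gc by (intro borel_integrable_compact continuous_on_subset[OF Gc]) auto
    moreover have "indicator (cball 0 3) \<xi> *\<^sub>R G \<xi> = G \<xi>" for \<xi> using G0[of \<xi>] by (auto simp: indicator_def)
    ultimately show ?thesis by simp
  qed
  have GB: "G \<in> borel_measurable borel" using Gc by (rule borel_measurable_continuous_onI)
  have Em: "E \<in> Pi\<^sub>M Basis (\<lambda>_. lborel) \<rightarrow>\<^sub>M borel" unfolding E_def by measurable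
  have lb: "(lborel :: (real ^ 'n) measure) = distr (Pi\<^sub>M Basis (\<lambda>_. lborel)) borel E"
    unfolding E_def by (rule lborel_eq)
  have GE: "integrable (Pi\<^sub>M Basis (\<lambda>_. lborel)) (\<lambda>f. G (E f))"
    using Gi unfolding lb by (subst (asm) integrable_distr_eq[OF Em GB])
  have "kernel (\<lambda>\<xi>. h ((norm \<xi>)\<^sup>2)) x = integral\<^sup>L lborel G"
    unfolding kernel_def inverse_fourier_def G_def[symmetric]
    by (rule integral_completion) (use GB in simp)
  also have "\<dots> = (\<integral>f. G (E f) \<partial>(Pi\<^sub>M Basis (\<lambda>_. lborel)))"
    unfolding lb by (rule integral_distr[OF Em GB])
  also have "\<dots> = (\<integral>f. (\<integral>s. G (E (f(e := s))) \<partial>lborel) \<partial>(Pi\<^sub>M ?A (\<lambda>_. lborel)))"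
    using product_integral_insert[of ?A e "\<lambda>f. G (E f)"] GE unfolding ins by simp
  finally have eq: "kernel (\<lambda>\<xi>. h ((norm \<xi>)\<^sup>2)) x = (\<integral>f. (\<integral>s. G (E (f(e := s))) \<partial>lborel) \<partial>(Pi\<^sub>M ?A (\<lambda>_. lborel)))" .
  have B0: "B \<ge> 0" using order_trans[OF norm_ge_zero B[of 0]] by simp
  let ?K = "Pi\<^sub>E ?A (\<lambda>_. {-4..4 :: real})"
  have inner: "cmod (\<integral>s. G (E (f(e := s))) \<partial>lborel) \<le> B * indicator ?K f" if f: "f \<in> space (Pi\<^sub>M ?A (\<lambda>_. lborel :: real measure))" for f
  proof -
    define q where "q = (\<Sum>b\<in>?A. (f b)\<^sup>2)"
    define w where "w = (\<Sum>b\<in>?A. f b * (x \<bullet> b))"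
    have q: "q \<ge> 0" by (auto simp: q_def sum_nonneg)
    have nE: "(norm (E (f(e := s))))\<^sup>2 = s\<^sup>2 + q" for s
    proof -
      have "(norm (E (f(e := s))))\<^sup>2 = (\<Sum>b\<in>Basis. ((f(e := s)) b)\<^sup>2)"
        unfolding E_def dot_square_norm[symmetric] by (subst euclidean_inner) (simp add: power2_eq_square)
      also have "\<dots> = s\<^sup>2 + (\<Sum>b\<in>?A. ((f(e := s)) b)\<^sup>2)"
        using sum.remove[OF finite_Basis e, of "\<lambda>b. ((f(e := s)) b)\<^sup>2"] by simp
      also have "(\<Sum>b\<in>?A. ((f(e := s)) b)\<^sup>2) = q" unfolding q_def by (intro sum.cong) auto
      finally show ?thesis .
    qed
    have xE: "x \<bullet> E (f(e := s)) = (x $ k) * s + w" for s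
    proof -
      have "x \<bullet> E (f(e := s)) = (\<Sum>b\<in>Basis. (f(e := s)) b * (x \<bullet> b))"
        unfolding E_def by (simp add: inner_sum_right)
      also have "\<dots> = s * (x \<bullet> e) + (\<Sum>b\<in>?A. (f(e := s)) b * (x \<bullet> b))"
        using sum.remove[OF finite_Basis e, of "\<lambda>b. (f(e := s)) b * (x \<bullet> b)"] by simp
      also have "(\<Sum>b\<in>?A. (f(e := s)) b * (x \<bullet> b)) = w" unfolding w_def by (intro sum.cong) auto
      finally show ?thesis by (simp only: xe mult.commute[of s])
    qed
    define g where "g s = cis (2 * pi * (x $ k) * s) * complex_of_real (h (s\<^sup>2 + q))" for s
    have Gg: "G (E (f(e := s))) = cis (2 * pi * w) * g s" for s
    proof -
      have "cis (2 * pi * (x $ k * s + w)) = cis (2 * pi * w) * cis (2 * pi * (x $ k) * s)"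
        unfolding cis_mult by (simp add: algebra_simps)
      then show ?thesis unfolding G_def g_def xE nE by (simp add: mult_ac)
    qed
    have gc: "continuous_on {-4..4} g" unfolding g_def
      by (intro continuous_intros continuous_on_compose2[OF h]) auto
    have gi: "set_integrable lborel {-4..4} g" by (rule borel_integrable_atLeastAtMost'[OF gc])
    have g0: "g s = indicator {-4..4} s *\<^sub>R g s" for s
    proof (cases "s \<in> {-4..4}")
      case False
      then have "4\<^sup>2 \<le> \<bar>s\<bar>\<^sup>2" by (intro power_mono) auto
      then have "h (s\<^sup>2 + q) = 0" using q by (intro h0) simp
      then show ?thesis by (simp add: g_def)
    qed simp
    have "(\<integral>s. g s \<partial>lborel) = integral {-4..4} g"
      using set_borel_integral_eq_integral(2)[OF gi] unfolding set_lebesgue_integral_def by (subst g0)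
    then have i1: "cmod (\<integral>s. G (E (f(e := s))) \<partial>lborel) \<le> B"
      unfolding Gg using B[OF q] by (simp add: norm_mult g_def[abs_def])
    show ?thesis
    proof (cases "f \<in> ?K")
      case False
      moreover have "f \<in> extensional ?A" using f by (simp add: space_PiM PiE_iff)
      ultimately have "\<not> (\<forall>b\<in>?A. f b \<in> {-4..4})" unfolding PiE_iff by blast
      then obtain b where b: "b \<in> ?A" "f b \<notin> {-4..4}" by blast
      then have "4\<^sup>2 \<le> \<bar>f b\<bar>\<^sup>2" by (intro power_mono) auto
      also have "\<bar>f b\<bar>\<^sup>2 \<le> q" unfolding q_def using b(1) member_le_sum[of b ?A "\<lambda>b. (f b)\<^sup>2"] by auto
      finally have "16 \<le> q" by simp
      then have "h (s\<^sup>2 + q) = 0" for s using zero_le_power2[of s] by (intro h0) linarith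
      then show ?thesis unfolding Gg by (simp add: g_def B0)
    qed (use i1 in simp)
  qed
  have eK: "emeasure (Pi\<^sub>M ?A (\<lambda>_. lborel :: real measure)) ?K = ennreal (8 ^ (CARD('n) - 1))"
    using card by (subst emeasure_PiM) (auto simp: ennreal_power[symmetric])
  have mK: "?K \<in> sets (Pi\<^sub>M ?A (\<lambda>_. lborel :: real measure))" by (rule sets_PiM_I_finite) auto
  have "cmod (kernel (\<lambda>\<xi>. h ((norm \<xi>)\<^sup>2)) x) \<le> (\<integral>f. B * indicator ?K f \<partial>(Pi\<^sub>M ?A (\<lambda>_. lborel :: real measure)))"
    unfolding eq
  proof (rule order_trans[OF Bochner_Integration.integral_norm_bound], rule integral_mono')
    show "integrable (Pi\<^sub>M ?A (\<lambda>_. lborel :: real measure)) (\<lambda>f. B * indicator ?K f)"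
      using mK eK by (intro integrable_mult_right integrable_real_indicator) auto
  qed (use inner B0 in auto)
  also have "\<dots> = B * measure (Pi\<^sub>M ?A (\<lambda>_. lborel :: real measure)) ?K" using mK sets.sets_into_space[OF mK] by (simp add: Int_absorb2)
  also have "measure (Pi\<^sub>M ?A (\<lambda>_. lborel :: real measure)) ?K = 8 ^ (CARD('n) - 1)"
    using eK by (simp add: measure_def)
  finally show ?thesis .
qed

text \<open>Slicing along coordinate \<open>k\<close> makes \<open>x $ k\<close> the frequency of
  the oscillation. The power is of one coordinate, not of the norm, because the separation of grid
  cells will also be observed in a single coordinate.\<close>

lemma kernel_smooth_family_tail:
  assumes P: "P \<subseteq> {0<..1}" and f: "smooth_family M UNIV P f" and f0: "\<And>\<sigma> t. \<sigma> \<in> P \<Longrightarrow> t > 9 \<Longrightarrow> f \<sigma> t = 0"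
  shows "\<exists>D\<ge>0. \<forall>\<sigma>\<in>P. \<forall>(x :: real ^ 'n) k. (\<sigma> * \<bar>x $ k\<bar>) ^ M * cmod (kernel (\<lambda>\<xi>. f \<sigma> ((norm \<xi>)\<^sup>2)) x) \<le> D"
proof -
  obtain D where D: "\<And>\<sigma> c q. \<sigma> \<in> P \<Longrightarrow> q \<ge> 0 \<Longrightarrow>
      (\<bar>c\<bar> * \<sigma>) ^ M * cmod (integral {-4..4} (\<lambda>s. cis (c * s) * of_real (s ^ 0 * f \<sigma> (s\<^sup>2 + q)))) \<le> D"
    using line_integral_tail[OF P f f0, of 0] by blast
  have "(\<sigma> * \<bar>x $ k\<bar>) ^ M * cmod (kernel (\<lambda>\<xi>. f \<sigma> ((norm \<xi>)\<^sup>2)) x) \<le> max 0 D * 8 ^ (CARD('n) - 1)"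
    if s: "\<sigma> \<in> P" for \<sigma> and x :: "real ^ 'n" and k
  proof (cases "(\<sigma> * \<bar>x $ k\<bar>) ^ M = 0")
    case False
    define y where "y = (\<sigma> * \<bar>x $ k\<bar>) ^ M"
    have s1: "\<sigma> > 0" using s P by auto
    have "y \<ge> 0" unfolding y_def using s1 by (intro zero_le_power mult_nonneg_nonneg) auto
    moreover have "y \<noteq> 0" using False unfolding y_def .
    ultimately have y: "y > 0" by linarith
    have "cmod (kernel (\<lambda>\<xi>. f \<sigma> ((norm \<xi>)\<^sup>2)) x) \<le> (max 0 D / y) * 8 ^ (CARD('n) - 1)"
    proof (rule kernel_radial_slice[of _ x k])
      show "continuous_on UNIV (f \<sigma>)" using smooth_family_0[OF f] s by auto
      show "f \<sigma> t = 0" if "t > 9" for t using f0 s that by auto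
      fix q :: real assume q: "q \<ge> 0"
      let ?J = "cmod (integral {-4..4} (\<lambda>s. cis (2 * pi * (x $ k) * s) * of_real (f \<sigma> (s\<^sup>2 + q))))"
      have "y \<le> (\<bar>2 * pi * (x $ k)\<bar> * \<sigma>) ^ M" unfolding y_def
        using s1 pi_ge_two mult_right_mono[of 1 "2 * pi" "\<sigma> * \<bar>x $ k\<bar>"] by (intro power_mono) (auto simp: abs_mult mult_ac)
      then have "y * ?J \<le> (\<bar>2 * pi * (x $ k)\<bar> * \<sigma>) ^ M * ?J" by (rule mult_right_mono) simp
      also have "\<dots> \<le> max 0 D" using D[OF s q, of "2 * pi * (x $ k)"] by simp
      finally show "?J \<le> max 0 D / y" using y by (simp add: field_simps)
    qed
    then show ?thesis unfolding y_def[symmetric] using y by (simp add: field_simps)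
  next
    case True
    then show ?thesis by (simp only: mult_zero_left) simp
  qed
  then show ?thesis by (intro exI[of _ "max 0 D * 8 ^ (CARD('n) - 1)"]) auto
qed


section \<open>Superposition of annular bumps\<close>

lemma integrable_powr_unit:
  assumes "\<delta> > (0::real)" "c \<ge> 0"
  shows "integrable lborel (\<lambda>\<sigma>. indicator {0<..c} \<sigma> * \<sigma> powr (\<delta> - 1))"
    and "(\<integral>\<sigma>. indicator {0<..c} \<sigma> * \<sigma> powr (\<delta> - 1) \<partial>lborel) = c powr \<delta> / \<delta>"
proof -
  have "((\<lambda>x. x powr (\<delta> - 1)) has_integral (c powr (\<delta> - 1 + 1) / (\<delta> - 1 + 1))) {0..c}"
    using assms by (intro has_integral_powr_from_0) auto
  then have hi: "((\<lambda>x. x powr (\<delta> - 1)) has_integral (c powr \<delta> / \<delta>)) {0..c}" by simp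
  have "has_bochner_integral lborel (\<lambda>x. indicator {0..c} x *\<^sub>R x powr (\<delta> - 1)) (c powr \<delta> / \<delta>)"
    by (intro has_bochner_integral_nn_integral) (use assms nn_integral_has_integral_lebesgue[OF _ hi] in \<open>auto simp: mult.commute\<close>)
  moreover have "(\<lambda>x. indicator {0..c} x *\<^sub>R x powr (\<delta> - 1)) = (\<lambda>x. indicator {0<..c} x * x powr (\<delta> - 1))"
    by (auto simp: fun_eq_iff indicator_def)
  ultimately show "integrable lborel (\<lambda>\<sigma>. indicator {0<..c} \<sigma> * \<sigma> powr (\<delta> - 1))"
    and "(\<integral>\<sigma>. indicator {0<..c} \<sigma> * \<sigma> powr (\<delta> - 1) \<partial>lborel) = c powr \<delta> / \<delta>"
    by (auto simp: has_bochner_integral_iff)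
qed

text \<open>
  A power of the distance \<open>u\<close> to the sphere is by homogeneity an integral over \<open>\<sigma>\<close> of the bumps
  \<open>chi (1 - u / \<sigma>)\<close>; the remaining factor \<open>(2 - u)\<^sup>\<delta>\<close> is expanded into powers of \<open>u\<close>.
\<close>

lemma powr_superposition:
  fixes chi :: "real \<Rightarrow> real" and \<delta> :: real
  assumes m: "chi \<in> borel_measurable borel"
    and lb: "\<And>t. indicator {-1/4..1/4} t \<le> chi t" and ub: "\<And>t. chi t \<le> indicator {-1/2..1/2} t"
    and \<delta>: "\<delta> > 0"
  shows "\<exists>A B. A \<in> borel_measurable borel \<and> (\<forall>\<sigma>\<in>{0<..1}. \<bar>A \<sigma>\<bar> \<le> B) \<and>
    (\<forall>u. 0 < u \<and> u \<le> 1/2 \<longrightarrow> (u * (2 - u)) powr \<delta> =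
       (\<integral>\<sigma>. indicator {0<..1} \<sigma> * \<sigma> powr (\<delta> - 1) * A \<sigma> * chi (1 - u / \<sigma>) \<partial>lborel))"
proof -
  note [measurable] = m
  have chi: "0 \<le> chi t" "chi t \<le> 1" "\<bar>t\<bar> > 1/2 \<Longrightarrow> chi t = 0" "\<bar>t\<bar> \<le> 1/4 \<Longrightarrow> chi t = 1" for t
    using lb[of t] ub[of t] by (auto simp: indicator_def of_bool_def abs_if split: if_splits)
  \<comment> \<open>With \<open>\<sigma> = u * v\<close> this is what remains of a bump integrated
    against \<open>\<sigma> powr (\<delta> + real i - 1)\<close>. As \<open>chi (1 - 1 / v)\<close>
    vanishes for positive \<open>v\<close> outside \<open>{2/3..2}\<close>, the interval
    \<open>{1/2..2}\<close> contains all of it.\<close>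
  define c where "c i = (\<integral>v. indicator {1/2..2} v * v powr (\<delta> + real i - 1) * chi (1 - 1 / v) \<partial>lborel)" for i
  have ci: "integrable lborel (\<lambda>v. indicator {1/2..2} v * v powr (\<delta> + real i - 1) * chi (1 - 1 / v))" for i
  proof (rule Bochner_Integration.integrable_bound)
    have "continuous_on {1/2..2} (\<lambda>v::real. v powr (\<delta> + real i - 1))" by (intro continuous_intros) auto
    from borel_integrable_atLeastAtMost'[OF this]
    show "integrable lborel (\<lambda>v. indicator {1/2..2} v * v powr (\<delta> + real i - 1))" by (simp add: set_integrable_def)
    show "AE v in lborel. norm (indicator {1/2..2} v * v powr (\<delta> + real i - 1) * chi (1 - 1 / v))
        \<le> norm (indicator {1/2..2} v * v powr (\<delta> + real i - 1))"
      using chi by (intro AE_I2) (auto simp: indicator_def abs_mult mult_left_le)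
  qed measurable
  \<comment> \<open>On \<open>{1..4/3}\<close> the cutoff is 1 and the power is at least
    \<open>1 / v \<ge> 3 / 4\<close>; the length 1/3 of the interval gives 1/4, uniformly in
    \<open>i\<close>.\<close>
  have c4: "c i \<ge> 1 / 4" for i
  proof -
    have "(\<integral>v. indicator {1..4/3} (v::real) * (3/4) \<partial>lborel) \<le> c i"
      unfolding c_def
    proof (rule Bochner_Integration.integral_mono[OF _ ci])
      fix v :: real
      show "indicator {1..4/3} v * (3/4) \<le> indicator {1/2..2} v * v powr (\<delta> + real i - 1) * chi (1 - 1 / v)"
      proof (cases "v \<in> {1..4/3}")
        case True
        then have "\<bar>1 - 1 / v\<bar> \<le> 1/4" by (auto simp: field_simps)
        then have "chi (1 - 1 / v) = 1" by (rule chi(4))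
        moreover have "3/4 \<le> v powr (-1)" using True by (simp add: powr_minus field_simps)
        moreover have "v powr (-1) \<le> v powr (\<delta> + real i - 1)" using True \<delta> by (intro powr_mono) auto
        ultimately show ?thesis using True by simp
      qed (use chi in \<open>auto intro!: mult_nonneg_nonneg\<close>)
    qed (auto intro!: integrable_mult_left integrable_real_indicator)
    then show ?thesis by simp
  qed
  define g where "g i u \<sigma> = indicator {0<..1} \<sigma> * \<sigma> powr (\<delta> + real i - 1) * chi (1 - u / \<sigma>)" for i u \<sigma>
  have gi: "integrable lborel (g i u)" for i u
  proof (rule Bochner_Integration.integrable_bound)
    show "integrable lborel (\<lambda>\<sigma>. indicator {0<..1} \<sigma> * \<sigma> powr (\<delta> + real i - 1))"
      using integrable_powr_unit(1)[of "\<delta> + real i" 1] \<delta> by simp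
    show "AE v in lborel. norm (g i u v) \<le> norm (indicator {0<..1} v * v powr (\<delta> + real i - 1))"
      using chi by (intro AE_I2) (auto simp: g_def indicator_def abs_mult mult_left_le)
  qed (unfold g_def, measurable)
  \<comment> \<open>Since \<open>v \<le> 2\<close> on the support, \<open>u \<le> 1/2\<close> keeps
    \<open>\<sigma> = u * v\<close> within \<open>{0<..1}\<close>, and the truncation to that
    interval loses nothing.\<close>
  have gint: "(\<integral>\<sigma>. g i u \<sigma> \<partial>lborel) = u powr (\<delta> + real i) * c i" if u: "0 < u" "u \<le> 1/2" for i u
  proof -
    have "(\<integral>\<sigma>. g i u \<sigma> \<partial>lborel) = \<bar>u\<bar> *\<^sub>R (\<integral>v. g i u (0 + u * v) \<partial>lborel)"
      using u by (intro lborel_integral_real_affine) auto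
    also have "(\<lambda>v. g i u (0 + u * v)) = (\<lambda>v. u powr (\<delta> + real i - 1) * (indicator {1/2..2} v * v powr (\<delta> + real i - 1) * chi (1 - 1 / v)))"
    proof
      fix v
      show "g i u (0 + u * v) = u powr (\<delta> + real i - 1) * (indicator {1/2..2} v * v powr (\<delta> + real i - 1) * chi (1 - 1 / v))"
      proof (cases "v > 0 \<and> chi (1 - 1 / v) \<noteq> 0")
        case True
        then have "\<bar>1 - 1 / v\<bar> \<le> 1/2" using chi(3)[of "1 - 1 / v"] by force
        then have "1 / v \<le> 3/2" "1 / v \<ge> 1/2" by linarith+
        then have v: "2/3 \<le> v" "v \<le> 2" using True by (auto simp: field_simps)
        then have "u * v \<le> 1" using u mult_mono[of u "1/2" v 2] by auto
        then show ?thesis using u v by (simp add: g_def powr_mult)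
      next
        case False
        then show ?thesis using u by (cases "v > 0") (auto simp: g_def indicator_def zero_less_mult_iff)
      qed
    qed
    also have "\<bar>u\<bar> *\<^sub>R (\<integral>v. u powr (\<delta> + real i - 1) * (indicator {1/2..2} v * v powr (\<delta> + real i - 1) * chi (1 - 1 / v)) \<partial>lborel) =
        u * u powr (\<delta> + real i - 1) * c i"
      using u by (simp add: c_def)
    also have "u * u powr (\<delta> + real i - 1) = u powr (\<delta> + real i)"
      using u by (simp add: powr_diff)
    finally show ?thesis .
  qed
  \<comment> \<open>Taylor coefficients of \<open>(2 - u) powr \<delta>\<close> at 0. Convergence of
    the binomial series at 3/4 gives its absolute convergence at 1/2, that is, summability of these
    coefficients.\<close>
  define b where "b i = 2 powr \<delta> * (\<delta> gchoose i) * (- 1 / 2) ^ i" for i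
  have bs: "summable (\<lambda>i. \<bar>b i\<bar>)"
  proof -
    have "summable (\<lambda>i. (\<delta> gchoose i) * (3/4) ^ i)"
      using gen_binomial_real[of "3/4" \<delta>] by (auto simp: sums_iff)
    then have "summable (\<lambda>i. norm ((\<delta> gchoose i) * (- 1 / 2) ^ i))"
      by (rule powser_insidea) simp
    then have "summable (\<lambda>i. 2 powr \<delta> * norm ((\<delta> gchoose i) * (- 1 / 2) ^ i))" by (rule summable_mult)
    then show ?thesis by (simp add: b_def abs_mult mult.assoc)
  qed
  have bser: "(\<lambda>i. b i * u powr (\<delta> + real i)) sums (u * (2 - u)) powr \<delta>" if u: "0 < u" "u \<le> 1/2" for u
  proof -
    have "(\<lambda>i. (\<delta> gchoose i) * (- u / 2) ^ i) sums (1 + (- u / 2)) powr \<delta>"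
      using u by (intro gen_binomial_real) auto
    then have "(\<lambda>i. (2 powr \<delta> * u powr \<delta>) * ((\<delta> gchoose i) * (- u / 2) ^ i)) sums ((2 powr \<delta> * u powr \<delta>) * (1 + (- u / 2)) powr \<delta>)"
      by (rule sums_mult)
    moreover have "(2 powr \<delta> * u powr \<delta>) * (1 + (- u / 2)) powr \<delta> = (u * (2 - u)) powr \<delta>"
      using u by (simp add: powr_mult[symmetric] algebra_simps)
    moreover have "(2 powr \<delta> * u powr \<delta>) * ((\<delta> gchoose i) * (- u / 2) ^ i) = b i * u powr (\<delta> + real i)" for i
    proof -
      have "(- u / 2) ^ i = (- 1 / 2) ^ i * u ^ i" by (simp flip: power_mult_distrib)
      then show ?thesis using u by (simp add: b_def powr_add powr_realpow)
    qed
    ultimately show ?thesis by simp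
  qed
  \<comment> \<open>Dividing by \<open>c i\<close> makes the term of index \<open>i\<close>
    integrate to \<open>b i * u powr (\<delta> + real i)\<close>; the lower bound on
    \<open>c i\<close> keeps the sum bounded.\<close>
  define A where "A \<sigma> = (\<Sum>i. b i / c i * \<sigma> ^ i)" for \<sigma>
  have bc: "\<bar>b i / c i\<bar> \<le> 4 * \<bar>b i\<bar>" for i
  proof -
    have "\<bar>b i\<bar> * 1 \<le> \<bar>b i\<bar> * (4 * c i)" using c4[of i] by (intro mult_left_mono) auto
    then show ?thesis using c4[of i] by (simp add: abs_divide field_simps)
  qed
  have trm: "norm (b i / c i * \<sigma> ^ i) \<le> 4 * \<bar>b i\<bar>" if "\<sigma> \<in> {0<..1}" for i \<sigma>
  proof -
    have "\<bar>\<sigma> ^ i\<bar> \<le> 1" using that by (auto simp: power_abs power_le_one)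
    then have "\<bar>b i / c i\<bar> * \<bar>\<sigma> ^ i\<bar> \<le> (4 * \<bar>b i\<bar>) * 1" using bc by (intro mult_mono) auto
    then show ?thesis by (simp add: abs_mult)
  qed
  have b4: "summable (\<lambda>i. 4 * \<bar>b i\<bar>)" using bs by (rule summable_mult)
  have As: "summable (\<lambda>i. b i / c i * \<sigma> ^ i)" "summable (\<lambda>i. norm (b i / c i * \<sigma> ^ i))" if "\<sigma> \<in> {0<..1}" for \<sigma>
    using trm[OF that] by (auto intro!: summable_comparison_test'[OF b4])
  have "A \<in> borel_measurable borel" unfolding A_def by measurable
  moreover have "\<bar>A \<sigma>\<bar> \<le> (\<Sum>i. 4 * \<bar>b i\<bar>)" if "\<sigma> \<in> {0<..1}" for \<sigma>
    using norm_suminf_le[OF trm[OF that] b4] by (simp add: A_def)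
  moreover have "(u * (2 - u)) powr \<delta> =
       (\<integral>\<sigma>. indicator {0<..1} \<sigma> * \<sigma> powr (\<delta> - 1) * A \<sigma> * chi (1 - u / \<sigma>) \<partial>lborel)" if u: "0 < u" "u \<le> 1/2" for u
  proof -
    have eq: "(b i / c i) * g i u \<sigma> = indicator {0<..1} \<sigma> * \<sigma> powr (\<delta> - 1) * chi (1 - u / \<sigma>) * (b i / c i * \<sigma> ^ i)" for i \<sigma>
    proof (cases "\<sigma> \<in> {0<..1}")
      case True
      have "\<sigma> powr ((\<delta> - 1) + real i) = \<sigma> powr (\<delta> - 1) * \<sigma> ^ i"
        using True by (subst powr_add) (simp add: powr_realpow)
      moreover have "(\<delta> - 1) + real i = \<delta> + real i - 1" by simp
      ultimately have "\<sigma> powr (\<delta> + real i - 1) = \<sigma> powr (\<delta> - 1) * \<sigma> ^ i" by (simp only:)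
      then show ?thesis by (simp add: g_def mult_ac)
    qed (simp add: g_def)
    have "(\<integral>\<sigma>. indicator {0<..1} \<sigma> * \<sigma> powr (\<delta> - 1) * A \<sigma> * chi (1 - u / \<sigma>) \<partial>lborel) =
        (\<integral>\<sigma>. (\<Sum>i. (b i / c i) * g i u \<sigma>) \<partial>lborel)"
    proof (rule Bochner_Integration.integral_cong[OF refl])
      fix \<sigma> :: real
      show "indicator {0<..1} \<sigma> * \<sigma> powr (\<delta> - 1) * A \<sigma> * chi (1 - u / \<sigma>) = (\<Sum>i. (b i / c i) * g i u \<sigma>)"
      proof (cases "\<sigma> \<in> {0<..1}")
        case True
        show ?thesis unfolding eq A_def by (subst suminf_mult[OF As(1)[OF True]]) (simp add: mult_ac)
      qed (simp add: g_def)
    qed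
    also have "\<dots> = (\<Sum>i. \<integral>\<sigma>. (b i / c i) * g i u \<sigma> \<partial>lborel)"
    proof (rule integral_suminf)
      show "integrable lborel (\<lambda>\<sigma>. b i / c i * g i u \<sigma>)" for i using gi by simp
      show "AE \<sigma> in lborel. summable (\<lambda>i. norm (b i / c i * g i u \<sigma>))"
      proof (intro AE_I2)
        fix \<sigma> :: real
        show "summable (\<lambda>i. norm (b i / c i * g i u \<sigma>))"
        proof (cases "\<sigma> \<in> {0<..1}")
          case True
          have "summable (\<lambda>i. norm (indicator {0<..1} \<sigma> * \<sigma> powr (\<delta> - 1) * chi (1 - u / \<sigma>)) * norm (b i / c i * \<sigma> ^ i))"
            by (rule summable_mult[OF As(2)[OF True]])
          then show ?thesis unfolding eq norm_mult[symmetric] .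
        qed (simp add: g_def)
      qed
      have "(\<integral>\<sigma>. norm (b i / c i * g i u \<sigma>) \<partial>lborel) = \<bar>b i\<bar> * u powr (\<delta> + real i)" for i
      proof -
        have "norm (b i / c i * g i u \<sigma>) = \<bar>b i / c i\<bar> * g i u \<sigma>" for \<sigma>
          using chi(1) by (simp add: abs_mult g_def)
        then show ?thesis using gint[OF u, of i] c4[of i] by (simp add: abs_divide)
      qed
      moreover have "norm (\<bar>b i\<bar> * u powr (\<delta> + real i)) \<le> \<bar>b i\<bar>" for i
        using u \<delta> by (auto simp: abs_mult intro!: mult_left_le powr_le1)
      ultimately show "summable (\<lambda>i. \<integral>\<sigma>. norm (b i / c i * g i u \<sigma>) \<partial>lborel)"
        by (auto intro!: summable_comparison_test'[OF bs])
    qed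
    also have "\<dots> = (\<Sum>i. b i * u powr (\<delta> + real i))"
    proof (rule suminf_cong)
      fix i
      have "c i \<noteq> 0" using c4[of i] by auto
      then show "(\<integral>\<sigma>. (b i / c i) * g i u \<sigma> \<partial>lborel) = b i * u powr (\<delta> + real i)"
        using gint[OF u, of i] by simp
    qed
    also have "\<dots> = (u * (2 - u)) powr \<delta>" using bser[OF u] by (simp add: sums_iff)
    finally show ?thesis by simp
  qed
  ultimately show ?thesis by blast
qed


section \<open>Annular multipliers on Lebesgue spaces\<close>

lemma integral_holder:
  fixes f g :: "'a \<Rightarrow> real"
  assumes pq: "p > 1" "q > 1" "1 / p + 1 / q = 1"
    and [measurable]: "f \<in> borel_measurable M" "g \<in> borel_measurable M"
    and nn: "\<And>x. f x \<ge> 0" "\<And>x. g x \<ge> 0"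
    and fi: "integrable M (\<lambda>x. f x powr p)" and gi: "integrable M (\<lambda>x. g x powr q)"
  shows "integrable M (\<lambda>x. f x * g x)"
    and "(\<integral>x. f x * g x \<partial>M) \<le> (\<integral>x. f x powr p \<partial>M) powr (1 / p) * (\<integral>x. g x powr q \<partial>M) powr (1 / q)"
proof -
  have young: "a * b \<le> a powr p / p + b powr q / q" if "a \<ge> 0" "b \<ge> 0" for a b
    using Youngs_inequality[of p q a b] pq that by auto
  have bound: "integrable M (\<lambda>x. f x powr p / p + g x powr q / q)" using fi gi by simp
  show int: "integrable M (\<lambda>x. f x * g x)"
    by (rule Bochner_Integration.integrable_bound[OF bound]) (use young nn pq in \<open>auto intro!: AE_I2 simp: abs_mult\<close>)
  define A where "A = (\<integral>x. f x powr p \<partial>M)"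
  define B where "B = (\<integral>x. g x powr q \<partial>M)"
  have A0: "A \<ge> 0" "B \<ge> 0" by (auto simp: A_def B_def intro!: integral_nonneg_AE)
  show "(\<integral>x. f x * g x \<partial>M) \<le> (\<integral>x. f x powr p \<partial>M) powr (1 / p) * (\<integral>x. g x powr q \<partial>M) powr (1 / q)"
  proof (cases "A = 0 \<or> B = 0")
    case True
    have "AE x in M. f x * g x = 0"
    proof (cases "A = 0")
      case True
      then have "AE x in M. f x powr p = 0"
        using integral_nonneg_eq_0_iff_AE[OF fi] by (simp add: A_def)
      then show ?thesis by eventually_elim auto
    next
      case False
      then have "AE x in M. g x powr q = 0"
        using \<open>A = 0 \<or> B = 0\<close> integral_nonneg_eq_0_iff_AE[OF gi] by (simp add: B_def)
      then show ?thesis by eventually_elim auto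
    qed
    then have "(\<integral>x. f x * g x \<partial>M) = 0" using int by (subst integral_nonneg_eq_0_iff_AE) (auto simp: nn)
    then show ?thesis by simp
  next
    case False
    then have AB: "A > 0" "B > 0" using A0 by auto
    define a where "a = A powr (1 / p)"
    define b where "b = B powr (1 / q)"
    have ab: "a > 0" "b > 0" "a powr p = A" "b powr q = B" using AB pq by (auto simp: a_def b_def powr_powr)
    have "(\<integral>x. (f x / a) * (g x / b) \<partial>M) \<le> (\<integral>x. (f x / a) powr p / p + (g x / b) powr q / q \<partial>M)"
    proof (rule integral_mono)
      show "integrable M (\<lambda>x. (f x / a) * (g x / b))" using int by simp
      show "integrable M (\<lambda>x. (f x / a) powr p / p + (g x / b) powr q / q)"
        using fi gi ab nn by (simp add: powr_divide)
      show "(f x / a) * (g x / b) \<le> (f x / a) powr p / p + (g x / b) powr q / q" for x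
        using young[of "f x / a" "g x / b"] nn ab by auto
    qed
    also have "\<dots> = (\<integral>x. f x powr p / (A * p) + g x powr q / (B * q) \<partial>M)"
      using ab nn by (simp add: powr_divide)
    also have "\<dots> = A / (A * p) + B / (B * q)" using fi gi by (simp add: A_def B_def)
    also have "\<dots> = 1" using AB pq by simp
    finally have "(\<integral>x. f x * g x \<partial>M) / (a * b) \<le> 1" by (simp add: mult_ac)
    then have "(\<integral>x. f x * g x \<partial>M) \<le> a * b" using ab by (simp add: field_simps)
    then show ?thesis by (simp add: a_def b_def A_def B_def)
  qed
qed

section \<open>Dilations\<close>

lemma lebesgue_scaleR:
  fixes c :: real
  assumes c: "c > 0"
  shows "(\<lambda>x :: real ^ 'n. c *\<^sub>R x) \<in> lebesgue \<rightarrow>\<^sub>M lebesgue"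
    and "lebesgue = density (distr lebesgue lebesgue (\<lambda>x :: real ^ 'n. c *\<^sub>R x)) (\<lambda>_. ennreal (c ^ CARD('n)))"
proof -
  have T: "(\<lambda>x :: real ^ 'n. 0 + (\<Sum>j\<in>Basis. (c * (x \<bullet> j)) *\<^sub>R j)) = (\<lambda>x. c *\<^sub>R x)"
    by (simp add: fun_eq_iff scaleR_scaleR[symmetric] scaleR_sum_right[symmetric] euclidean_representation del: scaleR_scaleR)
  show "(\<lambda>x :: real ^ 'n. c *\<^sub>R x) \<in> lebesgue \<rightarrow>\<^sub>M lebesgue"
    using lebesgue_affine_measurable[of "\<lambda>_. c" "0 :: real ^ 'n"] c unfolding T by simp
  have "(\<Prod>j\<in>(Basis :: (real ^ 'n) set). ennreal \<bar>c\<bar>) = ennreal (c ^ CARD('n))"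
    using c by (simp add: ennreal_power)
  then show "lebesgue = density (distr lebesgue lebesgue (\<lambda>x :: real ^ 'n. c *\<^sub>R x)) (\<lambda>_. ennreal (c ^ CARD('n)))"
    using lebesgue_affine_euclidean[of "\<lambda>_. c" "0 :: real ^ 'n"] c unfolding T by (simp add: prod_ennreal)
qed

lemma lebesgue_integral_scaleR:
  fixes h :: "real ^ 'n \<Rightarrow> 'b :: {banach, second_countable_topology}"
  assumes c: "c > 0" and h: "h \<in> borel_measurable lebesgue"
  shows "(\<integral>x. h (c *\<^sub>R x) \<partial>lebesgue) = inverse (c ^ CARD('n)) *\<^sub>R (\<integral>x. h x \<partial>lebesgue)"
    and "integrable lebesgue h \<Longrightarrow> integrable lebesgue (\<lambda>x. h (c *\<^sub>R x))"
    and "(\<lambda>x. h (c *\<^sub>R x)) \<in> borel_measurable lebesgue"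
proof -
  let ?D = "distr lebesgue lebesgue (\<lambda>x :: real ^ 'n. c *\<^sub>R x)"
  have hD: "h \<in> borel_measurable ?D" using h by simp
  show "(\<lambda>x. h (c *\<^sub>R x)) \<in> borel_measurable lebesgue"
    by (rule measurable_compose[OF lebesgue_scaleR(1)[OF c] h])
  have "(\<integral>x. h x \<partial>lebesgue) = (\<integral>x. h x \<partial>density ?D (\<lambda>_. ennreal (c ^ CARD('n))))"
    using lebesgue_scaleR(2)[OF c, where 'n = 'n] by simp
  also have "\<dots> = (\<integral>x. (c ^ CARD('n)) *\<^sub>R h x \<partial>?D)" using hD c by (intro integral_density) auto
  also have "\<dots> = (\<integral>x. (c ^ CARD('n)) *\<^sub>R h (c *\<^sub>R x) \<partial>lebesgue)"
    using h by (intro integral_distr[OF lebesgue_scaleR(1)[OF c]]) auto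
  finally show "(\<integral>x. h (c *\<^sub>R x) \<partial>lebesgue) = inverse (c ^ CARD('n)) *\<^sub>R (\<integral>x. h x \<partial>lebesgue)"
    using c by simp
  assume "integrable lebesgue h"
  then have "integrable (density ?D (\<lambda>_. ennreal (c ^ CARD('n)))) h"
    using lebesgue_scaleR(2)[OF c, where 'n = 'n] by simp
  then have "integrable ?D (\<lambda>x. (c ^ CARD('n)) *\<^sub>R h x)"
    using hD c by (subst (asm) integrable_density) auto
  then have "integrable ?D (\<lambda>x. inverse (c ^ CARD('n)) *\<^sub>R ((c ^ CARD('n)) *\<^sub>R h x))"
    by (rule integrable_scaleR_right)
  then have "integrable ?D h" using c by simp
  then show "integrable lebesgue (\<lambda>x. h (c *\<^sub>R x))"
    using integrable_distr_eq[OF lebesgue_scaleR(1)[OF c] h] by simp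
qed

lemma Lp_fun_scaleR:
  assumes c: "c > 0" and f: "Lp_fun p (f :: real ^ 'n \<Rightarrow> complex)"
  shows "Lp_fun p (\<lambda>x. f (c *\<^sub>R x))"
    and "Lp_norm p (\<lambda>x. f (c *\<^sub>R x)) = (inverse (c ^ CARD('n))) powr (1 / p) * Lp_norm p f"
proof -
  have m: "f \<in> borel_measurable lebesgue" and i: "integrable lebesgue (\<lambda>x. norm (f x) powr p)"
    using f by (auto simp: Lp_fun_def)
  have mp: "(\<lambda>x. norm (f x) powr p) \<in> borel_measurable lebesgue" using i by auto
  show "Lp_fun p (\<lambda>x. f (c *\<^sub>R x))"
    unfolding Lp_fun_def using lebesgue_integral_scaleR(3)[OF c m] lebesgue_integral_scaleR(2)[OF c mp i] by simp
  show "Lp_norm p (\<lambda>x. f (c *\<^sub>R x)) = (inverse (c ^ CARD('n))) powr (1 / p) * Lp_norm p f"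
    unfolding Lp_norm_def lebesgue_integral_scaleR(1)[OF c mp] using c
    by (simp add: powr_mult integral_nonneg_AE)
qed

text \<open>A change of variables on the frequency side carries the dilation over to both Fourier
  transforms. It is used to move an annulus centred inside the ball to the unit sphere, where the
  hypothesis applies.\<close>

lemma pairing_multiplier_op_dilate:
  fixes m :: "real ^ 'n \<Rightarrow> real"
  assumes c: "c > 0" and m: "integrable lebesgue m" and f: "integrable lebesgue f" and g: "integrable lebesgue g"
  shows "pairing (multiplier_op (\<lambda>\<xi>. m (inverse c *\<^sub>R \<xi>)) f) g =
    inverse (c ^ CARD('n)) *\<^sub>R pairing (multiplier_op m (\<lambda>x. f (inverse c *\<^sub>R x))) (\<lambda>x. g (inverse c *\<^sub>R x))"
proof -
  have ci: "inverse c > 0" using c by simp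
  have mm: "m \<in> borel_measurable lebesgue" "f \<in> borel_measurable lebesgue" "g \<in> borel_measurable lebesgue" using m f g by auto
  have four: "fourier (\<lambda>x. h (inverse c *\<^sub>R x)) \<xi> = (c ^ CARD('n)) *\<^sub>R fourier h (c *\<^sub>R \<xi>)"
    if h: "h \<in> borel_measurable lebesgue" for h :: "real ^ 'n \<Rightarrow> complex" and \<xi>
  proof -
    have "(\<lambda>x. cis (- (2 * pi * (x \<bullet> (c *\<^sub>R \<xi>)))) * h x) \<in> borel_measurable lebesgue"
      using h id_borel_measurable_lebesgue by measurable
    note scale = lebesgue_integral_scaleR(1)[OF ci this]
    have cz: "c * (inverse c * z) = z" for z using c by simp
    show ?thesis
      using scale c by (simp add: fourier_def power_inverse cz)
  qed
  have mi: "integrable lebesgue (\<lambda>\<xi>. m (inverse c *\<^sub>R \<xi>))"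
    by (rule lebesgue_integral_scaleR(2)[OF ci mm(1) m])
  have fi: "integrable lebesgue (\<lambda>x. f (inverse c *\<^sub>R x))" "integrable lebesgue (\<lambda>x. g (inverse c *\<^sub>R x))"
    using lebesgue_integral_scaleR(2)[OF ci mm(2) f] lebesgue_integral_scaleR(2)[OF ci mm(3) g] by auto
  define h where "h \<xi> = of_real (m (inverse c *\<^sub>R \<xi>)) * fourier f \<xi> * cnj (fourier g \<xi>)" for \<xi>
  have hm: "h \<in> borel_measurable lebesgue"
  proof -
    have "(\<lambda>\<xi>. cnj (fourier g \<xi>)) \<in> borel_measurable lebesgue"
      using measurable_fourier[OF mm(3)] by (intro borel_measurable_continuous_on[of cnj "fourier g"] continuous_intros)
    then show ?thesis unfolding h_def
      using borel_measurable_integrable[OF mi] measurable_fourier[OF mm(2)]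
      by (intro borel_measurable_times borel_measurable_of_real) auto
  qed
  have "pairing (multiplier_op m (\<lambda>x. f (inverse c *\<^sub>R x))) (\<lambda>x. g (inverse c *\<^sub>R x)) =
      (\<integral>\<xi>. (c ^ CARD('n) * c ^ CARD('n)) *\<^sub>R h (c *\<^sub>R \<xi>) \<partial>lebesgue)"
    unfolding pairing_multiplier_op[OF m fi] four[OF mm(2)] four[OF mm(3)]
  proof (rule Bochner_Integration.integral_cong[OF refl])
    fix \<xi> :: "real ^ 'n"
    have "inverse c *\<^sub>R c *\<^sub>R \<xi> = \<xi>" using c by simp
    then have "h (c *\<^sub>R \<xi>) = of_real (m \<xi>) * fourier f (c *\<^sub>R \<xi>) * cnj (fourier g (c *\<^sub>R \<xi>))"
      by (simp only: h_def)
    then show "of_real (m \<xi>) * ((c ^ CARD('n)) *\<^sub>R fourier f (c *\<^sub>R \<xi>)) * cnj ((c ^ CARD('n)) *\<^sub>R fourier g (c *\<^sub>R \<xi>)) =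
        (c ^ CARD('n) * c ^ CARD('n)) *\<^sub>R h (c *\<^sub>R \<xi>)"
      by (simp add: mult_ac)
  qed
  also have "\<dots> = (c ^ CARD('n)) *\<^sub>R (\<integral>\<xi>. h \<xi> \<partial>lebesgue)"
    using c by (simp add: lebesgue_integral_scaleR(1)[OF c hm])
  also have "(\<integral>\<xi>. h \<xi> \<partial>lebesgue) = pairing (multiplier_op (\<lambda>\<xi>. m (inverse c *\<^sub>R \<xi>)) f) g"
    unfolding pairing_multiplier_op[OF mi f g] h_def ..
  finally show ?thesis using c by simp
qed

lemma Lp_fun_1_iff: "Lp_fun 1 f \<longleftrightarrow> integrable lebesgue f"
  unfolding Lp_fun_def by (auto simp: integrable_norm_iff)

text \<open>Hoelder's inequality. The operator norm is an infimum over admissible constants, so one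
  of them lies below any \<open>K'\<close> strictly larger than \<open>K\<close>.\<close>

lemma Lp_op_norm_pairing:
  fixes T :: "(real ^ 'n \<Rightarrow> complex) \<Rightarrow> real ^ 'n \<Rightarrow> complex"
  assumes pq: "p > 1" "q > 1" "1 / p + 1 / q = 1"
    and T: "Lp_op_norm p T \<le> ennreal K" and K: "K < K'" "0 < K'"
    and f: "Lp_fun 1 f" "Lp_fun p f" and g: "Lp_fun q g"
  shows "cmod (pairing (T f) g) \<le> K' * Lp_norm p f * Lp_norm q g"
proof -
  have "Lp_op_norm p T < ennreal K'" using T K by (meson ennreal_lessI order_le_less_trans)
  then obtain C where C: "0 \<le> C" "ennreal C < ennreal K'"
      "\<And>f. Lp_fun 1 f \<Longrightarrow> Lp_fun p f \<Longrightarrow> Lp_fun p (T f) \<and> Lp_norm p (T f) \<le> C * Lp_norm p f"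
    unfolding Lp_op_norm_def Inf_less_iff by auto
  have CK: "C \<le> K'" using C(1,2) K by (simp add: ennreal_less_iff)
  have Tf: "Lp_fun p (T f)" "Lp_norm p (T f) \<le> C * Lp_norm p f" using C(3)[OF f] by auto
  have Tm: "T f \<in> borel_measurable lebesgue" "g \<in> borel_measurable lebesgue" using Tf g by (auto simp: Lp_fun_def)
  have ii: "integrable lebesgue (\<lambda>x. cmod (T f x) powr p)" "integrable lebesgue (\<lambda>x. cmod (g x) powr q)"
    using Tf g by (auto simp: Lp_fun_def)
  have n0: "Lp_norm p f \<ge> 0" "Lp_norm q g \<ge> 0" by (auto simp: Lp_norm_def)
  have "cmod (pairing (T f) g) \<le> (\<integral>x. cmod (T f x) * cmod (g x) \<partial>lebesgue)"
    unfolding pairing_def using integral_norm_bound[of lebesgue "\<lambda>x. T f x * cnj (g x)"] by (simp add: norm_mult)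
  also have "\<dots> \<le> Lp_norm p (T f) * Lp_norm q g"
    unfolding Lp_norm_def by (rule integral_holder(2)[OF pq _ _ _ _ ii]) (use Tm in auto)
  also have "\<dots> \<le> (K' * Lp_norm p f) * Lp_norm q g"
    using Tf(2) mult_right_mono[OF CK n0(1)] n0 by (intro mult_right_mono) auto
  finally show ?thesis .
qed

text \<open>With \<open>u = 1 - norm \<xi>\<close> the argument is \<open>1 - u / \<sigma>\<close>.
  The bump thus lives at depth between \<open>\<sigma> / 2\<close> and
  \<open>3 * \<sigma> / 2\<close> below the unit sphere, on the side where the Bochner-Riesz symbol
  is supported.\<close>

definition annulus_symbol :: "(real \<Rightarrow> real) \<Rightarrow> real \<Rightarrow> real ^ 'n \<Rightarrow> real" where
  "annulus_symbol chi \<sigma> \<xi> = chi ((norm \<xi> - 1 + \<sigma>) / \<sigma>)"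

text \<open>Dilation by \<open>1 - \<sigma>\<close> carries the annulus to the unit sphere with
  relative width \<open>\<tau> = \<sigma> / (1 - \<sigma>)\<close>, which is below 1 as
  \<open>\<sigma> < 1/2\<close>. The Jacobians cancel because \<open>1 / p + 1 / q = 1\<close>, and
  \<open>\<sigma> \<le> \<tau>\<close> turns the power of \<open>\<tau>\<close> into one of
  \<open>\<sigma>\<close>.\<close>

lemma annulus_pairing_bound:
  fixes chi :: "real \<Rightarrow> real"
  assumes pq: "p > 1" "q > 1" "1 / p + 1 / q = 1"
    and chi: "chi \<in> borel_measurable borel"
    and ub: "\<And>t. 0 \<le> chi t" "\<And>t. chi t \<le> indicator {-1/2..1/2} t"
    and S: "\<And>\<tau>. 0 < \<tau> \<Longrightarrow> \<tau> < 1 \<Longrightarrow>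
      Lp_op_norm p (annular_op chi \<tau> :: (real ^ 'n \<Rightarrow> complex) \<Rightarrow> _) \<le> ennreal (C * \<tau> powr - \<epsilon>)"
    and \<epsilon>: "\<epsilon> > 0" and \<sigma>: "0 < \<sigma>" "\<sigma> < 1/2"
    and f: "Lp_fun 1 (f :: real ^ 'n \<Rightarrow> complex)" "Lp_fun p f" and g: "Lp_fun 1 g" "Lp_fun q g"
  shows "cmod (pairing (multiplier_op (annulus_symbol chi \<sigma>) f) g) \<le> (\<bar>C\<bar> + 1) * \<sigma> powr - \<epsilon> * Lp_norm p f * Lp_norm q g"
proof -
  define c where "c = 1 - \<sigma>"
  define \<tau> where "\<tau> = \<sigma> / c"
  have c: "c > 0" "inverse c > 0" and \<tau>: "0 < \<tau>" "\<tau> < 1" "\<sigma> \<le> \<tau>"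
    using \<sigma> by (auto simp: c_def \<tau>_def field_simps)
  define m where "m \<xi> = chi ((norm \<xi> - 1) / \<tau>)" for \<xi> :: "real ^ 'n"
  have eq: "annulus_symbol chi \<sigma> = (\<lambda>\<xi>. m (inverse c *\<^sub>R \<xi>))"
  proof
    fix \<xi> :: "real ^ 'n"
    have "(norm (inverse c *\<^sub>R \<xi>) - 1) / \<tau> = (norm \<xi> - 1 + \<sigma>) / \<sigma>"
      using c \<sigma> by (simp add: \<tau>_def c_def field_simps)
    then show "annulus_symbol chi \<sigma> \<xi> = m (inverse c *\<^sub>R \<xi>)" by (simp add: m_def annulus_symbol_def)
  qed
  have mi: "integrable lebesgue m"
  proof (rule integrable_compact_support[where B = 1 and R = 2])
    have "m \<in> borel_measurable borel" unfolding m_def using chi by measurable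
    then show "m \<in> borel_measurable lebesgue" by (intro measurable_completion) simp
    fix \<xi> :: "real ^ 'n"
    have le1: "indicator {-1/2..1/2} t \<le> (1::real)" for t :: real by (simp add: indicator_def)
    then show "\<bar>m \<xi>\<bar> \<le> 1" using ub[of "(norm \<xi> - 1) / \<tau>"] order_trans[OF ub(2) le1, of "(norm \<xi> - 1) / \<tau>"]
      by (simp add: m_def)
    assume "m \<xi> \<noteq> 0"
    moreover have "chi t = 0" if "t \<notin> {-1/2..1/2}" for t using ub(1)[of t] ub(2)[of t] that by simp
    ultimately have "(norm \<xi> - 1) / \<tau> \<in> {-1/2..1/2}" unfolding m_def by blast
    then have "norm \<xi> - 1 \<le> \<tau> / 2" using \<tau> by (auto simp: field_simps)
    then show "norm \<xi> \<le> 2" using \<tau> by simp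
  qed
  have fi: "integrable lebesgue f" "integrable lebesgue g" using f g by (auto simp: Lp_fun_1_iff)
  let ?f = "\<lambda>x. f (inverse c *\<^sub>R x)" and ?g = "\<lambda>x. g (inverse c *\<^sub>R x)"
  \<comment> \<open>The sign of \<open>C\<close> is unknown; \<open>\<bar>C\<bar> + 1\<close> is
    positive and strictly larger than \<open>C\<close>.\<close>
  define K where "K = (\<bar>C\<bar> + 1) * \<tau> powr - \<epsilon>"
  have "cmod (pairing (annular_op chi \<tau> ?f) ?g) \<le> K * Lp_norm p ?f * Lp_norm q ?g"
  proof (rule Lp_op_norm_pairing[OF pq S[OF \<tau>(1,2)]])
    show "C * \<tau> powr - \<epsilon> < K" "0 < K" using \<tau> unfolding K_def by (auto intro!: mult_strict_right_mono mult_pos_pos)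
  qed (intro Lp_fun_scaleR c f g)+
  also have "\<dots> = (c ^ CARD('n)) * (K * Lp_norm p f * Lp_norm q g)"
  proof -
    have "(c ^ CARD('n)) powr (1 / p) * (c ^ CARD('n)) powr (1 / q) = c ^ CARD('n)"
      using c pq by (simp flip: powr_add)
    moreover have "K * (A * X) * (B * Y) = (A * B) * (K * X * Y)" for A B X Y by (simp only: mult_ac)
    moreover have "inverse (inverse c ^ CARD('n)) = c ^ CARD('n)" by (simp add: power_inverse)
    ultimately show ?thesis unfolding Lp_fun_scaleR(2)[OF c(2) f(2)] Lp_fun_scaleR(2)[OF c(2) g(2)]
      by (simp only:)
  qed
  finally have "cmod (pairing (multiplier_op m ?f) ?g) \<le> (c ^ CARD('n)) * (K * Lp_norm p f * Lp_norm q g)"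
    by (simp add: annular_op_def m_def[abs_def])
  then have "cmod (pairing (multiplier_op (annulus_symbol chi \<sigma>) f) g) \<le> K * Lp_norm p f * Lp_norm q g"
    unfolding eq pairing_multiplier_op_dilate[OF c(1) mi fi] using c by (simp add: field_simps)
  also have "\<dots> \<le> (\<bar>C\<bar> + 1) * \<sigma> powr - \<epsilon> * Lp_norm p f * Lp_norm q g"
    unfolding K_def using \<sigma> \<tau> \<epsilon> by (intro mult_right_mono mult_left_mono powr_mono2') (auto simp: Lp_norm_def)
  finally show ?thesis .
qed


section \<open>Interpolation on a cube\<close>

lemma geometric_mean_bound:
  fixes X :: real
  assumes X: "0 \<le> X" "X \<le> U" "X \<le> V" "X \<le> W" and e: "0 < e1" "0 < e2" "0 < e3" "e1 + e2 + e3 = 1"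
  shows "X \<le> U powr e1 * V powr e2 * W powr e3"
proof -
  have "X = X powr (e1 + e2 + e3)" using X e by simp
  also have "\<dots> = X powr e1 * X powr e2 * X powr e3" by (simp only: powr_add)
  also have "\<dots> \<le> U powr e1 * V powr e2 * W powr e3"
    using X e by (intro mult_mono powr_mono2) auto
  finally show ?thesis .
qed

section \<open>Restrictions, averages and level sets\<close>

definition restr :: "(real ^ 'n) set \<Rightarrow> (real ^ 'n \<Rightarrow> complex) \<Rightarrow> real ^ 'n \<Rightarrow> complex" where
  "restr A f x = indicator A x *\<^sub>R f x"

lemma bounded_compact_support_restr:
  assumes f: "bounded_compact_support f" and A: "A \<in> sets lebesgue"
  shows "bounded_compact_support (restr A f)"
proof -
  have "f \<in> borel_measurable lebesgue" using f by (simp add: bounded_compact_support_def)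
  then have "restr A f \<in> borel_measurable lebesgue" unfolding restr_def[abs_def] using A by measurable
  moreover have "bounded (range (restr A f))"
  proof -
    obtain B where "\<And>x. cmod (f x) \<le> B" using f by (auto simp: bounded_compact_support_def bounded_iff)
    then have "cmod (restr A f x) \<le> max 0 B" for x by (auto simp: restr_def indicator_def le_max_iff_disj)
    then show ?thesis unfolding bounded_iff by blast
  qed
  moreover have "closure {x. restr A f x \<noteq> 0} \<subseteq> closure {x. f x \<noteq> 0}"
    by (intro closure_mono) (auto simp: restr_def)
  then have "compact (closure {x. restr A f x \<noteq> 0})"
    using f compact_Int_closed[of "closure {x. f x \<noteq> 0}" "closure {x. restr A f x \<noteq> 0}"]
    by (simp add: bounded_compact_support_def Int_absorb1)
  ultimately show ?thesis by (simp add: bounded_compact_support_def)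
qed

lemma bounded_compact_support_powr_integrable:
  assumes f: "bounded_compact_support f" and u: "u > 0"
  shows "integrable lebesgue (\<lambda>x. cmod (f x) powr u)"
proof -
  obtain B where B: "\<And>x. cmod (f x) \<le> B" using f
    by (auto simp: bounded_compact_support_def bounded_iff)
  define K where "K = closure {x. f x \<noteq> 0}"
  have K: "compact K" using f by (simp add: K_def bounded_compact_support_def)
  have "integrable lebesgue (\<lambda>x. B powr u * indicator K x)"
    using lmeasurable_compact[OF K]
    by (intro integrable_mult_right integrable_real_indicator) (auto simp: fmeasurable_def)
  then show ?thesis
  proof (rule Bochner_Integration.integrable_bound)
    show "(\<lambda>x. cmod (f x) powr u) \<in> borel_measurable lebesgue" using f by (auto simp: bounded_compact_support_def)
    show "AE x in lebesgue. norm (cmod (f x) powr u) \<le> norm (B powr u * indicator K x)"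
    proof (intro AE_I2)
      fix x show "norm (cmod (f x) powr u) \<le> norm (B powr u * indicator K x)"
      proof (cases "f x = 0")
        case False
        then have "x \<in> K" unfolding K_def by (intro subsetD[OF closure_subset]) simp
        then show ?thesis using B[of x] u by (auto intro!: powr_mono2)
      qed auto
    qed
  qed
qed

lemma set_integrable_powr:
  assumes f: "bounded_compact_support f" and u: "u > 0" and T: "T \<in> sets lebesgue"
  shows "integrable lebesgue (\<lambda>x. indicator T x * cmod (f x) powr u)"
  using integrable_mult_indicator[OF T bounded_compact_support_powr_integrable[OF f u]] by simp

lemma cube_avg_nonneg: "cube_avg Q r f \<ge> 0"
  by (simp add: cube_avg_def)

lemma cube_avg_restr_le:
  assumes f: "bounded_compact_support f" and u: "u > 0" and T: "T \<in> lmeasurable" "measure lebesgue T > 0"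
    and A: "A \<in> sets lebesgue" "A \<subseteq> T" and c: "c \<ge> 0" "\<And>x. x \<in> A \<Longrightarrow> cmod (f x) \<le> c"
  shows "cube_avg T u (restr A f) \<le> c * (measure lebesgue A / measure lebesgue T) powr (1 / u)"
proof -
  have Al: "A \<in> lmeasurable" using T A by (meson fmeasurableI2)
  have "(\<integral>x. indicator T x * cmod (restr A f x) powr u \<partial>lebesgue) \<le> (\<integral>x. c powr u * indicator A x \<partial>lebesgue)"
  proof (rule integral_mono')
    show "integrable lebesgue (\<lambda>x. c powr u * indicator A x)"
      using Al by (intro integrable_mult_right integrable_real_indicator) (auto simp: fmeasurable_def)
    fix x
    show "indicator T x * cmod (restr A f x) powr u \<le> c powr u * indicator A x"
      using c(2)[of x] u by (auto simp: restr_def indicator_def intro!: powr_mono2)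
  qed auto
  then have "(LINT x:T|lebesgue. cmod (restr A f x) powr u) \<le> c powr u * measure lebesgue A"
    by (simp add: set_lebesgue_integral_def)
  then have "inverse (measure lebesgue T) * (LINT x:T|lebesgue. cmod (restr A f x) powr u)
      \<le> inverse (measure lebesgue T) * (c powr u * measure lebesgue A)"
    using T(2) by (intro mult_left_mono) auto
  then have "cube_avg T u (restr A f) \<le> (c powr u * (measure lebesgue A / measure lebesgue T)) powr (1 / u)"
    unfolding cube_avg_def using u T(2)
    by (intro powr_mono2) (auto simp: set_lebesgue_integral_def divide_inverse mult_ac intro!: integral_nonneg_AE mult_nonneg_nonneg)
  also have "\<dots> = c * (measure lebesgue A / measure lebesgue T) powr (1 / u)"
    by (subst powr_mult) (use c u in \<open>auto simp: powr_powr\<close>)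
  finally show ?thesis .
qed

lemma cube_avg_chebyshev:
  assumes f: "bounded_compact_support f" and r: "r > 0" and T: "T \<in> lmeasurable" "measure lebesgue T > 0"
    and A: "A \<in> sets lebesgue" "A \<subseteq> T" and c: "c > 0" "\<And>x. x \<in> A \<Longrightarrow> cmod (f x) \<ge> c"
  shows "measure lebesgue A / measure lebesgue T \<le> (cube_avg T r f / c) powr r"
proof -
  have "(\<integral>x. c powr r * indicator A x \<partial>lebesgue) \<le> (\<integral>x. indicator T x * cmod (f x) powr r \<partial>lebesgue)"
  proof (rule integral_mono')
    show "integrable lebesgue (\<lambda>x. indicator T x * cmod (f x) powr r)"
      using T by (intro set_integrable_powr f r) auto
    fix x
    show "c powr r * indicator A x \<le> indicator T x * cmod (f x) powr r"
      using c(1) c(2)[of x] r A(2) by (auto simp: indicator_def intro!: powr_mono2)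
  qed auto
  then have le: "c powr r * measure lebesgue A \<le> (LINT x:T|lebesgue. cmod (f x) powr r)"
    by (simp add: set_lebesgue_integral_def)
  have "cube_avg T r f powr r = inverse (measure lebesgue T) * (LINT x:T|lebesgue. cmod (f x) powr r)"
    unfolding cube_avg_def using r T(2)
    by (auto simp: powr_powr set_lebesgue_integral_def intro!: integral_nonneg_AE mult_nonneg_nonneg)
  then have "c powr r * (measure lebesgue A / measure lebesgue T) \<le> cube_avg T r f powr r"
    using mult_left_mono[OF le, of "inverse (measure lebesgue T)"] T(2) by (simp add: divide_inverse mult_ac)
  then show ?thesis using c(1) cube_avg_nonneg[of T r f] by (simp add: powr_divide field_simps)
qed

text \<open>Dyadic levels in units of \<open>\<alpha>\<close>, later the average of
  \<open>f\<close>. Level 0 collects all values up to \<open>\<alpha>\<close>, zeros included, so a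
  bounded function has only finitely many nonempty levels.\<close>

definition level :: "(real ^ 'n \<Rightarrow> complex) \<Rightarrow> (real ^ 'n) set \<Rightarrow> real \<Rightarrow> nat \<Rightarrow> (real ^ 'n) set" where
  "level f T \<alpha> k = {x \<in> T. cmod (f x) \<le> \<alpha> * 2 ^ k \<and> (k = 0 \<or> \<alpha> * 2 ^ (k - 1) < cmod (f x))}"

lemma level_measurable:
  assumes f [measurable]: "f \<in> borel_measurable lebesgue" and T: "T \<in> sets lebesgue"
  shows "level f T \<alpha> k \<in> sets lebesgue"
proof -
  define S where "S = (if k = 0 then {..\<alpha> * 2 ^ k} else {\<alpha> * 2 ^ (k - 1)<..\<alpha> * 2 ^ k})"
  have "level f T \<alpha> k = T \<inter> ((\<lambda>x. cmod (f x)) -` S \<inter> space lebesgue)"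
    by (auto simp: level_def S_def)
  also have "\<dots> \<in> sets lebesgue"
    by (intro sets.Int T measurable_sets[OF measurable_compose[OF f borel_measurable_norm]]) (simp add: S_def)
  finally show ?thesis .
qed

lemma sum_level:
  assumes \<alpha>: "\<alpha> > 0" and fT: "\<And>x. x \<notin> T \<Longrightarrow> f x = 0" and K: "\<And>x. cmod (f x) \<le> \<alpha> * 2 ^ K"
  shows "f x = (\<Sum>k\<le>K. restr (level f T \<alpha> k) f x)"
proof (cases "x \<in> T")
  case False
  then show ?thesis using fT by (simp add: restr_def)
next
  case True
  define j where "j = (LEAST k. cmod (f x) \<le> \<alpha> * 2 ^ k)"
  have j: "cmod (f x) \<le> \<alpha> * 2 ^ j" "j \<le> K"
    unfolding j_def by (rule LeastI[of _ K], rule K) (rule Least_le, rule K)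
  have jm: "\<alpha> * 2 ^ (j - 1) < cmod (f x)" if "j > 0"
    using not_less_Least[of "j - 1" "\<lambda>k. cmod (f x) \<le> \<alpha> * 2 ^ k"] that by (simp add: j_def[symmetric])
  have iff: "x \<in> level f T \<alpha> k \<longleftrightarrow> k = j" for k
  proof
    assume x: "x \<in> level f T \<alpha> k"
    then have "j \<le> k" unfolding j_def by (intro Least_le) (simp add: level_def)
    moreover have "k \<le> j"
    proof (rule ccontr)
      assume "\<not> k \<le> j"
      then have "j \<le> k - 1" "k \<noteq> 0" by auto
      then have "\<alpha> * 2 ^ j \<le> \<alpha> * 2 ^ (k - 1)" using \<alpha> by (intro mult_left_mono power_increasing) auto
      with j(1) x \<open>k \<noteq> 0\<close> show False by (simp add: level_def)
    qed
    ultimately show "k = j" by simp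
  next
    assume "k = j" then show "x \<in> level f T \<alpha> k" using j jm True by (auto simp: level_def)
  qed
  have "(\<Sum>k\<le>K. restr (level f T \<alpha> k) f x) = (\<Sum>k\<le>K. if k = j then f x else 0)"
    by (intro sum.cong) (auto simp: restr_def iff)
  then show ?thesis using j(2) by simp
qed

text \<open>On level \<open>k \<ge> 1\<close> the function exceeds \<open>2 ^ (k - 1)\<close> times
  its average, so Chebyshev's inequality bounds the relative measure by
  \<open>2 powr (r * (1 - k))\<close>. The weights are then dominated by a geometric sequence,
  summable as soon as \<open>x > 1 / r\<close>.\<close>

lemma level_weight:
  assumes f: "bounded_compact_support f" and T: "T \<in> lmeasurable" "measure lebesgue T > 0"
    and r: "r > 0" and \<alpha>: "\<alpha> = cube_avg T r f" "\<alpha> > 0" and x: "x > 0"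
  shows "2 ^ k * (measure lebesgue (level f T \<alpha> k) / measure lebesgue T) powr x \<le> 2 powr (r * x) * (2 powr (1 - r * x)) ^ k"
proof -
  let ?a = "measure lebesgue (level f T \<alpha> k) / measure lebesgue T"
  have m: "level f T \<alpha> k \<in> sets lebesgue" using f T by (intro level_measurable) (auto simp: bounded_compact_support_def)
  have "?a \<le> 2 powr (r * (1 - real k))"
  proof (cases k)
    case 0
    have "measure lebesgue (level f T \<alpha> k) \<le> measure lebesgue T"
      using T m by (intro measure_mono_fmeasurable) (auto simp: level_def)
    then have "?a \<le> 1" using T(2) by simp
    also have "1 \<le> 2 powr (r * (1 - real k))" using r 0 by (simp add: ge_one_powr_ge_zero)
    finally show ?thesis .
  next
    case (Suc i)
    have "?a \<le> (cube_avg T r f / (\<alpha> * 2 ^ i)) powr r"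
      using \<alpha> Suc by (intro cube_avg_chebyshev f r T m) (auto simp: level_def)
    also have "cube_avg T r f / (\<alpha> * 2 ^ i) = 2 powr (- real i)"
      using \<alpha> by (simp add: powr_minus powr_realpow divide_inverse)
    also have "(2 powr (- real i)) powr r = 2 powr (r * (1 - real k))"
      by (simp add: powr_powr Suc mult.commute)
    finally show ?thesis .
  qed
  then have "?a powr x \<le> (2 powr (r * (1 - real k))) powr x" using x by (intro powr_mono2) auto
  then have "2 ^ k * ?a powr x \<le> 2 ^ k * (2 powr (r * (1 - real k))) powr x" by (intro mult_left_mono) auto
  also have "\<dots> = 2 powr (r * x) * (2 powr (1 - r * x)) ^ k"
    by (simp add: powr_powr powr_realpow[symmetric] powr_add[symmetric] algebra_simps)
  finally show ?thesis .
qed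

lemma sum_level_weight_le:
  fixes u :: real
  assumes "u > 1"
  shows "(\<Sum>k\<le>K. 2 powr u * (2 powr (1 - u)) ^ k) \<le> 2 powr u / (1 - 2 powr (1 - u))"
proof -
  have q: "0 < 2 powr (1 - u)" "2 powr (1 - u) < 1" using assms by (auto simp: powr_less_one)
  have "(\<Sum>k\<le>K. (2 powr (1 - u)) ^ k) \<le> (\<Sum>k. (2 powr (1 - u)) ^ k)"
    using q by (intro sum_le_suminf summable_geometric) auto
  also have "\<dots> = 1 / (1 - 2 powr (1 - u))" using q by (intro suminf_geometric) auto
  finally have "2 powr u * (\<Sum>k\<le>K. (2 powr (1 - u)) ^ k) \<le> 2 powr u * (1 / (1 - 2 powr (1 - u)))"
    by (intro mult_left_mono) auto
  then show ?thesis by (simp add: sum_distrib_left)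
qed

text \<open>
  Both functions are split into dyadic level sets, and on each pair of levels the smallest of the
  three bounds is at most a geometric mean. The resulting sums converge since \<open>1 / r\<close> and \<open>1 / s\<close>
  lie strictly below the interpolated exponents.
\<close>

theorem form_interpolation:
  fixes m :: "real ^ 'n \<Rightarrow> real"
  assumes m: "integrable lebesgue m"
    and T: "T \<in> lmeasurable" "measure lebesgue T > 0"
    and f: "bounded_compact_support f" "\<And>x. x \<notin> T \<Longrightarrow> f x = 0"
    and g: "bounded_compact_support g" "\<And>x. x \<notin> T \<Longrightarrow> g x = 0"
    and pq: "p \<ge> 1" "q \<ge> 1" and N: "N \<ge> 0" and M: "M \<ge> 0"
    and b1: "\<And>A B. A \<in> sets lebesgue \<Longrightarrow> B \<in> sets lebesgue \<Longrightarrow>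
      cmod (pairing (multiplier_op m (restr A f)) (restr B g)) \<le> N * measure lebesgue T * cube_avg T p (restr A f) * cube_avg T q (restr B g)"
    and b2: "\<And>A B. A \<in> sets lebesgue \<Longrightarrow> B \<in> sets lebesgue \<Longrightarrow>
      cmod (pairing (multiplier_op m (restr A f)) (restr B g)) \<le> N * measure lebesgue T * cube_avg T q (restr A f) * cube_avg T p (restr B g)"
    and b3: "\<And>A B. A \<in> sets lebesgue \<Longrightarrow> B \<in> sets lebesgue \<Longrightarrow>
      cmod (pairing (multiplier_op m (restr A f)) (restr B g)) \<le> M * measure lebesgue T * cube_avg T 1 (restr A f) * cube_avg T 1 (restr B g)"
    and th: "0 < \<theta>" "\<theta> < 1" and l: "0 < l" "l < 1" and rs: "r > 0" "s > 0"
    and x: "x = \<theta> + (1 - \<theta>) * (l / p + (1 - l) / q)" "r * x > 1"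
    and y: "y = \<theta> + (1 - \<theta>) * (l / q + (1 - l) / p)" "s * y > 1"
  shows "cmod (pairing (multiplier_op m f) g) \<le>
    (2 powr (r * x) / (1 - 2 powr (1 - r * x))) * (2 powr (s * y) / (1 - 2 powr (1 - s * y))) *
    (N powr (1 - \<theta>) * M powr \<theta>) * measure lebesgue T * cube_avg T r f * cube_avg T s g"
proof -
  let ?V = "measure lebesgue T"
  let ?F = "\<lambda>f g. cmod (pairing (multiplier_op m f) g)"
  define \<alpha> where "\<alpha> = cube_avg T r f"
  define \<beta> where "\<beta> = cube_avg T s g"
  define Cx where "Cx = 2 powr (r * x) / (1 - 2 powr (1 - r * x))"
  define Cy where "Cy = 2 powr (s * y) / (1 - 2 powr (1 - s * y))"
  have xy: "x > 0" "y > 0"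
    using zero_less_mult_pos[OF order.strict_trans[OF zero_less_one x(2)] rs(1)]
      zero_less_mult_pos[OF order.strict_trans[OF zero_less_one y(2)] rs(2)] by auto
  have Cxy: "Cx \<ge> 0" "Cy \<ge> 0"
    using x(2) y(2) powr_less_one[of 2 "1 - r * x"] powr_less_one[of 2 "1 - s * y"] by (simp_all add: Cx_def Cy_def)
  have Ts: "T \<in> sets lebesgue" using T by auto
  have fm: "f \<in> borel_measurable lebesgue" "g \<in> borel_measurable lebesgue" using f g by (auto simp: bounded_compact_support_def)
  \<comment> \<open>A vanishing average forces the function to vanish almost everywhere on
    \<open>T\<close>, and then the third bound gives zero. Otherwise both averages can serve as
    units for the levels.\<close>
  have zero: "cube_avg T 1 h = 0" if h: "bounded_compact_support h" and u: "u > 0" and z: "cube_avg T u h = 0" for h u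
  proof -
    have "inverse ?V * (LINT x:T|lebesgue. cmod (h x) powr u) = 0" using z u by (simp add: cube_avg_def)
    then have "(\<integral>x. indicator T x * cmod (h x) powr u \<partial>lebesgue) = 0" using T(2) by (simp add: set_lebesgue_integral_def)
    then have "AE x in lebesgue. indicator T x * cmod (h x) powr u = 0"
      by (subst (asm) integral_nonneg_eq_0_iff_AE[OF set_integrable_powr[OF h u Ts]]) auto
    then have "AE x in lebesgue. indicator T x * cmod (h x) powr 1 = 0"
      by eventually_elim (auto simp: indicator_def split: if_splits)
    then have "(\<integral>x. indicator T x * cmod (h x) powr 1 \<partial>lebesgue) = 0"
      by (subst integral_nonneg_eq_0_iff_AE[OF set_integrable_powr[OF h _ Ts]]) auto
    then show ?thesis by (simp add: cube_avg_def set_lebesgue_integral_def)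
  qed
  have UN: "restr UNIV h = h" for h :: "real ^ 'n \<Rightarrow> complex" by (simp add: restr_def fun_eq_iff)
  show ?thesis
  proof (cases "\<alpha> = 0 \<or> \<beta> = 0")
    case True
    then have "cube_avg T 1 f = 0 \<or> cube_avg T 1 g = 0"
      using zero[OF f(1) rs(1)] zero[OF g(1) rs(2)] by (auto simp: \<alpha>_def \<beta>_def)
    then have "?F f g \<le> 0" using b3[of UNIV UNIV] unfolding UN by auto
    also have "0 \<le> Cx * Cy * (N powr (1 - \<theta>) * M powr \<theta>) * ?V * cube_avg T r f * cube_avg T s g"
      using Cxy cube_avg_nonneg[of T] by (intro mult_nonneg_nonneg) auto
    finally show ?thesis unfolding Cx_def Cy_def .
  next
    case False
    then have ab: "\<alpha> > 0" "\<beta> > 0" using cube_avg_nonneg[of T r f] cube_avg_nonneg[of T s g] by (auto simp: \<alpha>_def \<beta>_def)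
    obtain K where K: "\<And>x. cmod (f x) \<le> \<alpha> * 2 ^ K" "\<And>x. cmod (g x) \<le> \<beta> * 2 ^ K"
    proof -
      obtain B where B: "\<And>x. cmod (f x) \<le> B" using f by (auto simp: bounded_compact_support_def bounded_iff)
      obtain B' where B': "\<And>x. cmod (g x) \<le> B'" using g by (auto simp: bounded_compact_support_def bounded_iff)
      obtain K where K: "max (B / \<alpha>) (B' / \<beta>) < 2 ^ K" using real_arch_pow[of 2 "max (B / \<alpha>) (B' / \<beta>)"] by auto
      then have "B \<le> \<alpha> * 2 ^ K" "B' \<le> \<beta> * 2 ^ K" using ab by (auto simp: field_simps)
      then show ?thesis using that B B' order_trans by blast
    qed
    let ?fk = "\<lambda>k. restr (level f T \<alpha> k) f" and ?gk = "\<lambda>k. restr (level g T \<beta> k) g"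
    let ?a = "\<lambda>k. measure lebesgue (level f T \<alpha> k) / ?V" and ?b = "\<lambda>k. measure lebesgue (level g T \<beta> k) / ?V"
    have lm: "level f T \<alpha> k \<in> sets lebesgue" "level g T \<beta> k \<in> sets lebesgue" for k
      using level_measurable[OF fm(1) Ts] level_measurable[OF fm(2) Ts] by auto
    have fki: "integrable lebesgue (?fk k)" "integrable lebesgue (?gk k)" for k
      by (intro integrable_bounded_compact_support bounded_compact_support_restr f g lm)+
    have term_le: "?F (?fk k) (?gk j) \<le> (N powr (1 - \<theta>) * M powr \<theta>) * ?V * \<alpha> * \<beta> * (2 ^ k * ?a k powr x) * (2 ^ j * ?b j powr y)" for k j
    proof -
      define E where "E = \<alpha> * 2 ^ k * (\<beta> * 2 ^ j) * ?V"
      have E: "E > 0" using ab T by (simp add: E_def)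
      have av: "cube_avg T u (?fk k) \<le> \<alpha> * 2 ^ k * ?a k powr (1 / u)" "cube_avg T u (?gk j) \<le> \<beta> * 2 ^ j * ?b j powr (1 / u)" if "u \<ge> 1" for u
      proof -
        show "cube_avg T u (?fk k) \<le> \<alpha> * 2 ^ k * ?a k powr (1 / u)"
          by (rule cube_avg_restr_le[OF f(1) _ T lm(1)]) (use that ab in \<open>auto simp: level_def\<close>)
        show "cube_avg T u (?gk j) \<le> \<beta> * 2 ^ j * ?b j powr (1 / u)"
          by (rule cube_avg_restr_le[OF g(1) _ T lm(2)]) (use that ab in \<open>auto simp: level_def\<close>)
      qed
      have bd: "c * ?V * cube_avg T u (?fk k) * cube_avg T v (?gk j) \<le> E * (c * (?a k powr (1 / u) * ?b j powr (1 / v)))"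
        if "u \<ge> 1" "v \<ge> 1" "c \<ge> 0" for u v c
      proof -
        have "cube_avg T u (?fk k) * cube_avg T v (?gk j) \<le> (\<alpha> * 2 ^ k * ?a k powr (1 / u)) * (\<beta> * 2 ^ j * ?b j powr (1 / v))"
          using that ab cube_avg_nonneg by (intro mult_mono av mult_nonneg_nonneg) auto
        then have "(c * ?V) * (cube_avg T u (?fk k) * cube_avg T v (?gk j)) \<le> (c * ?V) * ((\<alpha> * 2 ^ k * ?a k powr (1 / u)) * (\<beta> * 2 ^ j * ?b j powr (1 / v)))"
          using that T by (intro mult_left_mono) auto
        then show ?thesis by (simp add: E_def mult_ac)
      qed
      define a where "a = ?a k"
      define b where "b = ?b j"
      have ab0: "a \<ge> 0" "b \<ge> 0" using T by (auto simp: a_def b_def)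
      have e: "0 < (1 - \<theta>) * l" "0 < (1 - \<theta>) * (1 - l)" "(1 - \<theta>) * l + (1 - \<theta>) * (1 - l) + \<theta> = 1"
        using th l by (simp, simp, simp add: algebra_simps)
      \<comment> \<open>The weights \<open>(1 - \<theta>) * l\<close>,
        \<open>(1 - \<theta>) * (1 - l)\<close> and \<open>\<theta>\<close> sum to 1. Hence the
        common factor \<open>E\<close> survives unchanged, and the densities \<open>a\<close> and
        \<open>b\<close> of the two levels acquire the exponents \<open>x\<close> and
        \<open>y\<close>.\<close>
      have "?F (?fk k) (?gk j) \<le> (E * (N * (a powr (1 / p) * b powr (1 / q)))) powr ((1 - \<theta>) * l) *
          (E * (N * (a powr (1 / q) * b powr (1 / p)))) powr ((1 - \<theta>) * (1 - l)) * (E * (M * (a powr (1 / 1) * b powr (1 / 1)))) powr \<theta>"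
        unfolding a_def b_def
        by (intro geometric_mean_bound order_trans[OF b1[OF lm] bd] order_trans[OF b2[OF lm] bd] order_trans[OF b3[OF lm] bd] pq N M e th)
           auto
      also have "\<dots> = (E powr ((1 - \<theta>) * l) * E powr ((1 - \<theta>) * (1 - l)) * E powr \<theta>) *
          (N powr ((1 - \<theta>) * l) * N powr ((1 - \<theta>) * (1 - l))) * M powr \<theta> *
          (a powr (1 / p * ((1 - \<theta>) * l)) * a powr (1 / q * ((1 - \<theta>) * (1 - l))) * a powr \<theta>) *
          (b powr (1 / q * ((1 - \<theta>) * l)) * b powr (1 / p * ((1 - \<theta>) * (1 - l))) * b powr \<theta>)"
        using E N M ab0 by (simp add: powr_mult powr_powr mult_ac)
      also have "E powr ((1 - \<theta>) * l) * E powr ((1 - \<theta>) * (1 - l)) * E powr \<theta> = E"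
      proof -
        have "(1 - \<theta>) * l + (1 - \<theta>) * (1 - l) + \<theta> = 1" by (simp add: algebra_simps)
        then show ?thesis using E unfolding powr_add[symmetric] by simp
      qed
      also have "N powr ((1 - \<theta>) * l) * N powr ((1 - \<theta>) * (1 - l)) = N powr (1 - \<theta>)"
        unfolding powr_add[symmetric] by (simp add: algebra_simps)
      also have "a powr (1 / p * ((1 - \<theta>) * l)) * a powr (1 / q * ((1 - \<theta>) * (1 - l))) * a powr \<theta> = a powr x"
        unfolding powr_add[symmetric] x(1) by (simp add: algebra_simps add_divide_distrib diff_divide_distrib)
      also have "b powr (1 / q * ((1 - \<theta>) * l)) * b powr (1 / p * ((1 - \<theta>) * (1 - l))) * b powr \<theta> = b powr y"
        unfolding powr_add[symmetric] y(1) by (simp add: algebra_simps add_divide_distrib diff_divide_distrib)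
      finally show ?thesis by (simp add: E_def a_def b_def mult_ac)
    qed
    have fsum: "f = (\<lambda>x. \<Sum>k\<le>K. ?fk k x)" "g = (\<lambda>x. \<Sum>k\<le>K. ?gk k x)"
      using sum_level[of \<alpha> T f K, OF ab(1) f(2) K(1)] sum_level[of \<beta> T g K, OF ab(2) g(2) K(2)]
      by (intro ext; simp)+
    have gi: "integrable lebesgue g" using g(1) by (rule integrable_bounded_compact_support)
    have "pairing (multiplier_op m f) g = (\<Sum>k\<le>K. pairing (multiplier_op m (?fk k)) g)"
      by (subst (1) fsum(1)) (rule pairing_multiplier_op_sum_left[OF m fki(1) gi])
    also have "\<dots> = (\<Sum>k\<le>K. \<Sum>j\<le>K. pairing (multiplier_op m (?fk k)) (?gk j))"
    proof (rule sum.cong[OF refl])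
      fix k
      show "pairing (multiplier_op m (?fk k)) g = (\<Sum>j\<le>K. pairing (multiplier_op m (?fk k)) (?gk j))"
        by (subst (1) fsum(2)) (rule pairing_multiplier_op_sum_right[OF m fki(2) fki(1)])
    qed
    finally have double: "pairing (multiplier_op m f) g = (\<Sum>k\<le>K. \<Sum>j\<le>K. pairing (multiplier_op m (?fk k)) (?gk j))" .
    define c where "c = (N powr (1 - \<theta>) * M powr \<theta>) * ?V * \<alpha> * \<beta>"
    define X where "X k = 2 ^ k * ?a k powr x" for k
    define Y where "Y j = 2 ^ j * ?b j powr y" for j
    have c0: "c \<ge> 0" using ab by (simp add: c_def)
    have XY: "X k \<ge> 0" "Y k \<ge> 0" for k by (auto simp: X_def Y_def)
    have SX: "(\<Sum>k\<le>K. X k) \<le> Cx" unfolding Cx_def X_def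
      by (rule order_trans[OF sum_mono sum_level_weight_le[OF x(2)]])
         (rule level_weight[OF f(1) T rs(1) \<alpha>_def ab(1) xy(1)])
    have SY: "(\<Sum>k\<le>K. Y k) \<le> Cy" unfolding Cy_def Y_def
      by (rule order_trans[OF sum_mono sum_level_weight_le[OF y(2)]])
         (rule level_weight[OF g(1) T rs(2) \<beta>_def ab(2) xy(2)])
    have "?F f g \<le> (\<Sum>k\<le>K. \<Sum>j\<le>K. c * X k * Y j)"
      unfolding double
    proof (rule order_trans[OF norm_sum], rule sum_mono)
      fix k
      have "cmod (\<Sum>j\<le>K. pairing (multiplier_op m (?fk k)) (?gk j)) \<le> (\<Sum>j\<le>K. ?F (?fk k) (?gk j))" by (rule norm_sum)
      also have "\<dots> \<le> (\<Sum>j\<le>K. c * X k * Y j)"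
        unfolding c_def X_def Y_def by (rule sum_mono) (rule term_le)
      finally show "cmod (\<Sum>j\<le>K. pairing (multiplier_op m (?fk k)) (?gk j)) \<le> (\<Sum>j\<le>K. c * X k * Y j)" .
    qed
    also have "\<dots> = c * ((\<Sum>k\<le>K. X k) * (\<Sum>j\<le>K. Y j))"
      unfolding sum_product by (simp only: sum_distrib_left mult.assoc)
    also have "\<dots> \<le> c * (Cx * Cy)"
      by (rule mult_left_mono[OF mult_mono[OF SX SY Cxy(1) sum_nonneg] c0]) (rule XY)
    finally show ?thesis by (simp add: Cx_def[symmetric] Cy_def[symmetric] c_def \<alpha>_def \<beta>_def mult_ac)
  qed
qed


section \<open>The trapezoid\<close>

lemma inverse_conj_exponent: "p \<noteq> 0 \<Longrightarrow> 1 / conj_exponent p = 1 - 1 / p"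
  by (simp add: conj_exponent_def field_simps)

text \<open>A linear functional is bounded on the hull by its largest value at a vertex and stays
  strictly below it in the interior. This is applied to the sum of the coordinates and to each
  coordinate.\<close>

lemma trapezoid_bounds:
  fixes p \<delta> :: real
  assumes p: "1 < p" "p < 2" and n: "n \<ge> 2" and \<delta>: "0 < \<delta>" "\<delta> < (real n - 1) / 2"
    and xy: "(x, y) \<in> trapezoid n p \<delta>"
  defines "t \<equiv> 2 * \<delta> / (real n - 1)"
  shows "x + y < 1 + t" "x < 1 / p + (1 - 1 / p) * t" "y < 1 / p + (1 - 1 / p) * t"
proof -
  define a where "a = 1 / p"
  have a: "1 / 2 < a" "a < 1" using p by (auto simp: a_def field_simps)
  have t: "0 < t" "t < 1" using \<delta> n by (auto simp: t_def field_simps)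
  have q: "1 / conj_exponent p = 1 - a" using p by (simp add: inverse_conj_exponent a_def)
  let ?V = "{trapezoid_v1 n p \<delta>, trapezoid_v2 n p \<delta>,
      prod.swap (trapezoid_v2 n p \<delta>), prod.swap (trapezoid_v1 n p \<delta>)}"
  \<comment> \<open>The coordinates of the first and the last vertex sum to 1, those of the two
    middle ones to \<open>1 + t\<close>.\<close>
  have V: "?V = {((1 - a) * (1 - t), a + (1 - a) * t), ((1 - a) + a * t, a + (1 - a) * t),
      (a + (1 - a) * t, (1 - a) + a * t), (a + (1 - a) * t, (1 - a) * (1 - t))}"
    unfolding trapezoid_v1_def trapezoid_v2_def q t_def[symmetric] a_def[symmetric] by auto
  have half: "c \<bullet> (x, y) < b" if "c \<noteq> 0" "\<And>v. v \<in> ?V \<Longrightarrow> c \<bullet> v \<le> b" for c :: "real \<times> real" and b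
  proof -
    have "convex hull ?V \<subseteq> {v. c \<bullet> v \<le> b}"
      by (rule hull_minimal) (use that in \<open>auto simp: convex_halfspace_le\<close>)
    then have "interior (convex hull ?V) \<subseteq> interior {v. c \<bullet> v \<le> b}" by (rule interior_mono)
    then show ?thesis using xy that(1) by (auto simp: trapezoid_def interior_halfspace_le)
  qed
  have e: "(1 - a) * (1 - t) \<le> a + (1 - a) * t" "(1 - a) + a * t \<le> a + (1 - a) * t" "0 \<le> t"
  proof -
    have "(2 * a - 1) * (1 - t) \<ge> 0" using a t by (intro mult_nonneg_nonneg) auto
    then show "(1 - a) + a * t \<le> a + (1 - a) * t" by (simp add: algebra_simps)
    have "(2 * a - 1) + 2 * t * (1 - a) \<ge> 0" using a t by (intro add_nonneg_nonneg mult_nonneg_nonneg) auto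
    then show "(1 - a) * (1 - t) \<le> a + (1 - a) * t" by (simp add: algebra_simps)
  qed (use t in auto)
  have "(1, 1) \<bullet> (x, y) < 1 + t"
    by (rule half) (use e in \<open>auto simp: V algebra_simps zero_prod_def\<close>)
  then show "x + y < 1 + t" by simp
  have "(1, 0) \<bullet> (x, y) < a + (1 - a) * t"
    by (rule half) (use e in \<open>auto simp: V zero_prod_def\<close>)
  then show "x < 1 / p + (1 - 1 / p) * t" by (simp add: a_def)
  have "(0, 1) \<bullet> (x, y) < a + (1 - a) * t"
    by (rule half) (use e in \<open>auto simp: V zero_prod_def\<close>)
  then show "y < 1 / p + (1 - 1 / p) * t" by (simp add: a_def)
qed

text \<open>The open region \<open>U\<close> with strict inequalities is placed inside the hull by
  explicit convex combinations. A point that satisfies the inequalities of the lemma is then a limit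
  of points of \<open>U\<close>.\<close>

lemma in_closure_trapezoid:
  fixes p \<delta> :: real
  assumes p: "1 < p" "p < 2" and n: "n \<ge> 2" and \<delta>: "0 < \<delta>" "\<delta> < (real n - 1) / 2"
  defines "t \<equiv> 2 * \<delta> / (real n - 1)"
  assumes xy: "1 < x + y" "x + y \<le> 1 + t" "x \<le> 1 / p + (1 - 1 / p) * t" "y \<le> 1 / p + (1 - 1 / p) * t"
  shows "(x, y) \<in> closure (trapezoid n p \<delta>)"
proof -
  define a where "a = 1 / p"
  define Y where "Y = a + (1 - a) * t"
  have a: "1 / 2 < a" "a < 1" using p by (auto simp: a_def field_simps)
  have t: "0 < t" "t < 1" using \<delta> n by (auto simp: t_def field_simps)
  have q: "1 / conj_exponent p = 1 - a" using p by (simp add: inverse_conj_exponent a_def)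
  let ?V = "{trapezoid_v1 n p \<delta>, trapezoid_v2 n p \<delta>,
      prod.swap (trapezoid_v2 n p \<delta>), prod.swap (trapezoid_v1 n p \<delta>)}"
  have V: "?V = {(1 - Y, Y), (1 + t - Y, Y), (Y, 1 + t - Y), (Y, 1 - Y)}"
    unfolding trapezoid_v1_def trapezoid_v2_def q t_def[symmetric] a_def[symmetric]
    by (auto simp: Y_def algebra_simps)
  \<comment> \<open>This says that the side on the line \<open>x + y = 1 + t\<close>, from
    \<open>(1 + t - Y, Y)\<close> to its mirror image, has positive length.\<close>
  have Y2: "1 + t < 2 * Y"
  proof -
    have "(2 * a - 1) * (1 - t) > 0" using a t by (intro mult_pos_pos) auto
    then show ?thesis by (simp add: Y_def algebra_simps)
  qed
  let ?H = "convex hull ?V"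
  define U where "U = {z :: real \<times> real. 1 < fst z + snd z \<and> fst z + snd z < 1 + t \<and> fst z < Y \<and> snd z < Y}"
  have UH: "U \<subseteq> ?H"
  proof
    fix z assume z: "z \<in> U"
    obtain u v where uv: "z = (u, v)" by (cases z)
    \<comment> \<open>\<open>h\<close> selects, on the two edges where one coordinate is
      \<open>Y\<close>, the points whose coordinate sum is \<open>u + v\<close>;
      \<open>\<mu>\<close> then divides the segment between these points.\<close>
    define h where "h = (u + v - 1) / t"
    define \<mu> where "\<mu> = (Y - v) / (2 * Y - (u + v))"
    have h: "0 \<le> h" "h \<le> 1" "h * t = u + v - 1" using z uv t by (auto simp: U_def h_def field_simps)
    have d: "2 * Y - (u + v) > 0" using z uv by (auto simp: U_def)
    have \<mu>: "0 \<le> \<mu>" "\<mu> \<le> 1" "\<mu> * (2 * Y - (u + v)) = Y - v"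
      using z uv d by (auto simp: U_def \<mu>_def field_simps)
    have in1: "(1 - h) *\<^sub>R (1 - Y, Y) + h *\<^sub>R (1 + t - Y, Y) \<in> ?H"
      using h unfolding V by (intro convexD[OF convex_convex_hull] hull_inc) auto
    have in2: "(1 - h) *\<^sub>R (Y, 1 - Y) + h *\<^sub>R (Y, 1 + t - Y) \<in> ?H"
      using h unfolding V by (intro convexD[OF convex_convex_hull] hull_inc) auto
    have in3: "(1 - \<mu>) *\<^sub>R ((1 - h) *\<^sub>R (1 - Y, Y) + h *\<^sub>R (1 + t - Y, Y)) +
        \<mu> *\<^sub>R ((1 - h) *\<^sub>R (Y, 1 - Y) + h *\<^sub>R (Y, 1 + t - Y)) \<in> ?H"
      using \<mu> by (intro convexD[OF convex_convex_hull] in1 in2) auto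
    have s1: "(1 - h) *\<^sub>R (1 - Y, Y) + h *\<^sub>R (1 + t - Y, Y) = (u + v - Y, Y)"
      using h(3) by (simp add: algebra_simps)
    have s2: "(1 - h) *\<^sub>R (Y, 1 - Y) + h *\<^sub>R (Y, 1 + t - Y) = (Y, u + v - Y)"
      using h(3) by (simp add: algebra_simps)
    have s3: "(1 - \<mu>) *\<^sub>R (u + v - Y, Y) + \<mu> *\<^sub>R (Y, u + v - Y) = (u, v)"
      using \<mu>(3) by (simp add: algebra_simps)
    show "z \<in> ?H" using in3 unfolding s1 s2 s3 uv .
  qed
  have "open U" unfolding U_def
    by (intro open_Collect_conj open_Collect_less continuous_intros)
  with UH have U: "U \<subseteq> trapezoid n p \<delta>" unfolding trapezoid_def by (rule interior_maximal)
  \<comment> \<open>\<open>(c, c)\<close> lies in \<open>U\<close>, as \<open>2 * c\<close> is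
    halfway between 1 and \<open>1 + t\<close>. Moving from \<open>(x, y)\<close> towards it makes
    all inequalities strict.\<close>
  define c where "c = (1 + t / 2) / 2"
  define s where "s e = (x + e * (c - x), y + e * (c - y))" for e
  have sU: "s e \<in> U" if "0 < e" "e < 1" for e
  proof -
    have c1: "2 * c > 1" "2 * c < 1 + t" "c < Y" using t Y2 by (auto simp: c_def)
    have x: "(1 - e) * x \<le> (1 - e) * Y" "(1 - e) * y \<le> (1 - e) * Y" "(1 - e) * (x + y) > (1 - e) * 1"
      "(1 - e) * (x + y) \<le> (1 - e) * (1 + t)"
      using xy that by (auto intro!: mult_left_mono simp: Y_def a_def)
    have c2: "e * c < e * Y" "e * 1 < e * (2 * c)" "e * (2 * c) < e * (1 + t)" using that c1 by auto
    show ?thesis using x c2 by (auto simp: U_def s_def algebra_simps)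
  qed
  have "(s \<longlongrightarrow> s 0) (at_right 0)"
    unfolding s_def by (intro tendsto_intros)
  moreover have "\<forall>\<^sub>F e in at_right 0. s e \<in> closure U"
    using sU closure_subset by (auto simp: eventually_at_right_field intro!: exI[of _ 1])
  ultimately have "s 0 \<in> closure U"
    by (intro Lim_in_closed_set[of "closure U" s "at_right 0"]) auto
  then show ?thesis using closure_mono[OF U] by (auto simp: s_def)
qed


section \<open>Sparse bounds from single scale estimates\<close>

lemma cube_facts:
  fixes a :: "real ^ 'n"
  assumes l: "l > 0"
  defines "S \<equiv> cbox a (\<chi> i. a $ i + l)"
  shows "cube S" "S \<in> lmeasurable" "measure lebesgue S = l ^ CARD('n)" "measure lebesgue (interior S) = l ^ CARD('n)"
proof -
  show "cube S" using l by (auto simp: cube_def S_def)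
  show S: "S \<in> lmeasurable" by (simp add: S_def)
  have "measure lebesgue S = (\<Prod>b\<in>Basis. ((\<chi> i. a $ i + l) - a) \<bullet> b)"
  proof -
    have "a \<bullet> b \<le> (\<chi> i. a $ i + l) \<bullet> b" if "b \<in> Basis" for b :: "real ^ 'n"
      using that l by (auto simp: Basis_vec_def inner_axis)
    then show ?thesis by (simp add: S_def measure_lborel_cbox_eq inner_diff_left)
  qed
  also have "\<dots> = (\<Prod>b\<in>(Basis :: (real ^ 'n) set). l)"
    by (intro prod.cong refl) (auto simp: Basis_vec_def inner_axis inner_diff_left)
  finally show m: "measure lebesgue S = l ^ CARD('n)" by simp
  have "measure lebesgue (interior S) = measure lebesgue S"
    unfolding S_def interior_cbox by (simp add: measure_lborel_box_eq measure_lborel_cbox_eq)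
  then show "measure lebesgue (interior S) = l ^ CARD('n)" using m by simp
qed

text \<open>The cell of index \<open>z\<close> enlarged by three cells on each side. The margin is
  chosen to hold the neighbours of the parent cell, so one cube contains both functions of a far
  term.\<close>

definition gridcube :: "real \<Rightarrow> int ^ 'n \<Rightarrow> (real ^ 'n) set" where
  "gridcube h z = cbox (\<chi> i. (of_int (z $ i) - 3) * h) (\<chi> i. (of_int (z $ i) + 4) * h)"

lemma gridcube_eq: "gridcube h z = cbox (\<chi> i. (of_int (z $ i) - 3) * h) (\<chi> i. (\<chi> i. (of_int (z $ i) - 3) * h) $ i + 7 * h)"
  unfolding gridcube_def by (rule arg_cong2[of _ _ _ _ cbox]) (auto simp: vec_eq_iff algebra_simps)

lemma gridcube_facts:
  assumes "h > 0"
  shows "cube (gridcube h z)" "gridcube h z \<in> lmeasurable" "measure lebesgue (gridcube h (z :: int ^ 'n)) = (7 * h) ^ CARD('n)"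
    "measure lebesgue (interior (gridcube h z)) = (7 * h) ^ CARD('n)" "measure lebesgue (gridcube h z) > 0"
  using cube_facts[of "7 * h" "\<chi> i. (of_int (z $ i) - 3) * h"] assms unfolding gridcube_eq[symmetric] by auto

definition sparse_sup :: "real \<Rightarrow> real \<Rightarrow> (real ^ 'n \<Rightarrow> complex) \<Rightarrow> (real ^ 'n \<Rightarrow> complex) \<Rightarrow> ennreal" where
  "sparse_sup r s f g = (SUP \<S>\<in>{\<S>. sparse \<S>}. sparse_form \<S> r s f g)"

lemma interior_gridcube: "h > 0 \<Longrightarrow> x \<in> interior (gridcube h z) \<Longrightarrow> (of_int (z $ i) - 3) * h < x $ i \<and> x $ i < (of_int (z $ i) + 4) * h"
  unfolding gridcube_def interior_cbox by (auto simp: mem_box_cart)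

text \<open>Side length 7 and indices congruent modulo 7 leave at most common boundary points. The
  cubes are closed, so their interiors are taken as the disjoint sets; these have full
  measure.\<close>

lemma sparse_gridcubes:
  fixes Z :: "(int ^ 'n) set"
  assumes h: "h > 0" and Z: "\<And>z w i. z \<in> Z \<Longrightarrow> w \<in> Z \<Longrightarrow> z $ i mod 7 = w $ i mod 7"
  shows "inj_on (gridcube h) Z" "sparse (gridcube h ` Z)"
proof -
  have ne: "interior (gridcube h z) \<noteq> {}" for z :: "int ^ 'n"
    using gridcube_facts(4)[OF h, of z] h by (intro notI) simp
  have disj: "z = w" if "z \<in> Z" "w \<in> Z" "x \<in> interior (gridcube h z)" "x \<in> interior (gridcube h w)" for z w x
  proof -
    have "z $ i = w $ i" for i
    proof -
      have a: "(of_int (z $ i) - 3) * h < (of_int (w $ i) + 4) * h" "(of_int (w $ i) - 3) * h < (of_int (z $ i) + 4) * h"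
        using interior_gridcube[OF h that(3), of i] interior_gridcube[OF h that(4), of i] by linarith+
      then have "real_of_int (z $ i) - 3 < of_int (w $ i) + 4" "real_of_int (w $ i) - 3 < of_int (z $ i) + 4" using h by auto
      then have "\<bar>z $ i - w $ i\<bar> < 7" by linarith
      moreover have "7 dvd (z $ i - w $ i)" using Z[OF that(1,2), of i] by (simp add: mod_eq_dvd_iff)
      ultimately show ?thesis using zdvd_imp_le[of 7 "\<bar>z $ i - w $ i\<bar>"] by fastforce
    qed
    then show ?thesis by (simp add: vec_eq_iff)
  qed
  show "inj_on (gridcube h) Z"
  proof (rule inj_onI)
    fix z w assume "z \<in> Z" "w \<in> Z" "gridcube h z = gridcube h w"
    moreover obtain x where "x \<in> interior (gridcube h z)" using ne[of z] by blast
    ultimately show "z = w" using disj by metis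
  qed
  show "sparse (gridcube h ` Z)"
    unfolding sparse_def
  proof (intro conjI exI[of _ interior] ballI)
    show "disjoint_family_on interior (gridcube h ` Z)"
      unfolding disjoint_family_on_def using disj by blast
    fix S assume "S \<in> gridcube h ` Z"
    then obtain z where z: "S = gridcube h z" by auto
    show "cube S" using gridcube_facts(1)[OF h] z by simp
    show "interior S \<in> sets lebesgue" by simp
    show "interior S \<subseteq> S" by (rule interior_subset)
    show "1 / 4 * measure lebesgue S < measure lebesgue (interior S)"
      using gridcube_facts[OF h, of z] z h by simp
  qed
qed

text \<open>Sorting the indices by their residues modulo 7 splits the cubes of one scale into
  \<open>7 ^ n\<close> sparse families, each of which is bounded by the supremum.\<close>

lemma sum_gridcubes_le:
  fixes Z :: "(int ^ 'n) set"
  assumes h: "h > 0" and Z: "finite Z"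
  shows "(\<Sum>z\<in>Z. ennreal (measure lebesgue (gridcube h z) * cube_avg (gridcube h z) r f * cube_avg (gridcube h z) s g))
    \<le> of_nat (card {\<rho> :: int ^ 'n. \<forall>i. 0 \<le> \<rho> $ i \<and> \<rho> $ i < 7}) * sparse_sup r s f g"
proof -
  define R where "R = {\<rho> :: int ^ 'n. \<forall>i. 0 \<le> \<rho> $ i \<and> \<rho> $ i < 7}"
  have finR: "finite R"
  proof -
    have "finite (PiE (UNIV :: 'n set) (\<lambda>_. {0..<7::int}))" by (intro finite_PiE) auto
    then have "finite ((\<lambda>f. \<chi> i. f i) ` PiE (UNIV :: 'n set) (\<lambda>_. {0..<7::int}))" by (rule finite_imageI)
    moreover have "R \<subseteq> (\<lambda>f. \<chi> i. f i) ` PiE (UNIV :: 'n set) (\<lambda>_. {0..<7::int})"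
    proof
      fix \<rho> assume "\<rho> \<in> R"
      then have "(\<lambda>i. \<rho> $ i) \<in> PiE (UNIV :: 'n set) (\<lambda>_. {0..<7::int})" by (auto simp: R_def)
      then show "\<rho> \<in> (\<lambda>f. \<chi> i. f i) ` PiE (UNIV :: 'n set) (\<lambda>_. {0..<7::int})"
        by (rule rev_image_eqI) (simp add: vec_eq_iff)
    qed
    ultimately show ?thesis by (rule finite_subset[rotated])
  qed
  define t where "t S = ennreal (measure lebesgue S * cube_avg S r f * cube_avg S s g)" for S
  define red where "red z = (\<chi> i. z $ i mod 7)" for z :: "int ^ 'n"
  have redR: "red z \<in> R" for z by (auto simp: red_def R_def)
  have cls: "(\<Sum>z\<in>{z\<in>Z. red z = \<rho>}. t (gridcube h z)) \<le> sparse_sup r s f g" for \<rho>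
  proof -
    let ?Z = "{z\<in>Z. red z = \<rho>}"
    have eqs: "z $ i mod 7 = w $ i mod 7" if "z \<in> ?Z" "w \<in> ?Z" for z w :: "int ^ 'n" and i
    proof -
      have "red z $ i = red w $ i" using that by simp
      then show ?thesis by (simp add: red_def)
    qed
    have sp: "inj_on (gridcube h) ?Z" "sparse (gridcube h ` ?Z)"
      by (rule sparse_gridcubes[OF h], rule eqs, assumption+)+
    have "(\<Sum>z\<in>?Z. t (gridcube h z)) = (\<Sum>S\<in>gridcube h ` ?Z. t S)" by (subst sum.reindex[OF sp(1)], rule sum.cong) simp_all
    also have "\<dots> = sparse_form (gridcube h ` ?Z) r s f g" using Z by (simp add: sparse_form_def t_def)
    also have "\<dots> \<le> sparse_sup r s f g" unfolding sparse_sup_def by (rule SUP_upper) (simp add: sp(2))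
    finally show ?thesis .
  qed
  have "(\<Sum>z\<in>Z. t (gridcube h z)) = (\<Sum>\<rho>\<in>R. \<Sum>z\<in>{z\<in>Z. red z = \<rho>}. t (gridcube h z))"
    by (rule sum.group[symmetric]) (use Z finR redR in auto)
  also have "\<dots> \<le> (\<Sum>\<rho>\<in>R. sparse_sup r s f g)" by (intro sum_mono cls)
  finally show ?thesis by (simp add: t_def R_def)
qed

section \<open>The dyadic grid\<close>

definition gridindex :: "nat \<Rightarrow> real ^ 'n \<Rightarrow> int ^ 'n" where
  "gridindex k x = (\<chi> i. \<lfloor>x $ i / 2 ^ k\<rfloor>)"

text \<open>Rounding down gives half-open cells, so that the cells of one scale partition the space
  and every cell lies in the cell of its \<open>parent\<close>.\<close>

definition gridcell :: "nat \<Rightarrow> int ^ 'n \<Rightarrow> (real ^ 'n) set" where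
  "gridcell k z = {x. gridindex k x = z}"

definition neighbours :: "nat \<Rightarrow> int ^ 'n \<Rightarrow> (real ^ 'n) set" where
  "neighbours k z = {x. \<forall>i. \<bar>gridindex k x $ i - z $ i\<bar> \<le> 1}"

definition parent :: "int ^ 'n \<Rightarrow> int ^ 'n" where
  "parent z = (\<chi> i. z $ i div 2)"

lemma gridindex_bounds: "of_int (gridindex k x $ i) * 2 ^ k \<le> x $ i" "x $ i < (of_int (gridindex k x $ i) + 1) * 2 ^ k"
proof -
  have "of_int \<lfloor>x $ i / 2 ^ k\<rfloor> * 2 ^ k \<le> (x $ i / 2 ^ k) * 2 ^ k" by (intro mult_right_mono) auto
  then show "of_int (gridindex k x $ i) * 2 ^ k \<le> x $ i" by (simp add: gridindex_def)
  have "(x $ i / 2 ^ k) * 2 ^ k < (of_int \<lfloor>x $ i / 2 ^ k\<rfloor> + 1) * 2 ^ k"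
    by (intro mult_strict_right_mono) (linarith, simp)
  then show "x $ i < (of_int (gridindex k x $ i) + 1) * 2 ^ k" by (simp add: gridindex_def)
qed

lemma gridindex_Suc: "gridindex (Suc k) x = parent (gridindex k x)"
proof -
  have "\<lfloor>y / (2 * 2 ^ k)\<rfloor> = \<lfloor>y / 2 ^ k\<rfloor> div 2" for y :: real
    using floor_divide_real_eq_div[of 2 "y / 2 ^ k"] by (simp add: field_simps)
  then show ?thesis by (simp add: gridindex_def parent_def vec_eq_iff)
qed

lemma floor_vec_borel: "{x :: real ^ 'n. P (gridindex k x $ i)} \<in> sets borel"
proof -
  have "(\<lambda>x :: real ^ 'n. gridindex k x $ i) \<in> measurable borel (count_space UNIV)"
    unfolding gridindex_def by simp
  then have "(\<lambda>x :: real ^ 'n. gridindex k x $ i) -` {z. P z} \<inter> space borel \<in> sets borel"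
    by (rule measurable_sets) simp
  then show ?thesis by (simp add: vimage_def)
qed

lemma grid_measurable:
  "gridcell k z \<in> sets lebesgue" "neighbours k (z :: int ^ 'n) \<in> sets lebesgue"
proof -
  have "gridcell k z = (\<Inter>i. {x. gridindex k x $ i = z $ i})" by (auto simp: gridcell_def vec_eq_iff)
  also have "\<dots> \<in> sets borel" by (intro sets.countable_INT'' floor_vec_borel) auto
  finally show "gridcell k z \<in> sets lebesgue" by simp
  have "neighbours k z = (\<Inter>i. {x. \<bar>gridindex k x $ i - z $ i\<bar> \<le> 1})" by (auto simp: neighbours_def)
  also have "\<dots> \<in> sets borel" by (intro sets.countable_INT'' floor_vec_borel) auto
  finally show "neighbours k z \<in> sets lebesgue" by simp
qed

lemma neighbours_subset: "neighbours k z \<subseteq> gridcube (2 ^ k) z"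
proof
  fix x assume x: "x \<in> neighbours k z"
  have "(of_int (z $ i) - 3) * 2 ^ k \<le> x $ i \<and> x $ i \<le> (of_int (z $ i) + 4) * 2 ^ k" for i
  proof -
    have "real_of_int (z $ i) - 3 \<le> of_int (gridindex k x $ i)" "real_of_int (gridindex k x $ i) + 1 \<le> of_int (z $ i) + 4"
      using x by (auto simp: neighbours_def abs_le_iff dest!: spec[of _ i])
    then have "(real_of_int (z $ i) - 3) * 2 ^ k \<le> of_int (gridindex k x $ i) * 2 ^ k"
      "(real_of_int (gridindex k x $ i) + 1) * 2 ^ k \<le> (of_int (z $ i) + 4) * 2 ^ k"
      by (auto intro!: mult_right_mono)
    then show ?thesis using gridindex_bounds[where k = k and x = x and i = i] by linarith
  qed
  then show "x \<in> gridcube (2 ^ k) z" by (auto simp: gridcube_def mem_box_cart)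
qed

lemma gridcell_subset: "gridcell k z \<subseteq> gridcube (2 ^ k) z"
  by (rule order_trans[OF _ neighbours_subset]) (auto simp: gridcell_def neighbours_def)

text \<open>If the halves of two integers, rounded down, differ by at most 1, the integers differ by
  at most 3. Hence the margin in \<open>gridcube\<close>.\<close>

lemma neighbours_parent_subset: "neighbours (Suc k) (parent z) \<subseteq> gridcube (2 ^ k) z"
proof
  fix x assume x: "x \<in> neighbours (Suc k) (parent z)"
  have "(of_int (z $ i) - 3) * 2 ^ k \<le> x $ i \<and> x $ i \<le> (of_int (z $ i) + 4) * 2 ^ k" for i
  proof -
    have "\<bar>gridindex k x $ i div 2 - z $ i div 2\<bar> \<le> 1" using x by (simp add: neighbours_def gridindex_Suc parent_def)
    then have "z $ i - 3 \<le> gridindex k x $ i" "gridindex k x $ i + 1 \<le> z $ i + 4" by linarith+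
    then have "real_of_int (z $ i) - 3 \<le> of_int (gridindex k x $ i)" "real_of_int (gridindex k x $ i) + 1 \<le> of_int (z $ i) + 4" by linarith+
    then have "(real_of_int (z $ i) - 3) * 2 ^ k \<le> of_int (gridindex k x $ i) * 2 ^ k"
      "(real_of_int (gridindex k x $ i) + 1) * 2 ^ k \<le> (of_int (z $ i) + 4) * 2 ^ k"
      by (auto intro!: mult_right_mono)
    then show ?thesis using gridindex_bounds[where k = k and x = x and i = i] by linarith
  qed
  then show "x \<in> gridcube (2 ^ k) z" by (auto simp: gridcube_def mem_box_cart)
qed

lemma neighbours_mono: "neighbours k z \<subseteq> neighbours (Suc k) (parent z)"
proof
  fix x assume x: "x \<in> neighbours k z"
  have "\<bar>gridindex k x $ i div 2 - z $ i div 2\<bar> \<le> 1" for i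
  proof -
    have "\<bar>gridindex k x $ i - z $ i\<bar> \<le> 1" using x by (simp add: neighbours_def)
    then show ?thesis by linarith
  qed
  then show "x \<in> neighbours (Suc k) (parent z)" by (simp add: neighbours_def gridindex_Suc parent_def)
qed

text \<open>Some coordinate of the indices differs by at least 2, so a whole cell of side
  \<open>2 ^ k\<close> lies between the points in that direction.\<close>

lemma not_neighbours_separated:
  fixes x y :: "real ^ 'n"
  assumes "y \<in> gridcell k z" "x \<notin> neighbours k z"
  shows "\<exists>i. \<bar>(x - y) $ i\<bar> \<ge> 2 ^ k"
proof -
  obtain i where i: "\<bar>gridindex k x $ i - gridindex k y $ i\<bar> \<ge> 2"
  proof -
    obtain i where "\<not> \<bar>gridindex k x $ i - gridindex k y $ i\<bar> \<le> 1"
      using assms by (auto simp: neighbours_def gridcell_def)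
    then show ?thesis by (intro that[of i]) linarith
  qed
  have b: "of_int (gridindex k x $ i) * 2 ^ k \<le> x $ i" "x $ i < (of_int (gridindex k x $ i) + 1) * 2 ^ k"
    "of_int (gridindex k y $ i) * 2 ^ k \<le> y $ i" "y $ i < (of_int (gridindex k y $ i) + 1) * 2 ^ k"
    by (rule gridindex_bounds)+
  have "x $ i - y $ i \<ge> 2 ^ k \<or> y $ i - x $ i \<ge> 2 ^ k"
  proof (cases "gridindex k x $ i \<ge> gridindex k y $ i + 2")
    case True
    then have "(real_of_int (gridindex k y $ i) + 2) * 2 ^ k \<le> of_int (gridindex k x $ i) * 2 ^ k"
      by (intro mult_right_mono) (linarith, simp)
    then show ?thesis using b by (simp add: distrib_right)
  next
    case False
    then have "(real_of_int (gridindex k x $ i) + 2) * 2 ^ k \<le> of_int (gridindex k y $ i) * 2 ^ k"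
      using i by (intro mult_right_mono) (linarith, simp)
    then show ?thesis using b by (simp add: distrib_right)
  qed
  then show ?thesis by (intro exI[of _ i]) (auto simp: abs_if)
qed

text \<open>The origin is a vertex of the grid at every scale, so a bounded set does not end up in
  one cell but in those with indices -1 and 0. These are mutually adjacent, and halving with
  rounding down preserves the two values.\<close>

lemma finite_gridindex:
  fixes f :: "real ^ 'n \<Rightarrow> complex"
  assumes "bounded_compact_support f"
  shows "finite (gridindex k ` {x. f x \<noteq> 0})"
    and "\<exists>J. \<forall>x i. f x \<noteq> 0 \<longrightarrow> gridindex J x $ i \<in> {-1, 0}"
proof -
  have "compact (closure {x. f x \<noteq> 0})" using assms by (simp add: bounded_compact_support_def)
  then have "bounded {x. f x \<noteq> 0}" by (meson bounded_subset closure_subset compact_imp_bounded)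
  then obtain B where B: "\<And>x. f x \<noteq> 0 \<Longrightarrow> norm x \<le> B" by (auto simp: bounded_iff)
  have Bi: "\<bar>x $ i\<bar> \<le> B" if "f x \<noteq> 0" for x :: "real ^ 'n" and i using B[OF that] component_le_norm_cart[of x i] by linarith
  show "finite (gridindex k ` {x. f x \<noteq> 0})"
  proof (rule finite_subset)
    show "gridindex k ` {x. f x \<noteq> 0} \<subseteq> (\<lambda>f. \<chi> i. f i) ` PiE (UNIV :: 'n set) (\<lambda>_. {\<lfloor>- B / 2 ^ k\<rfloor>..\<lfloor>B / 2 ^ k\<rfloor>})"
    proof
      fix z assume "z \<in> gridindex k ` {x. f x \<noteq> 0}"
      then obtain x where x: "f x \<noteq> 0" "z = gridindex k x" by auto
      have "z $ i \<in> {\<lfloor>- B / 2 ^ k\<rfloor>..\<lfloor>B / 2 ^ k\<rfloor>}" for i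
      proof -
        have "- B / 2 ^ k \<le> x $ i / 2 ^ k" "x $ i / 2 ^ k \<le> B / 2 ^ k"
          using Bi[OF x(1), of i] by (auto intro!: divide_right_mono simp del: divide_minus_left)
        then show ?thesis by (simp add: x(2) gridindex_def floor_mono del: divide_minus_left)
      qed
      then show "z \<in> (\<lambda>f. \<chi> i. f i) ` PiE (UNIV :: 'n set) (\<lambda>_. {\<lfloor>- B / 2 ^ k\<rfloor>..\<lfloor>B / 2 ^ k\<rfloor>})"
        by (intro rev_image_eqI[of "\<lambda>i. z $ i"]) (auto simp: vec_eq_iff)
    qed
    show "finite ((\<lambda>f. \<chi> i. f i) ` PiE (UNIV :: 'n set) (\<lambda>_. {\<lfloor>- B / 2 ^ k\<rfloor>..\<lfloor>B / 2 ^ k\<rfloor>}))"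
      by (intro finite_imageI finite_PiE) auto
  qed
  obtain J where J: "B < 2 ^ J" using real_arch_pow[of 2 B] by auto
  have "gridindex J x $ i \<in> {-1, 0}" if "f x \<noteq> 0" for x i
  proof -
    have "- 1 < x $ i / 2 ^ J" "x $ i / 2 ^ J < 1" using Bi[OF that, of i] J by (auto simp: field_simps abs_le_iff)
    then have "\<lfloor>x $ i / 2 ^ J\<rfloor> = -1 \<or> \<lfloor>x $ i / 2 ^ J\<rfloor> = 0" by linarith
    then show ?thesis by (auto simp: gridindex_def)
  qed
  then show "\<exists>J. \<forall>x i. f x \<noteq> 0 \<longrightarrow> gridindex J x $ i \<in> {-1, 0}" by blast
qed

text \<open>The part of the form in which the second variable lies in a cell adjacent or equal to
  that of the first. Increasing \<open>k\<close> by one adds precisely the pairs collected in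
  \<open>far_form\<close>, which are separated by about \<open>2 ^ k\<close>.\<close>

definition near_form :: "(real ^ 'n \<Rightarrow> real) \<Rightarrow> (real ^ 'n \<Rightarrow> complex) \<Rightarrow> (real ^ 'n \<Rightarrow> complex) \<Rightarrow> nat \<Rightarrow> complex" where
  "near_form m f g k = (\<Sum>z\<in>gridindex k ` {x. f x \<noteq> 0}. pairing (multiplier_op m (restr (gridcell k z) f)) (restr (neighbours k z) g))"

definition far_form :: "(real ^ 'n \<Rightarrow> real) \<Rightarrow> (real ^ 'n \<Rightarrow> complex) \<Rightarrow> (real ^ 'n \<Rightarrow> complex) \<Rightarrow> nat \<Rightarrow> complex" where
  "far_form m f g k = (\<Sum>z\<in>gridindex k ` {x. f x \<noteq> 0}.
     pairing (multiplier_op m (restr (gridcell k z) f)) (restr (neighbours (Suc k) (parent z) - neighbours k z) g))"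

lemma restr_gridcell_sum:
  assumes fin: "finite (gridindex k ` {x. f x \<noteq> 0})" and Z: "gridindex k ` {x. f x \<noteq> 0} \<subseteq> Z" "finite Z"
  shows "f = (\<lambda>x. \<Sum>z\<in>Z. restr (gridcell k z) f x)"
proof
  fix x
  have "(\<Sum>z\<in>Z. restr (gridcell k z) f x) = (\<Sum>z\<in>Z. if z = gridindex k x then f x else 0)"
    by (intro sum.cong) (auto simp: restr_def gridcell_def)
  also have "\<dots> = f x" using Z by (cases "f x = 0") auto
  finally show "f x = (\<Sum>z\<in>Z. restr (gridcell k z) f x)" by simp
qed

lemma integrable_restr:
  "bounded_compact_support f \<Longrightarrow> A \<in> sets lebesgue \<Longrightarrow> integrable lebesgue (restr A f)"
  by (intro integrable_bounded_compact_support bounded_compact_support_restr)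

text \<open>One step of a Whitney decomposition away from the diagonal. The coarse cells are split
  into their children, and \<open>neighbours_mono\<close> lets the neighbourhood of a parent be
  divided into that of the child and the rest.\<close>

lemma near_form_Suc:
  fixes m :: "real ^ 'n \<Rightarrow> real"
  assumes m: "integrable lebesgue m" and f: "bounded_compact_support f" and g: "bounded_compact_support g"
  shows "near_form m f g (Suc k) = near_form m f g k + far_form m f g k"
proof -
  let ?Z = "gridindex k ` {x. f x \<noteq> 0}" and ?Z' = "gridindex (Suc k) ` {x. f x \<noteq> 0}"
  let ?P = "\<lambda>f g. pairing (multiplier_op m f) g"
  have fin: "finite ?Z" "finite ?Z'" using finite_gridindex(1)[OF f] by blast+
  have Z': "?Z' = parent ` ?Z" by (auto simp: gridindex_Suc)
  have fi: "integrable lebesgue (restr A f)" "integrable lebesgue (restr A g)" if "A \<in> sets lebesgue" for A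
    using integrable_restr[OF f that] integrable_restr[OF g that] by auto
  have split: "restr (gridcell (Suc k) w) f = (\<lambda>x. \<Sum>z\<in>{z\<in>?Z. parent z = w}. restr (gridcell k z) f x)" for w
  proof
    fix x
    have "(\<Sum>z\<in>{z\<in>?Z. parent z = w}. restr (gridcell k z) f x) = (\<Sum>z\<in>{z\<in>?Z. parent z = w}. if z = gridindex k x then f x else 0)"
      by (intro sum.cong) (auto simp: restr_def gridcell_def)
    also have "\<dots> = restr (gridcell (Suc k) w) f x"
      using fin by (cases "f x = 0") (auto simp: restr_def gridcell_def gridindex_Suc)
    finally show "restr (gridcell (Suc k) w) f x = (\<Sum>z\<in>{z\<in>?Z. parent z = w}. restr (gridcell k z) f x)" by simp
  qed
  have "near_form m f g (Suc k) = (\<Sum>w\<in>?Z'. \<Sum>z\<in>{z\<in>?Z. parent z = w}. ?P (restr (gridcell k z) f) (restr (neighbours (Suc k) (parent z)) g))"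
    unfolding near_form_def
  proof (rule sum.cong[OF refl])
    fix w
    have "?P (restr (gridcell (Suc k) w) f) (restr (neighbours (Suc k) w) g) =
        (\<Sum>z\<in>{z\<in>?Z. parent z = w}. ?P (restr (gridcell k z) f) (restr (neighbours (Suc k) w) g))"
      unfolding split by (intro pairing_multiplier_op_sum_left m fi grid_measurable)
    then show "?P (restr (gridcell (Suc k) w) f) (restr (neighbours (Suc k) w) g) =
        (\<Sum>z\<in>{z\<in>?Z. parent z = w}. ?P (restr (gridcell k z) f) (restr (neighbours (Suc k) (parent z)) g))"
      by simp
  qed
  also have "\<dots> = (\<Sum>z\<in>?Z. ?P (restr (gridcell k z) f) (restr (neighbours (Suc k) (parent z)) g))"
    by (rule sum.group) (use fin Z' in auto)
  also have "\<dots> = (\<Sum>z\<in>?Z. ?P (restr (gridcell k z) f) (restr (neighbours k z) g) +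
      ?P (restr (gridcell k z) f) (restr (neighbours (Suc k) (parent z) - neighbours k z) g))"
  proof (rule sum.cong[OF refl])
    fix z :: "int ^ 'n"
    let ?A = "neighbours k z" and ?B = "neighbours (Suc k) (parent z) - neighbours k z"
    have eq: "restr (neighbours (Suc k) (parent z)) g = (\<lambda>x. \<Sum>b\<in>{True, False}. (if b then restr ?A g else restr ?B g) x)"
      using neighbours_mono[of k z] by (auto simp: restr_def fun_eq_iff indicator_def)
    show "?P (restr (gridcell k z) f) (restr (neighbours (Suc k) (parent z)) g) =
      ?P (restr (gridcell k z) f) (restr ?A g) + ?P (restr (gridcell k z) f) (restr ?B g)"
      unfolding eq by (subst pairing_multiplier_op_sum_right[OF m]) (auto intro!: fi grid_measurable sets.Diff)
  qed
  finally show ?thesis by (simp add: near_form_def far_form_def sum.distrib)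
qed

text \<open>At a large scale both supports meet only the cells around the origin, which are all
  neighbours. The telescoping sum over scales is therefore finite for each pair of
  functions.\<close>

lemma near_form_eventually:
  fixes m :: "real ^ 'n \<Rightarrow> real"
  assumes m: "integrable lebesgue m" and f: "bounded_compact_support f" and g: "bounded_compact_support g"
  shows "\<exists>J. near_form m f g J = pairing (multiplier_op m f) g"
proof -
  obtain J1 where J1: "\<And>x i. f x \<noteq> 0 \<Longrightarrow> gridindex J1 x $ i \<in> {-1, 0}" using finite_gridindex(2)[OF f] by blast
  obtain J2 where J2: "\<And>x i. g x \<noteq> 0 \<Longrightarrow> gridindex J2 x $ i \<in> {-1, 0}" using finite_gridindex(2)[OF g] by blast
  have up: "gridindex (j + d) x $ i \<in> {-1, 0}" if "gridindex j x $ i \<in> {-1, 0}" for j d and x :: "real ^ 'n" and i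
    using that by (induction d) (auto simp: gridindex_Suc parent_def)
  define J where "J = J1 + J2"
  have Jf: "gridindex J x $ i \<in> {-1, 0}" if "f x \<noteq> 0" for x i unfolding J_def by (rule up[OF J1[OF that]])
  have Jg: "gridindex J x $ i \<in> {-1, 0}" if "g x \<noteq> 0" for x i
    using up[OF J2[OF that], where d = J1] by (simp add: J_def add.commute)
  let ?Z = "gridindex J ` {x. f x \<noteq> 0}"
  have fin: "finite ?Z" by (rule finite_gridindex(1)[OF f])
  have ng: "restr (neighbours J z) g = g" if "z \<in> ?Z" for z
  proof
    fix x
    have "x \<in> neighbours J z" if "g x \<noteq> 0"
      unfolding neighbours_def
    proof (intro CollectI allI)
      fix i
      obtain w where w: "f w \<noteq> 0" "z = gridindex J w" using \<open>z \<in> ?Z\<close> by auto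
      show "\<bar>gridindex J x $ i - z $ i\<bar> \<le> 1" using Jg[OF that, of i] Jf[OF w(1), of i] w(2) by auto
    qed
    then show "restr (neighbours J z) g x = g x" by (auto simp: restr_def indicator_def)
  qed
  have fi: "integrable lebesgue (restr (gridcell J z) f)" for z
    by (intro integrable_bounded_compact_support bounded_compact_support_restr f grid_measurable)
  have "pairing (multiplier_op m f) g = (\<Sum>z\<in>?Z. pairing (multiplier_op m (restr (gridcell J z) f)) g)"
    by (subst (1) restr_gridcell_sum[OF fin order_refl fin])
       (intro pairing_multiplier_op_sum_left m fi integrable_bounded_compact_support g)
  also have "\<dots> = near_form m f g J" unfolding near_form_def by (intro sum.cong refl) (simp add: ng)
  finally show ?thesis by metis
qed

lemma cube_avg_1_le:
  assumes f: "bounded_compact_support f" and r: "r \<ge> 1" and T: "T \<in> lmeasurable" "measure lebesgue T > 0"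
  shows "cube_avg T 1 f \<le> cube_avg T r f"
proof (cases "r = 1")
  case False
  then have r1: "r > 1" using r by simp
  define q where "q = r / (r - 1)"
  have q: "q > 1" "1 / r + 1 / q = 1" using r1 by (auto simp: q_def field_simps)
  let ?V = "measure lebesgue T"
  define I where "I u = (\<integral>x. indicator T x * cmod (f x) powr u \<partial>lebesgue)" for u
  have I0: "I u \<ge> 0" for u by (auto simp: I_def intro!: integral_nonneg_AE)
  have Ts: "T \<in> sets lebesgue" using T by auto
  have fm: "f \<in> borel_measurable lebesgue" using f by (simp add: bounded_compact_support_def)
  have p1: "(indicator T x * cmod (f x)) powr r = indicator T x * cmod (f x) powr r" for x by (simp add: indicator_def)
  have p2: "(indicator T x :: real) powr q = indicator T x" for x by (simp add: indicator_def)
  have "(\<integral>x. (indicator T x * cmod (f x)) * indicator T x \<partial>lebesgue) \<le>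
      (\<integral>x. (indicator T x * cmod (f x)) powr r \<partial>lebesgue) powr (1 / r) * (\<integral>x. (indicator T x :: real) powr q \<partial>lebesgue) powr (1 / q)"
  proof (rule integral_holder(2)[OF r1 q])
    show "(\<lambda>x. indicator T x * cmod (f x)) \<in> borel_measurable lebesgue" using fm Ts by measurable
    show "integrable lebesgue (\<lambda>x. (indicator T x * cmod (f x)) powr r)" unfolding p1 using r1 by (intro set_integrable_powr f Ts) auto
    show "integrable lebesgue (\<lambda>x. (indicator T x :: real) powr q)" unfolding p2 using T by (intro integrable_real_indicator) (auto simp: fmeasurable_def)
  qed (use Ts in auto)
  moreover have "(indicator T x * cmod (f x)) * indicator T x = indicator T x * cmod (f x) powr 1" for x by (simp add: indicator_def)
  ultimately have "I 1 \<le> I r powr (1 / r) * ?V powr (1 / q)" unfolding p1 p2 I_def by simp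
  then have "I 1 / ?V \<le> I r powr (1 / r) * ?V powr (1 / q) / ?V" using T(2) by (intro divide_right_mono) auto
  also have "\<dots> = I r powr (1 / r) * ?V powr (1 / q - 1)" using T(2) by (simp add: powr_diff)
  also have "1 / q - 1 = - (1 / r)" using q by simp
  also have "I r powr (1 / r) * ?V powr - (1 / r) = (I r / ?V) powr (1 / r)" by (subst powr_divide) (use T(2) I0 in \<open>auto simp: powr_minus divide_inverse\<close>)
  finally show ?thesis using I0[of 1] T(2) by (simp add: cube_avg_def set_lebesgue_integral_def I_def divide_inverse mult.commute)
qed simp

lemma cube_avg_restr_mono:
  assumes f: "bounded_compact_support f" and r: "r > 0" and T: "T \<in> lmeasurable" "measure lebesgue T > 0" and A: "A \<in> sets lebesgue"
  shows "cube_avg T r (restr A f) \<le> cube_avg T r f"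
proof -
  have "(\<integral>x. indicator T x * cmod (restr A f x) powr r \<partial>lebesgue) \<le> (\<integral>x. indicator T x * cmod (f x) powr r \<partial>lebesgue)"
  proof (rule integral_mono')
    show "integrable lebesgue (\<lambda>x. indicator T x * cmod (f x) powr r)" using T by (intro set_integrable_powr f r) auto
    show "indicator T x * cmod (restr A f x) powr r \<le> indicator T x * cmod (f x) powr r" for x
      by (auto simp: restr_def indicator_def)
  qed auto
  then show ?thesis
    unfolding cube_avg_def set_lebesgue_integral_def real_scaleR_def using r
    by (intro powr_mono2 mult_left_mono mult_nonneg_nonneg integral_nonneg_AE) auto
qed

text \<open>
  Single scale estimates suffice, since the supremum is over all sparse families: a scale
  contributes a multiple of the supremum, and these multiples are summable.
\<close>

theorem sparse_bound_of_scales: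
  fixes m :: "real ^ 'n \<Rightarrow> real"
  assumes m: "integrable lebesgue m" and C: "C0 \<ge> 0" "\<And>k. C k \<ge> 0" "summable C"
    and near: "\<And>f g z. bounded_compact_support f \<Longrightarrow> bounded_compact_support g \<Longrightarrow>
      cmod (pairing (multiplier_op m (restr (gridcell 0 z) f)) (restr (neighbours 0 z) g)) \<le>
        C0 * measure lebesgue (gridcube 1 z) * cube_avg (gridcube 1 z) r f * cube_avg (gridcube 1 z) s g"
    and far: "\<And>f g z k. bounded_compact_support f \<Longrightarrow> bounded_compact_support g \<Longrightarrow>
      cmod (pairing (multiplier_op m (restr (gridcell k z) f)) (restr (neighbours (Suc k) (parent z) - neighbours k z) g)) \<le>
        C k * measure lebesgue (gridcube (2 ^ k) z) * cube_avg (gridcube (2 ^ k) z) r f * cube_avg (gridcube (2 ^ k) z) s g"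
  shows "sparse_norm (multiplier_op m) r s < \<infinity>"
proof -
  define c7 where "c7 = card {\<rho> :: int ^ 'n. \<forall>i. 0 \<le> \<rho> $ i \<and> \<rho> $ i < 7}"
  define A where "A = (C0 + (\<Sum>k. C k)) * real c7"
  have A0: "A \<ge> 0" unfolding A_def using C by (intro mult_nonneg_nonneg add_nonneg_nonneg suminf_nonneg) auto
  have main: "ennreal (cmod (pairing (multiplier_op m f) g)) \<le> ennreal A * sparse_sup r s f g"
    if f: "bounded_compact_support f" and g: "bounded_compact_support g" for f g
  proof -
    have layer: "ennreal (cmod (\<Sum>z\<in>Z. F z)) \<le> ennreal (c * real c7) * sparse_sup r s f g"
      if Z: "finite Z" and c: "c \<ge> 0" and h: "h > 0"
        and F: "\<And>z. cmod (F z) \<le> c * measure lebesgue (gridcube h z) * cube_avg (gridcube h z) r f * cube_avg (gridcube h z) s g"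
      for Z :: "(int ^ 'n) set" and F c h
    proof -
      let ?t = "\<lambda>z. measure lebesgue (gridcube h z) * cube_avg (gridcube h z) r f * cube_avg (gridcube h z) s g"
      have t0: "?t z \<ge> 0" for z by (intro mult_nonneg_nonneg cube_avg_nonneg) auto
      have "cmod (\<Sum>z\<in>Z. F z) \<le> (\<Sum>z\<in>Z. c * ?t z)"
        using F by (intro order_trans[OF norm_sum] sum_mono) (simp add: mult.assoc)
      then have "ennreal (cmod (\<Sum>z\<in>Z. F z)) \<le> ennreal (\<Sum>z\<in>Z. c * ?t z)" by (rule ennreal_leI)
      also have "\<dots> = ennreal c * (\<Sum>z\<in>Z. ennreal (?t z))"
        using t0 c by (simp add: sum_distrib_left[symmetric] ennreal_mult sum_nonneg)
      also have "\<dots> \<le> ennreal c * (of_nat c7 * sparse_sup r s f g)"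
        unfolding c7_def by (intro mult_left_mono sum_gridcubes_le h Z) auto
      also have "\<dots> = ennreal (c * real c7) * sparse_sup r s f g"
        using c by (simp add: ennreal_mult mult.assoc ennreal_of_nat_eq_real_of_nat)
      finally show ?thesis .
    qed
    have fin: "finite (gridindex k ` {x. f x \<noteq> 0})" for k by (rule finite_gridindex(1)[OF f])
    have l0: "ennreal (cmod (near_form m f g 0)) \<le> ennreal (C0 * real c7) * sparse_sup r s f g"
      unfolding near_form_def using near[OF f g] C by (intro layer fin) auto
    have lk: "ennreal (cmod (far_form m f g k)) \<le> ennreal (C k * real c7) * sparse_sup r s f g" for k
      unfolding far_form_def using far[OF f g] C by (intro layer[where h = "2 ^ k"] fin) auto
    have ind: "ennreal (cmod (near_form m f g J)) \<le> ennreal ((C0 + (\<Sum>k<J. C k)) * real c7) * sparse_sup r s f g" for J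
    proof (induction J)
      case 0 show ?case using l0 by simp
    next
      case (Suc J)
      have "ennreal (cmod (near_form m f g (Suc J))) \<le> ennreal (cmod (near_form m f g J) + cmod (far_form m f g J))"
        unfolding near_form_Suc[OF m f g] by (intro ennreal_leI norm_triangle_ineq)
      also have "\<dots> = ennreal (cmod (near_form m f g J)) + ennreal (cmod (far_form m f g J))" by simp
      also have "\<dots> \<le> ennreal ((C0 + (\<Sum>k<J. C k)) * real c7) * sparse_sup r s f g + ennreal (C J * real c7) * sparse_sup r s f g"
        by (intro add_mono Suc lk)
      also have "\<dots> = ennreal ((C0 + (\<Sum>k<J. C k)) * real c7 + C J * real c7) * sparse_sup r s f g"
      proof -
        have "ennreal ((C0 + (\<Sum>k<J. C k)) * real c7) + ennreal (C J * real c7) = ennreal ((C0 + (\<Sum>k<J. C k)) * real c7 + C J * real c7)"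
          using C by (intro ennreal_plus[symmetric] mult_nonneg_nonneg add_nonneg_nonneg sum_nonneg) auto
        then show ?thesis by (simp only: distrib_right[symmetric])
      qed
      also have "(C0 + (\<Sum>k<J. C k)) * real c7 + C J * real c7 = (C0 + (\<Sum>k<Suc J. C k)) * real c7" by (simp add: algebra_simps)
      finally show ?case .
    qed
    obtain J where J: "near_form m f g J = pairing (multiplier_op m f) g" using near_form_eventually[OF m f g] by blast
    have "(\<Sum>k<J. C k) \<le> (\<Sum>k. C k)" using C by (intro sum_le_suminf) auto
    then have "ennreal ((C0 + (\<Sum>k<J. C k)) * real c7) \<le> ennreal A" unfolding A_def by (intro ennreal_leI mult_right_mono) auto
    then show ?thesis using ind[of J] unfolding J by (meson mult_right_mono order_trans zero_le)
  qed
  have "sparse_norm (multiplier_op m) r s \<le> ennreal A"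
    unfolding sparse_norm_def
    by (rule Inf_lower) (use main A0 in \<open>auto simp: sparse_sup_def intro!: exI[of _ A]\<close>)
  then show ?thesis by (rule le_less_trans) simp
qed


section \<open>Splitting the Bochner-Riesz symbol\<close>

text \<open>
  Radial symbols are written in the variable \<open>t = |\<xi>|\<^sup>2\<close>. The parameter \<open>\<sigma>\<close> of the low profile is
  a dummy that turns it into a family.
\<close>

definition high_profile :: "(real \<Rightarrow> real) \<Rightarrow> real \<Rightarrow> real \<Rightarrow> real" where
  "high_profile chi \<sigma> t = (if t > 0 then (1 - chi t) * chi ((sqrt t - 1 + \<sigma>) / \<sigma>) else 0)"

definition low_profile :: "(real \<Rightarrow> real) \<Rightarrow> real \<Rightarrow> real \<Rightarrow> real \<Rightarrow> real" where
  "low_profile chi \<delta> \<sigma> t = chi t * max 0 (1 - t) powr \<delta>"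

text \<open>The factor \<open>1 - chi t\<close> vanishes for \<open>t\<close> up to 1/4 in modulus,
  and this removes the singularity of the square root at 0: the formula is smooth for
  \<open>t > 1/16\<close> and the profile is zero for \<open>t < 1/4\<close>.\<close>

lemma smooth_family_high_profile:
  assumes chi: "schwartz chi" and one: "\<And>t. \<bar>t\<bar> \<le> 1/4 \<Longrightarrow> chi t = 1"
  shows "smooth_family M UNIV {0<..1} (high_profile chi)"
proof -
  have P: "{0<..1::real} \<subseteq> {0<..1}" by simp
  have "smooth_family M {1/16<..} {0<..1} (\<lambda>\<sigma> t. (1 + (-1) * chi t) * chi ((sqrt t - 1 + \<sigma>) / \<sigma>))"
    using smooth_family_mult[OF smooth_family_add[OF smooth_family_const[where c = "\<lambda>_. 1" and K = 1]
        smooth_family_mult[OF smooth_family_const[where c = "\<lambda>_. -1" and K = 1] smooth_family_schwartz[OF chi P, of M "{1/16<..}" 0]]]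
      smooth_family_annulus[OF chi P, of M 0]] by simp
  then have U: "smooth_family M {1/16<..} {0<..1} (high_profile chi)"
    by (rule smooth_family_cong[rotated 2]) (auto simp: high_profile_def)
  have "smooth_family M ({1/16<..} \<union> {..<1/4}) {0<..1} (high_profile chi)"
    by (rule smooth_family_glue[OF _ _ U]) (use one in \<open>auto simp: high_profile_def\<close>)
  moreover have "{1/16<..} \<union> {..<1/4} = (UNIV :: real set)" by auto
  ultimately show ?thesis by simp
qed

text \<open>Here \<open>chi t\<close> vanishes before the singularity of the power at
  \<open>t = 1\<close> is reached.\<close>

lemma smooth_family_low_profile:
  assumes chi: "schwartz chi" and zero: "\<And>t. \<bar>t\<bar> > 1/2 \<Longrightarrow> chi t = 0"
  shows "smooth_family M UNIV {1} (low_profile chi \<delta>)"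
proof -
  have P: "{1::real} \<subseteq> {0<..1}" by simp
  have pw: "smooth_family M {1/4<..<2} {1} (\<lambda>\<sigma> t. t powr (\<delta> - real 0))"
  proof (rule smooth_family_powr[OF P])
    fix k
    have "compact ((\<lambda>t. t powr (\<delta> - real k)) ` {1/4..2})"
      by (intro compact_continuous_image continuous_intros) auto
    then have "bounded ((\<lambda>t. t powr (\<delta> - real k)) ` {1/4..2})" by (rule compact_imp_bounded)
    then obtain C where "\<forall>y\<in>(\<lambda>t. t powr (\<delta> - real k)) ` {1/4..2}. norm y \<le> C"
      unfolding bounded_iff by blast
    then show "\<exists>C. \<forall>t\<in>{1/4<..<2}. t powr (\<delta> - real k) \<le> C" by (intro exI[of _ C]) auto
  qed auto
  have "smooth_family M {-1<..<3/4} {1} (\<lambda>\<sigma> t. (1 - t) powr (\<delta> - real 0))"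
    by (rule smooth_family_compose_affine[OF pw]) auto
  from smooth_family_mult[OF smooth_family_schwartz[OF chi P, of M "{-1<..<3/4}" 0] this]
  have U: "smooth_family M {-1<..<3/4} {1} (low_profile chi \<delta>)"
    by (rule smooth_family_cong[rotated 2]) (auto simp: low_profile_def)
  have "smooth_family M ({-1<..<3/4} \<union> ({..<-1/2} \<union> {1/2<..})) {1} (low_profile chi \<delta>)"
    by (rule smooth_family_glue[OF _ _ U]) (use zero in \<open>auto simp: low_profile_def\<close>)
  moreover have "{-1<..<3/4} \<union> ({..<-1/2} \<union> {1/2<..}) = (UNIV :: real set)" by auto
  ultimately show ?thesis by (simp only:)
qed

locale riesz_setup =
  fixes chi :: "real \<Rightarrow> real" and \<delta> :: real
  assumes chi_schwartz: "schwartz chi"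
    and chi_lb: "\<And>t. indicator {-1/4..1/4} t \<le> chi t" and chi_ub: "\<And>t. chi t \<le> indicator {-1/2..1/2} t"
    and \<delta>: "\<delta> > 0"
begin

lemma chi_facts: "0 \<le> chi t" "chi t \<le> 1" "\<bar>t\<bar> > 1/2 \<Longrightarrow> chi t = 0" "\<bar>t\<bar> \<le> 1/4 \<Longrightarrow> chi t = 1"
  using chi_lb[of t] chi_ub[of t] by (auto simp: indicator_def of_bool_def abs_if split: if_splits)

lemma chi_borel [measurable]: "chi \<in> borel_measurable borel"
proof -
  have "continuous_on UNIV ((deriv ^^ 0) chi)"
    using schwartz_deriv(1)[OF chi_schwartz, of 0] DERIV_isCont continuous_at_imp_continuous_on by blast
  then show ?thesis by (intro borel_measurable_continuous_onI) simp
qed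

definition low_symbol :: "real ^ 'n \<Rightarrow> real" where
  "low_symbol \<xi> = low_profile chi \<delta> 1 ((norm \<xi>)\<^sup>2)"

definition high_symbol :: "real \<Rightarrow> real ^ 'n \<Rightarrow> real" where
  "high_symbol \<sigma> \<xi> = high_profile chi \<sigma> ((norm \<xi>)\<^sup>2)"

lemma high_symbol_eq: "\<sigma> > 0 \<Longrightarrow> high_symbol \<sigma> \<xi> = (1 - chi ((norm \<xi>)\<^sup>2)) * chi ((norm \<xi> - 1 + \<sigma>) / \<sigma>)"
  using chi_facts(4)[of 0] by (cases "\<xi> = 0") (auto simp: high_symbol_def high_profile_def)

lemma high_symbol_zero: "0 < \<sigma> \<Longrightarrow> \<sigma> \<le> 1 \<Longrightarrow> norm \<xi> > 3 \<Longrightarrow> high_symbol \<sigma> \<xi> = 0"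
proof -
  assume s: "0 < \<sigma>" "\<sigma> \<le> 1" "norm \<xi> > 3"
  then have "(norm \<xi> - 1 + \<sigma>) / \<sigma> > 1/2" by (simp add: field_simps)
  then have "chi ((norm \<xi> - 1 + \<sigma>) / \<sigma>) = 0" by (intro chi_facts(3)) linarith
  then show ?thesis using high_symbol_eq[OF s(1), of \<xi>] by simp
qed

lemma high_symbol_bound: "0 < \<sigma> \<Longrightarrow> \<bar>high_symbol \<sigma> \<xi>\<bar> \<le> 1"
  using chi_facts(1,2)[of "(norm \<xi>)\<^sup>2"] chi_facts(1,2)[of "(norm \<xi> - 1 + \<sigma>) / \<sigma>"]
  by (auto simp: high_symbol_eq abs_mult intro!: mult_le_one)

lemma integrable_high_symbol:
  assumes "0 < \<sigma>" "\<sigma> \<le> 1"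
  shows "integrable lebesgue (high_symbol \<sigma> :: real ^ 'n \<Rightarrow> real)"
proof (rule integrable_compact_support[where B = 1 and R = 3])
  have "(high_symbol \<sigma> :: real ^ 'n \<Rightarrow> real) \<in> borel_measurable borel"
    unfolding high_symbol_def[abs_def] high_profile_def by measurable
  then show "(high_symbol \<sigma> :: real ^ 'n \<Rightarrow> real) \<in> borel_measurable lebesgue" by (intro measurable_completion) simp
  show "\<bar>high_symbol \<sigma> \<xi>\<bar> \<le> 1" for \<xi> :: "real ^ 'n" by (rule high_symbol_bound) fact
  show "norm \<xi> \<le> 3" if "high_symbol \<sigma> \<xi> \<noteq> 0" for \<xi> :: "real ^ 'n"
    using high_symbol_zero[OF assms, of \<xi>] that by force
qed

lemma integrable_low_symbol: "integrable lebesgue (low_symbol :: real ^ 'n \<Rightarrow> real)"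
proof (rule integrable_compact_support[where B = 1 and R = 1])
  have "(low_symbol :: real ^ 'n \<Rightarrow> real) \<in> borel_measurable borel"
    unfolding low_symbol_def[abs_def] low_profile_def by measurable
  then show "(low_symbol :: real ^ 'n \<Rightarrow> real) \<in> borel_measurable lebesgue" by (intro measurable_completion) simp
  fix \<xi> :: "real ^ 'n"
  have "max 0 (1 - (norm \<xi>)\<^sup>2) powr \<delta> \<le> 1 powr \<delta>" using \<delta> by (intro powr_mono2) auto
  then show "\<bar>low_symbol \<xi>\<bar> \<le> 1" using chi_facts(1,2)[of "(norm \<xi>)\<^sup>2"]
    by (auto simp: low_symbol_def low_profile_def abs_mult intro!: mult_le_one)
  assume "low_symbol \<xi> \<noteq> 0"
  then have "(norm \<xi>)\<^sup>2 < 1" by (auto simp: low_symbol_def low_profile_def max_def split: if_splits)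
  then show "norm \<xi> \<le> 1" by (simp add: abs_square_less_1)
qed

lemma kernel_high_tail:
  "\<exists>D\<ge>0. \<forall>\<sigma>\<in>{0<..1}. \<forall>(x :: real ^ 'n) k. (\<sigma> * \<bar>x $ k\<bar>) ^ M * cmod (kernel (high_symbol \<sigma>) x) \<le> D"
proof -
  have "high_profile chi \<sigma> t = 0" if "\<sigma> \<in> {0<..1}" "t > 9" for \<sigma> t
  proof -
    have "sqrt t > 3" using that real_less_rsqrt[of 3 t] by simp
    then have "(sqrt t - 1 + \<sigma>) / \<sigma> > 1/2" using that by (simp add: field_simps)
    then have "chi ((sqrt t - 1 + \<sigma>) / \<sigma>) = 0" by (intro chi_facts(3)) linarith
    then show ?thesis by (simp add: high_profile_def)
  qed
  from kernel_smooth_family_tail[OF order_refl smooth_family_high_profile[OF chi_schwartz chi_facts(4)] this]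
  show ?thesis by (simp add: high_symbol_def[abs_def])
qed

lemma kernel_low_tail:
  "\<exists>D\<ge>0. \<forall>(x :: real ^ 'n) k. \<bar>x $ k\<bar> ^ M * cmod (kernel low_symbol x) \<le> D"
proof -
  have "low_profile chi \<delta> \<sigma> t = 0" if "\<sigma> \<in> {1}" "t > 9" for \<sigma> t
    using that chi_facts(3)[of t] by (simp add: low_profile_def)
  from kernel_smooth_family_tail[OF _ smooth_family_low_profile[OF chi_schwartz chi_facts(3)] this]
  show ?thesis by (simp add: low_symbol_def[abs_def])
qed

text \<open>The identity holds pointwise for the symbols, with weight
  \<open>\<sigma> powr (\<delta> - 1) * A \<sigma>\<close> integrable because
  \<open>\<delta> > 0\<close>; Fubini transfers it to the forms. It reduces estimates for the
  nonsmooth symbol to estimates for smooth ones that are uniform in \<open>\<sigma>\<close>.\<close>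

lemma form_superposition:
  "\<exists>A B. B \<ge> 0 \<and> (\<forall>\<sigma>\<in>{0<..1}. \<bar>A \<sigma>\<bar> \<le> B) \<and>
    (\<forall>h1 h2 :: real ^ 'n \<Rightarrow> complex. integrable lebesgue h1 \<longrightarrow> integrable lebesgue h2 \<longrightarrow>
      pairing (multiplier_op (br_symbol \<delta>) h1) h2 = pairing (multiplier_op low_symbol h1) h2 +
      (\<integral>\<sigma>. of_real (indicator {0<..1} \<sigma> * \<sigma> powr (\<delta> - 1) * A \<sigma>) * pairing (multiplier_op (high_symbol \<sigma>) h1) h2 \<partial>lebesgue))"
proof -
  obtain A B where AB: "A \<in> borel_measurable borel" "\<And>\<sigma>. \<sigma> \<in> {0<..1} \<Longrightarrow> \<bar>A \<sigma>\<bar> \<le> B"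
    "\<And>u. 0 < u \<Longrightarrow> u \<le> 1/2 \<Longrightarrow> (u * (2 - u)) powr \<delta> =
       (\<integral>\<sigma>. indicator {0<..1} \<sigma> * \<sigma> powr (\<delta> - 1) * A \<sigma> * chi (1 - u / \<sigma>) \<partial>lborel)"
    using powr_superposition[OF chi_borel chi_lb chi_ub \<delta>] by blast
  note [measurable] = AB(1)
  have B0: "B \<ge> 0" using AB(2)[of 1] by (auto intro: order_trans[OF abs_ge_zero])
  define w where "w \<sigma> = indicator {0<..1} \<sigma> * \<sigma> powr (\<delta> - 1) * A \<sigma>" for \<sigma>
  have wb: "w \<in> borel_measurable borel" unfolding w_def by measurable
  have wi: "integrable lborel w"
  proof (rule Bochner_Integration.integrable_bound)
    show "integrable lborel (\<lambda>\<sigma>. B * (indicator {0<..1} \<sigma> * \<sigma> powr (\<delta> - 1)))"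
      using integrable_powr_unit(1)[OF \<delta>, of 1] by (intro integrable_mult_right) simp
    show "AE \<sigma> in lborel. norm (w \<sigma>) \<le> norm (B * (indicator {0<..1} \<sigma> * \<sigma> powr (\<delta> - 1)))"
    proof (intro AE_I2)
      fix \<sigma> :: real
      show "norm (w \<sigma>) \<le> norm (B * (indicator {0<..1} \<sigma> * \<sigma> powr (\<delta> - 1)))"
        using AB(2)[of \<sigma>] B0 by (cases "\<sigma> \<in> {0<..1}") (auto simp: w_def abs_mult mult_ac intro!: mult_left_mono)
    qed
  qed (use wb in simp)
  have wl: "integrable lebesgue w" using wi wb by (subst integrable_completion) auto
  have br: "br_symbol \<delta> \<xi> = low_symbol \<xi> + (\<integral>\<sigma>. w \<sigma> * high_symbol \<sigma> \<xi> \<partial>lborel)" for \<xi> :: "real ^ 'n"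
  proof -
    have e: "w \<sigma> * high_symbol \<sigma> \<xi> = (1 - chi ((norm \<xi>)\<^sup>2)) * (w \<sigma> * chi ((norm \<xi> - 1 + \<sigma>) / \<sigma>))" for \<sigma>
      using high_symbol_eq[of \<sigma> \<xi>] by (cases "\<sigma> > 0") (auto simp: w_def)
    have f1: "(1 - chi ((norm \<xi>)\<^sup>2)) * br_symbol \<delta> \<xi> = (1 - chi ((norm \<xi>)\<^sup>2)) * (\<integral>\<sigma>. w \<sigma> * chi ((norm \<xi> - 1 + \<sigma>) / \<sigma>) \<partial>lborel)"
    proof -
      \<comment> \<open>Outside the ball all bumps vanish, as their argument is at least 1. Near the
        origin the factor \<open>1 - chi ((norm \<xi>)\<^sup>2)\<close> vanishes. In between, the
        depth \<open>1 - norm \<xi>\<close> is at most 1/2, as the superposition formula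
        requires.\<close>
      consider "norm \<xi> \<ge> 1" | "norm \<xi> < 1/2" | "1/2 \<le> norm \<xi>" "norm \<xi> < 1" by linarith
      then show ?thesis
      proof cases
        case 1
        have "w \<sigma> * chi ((norm \<xi> - 1 + \<sigma>) / \<sigma>) = 0" for \<sigma>
        proof (cases "\<sigma> \<in> {0<..1}")
          case True
          then have "(norm \<xi> - 1 + \<sigma>) / \<sigma> \<ge> 1" using 1 by (simp add: field_simps)
          then have "\<bar>(norm \<xi> - 1 + \<sigma>) / \<sigma>\<bar> > 1/2" by linarith
          then have "chi ((norm \<xi> - 1 + \<sigma>) / \<sigma>) = 0" by (rule chi_facts(3))
          then show ?thesis by simp
        qed (simp add: w_def)
        moreover have "br_symbol \<delta> \<xi> = 0" using one_le_power[OF 1, of 2] by (simp add: br_symbol_def max_def)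
        ultimately show ?thesis by (simp only: mult_zero_right Bochner_Integration.integral_zero)
      next
        case 2
        have "(norm \<xi>)\<^sup>2 \<le> (1/2)\<^sup>2" using 2 by (intro power_mono) auto
        then have "chi ((norm \<xi>)\<^sup>2) = 1" by (intro chi_facts(4)) (simp add: power2_eq_square)
        then show ?thesis by simp
      next
        case 3
        define u where "u = 1 - norm \<xi>"
        have u: "0 < u" "u \<le> 1/2" using 3 by (auto simp: u_def)
        have "br_symbol \<delta> \<xi> = (u * (2 - u)) powr \<delta>"
        proof -
          have "1 - (norm \<xi>)\<^sup>2 = u * (2 - u)" by (simp add: u_def power2_eq_square algebra_simps)
          moreover have "u * (2 - u) \<ge> 0" using u by simp
          ultimately show ?thesis by (simp add: br_symbol_def)
        qed
        also have "\<dots> = (\<integral>\<sigma>. w \<sigma> * chi ((norm \<xi> - 1 + \<sigma>) / \<sigma>) \<partial>lborel)"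
          unfolding AB(3)[OF u]
        proof (rule Bochner_Integration.integral_cong[OF refl])
          fix \<sigma> :: real
          have "1 - u / \<sigma> = (norm \<xi> - 1 + \<sigma>) / \<sigma>" if "\<sigma> \<noteq> 0" using that by (simp add: u_def field_simps)
          then show "indicator {0<..1} \<sigma> * \<sigma> powr (\<delta> - 1) * A \<sigma> * chi (1 - u / \<sigma>) = w \<sigma> * chi ((norm \<xi> - 1 + \<sigma>) / \<sigma>)"
            by (cases "\<sigma> = 0") (auto simp: w_def)
        qed
        finally show ?thesis by simp
      qed
    qed
    have f2: "low_symbol \<xi> = chi ((norm \<xi>)\<^sup>2) * br_symbol \<delta> \<xi>"
      by (simp add: low_symbol_def low_profile_def br_symbol_def)
    show ?thesis unfolding e Bochner_Integration.integral_mult_right_zero f1[symmetric] f2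
      by (simp add: algebra_simps)
  qed
  have "pairing (multiplier_op (br_symbol \<delta>) h1) h2 = pairing (multiplier_op low_symbol h1) h2 +
      (\<integral>\<sigma>. of_real (w \<sigma>) * pairing (multiplier_op (high_symbol \<sigma>) h1) h2 \<partial>lebesgue)"
    if h: "integrable lebesgue h1" "integrable lebesgue h2" for h1 h2 :: "real ^ 'n \<Rightarrow> complex"
  proof -
    define W where "W \<xi> = fourier h1 \<xi> * cnj (fourier h2 \<xi>)" for \<xi>
    have Wm: "W \<in> borel_measurable lebesgue"
    proof -
      have "(\<lambda>\<xi>. cnj (fourier h2 \<xi>)) \<in> borel_measurable lebesgue"
        using measurable_fourier[of h2] h by (intro borel_measurable_continuous_on[of cnj "fourier h2"] continuous_intros) auto
      then show ?thesis unfolding W_def using measurable_fourier[of h1] h by (intro borel_measurable_times) auto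
    qed
    define H where "H = (\<integral>x. cmod (h1 x) \<partial>lebesgue) * (\<integral>x. cmod (h2 x) \<partial>lebesgue)"
    have WH: "cmod (W \<xi>) \<le> H" for \<xi> unfolding W_def H_def norm_mult complex_mod_cnj
      by (intro mult_mono norm_fourier_le) (auto intro: integral_nonneg_AE)
    have form: "pairing (multiplier_op m h1) h2 = (\<integral>\<xi>. of_real (m \<xi>) * W \<xi> \<partial>lebesgue)" if "integrable lebesgue m" for m
      unfolding pairing_multiplier_op[OF that h] by (simp add: W_def mult.assoc)
    have Wint: "integrable lebesgue (\<lambda>\<xi>. of_real (m \<xi>) * W \<xi>)" if m: "integrable lebesgue m" for m :: "real ^ 'n \<Rightarrow> real"
    proof (rule Bochner_Integration.integrable_bound)
      show "integrable lebesgue (\<lambda>\<xi>. H * m \<xi>)" using m by simp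
      show "(\<lambda>\<xi>. of_real (m \<xi>) * W \<xi>) \<in> borel_measurable lebesgue"
        using m by (intro borel_measurable_times borel_measurable_of_real Wm) auto
      have "H \<ge> 0" using order_trans[OF norm_ge_zero WH] .
      then show "AE \<xi> in lebesgue. norm (of_real (m \<xi>) * W \<xi>) \<le> norm (H * m \<xi>)"
        using WH by (intro AE_I2) (auto simp: norm_mult abs_mult mult.commute[of H] intro!: mult_left_mono)
    qed
    define k where "k \<sigma> \<xi> = complex_of_real (if \<sigma> \<in> {0<..1} then high_symbol \<sigma> \<xi> else 0)" for \<sigma> and \<xi> :: "real ^ 'n"
    \<comment> \<open>\<open>W\<close> is bounded but need not be integrable. All high symbols are
      supported in the ball of radius 3, so truncating \<open>W\<close> to it changes nothing and
      makes Fubini applicable.\<close>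
    define W3 where "W3 \<xi> = indicator (cball 0 3) \<xi> * W \<xi>" for \<xi>
    have W3i: "integrable lebesgue W3"
    proof (rule Bochner_Integration.integrable_bound)
      show "integrable lebesgue (\<lambda>\<xi>. H * indicator (cball (0 :: real ^ 'n) 3) \<xi>)"
        using lmeasurable_compact[of "cball (0 :: real ^ 'n) 3"]
        by (intro integrable_mult_right integrable_real_indicator) (auto simp: fmeasurable_def)
      show "W3 \<in> borel_measurable lebesgue" unfolding W3_def by (intro borel_measurable_times borel_measurable_indicator Wm) auto
      show "AE \<xi> in lebesgue. norm (W3 \<xi>) \<le> norm (H * indicator (cball 0 3) \<xi>)"
        using WH by (intro AE_I2) (auto simp: W3_def indicator_def intro: order_trans[OF WH abs_ge_self])
    qed
    have kW: "w \<sigma> *\<^sub>R (of_real (high_symbol \<sigma> \<xi>) * W \<xi>) = k \<sigma> \<xi> * of_real (w \<sigma>) * W3 \<xi>" for \<sigma> \<xi>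
    proof (cases "\<sigma> \<in> {0<..1}")
      case True
      then show ?thesis using high_symbol_zero[of \<sigma> \<xi>]
        by (cases "norm \<xi> \<le> 3") (auto simp: k_def W3_def scaleR_conv_of_real mult_ac)
    qed (simp add: k_def w_def)
    have km: "(\<lambda>p :: real \<times> (real ^ 'n). k (fst p) (snd p)) \<in> borel_measurable (lebesgue \<Otimes>\<^sub>M lebesgue)"
    proof -
      note [measurable] = fst_borel_measurable_lebesgue snd_borel_measurable_lebesgue
      show ?thesis unfolding k_def high_symbol_def high_profile_def by measurable
    qed
    have k1: "cmod (k \<sigma> \<xi>) \<le> 1" for \<sigma> \<xi> using high_symbol_bound[of \<sigma> \<xi>] by (auto simp: k_def)
    have wc: "integrable lebesgue (\<lambda>\<sigma>. complex_of_real (w \<sigma>))" using wl by simp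
    have prod: "integrable (lebesgue \<Otimes>\<^sub>M lebesgue) (\<lambda>(\<sigma>, \<xi>). k \<sigma> \<xi> * of_real (w \<sigma>) * W3 \<xi>)"
      by (rule integrable_product[OF wc W3i km k1])
    have "(\<integral>\<sigma>. of_real (w \<sigma>) * pairing (multiplier_op (high_symbol \<sigma>) h1) h2 \<partial>lebesgue) =
        (\<integral>\<sigma>. (\<integral>\<xi>. k \<sigma> \<xi> * of_real (w \<sigma>) * W3 \<xi> \<partial>lebesgue) \<partial>lebesgue)"
    proof (rule Bochner_Integration.integral_cong[OF refl])
      fix \<sigma> :: real
      show "of_real (w \<sigma>) * pairing (multiplier_op (high_symbol \<sigma>) h1) h2 = (\<integral>\<xi>. k \<sigma> \<xi> * of_real (w \<sigma>) * W3 \<xi> \<partial>lebesgue)"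
      proof (cases "\<sigma> \<in> {0<..1}")
        case True
        then show ?thesis unfolding kW[symmetric]
          by (subst form[OF integrable_high_symbol]) (auto simp: scaleR_conv_of_real)
      qed (simp add: w_def)
    qed
    also have "\<dots> = (\<integral>\<xi>. (\<integral>\<sigma>. k \<sigma> \<xi> * of_real (w \<sigma>) * W3 \<xi> \<partial>lebesgue) \<partial>lebesgue)"
      by (rule lebesgue_pair.Fubini_integral[OF prod, symmetric])
    also have "\<dots> = (\<integral>\<xi>. of_real (br_symbol \<delta> \<xi> - low_symbol \<xi>) * W \<xi> \<partial>lebesgue)"
    proof (rule Bochner_Integration.integral_cong[OF refl])
      fix \<xi> :: "real ^ 'n"
      have "(\<integral>\<sigma>. k \<sigma> \<xi> * of_real (w \<sigma>) * W3 \<xi> \<partial>lebesgue) = (\<integral>\<sigma>. of_real (w \<sigma> * high_symbol \<sigma> \<xi>) * W \<xi> \<partial>lebesgue)"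
        unfolding kW[symmetric] by (simp add: scaleR_conv_of_real mult.assoc)
      also have "\<dots> = of_real (\<integral>\<sigma>. w \<sigma> * high_symbol \<sigma> \<xi> \<partial>lebesgue) * W \<xi>"
        by (simp only: Bochner_Integration.integral_mult_left_zero integral_complex_of_real)
      also have "(\<integral>\<sigma>. w \<sigma> * high_symbol \<sigma> \<xi> \<partial>lebesgue) = (\<integral>\<sigma>. w \<sigma> * high_symbol \<sigma> \<xi> \<partial>lborel)"
        by (rule integral_completion) (unfold high_symbol_def high_profile_def, use wb in measurable)
      finally show "(\<integral>\<sigma>. k \<sigma> \<xi> * of_real (w \<sigma>) * W3 \<xi> \<partial>lebesgue) = of_real (br_symbol \<delta> \<xi> - low_symbol \<xi>) * W \<xi>"
        unfolding br[of \<xi>] by simp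
    qed
    also have "\<dots> = pairing (multiplier_op (br_symbol \<delta>) h1) h2 - pairing (multiplier_op low_symbol h1) h2"
      using form[OF integrable_br_symbol[OF \<delta>]] form[OF integrable_low_symbol]
        Wint[OF integrable_br_symbol[OF \<delta>]] Wint[OF integrable_low_symbol]
      by (simp add: left_diff_distrib)
    finally show ?thesis by simp
  qed
  then show ?thesis using AB(2) B0 by (intro exI[of _ A] exI[of _ B]) (auto simp: w_def)
qed

end


section \<open>Single scale estimates\<close>

lemma Lp_norm_cube_avg:
  assumes h: "\<And>x. x \<notin> T \<Longrightarrow> h x = 0" and V: "measure lebesgue T > 0" and p: "p > 0"
  shows "Lp_norm p h = measure lebesgue T powr (1 / p) * cube_avg T p h"
proof -
  have "(LINT x:T|lebesgue. cmod (h x) powr p) = (\<integral>x. cmod (h x) powr p \<partial>lebesgue)"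
    unfolding set_lebesgue_integral_def
    by (rule Bochner_Integration.integral_cong[OF refl]) (use h in \<open>auto simp: indicator_def\<close>)
  moreover have "(\<integral>x. cmod (h x) powr p \<partial>lebesgue) \<ge> 0" by (auto intro: integral_nonneg_AE)
  moreover have inv: "measure lebesgue T * (inverse (measure lebesgue T) * z) = z" for z using V by simp
  moreover have "(measure lebesgue T * (inverse (measure lebesgue T) * (LINT x:T|lebesgue. cmod (h x) powr p))) powr (1 / p) =
      measure lebesgue T powr (1 / p) * (inverse (measure lebesgue T) * (LINT x:T|lebesgue. cmod (h x) powr p)) powr (1 / p)"
    by (rule powr_mult)
  ultimately show ?thesis unfolding Lp_norm_def cube_avg_def inv by simp
qed

lemma L1_norm_cube_avg:
  assumes h: "\<And>x. x \<notin> T \<Longrightarrow> h x = 0" and V: "measure lebesgue T > 0"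
  shows "(\<integral>x. cmod (h x) \<partial>lebesgue) = measure lebesgue T * cube_avg T 1 h"
proof -
  have "Lp_norm 1 h = (\<integral>x. cmod (h x) \<partial>lebesgue)"
    using Bochner_Integration.integral_nonneg_AE[of "\<lambda>x. cmod (h x)" lebesgue] by (simp add: Lp_norm_def)
  then show ?thesis using Lp_norm_cube_avg[where p = 1, OF h V] V by simp
qed

lemma Lp_fun_bounded_compact_support: "bounded_compact_support h \<Longrightarrow> p > 0 \<Longrightarrow> Lp_fun p h"
  using bounded_compact_support_powr_integrable[of h p] by (simp add: Lp_fun_def bounded_compact_support_def)

context riesz_setup
begin

lemma kernel_decay:
  "\<exists>C>0. \<forall>x :: real ^ 'n. cmod (kernel (br_symbol \<delta>) x) \<le> C \<and>
     (\<forall>L>0. norm x \<ge> L \<longrightarrow> cmod (kernel (br_symbol \<delta>) x) \<le> C * L powr - (\<delta> + real (CARD('n) - 1) / 2 + 1))"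
proof -
  define a where "a = \<delta> + real (CARD('n) - 1) / 2"
  have a: "a > 0" using \<delta> by (simp add: a_def add_pos_nonneg)
  obtain c where c: "c > 0" "\<And>x :: real ^ 'n. kernel (br_symbol \<delta>) x = of_real c * osc a (norm x)"
    using kernel_br_symbol[OF \<delta>, where 'n = 'n] by (auto simp: a_def)
  obtain C where C: "C > 0" "\<And>\<rho>. \<rho> > 0 \<Longrightarrow> cmod (osc a \<rho>) \<le> C * \<rho> powr - (a + 1)" using osc_decay[OF a] by blast
  define C' where "C' = c * (C + 2)"
  have "cmod (kernel (br_symbol \<delta>) x) \<le> C'" for x :: "real ^ 'n"
    using c C norm_osc_le[OF a, of "norm x"] by (simp add: C'_def norm_mult)
  moreover have "cmod (kernel (br_symbol \<delta>) x) \<le> C' * L powr - (a + 1)" if "L > 0" "norm x \<ge> L" for x :: "real ^ 'n" and L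
  proof -
    have "cmod (osc a (norm x)) \<le> C * (norm x) powr - (a + 1)" using that by (intro C) auto
    also have "\<dots> \<le> C * L powr - (a + 1)" using that a C by (intro mult_left_mono powr_mono2') auto
    also have "\<dots> \<le> (C + 2) * L powr - (a + 1)" by (intro mult_right_mono) auto
    finally show ?thesis using c by (simp add: C'_def norm_mult mult.assoc)
  qed
  moreover have "C' > 0" using c C by (simp add: C'_def)
  ultimately show ?thesis unfolding a_def by blast
qed

text \<open>The superposition is cut at \<open>\<sigma>L\<close>, which is
  \<open>L powr - (1 - \<eta>)\<close> up to a constant. Below it the hypothesis gives the integral
  of \<open>\<sigma> powr (\<delta> - \<epsilon> - 1)\<close>, of size
  \<open>\<sigma>L powr (\<delta> - \<epsilon>)\<close>, that is \<open>L powr - \<kappa>\<close>.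
  Above it \<open>\<sigma> * L\<close> is at least \<open>L powr \<eta> / 8\<close>, so the rapid
  decay of the kernels wins.\<close>

lemma separated_form_bound:
  fixes p q :: real
  assumes pq: "p > 1" "q > 1" "1 / p + 1 / q = 1"
    and S: "\<And>\<epsilon>::real. 0 < \<epsilon> \<Longrightarrow> \<epsilon> < 1 \<Longrightarrow>
      \<exists>C::real. \<forall>\<tau>. 0 < \<tau> \<and> \<tau> < 1 \<longrightarrow>
        Lp_op_norm p (annular_op chi \<tau> :: (real ^ 'n \<Rightarrow> complex) \<Rightarrow> real ^ 'n \<Rightarrow> complex)
          \<le> ennreal (C * \<tau> powr (- \<epsilon>))"
    and k0: "0 < \<kappa>" "\<kappa> < \<delta>"
  shows "\<exists>N\<ge>0. \<forall>(h1 :: real ^ 'n \<Rightarrow> complex) h2 L T.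
    L \<ge> 1 \<longrightarrow> bounded_compact_support h1 \<longrightarrow> bounded_compact_support h2 \<longrightarrow>
    (\<forall>x. x \<notin> T \<longrightarrow> h1 x = 0 \<and> h2 x = 0) \<longrightarrow> T \<in> lmeasurable \<longrightarrow> measure lebesgue T = (7 * L) ^ CARD('n) \<longrightarrow>
    (\<forall>x y. h2 x \<noteq> 0 \<longrightarrow> h1 y \<noteq> 0 \<longrightarrow> (\<exists>i. \<bar>(x - y) $ i\<bar> \<ge> L)) \<longrightarrow>
    cmod (pairing (multiplier_op (br_symbol \<delta>) h1) h2) \<le>
      N * L powr - \<kappa> * measure lebesgue T * cube_avg T p h1 * cube_avg T q h2"
proof -
  \<comment> \<open>Half of the gap between \<open>\<kappa>\<close> and \<open>\<delta>\<close> is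
    given to the hypothesis; the remaining half determines \<open>\<eta>\<close> through
    \<open>(1 - \<eta>) * (\<delta> - \<epsilon>) = \<kappa>\<close>.\<close>
  define \<epsilon> where "\<epsilon> = min ((\<delta> - \<kappa>) / 2) (1 / 2)"
  have eps: "0 < \<epsilon>" "\<epsilon> < 1" "\<delta> - \<epsilon> > \<kappa>" "\<delta> - \<epsilon> > 0" using k0 by (auto simp: \<epsilon>_def min_def field_simps)
  define \<eta> where "\<eta> = 1 - \<kappa> / (\<delta> - \<epsilon>)"
  have eta: "0 < \<eta>" "\<eta> < 1" "(1 - \<eta>) * (\<delta> - \<epsilon>) = \<kappa>" using eps k0 by (auto simp: \<eta>_def field_simps)
  \<comment> \<open>The kernel bound uses integrals instead of normalised norms and so carries an
    additional volume, of order \<open>L ^ n\<close>; the order of decay has to outweigh it and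
    still leave \<open>L powr - \<kappa>\<close>.\<close>
  obtain M :: nat where M: "\<eta> * real M \<ge> real CARD('n) + \<kappa>"
  proof -
    obtain M :: nat where "(real CARD('n) + \<kappa>) / \<eta> \<le> real M" using real_arch_simple by blast
    then have "\<eta> * real M \<ge> real CARD('n) + \<kappa>" using eta by (simp add: field_simps)
    then show ?thesis by (rule that)
  qed
  obtain C where C: "\<And>\<tau>. 0 < \<tau> \<Longrightarrow> \<tau> < 1 \<Longrightarrow>
      Lp_op_norm p (annular_op chi \<tau> :: (real ^ 'n \<Rightarrow> complex) \<Rightarrow> _) \<le> ennreal (C * \<tau> powr - \<epsilon>)"
    using S[OF eps(1,2)] by blast
  obtain A B where AB: "B \<ge> 0" "\<And>\<sigma>. \<sigma> \<in> {0<..1} \<Longrightarrow> \<bar>A \<sigma>\<bar> \<le> B"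
    "\<And>h1 h2 :: real ^ 'n \<Rightarrow> complex. integrable lebesgue h1 \<Longrightarrow> integrable lebesgue h2 \<Longrightarrow>
      pairing (multiplier_op (br_symbol \<delta>) h1) h2 = pairing (multiplier_op low_symbol h1) h2 +
      (\<integral>\<sigma>. of_real (indicator {0<..1} \<sigma> * \<sigma> powr (\<delta> - 1) * A \<sigma>) * pairing (multiplier_op (high_symbol \<sigma>) h1) h2 \<partial>lebesgue)"
    using form_superposition[where 'n = 'n] by blast
  obtain D where D: "D \<ge> 0" "\<And>\<sigma> (x :: real ^ 'n) k. \<sigma> \<in> {0<..1} \<Longrightarrow> (\<sigma> * \<bar>x $ k\<bar>) ^ M * cmod (kernel (high_symbol \<sigma>) x) \<le> D"
    using kernel_high_tail[where 'n = 'n and M = M] by blast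
  obtain E where E: "E \<ge> 0" "\<And>(x :: real ^ 'n) k. \<bar>x $ k\<bar> ^ M * cmod (kernel low_symbol x) \<le> E"
    using kernel_low_tail[where 'n = 'n and M = M] by blast
  define n where "n = CARD('n)"
  define G where "G = E + B * (D * 8 ^ M) / \<delta>"
  define F where "F = B * (\<bar>C\<bar> + 1) / (\<delta> - \<epsilon>)"
  define N where "N = G * 7 ^ n + F"
  have G0: "G \<ge> 0" "F \<ge> 0" using E D AB \<delta> eps by (auto simp: G_def F_def)
  have "cmod (pairing (multiplier_op (br_symbol \<delta>) h1) h2) \<le>
      N * L powr - \<kappa> * measure lebesgue T * cube_avg T p h1 * cube_avg T q h2"
    if L: "L \<ge> 1" and h: "bounded_compact_support h1" "bounded_compact_support h2"
      and supp: "\<And>x. x \<notin> T \<Longrightarrow> h1 x = 0 \<and> h2 x = 0" and T: "T \<in> lmeasurable" and V: "measure lebesgue T = (7 * L) ^ CARD('n)"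
      and sep: "\<And>x y. h2 x \<noteq> 0 \<Longrightarrow> h1 y \<noteq> 0 \<Longrightarrow> (\<exists>i. \<bar>(x - y) $ i\<bar> \<ge> L)"
    for h1 h2 :: "real ^ 'n \<Rightarrow> complex" and L T
  proof -
    let ?V = "measure lebesgue T"
    have V0: "?V > 0" using L by (simp add: V)
    have hi: "integrable lebesgue h1" "integrable lebesgue h2" using h by (auto intro: integrable_bounded_compact_support)
    have Lf: "Lp_fun 1 h1" "Lp_fun p h1" "Lp_fun 1 h2" "Lp_fun q h2" using h pq by (auto intro!: Lp_fun_bounded_compact_support)
    define I1 where "I1 = (\<integral>x. cmod (h1 x) \<partial>lebesgue) * (\<integral>x. cmod (h2 x) \<partial>lebesgue)"
    define Ip where "Ip = Lp_norm p h1 * Lp_norm q h2"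
    define X where "X = cube_avg T p h1 * cube_avg T q h2"
    have X0: "X \<ge> 0" by (simp add: X_def cube_avg_nonneg)
    have I0: "I1 \<ge> 0" "Ip \<ge> 0" by (auto simp: I1_def Ip_def Lp_norm_def intro!: mult_nonneg_nonneg integral_nonneg_AE)
    have I1: "I1 \<le> ?V * ?V * X"
    proof -
      have "I1 = ?V * ?V * (cube_avg T 1 h1 * cube_avg T 1 h2)"
        unfolding I1_def using L1_norm_cube_avg[of T h1] L1_norm_cube_avg[of T h2] supp V0 by simp
      also have "\<dots> \<le> ?V * ?V * X" unfolding X_def
        using pq V0 by (intro mult_left_mono mult_mono cube_avg_1_le h T cube_avg_nonneg) auto
      finally show ?thesis .
    qed
    have Ip: "Ip = ?V * X"
    proof -
      have "?V powr (1 / p) * ?V powr (1 / q) = ?V" using pq V0 by (simp flip: powr_add)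
      then have "(?V powr (1 / p) * cube_avg T p h1) * (?V powr (1 / q) * cube_avg T q h2) = ?V * X"
        unfolding X_def by (metis mult.assoc mult.left_commute)
      then show ?thesis unfolding Ip_def
        using Lp_norm_cube_avg[of T h1 p] Lp_norm_cube_avg[of T h2 q] supp V0 pq by simp
    qed
    define \<sigma>L where "\<sigma>L = L powr - (1 - \<eta>) / 8"
    have sL: "0 < \<sigma>L" "\<sigma>L \<le> 1/8"
    proof -
      have "L powr - (1 - \<eta>) \<le> L powr 0" using L eta by (intro powr_mono) auto
      then show "\<sigma>L \<le> 1/8" using L by (simp add: \<sigma>L_def)
      show "0 < \<sigma>L" using L by (simp add: \<sigma>L_def)
    qed
    define Q where "Q = L powr - (\<eta> * real M)"
    have Q0: "Q > 0" using L by (simp add: Q_def)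
    have low: "cmod (pairing (multiplier_op low_symbol h1) h2) \<le> E * Q * I1"
    proof -
      have "cmod (pairing (multiplier_op low_symbol h1) h2) \<le> (E * Q) * (\<integral>x. cmod (h1 x) \<partial>lebesgue) * (\<integral>x. cmod (h2 x) \<partial>lebesgue)"
      proof (rule norm_pairing_le_kernel[OF integrable_low_symbol hi])
        show "0 \<le> E * Q" using E Q0 by simp
        fix x y assume "h2 x \<noteq> 0" "h1 y \<noteq> 0"
        then obtain i where i: "\<bar>(x - y) $ i\<bar> \<ge> L" using sep by blast
        have "L ^ M * cmod (kernel low_symbol (x - y)) \<le> \<bar>(x - y) $ i\<bar> ^ M * cmod (kernel low_symbol (x - y))"
          using i L by (intro mult_right_mono power_mono) auto
        also have "\<dots> \<le> E" by (rule E(2))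
        finally have "cmod (kernel low_symbol (x - y)) \<le> E * L powr - real M"
          using L by (simp add: powr_minus powr_realpow field_simps)
        also have "\<dots> \<le> E * Q" unfolding Q_def using L eta E(1)
          by (intro mult_left_mono powr_mono) (auto simp: mult_left_le_one_le)
        finally show "cmod (kernel low_symbol (x - y)) \<le> E * Q" .
      qed
      then show ?thesis by (simp add: I1_def mult.assoc)
    qed
    have far: "cmod (pairing (multiplier_op (high_symbol \<sigma>) h1) h2) \<le> D * 8 ^ M * Q * I1" if s: "\<sigma> \<in> {0<..1}" "\<sigma> > \<sigma>L" for \<sigma>
    proof -
      have sLL: "\<sigma>L * L = L powr \<eta> / 8"
      proof -
        have "L powr \<eta> = L powr - (1 - \<eta>) * L powr 1" unfolding powr_add[symmetric] by simp
        then show ?thesis using L by (simp add: \<sigma>L_def)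
      qed
      have "cmod (pairing (multiplier_op (high_symbol \<sigma>) h1) h2) \<le> (D * 8 ^ M * Q) * (\<integral>x. cmod (h1 x) \<partial>lebesgue) * (\<integral>x. cmod (h2 x) \<partial>lebesgue)"
      proof (rule norm_pairing_le_kernel[OF integrable_high_symbol hi])
        show "0 < \<sigma>" "\<sigma> \<le> 1" using s by auto
        show "0 \<le> D * 8 ^ M * Q" using D Q0 by simp
        fix x y assume "h2 x \<noteq> 0" "h1 y \<noteq> 0"
        then obtain i where i: "\<bar>(x - y) $ i\<bar> \<ge> L" using sep by blast
        have "\<sigma>L * L \<le> \<sigma> * \<bar>(x - y) $ i\<bar>" using s i L sL by (intro mult_mono) auto
        then have "(L powr \<eta> / 8) ^ M * cmod (kernel (high_symbol \<sigma>) (x - y)) \<le> (\<sigma> * \<bar>(x - y) $ i\<bar>) ^ M * cmod (kernel (high_symbol \<sigma>) (x - y))"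
          unfolding sLL by (intro mult_right_mono power_mono) auto
        also have "\<dots> \<le> D" by (rule D(2)[OF s(1)])
        finally have "L powr (\<eta> * real M) * cmod (kernel (high_symbol \<sigma>) (x - y)) \<le> D * 8 ^ M"
          using L by (simp add: power_divide powr_realpow[symmetric] powr_powr field_simps)
        then show "cmod (kernel (high_symbol \<sigma>) (x - y)) \<le> D * 8 ^ M * Q"
          unfolding Q_def powr_minus using L by (simp add: field_simps)
      qed
      then show ?thesis by (simp add: I1_def mult.assoc)
    qed
    have near: "cmod (pairing (multiplier_op (high_symbol \<sigma>) h1) h2) \<le> (\<bar>C\<bar> + 1) * \<sigma> powr - \<epsilon> * Ip" if s: "0 < \<sigma>" "\<sigma> \<le> \<sigma>L" for \<sigma>
    proof -
      have s8: "\<sigma> \<le> 1/8" using s sL by linarith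
      \<comment> \<open>For \<open>\<sigma> \<le> 1/8\<close> the bump lives where
        \<open>norm \<xi> \<ge> 13/16\<close>. There \<open>chi ((norm \<xi>)\<^sup>2)\<close> is 0
        because \<open>(13/16)\<^sup>2 > 1/2\<close>, so the factor that protects the origin is 1.
        This is the reason for the 8 in \<open>\<sigma>L\<close>.\<close>
      have "high_symbol \<sigma> \<xi> = annulus_symbol chi \<sigma> \<xi>" for \<xi> :: "real ^ 'n"
      proof (cases "norm \<xi> \<ge> 13/16")
        case True
        then have "(13/16)\<^sup>2 \<le> (norm \<xi>)\<^sup>2" by (intro power_mono) auto
        then have "chi ((norm \<xi>)\<^sup>2) = 0" by (intro chi_facts(3)) (auto simp: power2_eq_square)
        then show ?thesis using s by (simp add: high_symbol_eq annulus_symbol_def)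
      next
        case False
        then have "(norm \<xi> - 1 + \<sigma>) / \<sigma> < - 1/2" using s s8 by (simp add: field_simps)
        then have "chi ((norm \<xi> - 1 + \<sigma>) / \<sigma>) = 0" by (intro chi_facts(3)) linarith
        then show ?thesis using s by (simp add: high_symbol_eq annulus_symbol_def)
      qed
      then have "(high_symbol \<sigma> :: real ^ 'n \<Rightarrow> real) = annulus_symbol chi \<sigma>" by auto
      then show ?thesis
        using annulus_pairing_bound[OF pq chi_borel chi_facts(1) chi_ub C eps(1) s(1) _ Lf] s8 by (simp add: Ip_def mult.assoc)
    qed
    \<comment> \<open>Majorant of the integrand: the first term comes from the hypothesis below
      \<open>\<sigma>L\<close>, the second from the kernel tail, extended to all of
      \<open>{0<..1}\<close>.\<close>
    define \<Psi> where "\<Psi> \<sigma> = B * (\<bar>C\<bar> + 1) * Ip * (indicator {0<..\<sigma>L} \<sigma> * \<sigma> powr (\<delta> - \<epsilon> - 1)) +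
        B * (D * 8 ^ M * Q * I1) * (indicator {0<..1} \<sigma> * \<sigma> powr (\<delta> - 1))" for \<sigma>
    let ?w = "\<lambda>\<sigma>. indicator {0<..1} \<sigma> * \<sigma> powr (\<delta> - 1) * A \<sigma>"
    have Psi0: "\<Psi> \<sigma> \<ge> 0" for \<sigma>
      unfolding \<Psi>_def using AB(1) D(1) Q0 I0 by (intro add_nonneg_nonneg mult_nonneg_nonneg) auto
    have ib: "integrable lborel (\<lambda>\<sigma>. indicator {0<..\<sigma>L} \<sigma> * \<sigma> powr (\<delta> - \<epsilon> - 1))" "integrable lborel (\<lambda>\<sigma>. indicator {0<..1} \<sigma> * \<sigma> powr (\<delta> - 1))"
      using integrable_powr_unit(1)[OF eps(4), of \<sigma>L] integrable_powr_unit(1)[OF \<delta>, of 1] sL by auto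
    have Psii: "integrable lborel \<Psi>" unfolding \<Psi>_def
      by (intro Bochner_Integration.integrable_add integrable_mult_right ib)
    have Psil: "integrable lebesgue \<Psi>" using Psii by (subst integrable_completion) auto
    have Psiv: "(\<integral>\<sigma>. \<Psi> \<sigma> \<partial>lebesgue) = B * (\<bar>C\<bar> + 1) * Ip * (\<sigma>L powr (\<delta> - \<epsilon>) / (\<delta> - \<epsilon>)) + B * (D * 8 ^ M * Q * I1) * (1 / \<delta>)"
    proof -
      have "(\<integral>\<sigma>. \<Psi> \<sigma> \<partial>lebesgue) = (\<integral>\<sigma>. \<Psi> \<sigma> \<partial>lborel)" using Psii by (intro integral_completion) auto
      also have "\<dots> = B * (\<bar>C\<bar> + 1) * Ip * (\<sigma>L powr (\<delta> - \<epsilon>) / (\<delta> - \<epsilon>)) + B * (D * 8 ^ M * Q * I1) * (1 / \<delta>)"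
        unfolding \<Psi>_def using ib integrable_powr_unit(2)[OF eps(4), of \<sigma>L] integrable_powr_unit(2)[OF \<delta>, of 1] sL
        by simp
      finally show ?thesis .
    qed
    have pt: "cmod (of_real (?w \<sigma>) * pairing (multiplier_op (high_symbol \<sigma>) h1) h2) \<le> \<Psi> \<sigma>" for \<sigma>
    proof (cases "\<sigma> \<in> {0<..1}")
      case True
      have A1: "cmod (of_real (?w \<sigma>) * z) \<le> \<sigma> powr (\<delta> - 1) * (B * cmod z)" for z
        using True AB(2)[OF True] by (auto simp: norm_mult abs_mult mult.assoc intro!: mult_left_mono mult_right_mono)
      show ?thesis
      proof (cases "\<sigma> \<le> \<sigma>L")
        case sm: True
        have "cmod (of_real (?w \<sigma>) * pairing (multiplier_op (high_symbol \<sigma>) h1) h2) \<le> \<sigma> powr (\<delta> - 1) * (B * ((\<bar>C\<bar> + 1) * \<sigma> powr - \<epsilon> * Ip))"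
          using True sm AB(1) by (intro order_trans[OF A1] mult_left_mono near) auto
        also have "\<dots> = B * (\<bar>C\<bar> + 1) * Ip * (\<sigma> powr (\<delta> - 1) * \<sigma> powr - \<epsilon>)" by (simp only: mult_ac)
        also have "\<sigma> powr (\<delta> - 1) * \<sigma> powr - \<epsilon> = \<sigma> powr (\<delta> - \<epsilon> - 1)"
          unfolding powr_add[symmetric] by (simp add: algebra_simps)
        also have "B * (\<bar>C\<bar> + 1) * Ip * \<sigma> powr (\<delta> - \<epsilon> - 1) \<le> \<Psi> \<sigma>"
          using True sm AB(1) D(1) Q0 I0 unfolding \<Psi>_def by simp
        finally show ?thesis .
      next
        case False
        have "cmod (of_real (?w \<sigma>) * pairing (multiplier_op (high_symbol \<sigma>) h1) h2) \<le> \<sigma> powr (\<delta> - 1) * (B * (D * 8 ^ M * Q * I1))"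
          using True False AB(1) by (intro order_trans[OF A1] mult_left_mono far) auto
        also have "\<dots> \<le> \<Psi> \<sigma>" using True False by (simp add: \<Psi>_def mult_ac)
        finally show ?thesis .
      qed
    qed (use Psi0 in simp)
    have "cmod (\<integral>\<sigma>. of_real (?w \<sigma>) * pairing (multiplier_op (high_symbol \<sigma>) h1) h2 \<partial>lebesgue) \<le> (\<integral>\<sigma>. \<Psi> \<sigma> \<partial>lebesgue)"
      by (rule order_trans[OF Bochner_Integration.integral_norm_bound integral_mono'[OF Psil]]) (use pt Psi0 in auto)
    then have "cmod (pairing (multiplier_op (br_symbol \<delta>) h1) h2) \<le> E * Q * I1 +
        (B * (\<bar>C\<bar> + 1) * Ip * (\<sigma>L powr (\<delta> - \<epsilon>) / (\<delta> - \<epsilon>)) + B * (D * 8 ^ M * Q * I1) * (1 / \<delta>))"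
      unfolding AB(3)[OF hi] Psiv using low by (intro order_trans[OF norm_triangle_ineq] add_mono) auto
    also have "\<dots> = G * (Q * I1) + F * (\<sigma>L powr (\<delta> - \<epsilon>) * Ip)"
      by (simp add: G_def F_def algebra_simps add_divide_distrib)
    also have "\<dots> \<le> G * (7 ^ n * (L powr - \<kappa> * (?V * X))) + F * (L powr - \<kappa> * (?V * X))"
    proof (intro add_mono mult_left_mono G0)
      have "Q * I1 \<le> Q * (?V * ?V * X)" using I1 Q0 by (intro mult_left_mono) auto
      also have "\<dots> = Q * ?V * (?V * X)" by simp
      also have "Q * ?V \<le> 7 ^ n * L powr - \<kappa>"
      proof -
        have "Q * ?V = 7 ^ n * (L powr - (\<eta> * real M) * L powr real n)"
          using L by (simp add: Q_def V n_def power_mult_distrib powr_realpow)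
        also have "\<dots> = 7 ^ n * L powr (real n - \<eta> * real M)" by (simp add: powr_add[symmetric])
        also have "\<dots> \<le> 7 ^ n * L powr - \<kappa>" using L M by (intro mult_left_mono powr_mono) (auto simp: n_def)
        finally show ?thesis .
      qed
      then have "Q * ?V * (?V * X) \<le> 7 ^ n * L powr - \<kappa> * (?V * X)" using X0 V0 by (intro mult_right_mono) auto
      finally show "Q * I1 \<le> 7 ^ n * (L powr - \<kappa> * (?V * X))" by (simp add: mult.assoc)
      have "\<sigma>L powr (\<delta> - \<epsilon>) \<le> (L powr - (1 - \<eta>)) powr (\<delta> - \<epsilon>)"
        using sL eps by (intro powr_mono2) (auto simp: \<sigma>L_def)
      also have "\<dots> = L powr - \<kappa>" by (simp only: powr_powr mult_minus_left eta(3))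
      finally show "\<sigma>L powr (\<delta> - \<epsilon>) * Ip \<le> L powr - \<kappa> * (?V * X)" unfolding Ip using X0 V0 by (intro mult_right_mono) auto
    qed
    also have "\<dots> = N * L powr - \<kappa> * ?V * cube_avg T p h1 * cube_avg T q h2"
      by (simp add: N_def X_def algebra_simps)
    finally show ?thesis .
  qed
  moreover have "N \<ge> 0" using G0 by (simp add: N_def)
  ultimately show ?thesis by blast
qed

end

text \<open>The inequalities are strict at \<open>t\<close>, so they persist for some smaller
  \<open>\<theta>\<close>. For that \<open>\<theta>\<close> the interpolated exponents run through a
  segment on the line of coordinate sum \<open>1 + \<theta>\<close>, and \<open>l\<close> is chosen
  so that a point of it dominates \<open>(x, y)\<close>.\<close>

lemma interpolation_exponents:
  fixes p t x y :: real
  assumes a: "1 / 2 < a" "a < 1" and t: "0 < t" "t < 1"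
    and xy: "x + y < 1 + t" "x < a + (1 - a) * t" "y < a + (1 - a) * t"
  shows "\<exists>\<theta> l. 0 < \<theta> \<and> \<theta> < t \<and> 0 < l \<and> l < 1 \<and>
    x < \<theta> + (1 - \<theta>) * (l * a + (1 - l) * (1 - a)) \<and> y < \<theta> + (1 - \<theta>) * (l * (1 - a) + (1 - l) * a)"
proof -
  \<comment> \<open>The largest of the lower bounds that positivity and the three inequalities
    impose on \<open>\<theta>\<close>.\<close>
  define m where "m = max (max 0 (x + y - 1)) (max ((x - a) / (1 - a)) ((y - a) / (1 - a)))"
  have "m < t" using a t xy by (auto simp: m_def field_simps)
  then obtain \<theta> where th: "m < \<theta>" "\<theta> < t" using dense by blast
  have b: "0 < \<theta>" "x + y - 1 < \<theta>" "x < a + (1 - a) * \<theta>" "y < a + (1 - a) * \<theta>"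
    using th(1) a by (auto simp: m_def field_simps)
  have th1: "\<theta> < 1" using th t by simp
  define Y where "Y = a + (1 - a) * \<theta>"
  have Y2: "1 + \<theta> < 2 * Y"
  proof -
    have "(2 * a - 1) * (1 - \<theta>) > 0" using a th1 by (intro mult_pos_pos) auto
    then show ?thesis by (simp add: Y_def algebra_simps)
  qed
  \<comment> \<open>A point \<open>(u, 1 + \<theta> - u)\<close> lies strictly between the ends of
    the segment iff both coordinates are below \<open>Y\<close>, and it dominates
    \<open>(x, y)\<close> iff \<open>x < u\<close> and \<open>u < 1 + \<theta> - y\<close>.\<close>
  have "max x (1 + \<theta> - Y) < min Y (1 + \<theta> - y)" using b Y2 unfolding Y_def[symmetric] by auto
  then obtain u where "max x (1 + \<theta> - Y) < u" "u < min Y (1 + \<theta> - y)" using dense by blast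
  then have u: "x < u" "1 + \<theta> - Y < u" "u < Y" "u < 1 + \<theta> - y" by auto
  define l where "l = ((u - \<theta>) / (1 - \<theta>) - (1 - a)) / (2 * a - 1)"
  have l: "l * (2 * a - 1) = (u - \<theta>) / (1 - \<theta>) - (1 - a)" using a by (simp add: l_def)
  have ul: "\<theta> + (1 - \<theta>) * (l * a + (1 - l) * (1 - a)) = u"
  proof -
    have "l * a + (1 - l) * (1 - a) = l * (2 * a - 1) + (1 - a)" by (simp add: algebra_simps)
    also have "\<dots> = (u - \<theta>) / (1 - \<theta>)" using l by simp
    finally show ?thesis using th1 by simp
  qed
  have yl: "\<theta> + (1 - \<theta>) * (l * (1 - a) + (1 - l) * a) = 1 + \<theta> - u"
  proof -
    have "\<theta> + (1 - \<theta>) * (l * (1 - a) + (1 - l) * a) = 1 + \<theta> - (\<theta> + (1 - \<theta>) * (l * a + (1 - l) * (1 - a)))"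
      by (simp add: algebra_simps)
    then show ?thesis using ul by simp
  qed
  have "(u - \<theta>) / (1 - \<theta>) > 1 - a" using u(2) th1 by (simp add: Y_def field_simps)
  then have l0: "l > 0" using a by (simp add: l_def)
  have "(u - \<theta>) / (1 - \<theta>) < a" using u(3) th1 by (simp add: Y_def field_simps)
  then have l1: "l < 1" using a by (simp add: l_def field_simps)
  show ?thesis using b(1) th(2) l0 l1 u ul yl by (intro exI[of _ \<theta>] exI[of _ l]) auto
qed


section \<open>Boundedness inside the trapezoid\<close>

lemma restr_restr_zero: "x \<notin> T \<Longrightarrow> A \<subseteq> T \<Longrightarrow> restr A f x = 0"
  by (auto simp: restr_def indicator_def)

context riesz_setup
begin

text \<open>The gain \<open>L powr - \<kappa>\<close> with weight \<open>1 - \<theta>\<close> and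
  the loss \<open>L powr h\<close> with weight \<open>\<theta>\<close> combine to
  \<open>L powr - e\<close> with \<open>e > 0\<close>. For \<open>L = 2 ^ k\<close> this is a
  summable geometric sequence.\<close>

theorem sparse_norm_bochner_riesz_finite:
  fixes p r s :: real
  assumes dim: "CARD('n::finite) \<ge> 2" and \<delta>n: "\<delta> < (real CARD('n) - 1) / 2"
    and p: "1 < p" "p < 2"
    and S: "\<And>\<epsilon>::real. 0 < \<epsilon> \<Longrightarrow> \<epsilon> < 1 \<Longrightarrow>
      \<exists>C::real. \<forall>\<tau>. 0 < \<tau> \<and> \<tau> < 1 \<longrightarrow>
        Lp_op_norm p (annular_op chi \<tau> :: (real ^ 'n \<Rightarrow> complex) \<Rightarrow> real ^ 'n \<Rightarrow> complex)
          \<le> ennreal (C * \<tau> powr (- \<epsilon>))"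
    and rs: "1 \<le> r" "1 \<le> s" and tr: "(1 / r, 1 / s) \<in> trapezoid CARD('n) p \<delta>"
  shows "sparse_norm (bochner_riesz \<delta> :: (real ^ 'n \<Rightarrow> complex) \<Rightarrow> _) r s < \<infinity>"
proof -
  define n where "n = CARD('n)"
  have n2: "n \<ge> 2" using dim by (simp add: n_def)
  define t where "t = 2 * \<delta> / (real n - 1)"
  have t: "0 < t" "t < 1" using \<delta> \<delta>n n2 by (auto simp: t_def n_def field_simps)
  define q where "q = p / (p - 1)"
  have q: "q > 1" "1 / p + 1 / q = 1" and q1: "1 / q = 1 - 1 / p" using p by (auto simp: q_def field_simps)
  have a: "1 / 2 < 1 / p" "1 / p < 1" using p by (auto simp: field_simps)
  note tb = trapezoid_bounds[OF p dim \<delta> \<delta>n tr, folded n_def, folded t_def]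
  obtain \<theta> l where th: "0 < \<theta>" "\<theta> < t" "0 < l" "l < 1"
    "1 / r < \<theta> + (1 - \<theta>) * (l * (1 / p) + (1 - l) * (1 - 1 / p))"
    "1 / s < \<theta> + (1 - \<theta>) * (l * (1 - 1 / p) + (1 - l) * (1 / p))"
    using interpolation_exponents[OF a t tb] by blast
  have th1: "\<theta> < 1" using th t by linarith
  define x where "x = \<theta> + (1 - \<theta>) * (l / p + (1 - l) / q)"
  define y where "y = \<theta> + (1 - \<theta>) * (l / q + (1 - l) / p)"
  have xe: "x = \<theta> + (1 - \<theta>) * (l * (1 / p) + (1 - l) * (1 - 1 / p))"
    "y = \<theta> + (1 - \<theta>) * (l * (1 - 1 / p) + (1 - l) * (1 / p))"
    unfolding x_def y_def q1[symmetric] by simp_all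
  have xy: "r * x > 1" "s * y > 1" using th(5,6) rs unfolding xe[symmetric] by (simp_all add: field_simps)
  \<comment> \<open>Growth exponent of the (1, 1) bound: the volume contributes \<open>n\<close> and
    the kernel \<open>- b\<close>, and \<open>n - b\<close> is this number. The condition
    \<open>\<theta> < t\<close> is equivalent to
    \<open>\<theta> * h < \<delta> * (1 - \<theta>)\<close>.\<close>
  define h where "h = (real n - 1) / 2 - \<delta>"
  have h0: "h \<ge> 0" using \<delta>n by (simp add: h_def n_def)
  have hth: "\<theta> * h < \<delta> * (1 - \<theta>)"
  proof -
    have "\<theta> * (real n - 1) < 2 * \<delta>" using th(2) n2 by (simp add: t_def field_simps)
    then show ?thesis by (simp add: h_def algebra_simps)
  qed
  \<comment> \<open>The midpoint: below \<open>\<delta>\<close>, so that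
    \<open>separated_form_bound\<close> applies, and above
    \<open>\<theta> * h / (1 - \<theta>)\<close>, so that the interpolated exponent still
    decays.\<close>
  define \<kappa> where "\<kappa> = (\<theta> * h / (1 - \<theta>) + \<delta>) / 2"
  have hk: "\<theta> * h / (1 - \<theta>) < \<delta>" "\<theta> * h / (1 - \<theta>) \<ge> 0" using hth th1 th(1) h0 by (auto simp: field_simps)
  have mid: "0 < (w + \<delta>) / 2 \<and> (w + \<delta>) / 2 < \<delta> \<and> w < (w + \<delta>) / 2" if "w < \<delta>" "w \<ge> 0" for w
    using that by auto
  have k: "0 < \<kappa>" "\<kappa> < \<delta>" "\<theta> * h / (1 - \<theta>) < \<kappa>"
    unfolding \<kappa>_def using mid[OF hk] by blast+
  define e where "e = \<kappa> * (1 - \<theta>) - \<theta> * h"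
  have e: "e > 0" using k(3) th1 by (simp add: e_def field_simps)
  obtain N where N: "N \<ge> 0" "\<And>(h1 :: real ^ 'n \<Rightarrow> complex) h2 L T. L \<ge> 1 \<Longrightarrow> bounded_compact_support h1 \<Longrightarrow> bounded_compact_support h2 \<Longrightarrow>
    (\<forall>x. x \<notin> T \<longrightarrow> h1 x = 0 \<and> h2 x = 0) \<Longrightarrow> T \<in> lmeasurable \<Longrightarrow> measure lebesgue T = (7 * L) ^ CARD('n) \<Longrightarrow>
    (\<forall>x y. h2 x \<noteq> 0 \<longrightarrow> h1 y \<noteq> 0 \<longrightarrow> (\<exists>i. \<bar>(x - y) $ i\<bar> \<ge> L)) \<Longrightarrow>
    cmod (pairing (multiplier_op (br_symbol \<delta>) h1) h2) \<le>
      N * L powr - \<kappa> * measure lebesgue T * cube_avg T p h1 * cube_avg T q h2"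
    using separated_form_bound[OF p(1) q S k(1,2)] by blast
  define b where "b = \<delta> + real (CARD('n) - 1) / 2 + 1"
  obtain C where C: "C > 0" "\<And>x :: real ^ 'n. cmod (kernel (br_symbol \<delta>) x) \<le> C"
    "\<And>(x :: real ^ 'n) L. L > 0 \<Longrightarrow> norm x \<ge> L \<Longrightarrow> cmod (kernel (br_symbol \<delta>) x) \<le> C * L powr - b"
    using kernel_decay[where 'n = 'n] unfolding b_def by blast
  have bn: "real n - b = h" using n2 by (simp add: b_def h_def n_def of_nat_diff field_simps)
  let ?m = "br_symbol \<delta> :: real ^ 'n \<Rightarrow> real"
  have m: "integrable lebesgue ?m" by (rule integrable_br_symbol[OF \<delta>])
  define K where "K = (2 powr (r * x) / (1 - 2 powr (1 - r * x))) * (2 powr (s * y) / (1 - 2 powr (1 - s * y)))"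
  have K0: "K \<ge> 0" unfolding K_def
    using xy powr_less_one[of 2 "1 - r * x"] powr_less_one[of 2 "1 - s * y"] by simp
  define K2 where "K2 = N powr (1 - \<theta>) * (C * 7 ^ n) powr \<theta>"
  define c where "c k = K * K2 * (2 powr - e) ^ k" for k :: nat
  have L1: "(\<integral>x. cmod (w x) \<partial>lebesgue) = measure lebesgue T * cube_avg T 1 w"
    if "\<And>x. x \<notin> T \<Longrightarrow> w x = 0" "measure lebesgue T > 0" for w :: "real ^ 'n \<Rightarrow> complex" and T
    using L1_norm_cube_avg[OF that] .
  have "sparse_norm (multiplier_op ?m) r s < \<infinity>"
  proof (rule sparse_bound_of_scales[OF m, where ?C0.0 = "C * 7 ^ n" and C = c])
    show "0 \<le> C * 7 ^ n" using C by simp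
    show "0 \<le> c k" for k using K0 by (simp add: c_def K2_def)
    have "2 powr - e < 1" using e by (simp add: powr_less_one)
    then show "summable c" unfolding c_def by (intro summable_mult summable_geometric) simp
  next
    fix f g :: "real ^ 'n \<Rightarrow> complex" and z :: "int ^ 'n"
    assume f: "bounded_compact_support f" and g: "bounded_compact_support g"
    let ?T = "gridcube 1 z" and ?h1 = "restr (gridcell 0 z) f" and ?h2 = "restr (neighbours 0 z) g"
    have T: "?T \<in> lmeasurable" "measure lebesgue ?T = 7 ^ n" "measure lebesgue ?T > 0"
      using gridcube_facts[of 1 z] by (auto simp: n_def)
    have z: "w \<notin> ?T \<Longrightarrow> ?h1 w = 0" "w \<notin> ?T \<Longrightarrow> ?h2 w = 0" for w
      using gridcell_subset[of 0 z] neighbours_subset[of 0 z] by (auto intro: restr_restr_zero)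
    have hi: "integrable lebesgue ?h1" "integrable lebesgue ?h2" by (intro integrable_restr f g grid_measurable)+
    \<comment> \<open>At unit scale boundedness of the kernel is enough: averages of order 1 are at
      most those of order \<open>r\<close> and \<open>s\<close>.\<close>
    have "cmod (pairing (multiplier_op ?m ?h1) ?h2) \<le> C * (\<integral>x. cmod (?h1 x) \<partial>lebesgue) * (\<integral>x. cmod (?h2 x) \<partial>lebesgue)"
      by (rule norm_pairing_le_kernel[OF m hi]) (use C in auto)
    also have "\<dots> = C * 7 ^ n * measure lebesgue ?T * (cube_avg ?T 1 ?h1 * cube_avg ?T 1 ?h2)"
    proof -
      have "(\<integral>x. cmod (?h1 x) \<partial>lebesgue) = measure lebesgue ?T * cube_avg ?T 1 ?h1"
        "(\<integral>x. cmod (?h2 x) \<partial>lebesgue) = measure lebesgue ?T * cube_avg ?T 1 ?h2"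
        using z T(3) by (intro L1; blast)+
      then show ?thesis by (simp only: T(2) mult_ac)
    qed
    also have "\<dots> \<le> C * 7 ^ n * measure lebesgue ?T * (cube_avg ?T r f * cube_avg ?T s g)"
    proof (intro mult_left_mono mult_mono cube_avg_nonneg)
      show "cube_avg ?T 1 ?h1 \<le> cube_avg ?T r f"
        by (rule order_trans[OF cube_avg_restr_mono[OF f _ T(1,3) grid_measurable(1)] cube_avg_1_le[OF f rs(1) T(1,3)]]) simp
      show "cube_avg ?T 1 ?h2 \<le> cube_avg ?T s g"
        by (rule order_trans[OF cube_avg_restr_mono[OF g _ T(1,3) grid_measurable(2)] cube_avg_1_le[OF g rs(2) T(1,3)]]) simp
    qed (use C in auto)
    finally show "cmod (pairing (multiplier_op ?m ?h1) ?h2) \<le> C * 7 ^ n * measure lebesgue ?T * cube_avg ?T r f * cube_avg ?T s g"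
      by (simp add: mult.assoc)
  next
    fix f g :: "real ^ 'n \<Rightarrow> complex" and z :: "int ^ 'n" and k :: nat
    assume f: "bounded_compact_support f" and g: "bounded_compact_support g"
    define L where "L = (2::real) ^ k"
    have L: "L \<ge> 1" "L > 0" by (auto simp: L_def)
    let ?T = "gridcube L z"
    define R where "R = neighbours (Suc k) (parent z) - neighbours k z"
    define h1 where "h1 = restr (gridcell k z) f"
    define h2 where "h2 = restr R g"
    have T: "?T \<in> lmeasurable" "measure lebesgue ?T = (7 * L) ^ CARD('n)" "measure lebesgue ?T > 0"
      using gridcube_facts[OF L(2), of z] by auto
    have Rm: "R \<in> sets lebesgue" unfolding R_def by (intro sets.Diff grid_measurable)
    have z: "w \<notin> ?T \<Longrightarrow> h1 w = 0" "w \<notin> ?T \<Longrightarrow> h2 w = 0" for w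
      using gridcell_subset[of k z] neighbours_parent_subset[of k z]
      by (auto simp: h1_def h2_def R_def L_def intro!: restr_restr_zero[where T = "gridcube (2 ^ k) z"])
    have hb: "bounded_compact_support h1" "bounded_compact_support h2"
      unfolding h1_def h2_def by (intro bounded_compact_support_restr f g grid_measurable Rm)+
    have sep: "\<exists>i. \<bar>(u - v) $ i\<bar> \<ge> L" if "h2 u \<noteq> 0" "h1 v \<noteq> 0" for u v :: "real ^ 'n"
    proof -
      have "v \<in> gridcell k z" "u \<notin> neighbours k z" using that by (auto simp: h1_def h2_def R_def restr_def indicator_def split: if_splits)
      then show ?thesis unfolding L_def by (rule not_neighbours_separated)
    qed
    have sep': "\<exists>i. \<bar>(u - v) $ i\<bar> \<ge> L" if uv: "h1 u \<noteq> 0" "h2 v \<noteq> 0" for u v :: "real ^ 'n"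
    proof -
      obtain i where "\<bar>(v - u) $ i\<bar> \<ge> L" using sep[OF uv(2,1)] by blast
      then show ?thesis by (intro exI[of _ i]) (simp add: abs_minus_commute)
    qed
    have rz: "restr A w u \<noteq> 0 \<Longrightarrow> w u \<noteq> 0" for A and w :: "real ^ 'n \<Rightarrow> complex" and u by (auto simp: restr_def)
    have rt: "u \<notin> ?T \<Longrightarrow> restr A h1 u = 0 \<and> restr B h2 u = 0" for A B u using z by (auto simp: restr_def)
    let ?V = "measure lebesgue ?T"
    have main: "cmod (pairing (multiplier_op ?m h1) h2) \<le> K * ((N * L powr - \<kappa>) powr (1 - \<theta>) * (C * L powr - b * ?V) powr \<theta>) * ?V * cube_avg ?T r h1 * cube_avg ?T s h2"
      unfolding K_def
    proof (rule form_interpolation[OF m T(1,3) hb(1) z(1) hb(2) z(2) _ _ _ _ _ _ _ th(1) th1 th(3,4) _ _ x_def xy(1) y_def xy(2)])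
      show "p \<ge> 1" "q \<ge> 1" "0 \<le> N * L powr - \<kappa>" "0 \<le> C * L powr - b * ?V" "r > 0" "s > 0"
        using p q N(1) C rs T by auto
      \<comment> \<open>Restriction only shrinks the supports, so containment in the cube and
        separation persist and all three endpoint bounds hold for every pair of pieces.\<close>
      fix A B :: "(real ^ 'n) set" assume AB: "A \<in> sets lebesgue" "B \<in> sets lebesgue"
      have rb: "bounded_compact_support (restr A h1)" "bounded_compact_support (restr B h2)"
        by (intro bounded_compact_support_restr hb AB)+
      have ri: "integrable lebesgue (restr A h1)" "integrable lebesgue (restr B h2)" by (intro integrable_restr hb AB)+
      show "cmod (pairing (multiplier_op ?m (restr A h1)) (restr B h2)) \<le> N * L powr - \<kappa> * ?V * cube_avg ?T p (restr A h1) * cube_avg ?T q (restr B h2)"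
        by (rule N(2)[OF L(1) rb _ T(1,2)]) (use rt sep rz in blast)+
      \<comment> \<open>Self-adjointness exchanges the two functions, and the separation is
        symmetric.\<close>
      have "cmod (pairing (multiplier_op ?m (restr A h1)) (restr B h2)) = cmod (pairing (multiplier_op ?m (restr B h2)) (restr A h1))"
        unfolding pairing_multiplier_op_commute[OF m ri] by simp
      also have "\<dots> \<le> N * L powr - \<kappa> * ?V * cube_avg ?T p (restr B h2) * cube_avg ?T q (restr A h1)"
        by (rule N(2)[OF L(1) rb(2,1) _ T(1,2)]) (use rt sep' rz in blast)+
      finally show "cmod (pairing (multiplier_op ?m (restr A h1)) (restr B h2)) \<le> N * L powr - \<kappa> * ?V * cube_avg ?T q (restr A h1) * cube_avg ?T p (restr B h2)"
        by (simp only: mult_ac)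
      have "cmod (pairing (multiplier_op ?m (restr A h1)) (restr B h2)) \<le>
          (C * L powr - b) * (\<integral>x. cmod (restr A h1 x) \<partial>lebesgue) * (\<integral>x. cmod (restr B h2 x) \<partial>lebesgue)"
      proof (rule norm_pairing_le_kernel[OF m ri])
        fix u v :: "real ^ 'n" assume "restr B h2 u \<noteq> 0" "restr A h1 v \<noteq> 0"
        then obtain i where i: "\<bar>(u - v) $ i\<bar> \<ge> L" using sep rz by blast
        then have "norm (u - v) \<ge> L" using component_le_norm_cart[of "u - v" i] by linarith
        then show "cmod (kernel ?m (u - v)) \<le> C * L powr - b" by (rule C(3)[OF L(2)])
      qed (use C in simp)
      also have "(\<integral>x. cmod (restr A h1 x) \<partial>lebesgue) = ?V * cube_avg ?T 1 (restr A h1)" using rt by (intro L1 T) blast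
      also have "(\<integral>x. cmod (restr B h2 x) \<partial>lebesgue) = ?V * cube_avg ?T 1 (restr B h2)" using rt by (intro L1 T) blast
      finally show "cmod (pairing (multiplier_op ?m (restr A h1)) (restr B h2)) \<le> C * L powr - b * ?V * ?V * cube_avg ?T 1 (restr A h1) * cube_avg ?T 1 (restr B h2)"
        by (simp only: mult_ac)
    qed
    have const: "(N * L powr - \<kappa>) powr (1 - \<theta>) * (C * L powr - b * ?V) powr \<theta> = K2 * (2 powr - e) ^ k"
    proof -
      have "C * L powr - b * ?V = (C * 7 ^ n) * L powr h"
      proof -
        have "?V = 7 ^ n * L powr real n" using L by (simp add: T(2) n_def power_mult_distrib powr_realpow)
        then have "C * L powr - b * ?V = (C * 7 ^ n) * (L powr - b * L powr real n)" by simp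
        also have "L powr - b * L powr real n = L powr h" unfolding powr_add[symmetric] bn[symmetric] by simp
        finally show ?thesis .
      qed
      then have "(N * L powr - \<kappa>) powr (1 - \<theta>) * (C * L powr - b * ?V) powr \<theta> =
          K2 * ((L powr - \<kappa>) powr (1 - \<theta>) * (L powr h) powr \<theta>)"
        using N(1) C(1) by (simp add: K2_def powr_mult mult_ac)
      also have "(L powr - \<kappa>) powr (1 - \<theta>) * (L powr h) powr \<theta> = L powr - e"
        unfolding powr_powr powr_add[symmetric] by (simp add: e_def algebra_simps)
      also have "L powr - e = (2 powr - e) ^ k"
        unfolding L_def by (simp add: powr_realpow[symmetric] powr_powr mult.commute)
      finally show ?thesis .
    qed
    have K20: "K2 \<ge> 0" by (simp add: K2_def)
    have "cmod (pairing (multiplier_op ?m h1) h2) \<le> c k * ?V * (cube_avg ?T r h1 * cube_avg ?T s h2)"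
      using main unfolding const c_def by (simp add: mult.assoc)
    also have "\<dots> \<le> c k * ?V * (cube_avg ?T r f * cube_avg ?T s g)"
    proof (intro mult_left_mono mult_mono cube_avg_nonneg)
      show "cube_avg ?T r h1 \<le> cube_avg ?T r f" "cube_avg ?T s h2 \<le> cube_avg ?T s g"
        unfolding h1_def h2_def using rs by (auto intro!: cube_avg_restr_mono f g T grid_measurable Rm)
      show "0 \<le> c k * ?V" using K0 K20 by (simp add: c_def)
    qed
    finally show "cmod (pairing (multiplier_op ?m (restr (gridcell k z) f)) (restr (neighbours (Suc k) (parent z) - neighbours k z) g)) \<le>
        c k * measure lebesgue (gridcube (2 ^ k) z) * cube_avg (gridcube (2 ^ k) z) r f * cube_avg (gridcube (2 ^ k) z) s g"
      unfolding h1_def h2_def R_def L_def by (simp only: mult.assoc)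
  qed
  moreover have "bochner_riesz \<delta> = multiplier_op ?m" by (simp add: bochner_riesz_def br_symbol_def[abs_def])
  ultimately show ?thesis by simp
qed

end


section \<open>Sparse forms of separated sets\<close>

lemma continuous_on_fourier:
  assumes f: "integrable lebesgue (f :: real ^ 'n \<Rightarrow> complex)"
  shows "continuous_on UNIV (fourier f)"
  unfolding continuous_on_sequentially comp_def
proof (intro allI ballI impI, elim conjE)
  fix u :: "nat \<Rightarrow> real ^ 'n" and \<xi> assume u: "u \<longlonglongrightarrow> \<xi>"
  have [measurable]: "(\<lambda>x. x) \<in> lebesgue \<rightarrow>\<^sub>M (borel :: (real ^ 'n) measure)"
    by (rule id_borel_measurable_lebesgue)
  have [measurable]: "f \<in> borel_measurable lebesgue" using f by simp
  show "(\<lambda>k. fourier f (u k)) \<longlonglongrightarrow> fourier f \<xi>"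
    unfolding fourier_def
  proof (rule integral_dominated_convergence[where w = "\<lambda>x. cmod (f x)"])
    show "AE x in lebesgue. (\<lambda>k. cis (- (2 * pi * (x \<bullet> u k))) * f x) \<longlonglongrightarrow> cis (- (2 * pi * (x \<bullet> \<xi>))) * f x"
      by (intro AE_I2 tendsto_intros u)
  qed (use f in \<open>auto simp: norm_mult\<close>)
qed

lemma inverse_fourier_eq_fourier: "inverse_fourier F x = fourier F (- x)"
  by (simp add: inverse_fourier_def fourier_def inner_commute)

lemma continuous_on_inverse_fourier:
  assumes "integrable lebesgue F"
  shows "continuous_on UNIV (inverse_fourier F)"
  unfolding inverse_fourier_eq_fourier[abs_def]
  by (rule continuous_on_compose2[OF continuous_on_fourier[OF assms]]) (auto intro: continuous_intros)

lemma continuous_lebesgue_integrable: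
  assumes k: "continuous_on UNIV (k :: 'a::euclidean_space \<Rightarrow> complex)" "\<And>x. cmod (k x) \<le> B"
    and f: "integrable lebesgue (f :: 'a \<Rightarrow> complex)"
  shows "integrable lebesgue (\<lambda>x. k x * f x)"
proof (rule Bochner_Integration.integrable_bound)
  show "integrable lebesgue (\<lambda>x. of_real B * f x)" using f by simp
  have "k \<in> borel_measurable lebesgue"
    using borel_measurable_continuous_onI[OF k(1)] by (simp add: measurable_completion)
  then show "(\<lambda>x. k x * f x) \<in> borel_measurable lebesgue" using f by simp
  have "B \<ge> 0" using k(2)[of undefined] norm_ge_zero[of "k undefined"] by linarith
  then show "AE x in lebesgue. norm (k x * f x) \<le> norm (of_real B * f x)"
    using k(2) by (auto simp: norm_mult intro!: mult_right_mono)
qed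

lemma integrable_indicator_lmeasurable:
  assumes "F \<in> lmeasurable"
  shows "integrable lebesgue (indicator F :: 'a::euclidean_space \<Rightarrow> real)"
    and "integrable lebesgue (indicator F :: 'a::euclidean_space \<Rightarrow> complex)"
proof -
  show r: "integrable lebesgue (indicator F :: 'a \<Rightarrow> real)"
    using assms by (auto simp: fmeasurable_def simp del: emeasure_completion intro!: integrable_real_indicator)
  have "(indicator F :: 'a \<Rightarrow> complex) = (\<lambda>x. of_real (indicator F x))" by (auto simp: indicator_def)
  then show "integrable lebesgue (indicator F :: 'a \<Rightarrow> complex)" using r by simp
qed

text \<open>Indicators are nonnegative, so a lower bound for the real part of the kernel integrates
  without cancellation. Continuity and boundedness of the kernel and of the image function make the
  integrals converge, which allows real parts to be taken inside.\<close>

lemma pairing_indicator_ge: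
  fixes m :: "real ^ 'n \<Rightarrow> real"
  assumes m: "integrable lebesgue m" and F: "F \<in> lmeasurable" and G: "G \<in> lmeasurable"
    and B: "\<And>x y. x \<in> G \<Longrightarrow> y \<in> F \<Longrightarrow> B \<le> Re (kernel m (x - y))"
  shows "B * measure lebesgue F * measure lebesgue G \<le> cmod (pairing (multiplier_op m (indicator F)) (indicator G))"
proof -
  let ?f = "indicator F :: real ^ 'n \<Rightarrow> complex" and ?g = "indicator G :: real ^ 'n \<Rightarrow> complex"
  have f: "integrable lebesgue ?f" and g: "integrable lebesgue ?g"
    using integrable_indicator_lmeasurable[OF F] integrable_indicator_lmeasurable[OF G] by auto
  have fr: "integrable lebesgue (\<lambda>y. B * indicator F y)" for B :: real
    using integrable_indicator_lmeasurable[OF F] by simp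
  have gr: "integrable lebesgue (\<lambda>y. B * indicator G y)" for B :: real
    using integrable_indicator_lmeasurable[OF G] by simp
  have m': "integrable lebesgue (\<lambda>\<xi>. complex_of_real (m \<xi>))" using m by simp
  have kc: "continuous_on UNIV (kernel m)"
    unfolding kernel_def by (rule continuous_on_inverse_fourier[OF m'])
  have kb: "cmod (kernel m x) \<le> (\<integral>x. cmod (of_real (m x)) \<partial>lebesgue)" for x
    unfolding kernel_def inverse_fourier_eq_fourier by (rule norm_fourier_le)
  have ki: "integrable lebesgue (\<lambda>y. kernel m (x - y) * ?f y)" for x
    by (rule continuous_lebesgue_integrable[OF _ kb f])
      (rule continuous_on_compose2[OF kc]; auto intro: continuous_intros)
  have T: "B * measure lebesgue F \<le> Re (multiplier_op m ?f x)" if "x \<in> G" for x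
  proof -
    have "(\<integral>y. B * indicator F y \<partial>lebesgue) \<le> (\<integral>y. Re (kernel m (x - y) * ?f y) \<partial>lebesgue)"
    proof (rule integral_mono[OF fr])
      show "integrable lebesgue (\<lambda>y. Re (kernel m (x - y) * ?f y))"
        by (rule integrable_bounded_linear[OF bounded_linear_Re ki])
      show "B * indicator F y \<le> Re (kernel m (x - y) * ?f y)" for y
        using B[OF that, of y] by (cases "y \<in> F") auto
    qed
    also have "\<dots> = Re (multiplier_op m ?f x)"
      unfolding multiplier_op_kernel[OF m f] by (rule integral_Re[OF ki])
    finally show ?thesis using F by (simp add: fmeasurable_def)
  qed
  have mi: "integrable lebesgue (\<lambda>\<xi>. of_real (m \<xi>) * fourier ?f \<xi>)" by (rule integrable_mult_fourier[OF m f])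
  have Tc: "continuous_on UNIV (multiplier_op m ?f)"
    unfolding multiplier_op_def by (rule continuous_on_inverse_fourier[OF mi])
  have Tb: "cmod (multiplier_op m ?f x) \<le> (\<integral>\<xi>. cmod (of_real (m \<xi>) * fourier ?f \<xi>) \<partial>lebesgue)" for x
    unfolding multiplier_op_def inverse_fourier_eq_fourier by (rule norm_fourier_le)
  have Ti: "integrable lebesgue (\<lambda>x. multiplier_op m ?f x * cnj (?g x))"
    by (rule continuous_lebesgue_integrable[OF Tc Tb]) (use g in simp)
  have "(\<integral>x. (B * measure lebesgue F) * indicator G x \<partial>lebesgue) \<le> (\<integral>x. Re (multiplier_op m ?f x * cnj (?g x)) \<partial>lebesgue)"
  proof (rule integral_mono[OF gr])
    show "integrable lebesgue (\<lambda>x. Re (multiplier_op m ?f x * cnj (?g x)))"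
      by (rule integrable_bounded_linear[OF bounded_linear_Re Ti])
    show "B * measure lebesgue F * indicator G x \<le> Re (multiplier_op m ?f x * cnj (?g x))" for x
      using T[of x] by (cases "x \<in> G") auto
  qed
  also have "\<dots> = Re (pairing (multiplier_op m ?f) ?g)"
    unfolding pairing_def by (rule integral_Re[OF Ti])
  also have "\<dots> \<le> cmod (pairing (multiplier_op m ?f) ?g)" by (rule complex_Re_le_cmod)
  finally show ?thesis using G by (simp add: fmeasurable_def)
qed

section \<open>Upper bounds for sparse forms of indicators\<close>

lemma nn_integral_shifted_powr:
  assumes R: "R > 0" and \<gamma>: "\<gamma> > 1"
  shows "(\<integral>\<^sup>+t. ennreal ((R + \<bar>t\<bar>) powr - \<gamma>) \<partial>lborel) \<le> ennreal (2 / (\<gamma> - 1) * R powr (1 - \<gamma>))"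
proof -
  define A where "A t = ennreal ((R + t) powr - \<gamma>) * indicator {0..} t" for t :: real
  have [measurable]: "A \<in> borel_measurable borel" unfolding A_def by measurable
  define F where "F t = - ((R + t) powr (1 - \<gamma>)) / (\<gamma> - 1)" for t
  have "(\<integral>\<^sup>+t. A t \<partial>lborel) = ennreal (0 - F 0)"
    unfolding A_def
  proof (rule nn_integral_FTC_atLeast)
    show "DERIV F t :> (R + t) powr - \<gamma>" if "0 \<le> t" for t
    proof -
      have "((\<lambda>t. (R + t) powr (1 - \<gamma>)) has_real_derivative (1 - \<gamma>) * (R + t) powr (1 - \<gamma> - 1)) (at t)"
        using that R by (auto intro!: derivative_eq_intros)
      moreover have "F = (\<lambda>t. - 1 / (\<gamma> - 1) * (R + t) powr (1 - \<gamma>))" by (auto simp: F_def)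
      moreover have "- 1 / (\<gamma> - 1) * ((1 - \<gamma>) * (R + t) powr (1 - \<gamma> - 1)) = (R + t) powr - \<gamma>"
        using \<gamma> by (simp add: divide_simps) (simp add: algebra_simps)
      ultimately show ?thesis using DERIV_cmult[of _ "(1 - \<gamma>) * (R + t) powr (1 - \<gamma> - 1)" t UNIV "- 1 / (\<gamma> - 1)"] by metis
    qed
    show "(F \<longlongrightarrow> 0) at_top" unfolding F_def using \<gamma> by real_asymp
  qed auto
  then have A: "(\<integral>\<^sup>+t. A t \<partial>lborel) = ennreal (R powr (1 - \<gamma>) / (\<gamma> - 1))" by (simp add: F_def)
  have "(\<integral>\<^sup>+t. ennreal ((R + \<bar>t\<bar>) powr - \<gamma>) \<partial>lborel) \<le> (\<integral>\<^sup>+t. A t + A (- t) \<partial>lborel)"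
    by (intro nn_integral_mono) (auto simp: A_def indicator_def abs_if intro!: add_increasing2)
  also have "\<dots> = (\<integral>\<^sup>+t. A t \<partial>lborel) + (\<integral>\<^sup>+t. A (- t) \<partial>lborel)" by (intro nn_integral_add) auto
  also have "(\<integral>\<^sup>+t. A (- t) \<partial>lborel) = (\<integral>\<^sup>+t. A t \<partial>lborel)"
    using nn_integral_real_affine[of A "-1" 0] by simp
  also have "(\<integral>\<^sup>+t. A t \<partial>lborel) + (\<integral>\<^sup>+t. A t \<partial>lborel) = ennreal (2 / (\<gamma> - 1) * R powr (1 - \<gamma>))"
    unfolding A using \<gamma> by (subst ennreal_plus[symmetric]) (auto simp: add_divide_distrib[symmetric])
  finally show ?thesis .
qed

lemma prod_Basis_cart: "(\<Prod>b\<in>Basis. h ((x :: real ^ 'n) \<bullet> b)) = (\<Prod>i\<in>UNIV. h (x $ i))"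
proof -
  have B: "(Basis :: (real ^ 'n) set) = (\<lambda>i. axis i 1) ` UNIV" by (auto simp: Basis_vec_def)
  have inj: "inj (\<lambda>i. axis i 1 :: real ^ 'n)" by (auto simp: inj_on_def axis_eq_axis)
  show ?thesis unfolding B prod.reindex[OF inj] by (simp add: inner_axis)
qed

text \<open>A product weight is chosen because a cube of side \<open>l\<close> has
  \<open>l ^ n\<close> as its volume: \<open>n\<close> factors of size
  \<open>l powr - \<gamma>\<close> match its power \<open>- \<gamma>\<close>. Integrability in each
  coordinate rests on \<open>\<gamma> > 1\<close>.\<close>

lemma nn_integral_shifted_powr_prod:
  assumes R: "R > 0" and \<gamma>: "\<gamma> > 1"
  shows "(\<integral>\<^sup>+x. ennreal (\<Prod>i\<in>UNIV. (R + \<bar>x $ i\<bar>) powr - \<gamma>) \<partial>(lebesgue :: (real ^ 'n) measure))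
    \<le> ennreal ((2 / (\<gamma> - 1) * R powr (1 - \<gamma>)) ^ CARD('n))"
proof -
  have "(\<integral>\<^sup>+x. ennreal (\<Prod>i\<in>UNIV. (R + \<bar>x $ i\<bar>) powr - \<gamma>) \<partial>(lebesgue :: (real ^ 'n) measure)) =
      (\<integral>\<^sup>+x. (\<Prod>b\<in>Basis. ennreal ((R + \<bar>(x :: real ^ 'n) \<bullet> b\<bar>) powr - \<gamma>)) \<partial>lborel)"
    unfolding prod_Basis_cart[of "\<lambda>t. ennreal ((R + \<bar>t\<bar>) powr - \<gamma>)"]
    by (simp add: nn_integral_completion prod_ennreal)
  also have "\<dots> = (\<Prod>b\<in>(Basis :: (real ^ 'n) set). \<integral>\<^sup>+t. ennreal ((R + \<bar>t\<bar>) powr - \<gamma>) \<partial>lborel)"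
    by (rule nn_integral_lborel_prod) auto
  also have "\<dots> \<le> ennreal ((2 / (\<gamma> - 1) * R powr (1 - \<gamma>)) ^ CARD('n))"
    using nn_integral_shifted_powr[OF assms] \<gamma>
    by (cases "\<integral>\<^sup>+t. ennreal ((R + \<bar>t\<bar>) powr - \<gamma>) \<partial>lborel")
      (auto simp: ennreal_power top_unique intro!: ennreal_leI power_mono)
  finally show ?thesis .
qed

lemma cube_avg_indicator_le:
  assumes T: "T \<in> lmeasurable" "measure lebesgue T > 0" and F: "F \<in> lmeasurable" and u: "u > 0"
  shows "cube_avg T u (indicator F) \<le> (measure lebesgue F / measure lebesgue T) powr (1 / u)"
    and "T \<inter> F = {} \<Longrightarrow> cube_avg T u (indicator F) = 0"
proof -
  have "(LINT x:T|lebesgue. cmod (indicator F x) powr u) \<le> (\<integral>x. indicator F x \<partial>lebesgue)"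
    unfolding set_lebesgue_integral_def
    by (rule integral_mono'[OF integrable_indicator_lmeasurable(1)[OF F]]) (use u in \<open>auto simp: indicator_def\<close>)
  also have "\<dots> = measure lebesgue F" using F by (simp add: fmeasurable_def)
  finally have le: "(LINT x:T|lebesgue. cmod (indicator F x) powr u) \<le> measure lebesgue F" .
  have "0 \<le> (LINT x:T|lebesgue. cmod (indicator F x) powr u)"
    unfolding set_lebesgue_integral_def by (intro integral_nonneg_AE) auto
  then show "cube_avg T u (indicator F) \<le> (measure lebesgue F / measure lebesgue T) powr (1 / u)"
    unfolding cube_avg_def using le T u
    by (intro powr_mono2) (auto simp: field_simps intro!: mult_nonneg_nonneg)
  assume "T \<inter> F = {}"
  then have "(\<lambda>x. indicator T x *\<^sub>R cmod (indicator F x) powr u) = (\<lambda>x. 0)"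
    using u by (auto simp: fun_eq_iff indicator_def)
  then show "cube_avg T u (indicator F) = 0" unfolding cube_avg_def set_lebesgue_integral_def by simp
qed


text \<open>
  A cube \<open>S\<close> meeting both sets has side at least \<open>R / n\<close>. Hence \<open>|S|\<close> to the power \<open>- \<gamma>\<close> is on
  \<open>S\<close> at most a multiple of the integrable weight of the preceding lemmas, and the integrals over the
  disjoint sets \<open>E\<^sub>S\<close> add up.
\<close>

theorem sparse_sup_indicator_le:
  fixes F G :: "(real ^ 'n) set"
  assumes R: "R > 0" and rs: "1 \<le> r" "1 \<le> s" and F: "F \<in> lmeasurable" and G: "G \<in> lmeasurable"
    and bd: "\<And>y. y \<in> F \<Longrightarrow> norm y \<le> 6 * R"
    and sep: "\<And>x y. x \<in> G \<Longrightarrow> y \<in> F \<Longrightarrow> R \<le> norm (x - y)"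
  defines "\<gamma> \<equiv> 1 / r + 1 / s" and "n \<equiv> real CARD('n)"
  assumes \<gamma>: "\<gamma> > 1"
  shows "sparse_sup r s (indicator F) (indicator G) \<le>
    ennreal (4 * (measure lebesgue F powr (1 / r) * measure lebesgue G powr (1 / s)) * (8 * n) powr (n * \<gamma>) *
      (2 / (\<gamma> - 1) * R powr (1 - \<gamma>)) ^ CARD('n))"
  unfolding sparse_sup_def
proof (rule SUP_least)
  fix \<S> :: "(real ^ 'n) set set" assume "\<S> \<in> {\<S>. sparse \<S>}"
  then obtain E where cube: "\<And>S. S \<in> \<S> \<Longrightarrow> cube S" and disj: "disjoint_family_on E \<S>"
    and E: "\<And>S. S \<in> \<S> \<Longrightarrow> E S \<in> sets lebesgue" "\<And>S. S \<in> \<S> \<Longrightarrow> E S \<subseteq> S"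
      "\<And>S. S \<in> \<S> \<Longrightarrow> measure lebesgue (E S) > 1 / 4 * measure lebesgue S"
    unfolding sparse_def by blast
  define A where "A = measure lebesgue F powr (1 / r) * measure lebesgue G powr (1 / s)"
  define K where "K = (8 * n) powr (n * \<gamma>)"
  define w where "w x = (\<Prod>i\<in>UNIV. (R + \<bar>x $ i\<bar>) powr - \<gamma>)" for x :: "real ^ 'n"
  have n1: "n \<ge> 1" unfolding n_def by (simp add: Suc_le_eq)
  have A0: "A \<ge> 0" and K0: "K \<ge> 0" by (simp_all add: A_def K_def)
  have [measurable]: "w \<in> borel_measurable lebesgue"
    unfolding w_def by (intro measurable_completion) simp
  let ?t = "\<lambda>S. measure lebesgue S * cube_avg S r (indicator F) * cube_avg S s (indicator G)"
  have each: "ennreal (?t S) \<le> (\<integral>\<^sup>+x. ennreal (4 * A * K) * ennreal (w x) * indicator (E S) x \<partial>lebesgue)"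
    if S: "S \<in> \<S>" for S
  proof -
    obtain a l where l: "l > 0" and Sa: "S = cbox a (\<chi> i. a $ i + l)" using cube[OF S] unfolding cube_def by blast
    have Sm: "S \<in> lmeasurable" "measure lebesgue S = l ^ CARD('n)" using cube_facts[OF l, of a] Sa by auto
    then have Sp: "measure lebesgue S > 0" using l by simp
    show ?thesis
    proof (cases "S \<inter> F = {} \<or> S \<inter> G = {}")
      case True
      then show ?thesis
        using cube_avg_indicator_le(2)[OF Sm(1) Sp F, of r] cube_avg_indicator_le(2)[OF Sm(1) Sp G, of s] rs by auto
    next
      case False
      then obtain x y where y: "y \<in> S" "y \<in> F" and x: "x \<in> S" "x \<in> G" by blast
      have co: "\<bar>(u - v) $ i\<bar> \<le> l" if "u \<in> S" "v \<in> S" for u v :: "real ^ 'n" and i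
        using that unfolding Sa by (auto simp: mem_box_cart abs_le_iff) (smt (verit))+
      \<comment> \<open>The cube contains two points at distance at least \<open>R\<close>, and the
        Euclidean norm is at most the sum of the \<open>n\<close> coordinate differences.\<close>
      have Rl: "R \<le> n * l"
      proof -
        have "R \<le> norm (x - y)" using sep x y by blast
        also have "\<dots> \<le> (\<Sum>i\<in>UNIV. \<bar>(x - y) $ i\<bar>)" by (rule norm_le_l1_cart)
        also have "\<dots> \<le> (\<Sum>i\<in>(UNIV :: 'n set). l)" by (intro sum_mono co x y)
        finally show ?thesis by (simp add: n_def)
      qed
      \<comment> \<open>A coordinate of \<open>z\<close> differs by at most \<open>l\<close> from
        one of \<open>y \<in> F\<close>, which is at most \<open>6 * R\<close>. So
        \<open>R + \<bar>z $ i\<bar> \<le> 7 * R + l \<le> 8 * n * l\<close>.\<close>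
      have wge: "(measure lebesgue S) powr - \<gamma> \<le> K * w z" if z: "z \<in> S" for z
      proof -
        have "(8 * n * l) powr - \<gamma> \<le> (R + \<bar>z $ i\<bar>) powr - \<gamma>" for i
        proof (rule powr_mono2')
          have "\<bar>z $ i\<bar> \<le> \<bar>y $ i\<bar> + l" using co[OF z y(1), of i] by simp
          moreover have "\<bar>y $ i\<bar> \<le> 6 * R" using component_le_norm_cart[of y i] bd[OF y(2)] by linarith
          moreover have "l \<le> n * l" using n1 l by simp
          ultimately show "R + \<bar>z $ i\<bar> \<le> 8 * n * l" using Rl by linarith
        qed (use R \<gamma> in auto)
        then have "(\<Prod>i\<in>(UNIV :: 'n set). (8 * n * l) powr - \<gamma>) \<le> w z" unfolding w_def by (intro prod_mono) auto
        also have "(\<Prod>i\<in>(UNIV :: 'n set). (8 * n * l) powr - \<gamma>) = (8 * n) powr - (n * \<gamma>) * (measure lebesgue S) powr - \<gamma>"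
          using l n1 unfolding Sm(2)
          by (simp add: n_def powr_mult power_mult_distrib powr_power powr_realpow[symmetric] powr_powr mult_ac)
        finally have "K * ((8 * n) powr - (n * \<gamma>) * (measure lebesgue S) powr - \<gamma>) \<le> K * w z"
          using K0 by (rule mult_left_mono)
        moreover have "K * (8 * n) powr - (n * \<gamma>) = 1"
          unfolding K_def powr_add[symmetric] using n1 by simp
        ultimately show ?thesis by (simp add: mult.assoc[symmetric])
      qed
      have "?t S \<le> measure lebesgue S * ((measure lebesgue F / measure lebesgue S) powr (1 / r) * (measure lebesgue G / measure lebesgue S) powr (1 / s))"
        unfolding mult.assoc
        by (intro mult_left_mono mult_mono cube_avg_indicator_le Sm(1) Sp F G cube_avg_nonneg) (use rs in auto)
      also have "\<dots> = A * measure lebesgue S powr - \<gamma> * measure lebesgue S"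
      proof -
        have "measure lebesgue S powr - \<gamma> = inverse (measure lebesgue S powr (1 / r)) * inverse (measure lebesgue S powr (1 / s))"
          unfolding \<gamma>_def powr_minus powr_add by (rule inverse_mult_distrib)
        moreover have "(measure lebesgue F / measure lebesgue S) powr (1 / r) = measure lebesgue F powr (1 / r) * inverse (measure lebesgue S powr (1 / r))"
          "(measure lebesgue G / measure lebesgue S) powr (1 / s) = measure lebesgue G powr (1 / s) * inverse (measure lebesgue S powr (1 / s))"
          using Sp by (simp_all add: powr_divide field_simps)
        ultimately show ?thesis by (simp only: A_def mult_ac)
      qed
      also have "\<dots> \<le> A * measure lebesgue S powr - \<gamma> * (4 * measure lebesgue (E S))"
        using E(3)[OF S] A0 by (intro mult_left_mono) auto
      finally have "ennreal (?t S) \<le> ennreal (4 * A * measure lebesgue S powr - \<gamma> * measure lebesgue (E S))"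
        by (intro ennreal_leI) (simp add: mult_ac)
      also have "\<dots> = (\<integral>\<^sup>+x. ennreal (4 * A * measure lebesgue S powr - \<gamma>) * indicator (E S) x \<partial>lebesgue)"
      proof -
        have "E S \<in> lmeasurable" using E(1,2)[OF S] Sm(1) by (meson fmeasurableI2)
        then have "emeasure lebesgue (E S) = ennreal (measure lebesgue (E S))" by (rule emeasure_eq_measure2)
        then show ?thesis using E(1)[OF S] A0 by (simp add: nn_integral_cmult_indicator ennreal_mult del: emeasure_completion)
      qed
      also have "\<dots> \<le> (\<integral>\<^sup>+x. ennreal (4 * A * K) * ennreal (w x) * indicator (E S) x \<partial>lebesgue)"
      proof (rule nn_integral_mono)
        fix z
        show "ennreal (4 * A * measure lebesgue S powr - \<gamma>) * indicator (E S) z \<le> ennreal (4 * A * K) * ennreal (w z) * indicator (E S) z"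
        proof (cases "z \<in> E S")
          case True
          then have "z \<in> S" using E(2)[OF S] by blast
          then have "4 * A * measure lebesgue S powr - \<gamma> \<le> 4 * A * (K * w z)" using A0 wge by (intro mult_left_mono) auto
          then show ?thesis using True A0 K0 by (simp add: ennreal_mult'[symmetric] mult.assoc ennreal_leI)
        qed simp
      qed
      finally show ?thesis .
    qed
  qed
  \<comment> \<open>The infinite sum in \<open>ennreal\<close> is the supremum of its finite partial
    sums, so it suffices to bound finite subfamilies uniformly.\<close>
  have "sparse_form \<S> r s (indicator F) (indicator G) = (SUP T\<in>{T. finite T \<and> T \<subseteq> \<S>}. \<Sum>S\<in>T. ennreal (?t S))"
    unfolding sparse_form_def by (rule nonneg_infsum_complete) simp
  also have "\<dots> \<le> (\<integral>\<^sup>+x. ennreal (4 * A * K) * ennreal (w x) \<partial>lebesgue)"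
  proof (rule SUP_least)
    fix T assume "T \<in> {T. finite T \<and> T \<subseteq> \<S>}"
    then have T: "finite T" "T \<subseteq> \<S>" by auto
    have "(\<Sum>S\<in>T. ennreal (?t S)) \<le> (\<Sum>S\<in>T. \<integral>\<^sup>+x. ennreal (4 * A * K) * ennreal (w x) * indicator (E S) x \<partial>lebesgue)"
      using T by (intro sum_mono each) auto
    also have "\<dots> = (\<integral>\<^sup>+x. (\<Sum>S\<in>T. ennreal (4 * A * K) * ennreal (w x) * indicator (E S) x) \<partial>lebesgue)"
      using T E(1) by (intro nn_integral_sum[symmetric]) (auto intro!: borel_measurable_times_ennreal borel_measurable_indicator)
    also have "\<dots> \<le> (\<integral>\<^sup>+x. ennreal (4 * A * K) * ennreal (w x) \<partial>lebesgue)"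
    proof (rule nn_integral_mono)
      fix x
      have "(\<Sum>S\<in>T. indicator (E S) x) = (indicator (\<Union>(E ` T)) x :: ennreal)"
        using T disj by (intro indicator_UN_disjoint[symmetric]) (auto simp: disjoint_family_on_def)
      then show "(\<Sum>S\<in>T. ennreal (4 * A * K) * ennreal (w x) * indicator (E S) x) \<le> ennreal (4 * A * K) * ennreal (w x)"
        unfolding sum_distrib_left[symmetric] by (simp add: indicator_def)
    qed
    finally show "(\<Sum>S\<in>T. ennreal (?t S)) \<le> (\<integral>\<^sup>+x. ennreal (4 * A * K) * ennreal (w x) \<partial>lebesgue)" .
  qed
  also have "\<dots> = ennreal (4 * A * K) * (\<integral>\<^sup>+x. ennreal (w x) \<partial>lebesgue)"
    by (intro nn_integral_cmult) simp
  also have "\<dots> \<le> ennreal (4 * A * K) * ennreal ((2 / (\<gamma> - 1) * R powr (1 - \<gamma>)) ^ CARD('n))"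
    unfolding w_def by (intro mult_left_mono nn_integral_shifted_powr_prod R \<gamma>) simp
  also have "\<dots> = ennreal (4 * A * K * (2 / (\<gamma> - 1) * R powr (1 - \<gamma>)) ^ CARD('n))"
    using \<gamma> A0 K0 by (intro ennreal_mult'[symmetric]) auto
  finally show "sparse_form \<S> r s (indicator F) (indicator G) \<le>
    ennreal (4 * (measure lebesgue F powr (1 / r) * measure lebesgue G powr (1 / s)) * (8 * n) powr (n * \<gamma>) *
      (2 / (\<gamma> - 1) * R powr (1 - \<gamma>)) ^ CARD('n))" unfolding A_def K_def .
qed


section \<open>Necessary conditions\<close>

lemma powr_exponent_le:
  assumes c: "c > 0" and le: "\<And>R :: real. R \<ge> R0 \<Longrightarrow> c * R powr e \<le> C * R powr e'"
  shows "e \<le> e'"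
proof (rule ccontr)
  assume "\<not> e \<le> e'"
  then have "filterlim (\<lambda>R :: real. R powr (e - e')) at_top at_top" by real_asymp
  then have "\<forall>\<^sub>F R in at_top. C / c < R powr (e - e')" by (simp add: filterlim_at_top_dense)
  moreover have "\<forall>\<^sub>F R in at_top. R \<ge> max R0 1" by (rule eventually_ge_at_top)
  ultimately have "\<forall>\<^sub>F R :: real in at_top. False"
  proof eventually_elim
    case (elim R)
    then have R: "R > 0" "R \<ge> R0" by auto
    have "C / c * R powr e' < R powr (e - e') * R powr e'"
      using elim R by (intro mult_strict_right_mono) auto
    also have "\<dots> = R powr e" by (simp add: powr_add[symmetric])
    finally show ?case using le[OF R(2)] c by (simp add: field_simps)
  qed
  then show False by simp
qed

lemma bounded_compact_support_indicator:
  fixes F :: "(real ^ 'n) set"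
  assumes F: "F \<in> lmeasurable" and b: "\<And>y. y \<in> F \<Longrightarrow> norm y \<le> B"
  shows "bounded_compact_support (indicator F)"
  unfolding bounded_compact_support_def
proof (intro conjI)
  show "(indicator F :: real ^ 'n \<Rightarrow> complex) \<in> borel_measurable lebesgue" by (rule borel_measurable_integrable[OF integrable_indicator_lmeasurable(2)[OF F]])
  show "bounded (range (indicator F :: _ \<Rightarrow> complex))" by (auto simp: bounded_iff indicator_def intro!: exI[of _ 1])
  have "bounded F" using b by (auto simp: bounded_iff)
  moreover have "{x. indicator F x \<noteq> (0 :: complex)} = F" by (auto simp: indicator_def)
  ultimately show "compact (closure {x. indicator F x \<noteq> (0 :: complex)})" by (simp add: compact_closure)
qed

text \<open>The form of the indicators is at least of order \<open>R powr - (a + 1)\<close> times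
  both measures, the sparse forms at most of order \<open>R powr (n * (1 - \<gamma>))\<close> times
  their powers \<open>1 / r\<close> and \<open>1 / s\<close>. Dividing and letting \<open>R\<close>
  grow compares the exponents.\<close>

theorem exponents_of_finite_sparse_norm:
  fixes r s \<delta> \<alpha> \<beta> \<theta> :: real
  assumes \<delta>: "\<delta> > 0" and rs: "1 \<le> r" "1 \<le> s" and \<gamma>: "1 / r + 1 / s > 1"
    and fin: "sparse_norm (bochner_riesz \<delta> :: (real ^ 'n \<Rightarrow> complex) \<Rightarrow> _) r s < \<infinity>"
  defines "n \<equiv> real CARD('n)" and "a \<equiv> \<delta> + real (CARD('n) - 1) / 2"
  assumes osc: "c1 > 0" "\<And>\<rho> m. \<rho> \<ge> \<rho>0 \<Longrightarrow> \<bar>\<rho> - \<theta> - real_of_int m\<bar> \<le> 1 / 6 \<Longrightarrow> c1 * \<rho> powr - (a + 1) \<le> Re (osc a \<rho>)"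
    and c: "c > 0"
    and ex: "\<And>R. R \<ge> R0 \<Longrightarrow> \<exists>F G :: (real ^ 'n) set. F \<in> lmeasurable \<and> G \<in> lmeasurable \<and>
      (\<forall>y\<in>F \<union> G. norm y \<le> 6 * R) \<and> c * R powr \<alpha> \<le> measure lebesgue F \<and> c * R powr \<beta> \<le> measure lebesgue G \<and>
      (\<forall>x\<in>G. \<forall>y\<in>F. R \<le> norm (x - y) \<and> (\<exists>m::int. \<bar>norm (x - y) - \<theta> - real_of_int m\<bar> \<le> 1 / 6))"
  shows "\<alpha> * (1 - 1 / r) + \<beta> * (1 - 1 / s) - (a + 1) \<le> n * (1 - (1 / r + 1 / s))"
proof -
  obtain C where C: "C \<ge> 0" "\<And>f g. bounded_compact_support f \<Longrightarrow> bounded_compact_support (g :: real ^ 'n \<Rightarrow> complex) \<Longrightarrow>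
        ennreal (cmod (pairing (bochner_riesz \<delta> f) g)) \<le> ennreal C * sparse_sup r s f g"
    using fin unfolding sparse_norm_def Inf_less_iff sparse_sup_def by blast
  obtain c2 where c2: "c2 > 0" "\<And>x :: real ^ 'n. kernel (br_symbol \<delta>) x = of_real c2 * osc a (norm x)"
    using kernel_br_symbol[OF \<delta>, where 'n = 'n] unfolding a_def by blast
  define g where "g = 1 / r + 1 / s"
  define K where "K = 4 * (8 * n) powr (n * g) * (2 / (g - 1)) ^ CARD('n)"
  \<comment> \<open>The factor 12 appears since points of norm at most \<open>6 * R\<close> have
    distance at most \<open>12 * R\<close>.\<close>
  define b where "b = c2 * (c1 * 12 powr - (a + 1))"
  have a0: "a > 0" using \<delta> by (simp add: a_def add_pos_nonneg)
  have b0: "b > 0" using c2 osc by (simp add: b_def)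
  define u where "u = 1 - 1 / r"
  define v where "v = 1 - 1 / s"
  \<comment> \<open>After the division the measures remain with these nonnegative exponents, so
    lower bounds for them suffice.\<close>
  have uv: "u \<ge> 0" "v \<ge> 0" using rs by (auto simp: u_def v_def)
  have "b * c powr u * c powr v * R powr (\<alpha> * u + \<beta> * v - (a + 1)) \<le> C * K * R powr (n * (1 - g))"
    if R: "R \<ge> max (max R0 \<rho>0) 1" for R
  proof -
    have R: "R \<ge> R0" "R \<ge> \<rho>0" "R > 0" using R by auto
    obtain F G :: "(real ^ 'n) set" where F: "F \<in> lmeasurable" and G: "G \<in> lmeasurable"
      and bd: "\<And>y. y \<in> F \<union> G \<Longrightarrow> norm y \<le> 6 * R"
      and mF: "c * R powr \<alpha> \<le> measure lebesgue F" and mG: "c * R powr \<beta> \<le> measure lebesgue G"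
      and ph: "\<And>x y. x \<in> G \<Longrightarrow> y \<in> F \<Longrightarrow> R \<le> norm (x - y)"
        "\<And>x y. x \<in> G \<Longrightarrow> y \<in> F \<Longrightarrow> \<exists>m::int. \<bar>norm (x - y) - \<theta> - real_of_int m\<bar> \<le> 1 / 6"
      using ex[OF R(1)] by blast
    let ?F = "measure lebesgue F" and ?G = "measure lebesgue G"
    have pos: "?F > 0" "?G > 0" "c * R powr \<alpha> > 0" "c * R powr \<beta> > 0"
      using mF mG c R by (auto intro: less_le_trans[rotated])
    have "b * R powr - (a + 1) * ?F * ?G \<le> cmod (pairing (multiplier_op (br_symbol \<delta>) (indicator F)) (indicator G))"
    proof (rule pairing_indicator_ge[OF integrable_br_symbol[OF \<delta>] F G])
      fix x y assume xy: "x \<in> G" "y \<in> F"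
      have N: "R \<le> norm (x - y)" "norm (x - y) \<le> 12 * R"
        using ph(1)[OF xy] bd[of x] bd[of y] xy norm_triangle_ineq4[of x y] by auto
      have "b * R powr - (a + 1) = c2 * (c1 * (12 * R) powr - (a + 1))" using R by (simp add: b_def powr_mult)
      also have "\<dots> \<le> c2 * (c1 * norm (x - y) powr - (a + 1))"
        using c2 osc(1) a0 N R by (intro mult_left_mono powr_mono2') auto
      also have "\<dots> \<le> c2 * Re (osc a (norm (x - y)))"
      proof (rule mult_left_mono)
        obtain m :: int where "\<bar>norm (x - y) - \<theta> - real_of_int m\<bar> \<le> 1 / 6" using ph(2)[OF xy] by blast
        then show "c1 * norm (x - y) powr - (a + 1) \<le> Re (osc a (norm (x - y)))" using N(1) R(2) by (intro osc(2)) auto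
      qed (use c2(1) in simp)
      finally show "b * R powr - (a + 1) \<le> Re (kernel (br_symbol \<delta>) (x - y))" unfolding c2(2) by simp
    qed
    also have "\<dots> \<le> C * (K * (?F powr (1 / r) * ?G powr (1 / s)) * R powr (n * (1 - g)))"
    proof -
      have bF: "bounded_compact_support (indicator F)" and bG: "bounded_compact_support (indicator G)"
        by (rule bounded_compact_support_indicator[where B = "6 * R"]; use F G bd in auto)+
      have "(2 / (g - 1) * R powr (1 - g)) ^ CARD('n) = (2 / (g - 1)) ^ CARD('n) * R powr (n * (1 - g))"
        unfolding power_mult_distrib using R by (simp add: powr_power n_def mult.commute)
      then have "sparse_sup r s (indicator F) (indicator G) \<le> ennreal (K * (?F powr (1 / r) * ?G powr (1 / s)) * R powr (n * (1 - g)))"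
        using sparse_sup_indicator_le[OF R(3) rs F G bd ph(1) \<gamma>]
        unfolding g_def[symmetric] n_def[symmetric] K_def by (simp add: mult_ac)
      then have "ennreal C * sparse_sup r s (indicator F) (indicator G) \<le> ennreal (C * (K * (?F powr (1 / r) * ?G powr (1 / s)) * R powr (n * (1 - g))))"
        unfolding ennreal_mult'[OF C(1)] by (rule mult_left_mono) simp
      then have "ennreal (cmod (pairing (bochner_riesz \<delta> (indicator F)) (indicator G))) \<le> ennreal (C * (K * (?F powr (1 / r) * ?G powr (1 / s)) * R powr (n * (1 - g))))"
        using C(2)[OF bF bG] by (rule order_trans[rotated])
      moreover have "0 \<le> C * (K * (?F powr (1 / r) * ?G powr (1 / s)) * R powr (n * (1 - g)))"
        using C(1) \<gamma> by (simp add: K_def g_def)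
      ultimately show ?thesis by (simp add: bochner_riesz_def br_symbol_def[abs_def])
    qed
    finally have "b * R powr - (a + 1) * (?F * ?G) \<le> C * K * R powr (n * (1 - g)) * (?F powr (1 / r) * ?G powr (1 / s))"
      by (simp add: mult_ac)
    moreover have "?F * ?G = (?F powr u * ?F powr (1 / r)) * (?G powr v * ?G powr (1 / s))"
      using pos by (intro arg_cong2[where f = "(*)"]) (simp_all add: powr_add[symmetric] u_def v_def)
    ultimately have "(b * R powr - (a + 1) * (?F powr u * ?G powr v)) * (?F powr (1 / r) * ?G powr (1 / s))
        \<le> C * K * R powr (n * (1 - g)) * (?F powr (1 / r) * ?G powr (1 / s))"
      by (simp only: mult_ac)
    then have up: "b * R powr - (a + 1) * (?F powr u * ?G powr v) \<le> C * K * R powr (n * (1 - g))"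
      using pos by (simp add: mult_le_cancel_right)
    have "b * c powr u * c powr v * R powr (\<alpha> * u + \<beta> * v - (a + 1)) =
        b * R powr - (a + 1) * ((c * R powr \<alpha>) powr u * (c * R powr \<beta>) powr v)"
      using c R by (simp add: powr_mult powr_powr powr_add powr_diff powr_minus divide_inverse mult_ac)
    also have "\<dots> \<le> b * R powr - (a + 1) * (?F powr u * ?G powr v)"
      using b0 uv pos mF mG by (intro mult_left_mono mult_mono powr_mono2) auto
    also note up
    finally show ?thesis .
  qed
  moreover have "b * c powr u * c powr v > 0" using b0 c by simp
  ultimately have "\<alpha> * u + \<beta> * v - (a + 1) \<le> n * (1 - g)" by (rule powr_exponent_le[rotated])
  then show ?thesis by (simp add: u_def v_def g_def)
qed

section \<open>Test sets: shells and planks\<close>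

lemma measure_UN_ge:
  assumes "finite M" "\<And>m. m \<in> M \<Longrightarrow> A m \<in> lmeasurable" "disjoint_family_on A M" "\<And>m. m \<in> M \<Longrightarrow> v \<le> measure lebesgue (A m)"
  shows "(\<Union>m\<in>M. A m) \<in> lmeasurable" "real (card M) * v \<le> measure lebesgue (\<Union>m\<in>M. A m)"
proof -
  show "(\<Union>m\<in>M. A m) \<in> lmeasurable" using assms(1,2) by (rule fmeasurable.finite_UN)
  have "real (card M) * v \<le> (\<Sum>m\<in>M. measure lebesgue (A m))" using assms(4) sum_mono[of M "\<lambda>_. v"] by simp
  also have "\<dots> = measure lebesgue (\<Union>m\<in>M. A m)"
  proof (rule measure_finite_Union[symmetric])
    show "A ` M \<subseteq> sets lebesgue" using assms(2) by (auto dest: fmeasurableD)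
    show "emeasure lebesgue (A i) \<noteq> \<infinity>" if "i \<in> M" for i
      using emeasure_eq_measure2[OF assms(2)[OF that]] by (simp del: emeasure_completion)
  qed fact+
  finally show "real (card M) * v \<le> measure lebesgue (\<Union>m\<in>M. A m)" .
qed

lemma card_int_interval_ge: "v - u - 1 \<le> real (card {\<lceil>u\<rceil>..\<lfloor>v\<rfloor>})"
  using floor_correct[of v] ceiling_correct[of u] by simp linarith

text \<open>About \<open>R\<close> shells of thickness 1/6 and radius of order \<open>R\<close>,
  centred at the radii \<open>\<theta> + m\<close>, have total volume of order \<open>R ^ n\<close>.
  A point of the ball of radius 1/12 changes the distance by at most 1/12, and half the thickness
  adds the same, which gives 1/6.\<close>

lemma shells:
  fixes \<theta> :: real
  shows "\<exists>c>0. \<exists>R0. \<forall>R\<ge>R0. \<exists>F G :: (real ^ 'n) set. F \<in> lmeasurable \<and> G \<in> lmeasurable \<and>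
      (\<forall>y\<in>F \<union> G. norm y \<le> 6 * R) \<and> c * R powr real CARD('n) \<le> measure lebesgue F \<and> c * R powr 0 \<le> measure lebesgue G \<and>
      (\<forall>x\<in>G. \<forall>y\<in>F. R \<le> norm (x - y) \<and> (\<exists>m::int. \<bar>norm (x - y) - \<theta> - real_of_int m\<bar> \<le> 1 / 6))"
proof -
  define V where "V = measure lebesgue (ball (0 :: real ^ 'n) 1)"
  have V: "V > 0" unfolding V_def using content_ball_pos[of 1 "0 :: real ^ 'n"] by simp
  have mb: "measure lborel (ball (0 :: real ^ 'n) t) = t ^ CARD('n) * V" if "t \<ge> 0" for t
    using content_ball_conv_unit_ball[OF that, of "0 :: real ^ 'n"] by (simp add: V_def)
  define c where "c = min (V / 12) ((1 / 12) ^ CARD('n) * V)"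
  have "\<exists>F G :: (real ^ 'n) set. F \<in> lmeasurable \<and> G \<in> lmeasurable \<and>
      (\<forall>y\<in>F \<union> G. norm y \<le> 6 * R) \<and> c * R powr real CARD('n) \<le> measure lebesgue F \<and> c * R powr 0 \<le> measure lebesgue G \<and>
      (\<forall>x\<in>G. \<forall>y\<in>F. R \<le> norm (x - y) \<and> (\<exists>m::int. \<bar>norm (x - y) - \<theta> - real_of_int m\<bar> \<le> 1 / 6))" if R: "R \<ge> 8" for R
  proof -
    \<comment> \<open>The margins 2 and 1 absorb the thickness and the radius of the small ball. The
      range has length \<open>R - 3\<close>, hence at least \<open>R - 4\<close> integers, and this
      is at least \<open>R / 2\<close> from \<open>R = 8\<close> on.\<close>
    define M where "M = {\<lceil>R + 2 - \<theta>\<rceil>..\<lfloor>2 * R - 1 - \<theta>\<rfloor>}"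
    define A where "A m = ball (0 :: real ^ 'n) (\<theta> + of_int m + 1 / 12) - ball 0 (\<theta> + of_int m - 1 / 12)" for m
    have M: "R + 2 \<le> \<theta> + of_int m \<and> \<theta> + of_int m \<le> 2 * R - 1" if "m \<in> M" for m
      using that unfolding M_def by (auto simp: ceiling_le_iff le_floor_iff)
    have AD: "\<theta> + of_int m - 1 / 12 \<le> norm y \<and> norm y < \<theta> + of_int m + 1 / 12" if "y \<in> A m" for m y
      using that by (auto simp: A_def)
    have mA: "R ^ (CARD('n) - 1) * V / 6 \<le> measure lebesgue (A m)" if "m \<in> M" for m
    proof -
      define t where "t = \<theta> + of_int m"
      have t: "t - 1 / 12 \<ge> R" using M[OF that] by (simp add: t_def)
      define k where "k = CARD('n) - 1"
      have k: "CARD('n) = Suc k" unfolding k_def using zero_less_card_finite[where 'a = 'n] by linarith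
      have "measure lebesgue (A m) = (t + 1 / 12) ^ CARD('n) * V - (t - 1 / 12) ^ CARD('n) * V"
        unfolding A_def t_def[symmetric]
        by (subst measurable_measure_Diff) (use t R in \<open>auto simp: mb subset_ball\<close>)
      also have "\<dots> = ((t + 1 / 12) * (t + 1 / 12) ^ k - (t - 1 / 12) * (t - 1 / 12) ^ k) * V"
        by (simp add: k algebra_simps)
      \<comment> \<open>Lowering all but one of the factors to \<open>t - 1 / 12\<close> leaves the
        thickness 1/6 times a power of the inner radius.\<close>
      also have "\<dots> \<ge> ((t + 1 / 12) * (t - 1 / 12) ^ k - (t - 1 / 12) * (t - 1 / 12) ^ k) * V"
        using t R V by (intro mult_right_mono diff_right_mono mult_left_mono power_mono) auto
      also have "((t + 1 / 12) * (t - 1 / 12) ^ k - (t - 1 / 12) * (t - 1 / 12) ^ k) * V = (t - 1 / 12) ^ k * V / 6"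
        by (simp add: algebra_simps)
      also have "\<dots> \<ge> R ^ k * V / 6" using t R V by (intro divide_right_mono mult_right_mono power_mono) auto
      finally show ?thesis by (simp add: k_def)
    qed
    have disj: "disjoint_family_on A M"
      unfolding disjoint_family_on_def
    proof (intro ballI impI)
      fix m m' :: int assume "m \<noteq> m'"
      then have "\<bar>of_int m - of_int m'\<bar> \<ge> (1 :: real)" by linarith
      then show "A m \<inter> A m' = {}" using AD[of _ m] AD[of _ m'] by force
    qed
    have Am: "A m \<in> lmeasurable" for m unfolding A_def by (intro fmeasurable.Diff) auto
    note U = measure_UN_ge[OF _ Am disj mA, unfolded M_def, OF finite_atLeastAtMost_int, folded M_def]
    have "R / 2 \<le> real (card M)" using card_int_interval_ge[of "2 * R - 1 - \<theta>" "R + 2 - \<theta>", folded M_def] R by simp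
    then have "R / 2 * (R ^ (CARD('n) - 1) * V / 6) \<le> real (card M) * (R ^ (CARD('n) - 1) * V / 6)"
      using V R by (intro mult_right_mono) auto
    also have "\<dots> \<le> measure lebesgue (\<Union>m\<in>M. A m)" using U(2) by blast
    finally have "R / 2 * (R ^ (CARD('n) - 1) * V / 6) \<le> measure lebesgue (\<Union>m\<in>M. A m)" .
    moreover have "R / 2 * (R ^ (CARD('n) - 1) * V / 6) = V / 12 * R powr real CARD('n)"
    proof -
      have "R powr real CARD('n) = R * R ^ (CARD('n) - 1)"
        using R power_minus_mult[of "CARD('n)" R] by (simp add: powr_realpow mult.commute)
      then show ?thesis by simp
    qed
    moreover have "c * R powr real CARD('n) \<le> V / 12 * R powr real CARD('n)"
      by (intro mult_right_mono) (auto simp: c_def)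
    ultimately have mF: "c * R powr real CARD('n) \<le> measure lebesgue (\<Union>m\<in>M. A m)" by (simp only:)
    have "c * R powr 0 \<le> measure lebesgue (ball (0 :: real ^ 'n) (1 / 12))" using R by (simp add: mb c_def)
    moreover have "norm y \<le> 6 * R" if "y \<in> (\<Union>m\<in>M. A m) \<union> ball 0 (1 / 12)" for y
      using that AD M R by force
    moreover have "R \<le> norm (x - y) \<and> (\<exists>m::int. \<bar>norm (x - y) - \<theta> - real_of_int m\<bar> \<le> 1 / 6)"
      if "x \<in> ball 0 (1 / 12)" and yF: "y \<in> (\<Union>m\<in>M. A m)" for x y
    proof -
      obtain m where m: "m \<in> M" "y \<in> A m" using yF by blast
      have "\<bar>norm (x - y) - norm y\<bar> \<le> 1 / 12" using that(1) norm_triangle_ineq3[of "y - x" y] by (simp add: norm_minus_commute)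
      then have "R \<le> norm (x - y)" "\<bar>norm (x - y) - \<theta> - real_of_int m\<bar> \<le> 1 / 6" using AD[OF m(2)] M[OF m(1)] by linarith+
      then show ?thesis by blast
    qed
    ultimately show ?thesis using mF U(1)
      by (intro exI[of _ "\<Union>m\<in>M. A m"] exI[of _ "ball 0 (1 / 12)"] conjI) auto
  qed
  moreover have "c > 0" using V by (simp add: c_def)
  ultimately show ?thesis by blast
qed


text \<open>At least \<open>R / 2\<close> planks at unit spacing, each of thickness
  \<open>\<eta>\<close> and of width \<open>2 * \<eta> * sqrt R\<close> in the other
  \<open>n - 1\<close> directions, so the total is of order
  \<open>R * sqrt R ^ (n - 1)\<close>.\<close>

lemma plank_stack:
  fixes i0 :: "'n::finite" and t lo :: real
  assumes \<eta>: "0 < \<eta>" "\<eta> < 1" and R: "R \<ge> 2"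
  shows "\<exists>P :: (real ^ 'n) set. P \<in> lmeasurable \<and>
    \<eta> * (2 * \<eta>) ^ (CARD('n) - 1) / 2 * R powr ((real CARD('n) + 1) / 2) \<le> measure lebesgue P \<and>
    (\<forall>x\<in>P. (\<exists>m::int. lo \<le> t + of_int m \<and> t + of_int m \<le> lo + R \<and> t + of_int m \<le> x $ i0 \<and> x $ i0 \<le> t + of_int m + \<eta>) \<and>
       (\<forall>i. i \<noteq> i0 \<longrightarrow> \<bar>x $ i\<bar> \<le> \<eta> * sqrt R))"
proof -
  define w where "w = \<eta> * sqrt R"
  have w: "w > 0" using \<eta> R by (simp add: w_def)
  define lower upper :: "real \<Rightarrow> real ^ 'n" where "lower u = (\<chi> i. if i = i0 then u else - w)"
    and "upper u = (\<chi> i. if i = i0 then u + \<eta> else w)" for u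
  define A where "A m = cbox (lower (t + of_int m)) (upper (t + of_int m))" for m :: int
  define M where "M = {\<lceil>lo - t\<rceil>..\<lfloor>lo + R - t\<rfloor>}"
  have M: "lo \<le> t + of_int m \<and> t + of_int m \<le> lo + R" if "m \<in> M" for m
    using that unfolding M_def by (auto simp: ceiling_le_iff le_floor_iff)
  have AD: "t + of_int m \<le> x $ i0 \<and> x $ i0 \<le> t + of_int m + \<eta> \<and> (\<forall>i. i \<noteq> i0 \<longrightarrow> \<bar>x $ i\<bar> \<le> w)" if "x \<in> A m" for x m
  proof -
    have b: "lower (t + of_int m) $ i \<le> x $ i \<and> x $ i \<le> upper (t + of_int m) $ i" for i
      using that by (auto simp: A_def mem_box_cart)
    have "\<bar>x $ i\<bar> \<le> w" if "i \<noteq> i0" for i using b[of i] that by (auto simp: lower_def upper_def abs_le_iff)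
    then show ?thesis using b[of i0] by (simp add: lower_def upper_def)
  qed
  have mA: "measure lebesgue (A m) = \<eta> * (2 * w) ^ (CARD('n) - 1)" for m
  proof -
    have "lower u $ i \<le> upper u $ i" for u i using \<eta> w by (simp add: lower_def upper_def)
    then have "cbox (lower (t + of_int m)) (upper (t + of_int m)) \<noteq> {}" by (simp add: interval_ne_empty_cart)
    then have "measure lebesgue (A m) = (\<Prod>i\<in>UNIV. upper (t + of_int m) $ i - lower (t + of_int m) $ i)"
      unfolding A_def by (simp add: content_cbox_cart)
    also have "\<dots> = \<eta> * (\<Prod>i\<in>UNIV - {i0}. upper (t + of_int m) $ i - lower (t + of_int m) $ i)"
      by (subst prod.remove[of UNIV i0]) (auto simp: lower_def upper_def)
    also have "(\<Prod>i\<in>UNIV - {i0}. upper (t + of_int m) $ i - lower (t + of_int m) $ i) = (\<Prod>i\<in>UNIV - {i0}. 2 * w)"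
      by (intro prod.cong) (auto simp: lower_def upper_def)
    finally show ?thesis by simp
  qed
  have disj: "disjoint_family_on A M"
    unfolding disjoint_family_on_def
  proof (intro ballI impI)
    fix m m' :: int assume "m \<noteq> m'"
    then have "\<bar>of_int m - of_int m'\<bar> \<ge> (1 :: real)" by linarith
    then show "A m \<inter> A m' = {}" using AD[of _ m] AD[of _ m'] \<eta> by force
  qed
  have Am: "A m \<in> lmeasurable" for m unfolding A_def by simp
  have fin: "finite M" by (simp add: M_def)
  note U = measure_UN_ge[OF fin Am disj, of "\<eta> * (2 * w) ^ (CARD('n) - 1)"]
  have card: "R / 2 \<le> real (card M)"
    using card_int_interval_ge[of "lo + R - t" "lo - t", folded M_def] R by simp
  have "R powr ((real CARD('n) + 1) / 2) = R * sqrt R ^ (CARD('n) - 1)"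
  proof -
    define k where "k = CARD('n) - 1"
    have k: "CARD('n) = Suc k" unfolding k_def using zero_less_card_finite[where 'a = 'n] by linarith
    have "(real CARD('n) + 1) / 2 = 1 + 1 / 2 * real k" by (simp add: k)
    moreover have "sqrt R ^ k = R powr (1 / 2 * real k)" using R by (simp add: powr_half_sqrt[symmetric] powr_power)
    ultimately show ?thesis using R by (simp only: powr_add powr_one k_def[symmetric])
  qed
  then have "\<eta> * (2 * \<eta>) ^ (CARD('n) - 1) / 2 * R powr ((real CARD('n) + 1) / 2) = R / 2 * (\<eta> * (2 * w) ^ (CARD('n) - 1))"
    by (simp add: w_def power_mult_distrib)
  also have "\<dots> \<le> real (card M) * (\<eta> * (2 * w) ^ (CARD('n) - 1))" using card \<eta> w by (intro mult_right_mono) auto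
  also have "\<dots> \<le> measure lebesgue (\<Union>m\<in>M. A m)" by (rule U(2)) (simp_all add: mA)
  finally have "\<eta> * (2 * \<eta>) ^ (CARD('n) - 1) / 2 * R powr ((real CARD('n) + 1) / 2) \<le> measure lebesgue (\<Union>m\<in>M. A m)" .
  moreover have "(\<Union>m\<in>M. A m) \<in> lmeasurable" by (rule U(1)) (simp_all add: mA)
  moreover have "(\<exists>m::int. lo \<le> t + of_int m \<and> t + of_int m \<le> lo + R \<and> t + of_int m \<le> x $ i0 \<and> x $ i0 \<le> t + of_int m + \<eta>) \<and>
       (\<forall>i. i \<noteq> i0 \<longrightarrow> \<bar>x $ i\<bar> \<le> \<eta> * sqrt R)" if "x \<in> (\<Union>m\<in>M. A m)" for x
    using that AD M unfolding w_def by blast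
  ultimately show ?thesis by blast
qed

text \<open>A transversal displacement of order \<open>\<eta> * sqrt R\<close> over a distance at
  least \<open>R\<close> changes that distance only by an amount independent of \<open>R\<close>. So
  distances are governed by the difference of the \<open>i0\<close> coordinates;
  \<open>sqrt R\<close> is the largest order of width with this property.\<close>

lemma planks:
  fixes \<theta> :: real
  shows "\<exists>c>0. \<forall>R\<ge>2. \<exists>F G :: (real ^ 'n) set. F \<in> lmeasurable \<and> G \<in> lmeasurable \<and>
      (\<forall>y\<in>F \<union> G. norm y \<le> 6 * R) \<and> c * R powr ((real CARD('n) + 1) / 2) \<le> measure lebesgue F \<and>
      c * R powr ((real CARD('n) + 1) / 2) \<le> measure lebesgue G \<and>
      (\<forall>x\<in>G. \<forall>y\<in>F. R \<le> norm (x - y) \<and> (\<exists>m::int. \<bar>norm (x - y) - \<theta> - real_of_int m\<bar> \<le> 1 / 6))"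
proof -
  define n where "n = real CARD('n)"
  have n1: "n \<ge> 1" unfolding n_def by (simp add: Suc_le_eq)
  \<comment> \<open>With this value the sum of the \<open>n\<close> transversal squares is at most
    \<open>R * \<eta> / 5\<close>. The phase error is then at most
    \<open>\<eta> + \<eta> / 5\<close>, well below 1/6.\<close>
  define \<eta> where "\<eta> = 1 / (20 * n)"
  have \<eta>: "0 < \<eta>" "\<eta> \<le> 1 / 20" "n * \<eta> = 1 / 20" using n1 by (auto simp: \<eta>_def field_simps)
  define c where "c = \<eta> * (2 * \<eta>) ^ (CARD('n) - 1) / 2"
  obtain i0 :: 'n where "True" by blast
  have "\<exists>F G :: (real ^ 'n) set. F \<in> lmeasurable \<and> G \<in> lmeasurable \<and>
      (\<forall>y\<in>F \<union> G. norm y \<le> 6 * R) \<and> c * R powr ((real CARD('n) + 1) / 2) \<le> measure lebesgue F \<and>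
      c * R powr ((real CARD('n) + 1) / 2) \<le> measure lebesgue G \<and>
      (\<forall>x\<in>G. \<forall>y\<in>F. R \<le> norm (x - y) \<and> (\<exists>m::int. \<bar>norm (x - y) - \<theta> - real_of_int m\<bar> \<le> 1 / 6))" if R: "R \<ge> 2" for R
  proof -
    define w where "w = \<eta> * sqrt R"
    have \<eta>1: "\<eta> < 1" using \<eta>(2) by simp
    obtain F :: "(real ^ 'n) set" where F: "F \<in> lmeasurable" "c * R powr ((real CARD('n) + 1) / 2) \<le> measure lebesgue F"
      "\<And>y. y \<in> F \<Longrightarrow> \<exists>m::int. 0 \<le> 0 + real_of_int m \<and> 0 + real_of_int m \<le> 0 + R \<and> 0 + real_of_int m \<le> y $ i0 \<and> y $ i0 \<le> 0 + real_of_int m + \<eta>"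
      "\<And>y i. y \<in> F \<Longrightarrow> i \<noteq> i0 \<Longrightarrow> \<bar>y $ i\<bar> \<le> w"
      using plank_stack[OF \<eta>(1) \<eta>1 R, of 0 0 i0] unfolding c_def w_def by blast
    \<comment> \<open>The first stack sits at integers in \<open>{0..R}\<close>, this one at
      \<open>\<theta>\<close> plus integers in \<open>{3 * R..4 * R}\<close>. The differences are
      therefore near \<open>\<theta>\<close> plus an integer and at least \<open>R\<close>.\<close>
    obtain G :: "(real ^ 'n) set" where G: "G \<in> lmeasurable" "c * R powr ((real CARD('n) + 1) / 2) \<le> measure lebesgue G"
      "\<And>y. y \<in> G \<Longrightarrow> \<exists>m::int. 3 * R \<le> \<theta> + of_int m \<and> \<theta> + of_int m \<le> 3 * R + R \<and> \<theta> + of_int m \<le> y $ i0 \<and> y $ i0 \<le> \<theta> + of_int m + \<eta>"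
      "\<And>y i. y \<in> G \<Longrightarrow> i \<noteq> i0 \<Longrightarrow> \<bar>y $ i\<bar> \<le> w"
      using plank_stack[OF \<eta>(1) \<eta>1 R, of "3 * R" \<theta> i0] unfolding c_def w_def by blast
    have w0: "w \<ge> 0" using \<eta> R by (simp add: w_def)
    have nw: "n * w \<le> R"
    proof -
      have "sqrt R * 1 \<le> sqrt R * sqrt R" using R by (intro mult_left_mono) auto
      then have "sqrt R \<le> R" using R by simp
      moreover have "n * w = sqrt R / 20" using \<eta>(3) by (simp add: w_def mult.assoc[symmetric])
      ultimately show ?thesis using R by simp
    qed
    have norm: "norm y \<le> 6 * R" if y: "\<bar>y $ i0\<bar> \<le> 4 * R + 1" "\<And>i. i \<noteq> i0 \<Longrightarrow> \<bar>y $ i\<bar> \<le> w" for y :: "real ^ 'n"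
    proof -
      have "norm y \<le> (\<Sum>i\<in>UNIV. \<bar>y $ i\<bar>)" by (rule norm_le_l1_cart)
      also have "\<dots> = \<bar>y $ i0\<bar> + (\<Sum>i\<in>UNIV - {i0}. \<bar>y $ i\<bar>)" by (rule sum.remove) auto
      also have "(\<Sum>i\<in>UNIV - {i0}. \<bar>y $ i\<bar>) \<le> (\<Sum>i\<in>UNIV - {i0}. w)" by (intro sum_mono) (use y in auto)
      also have "\<dots> \<le> (\<Sum>i\<in>(UNIV :: 'n set). w)" using w0 by (intro sum_mono2) auto
      also have "\<dots> = n * w" by (simp add: n_def)
      finally show ?thesis using y(1) nw R by linarith
    qed
    have "norm y \<le> 6 * R" if "y \<in> F \<union> G" for y
      using that
    proof
      assume y: "y \<in> F"
      show ?thesis using F(3)[OF y] \<eta>1 R by (intro norm F(4)[OF y]) auto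
    next
      assume y: "y \<in> G"
      show ?thesis using G(3)[OF y] \<eta>1 R by (intro norm G(4)[OF y]) auto
    qed
    moreover have "R \<le> norm (x - y) \<and> (\<exists>m::int. \<bar>norm (x - y) - \<theta> - real_of_int m\<bar> \<le> 1 / 6)" if x: "x \<in> G" and y: "y \<in> F" for x y
    proof -
      define d where "d = (x - y) $ i0"
      obtain k l :: int where k: "0 \<le> real_of_int k" "real_of_int k \<le> R" "real_of_int k \<le> y $ i0" "y $ i0 \<le> real_of_int k + \<eta>"
        and l: "3 * R \<le> \<theta> + of_int l" "\<theta> + of_int l \<le> 3 * R + R" "\<theta> + of_int l \<le> x $ i0" "x $ i0 \<le> \<theta> + of_int l + \<eta>"
        using F(3)[OF y] G(3)[OF x] by auto
      have d: "d \<ge> R" "\<bar>d - \<theta> - real_of_int (l - k)\<bar> \<le> \<eta>"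
        using k l \<eta>1 R by (auto simp: d_def)
      have Nd: "d \<le> norm (x - y)" using component_le_norm_cart[of "x - y" i0] by (simp add: d_def)
      have "(norm (x - y))\<^sup>2 = (\<Sum>i\<in>UNIV. ((x - y) $ i)\<^sup>2)"
        by (simp add: norm_vec_def L2_set_def real_sqrt_pow2 sum_nonneg)
      also have "\<dots> = d\<^sup>2 + (\<Sum>i\<in>UNIV - {i0}. ((x - y) $ i)\<^sup>2)" unfolding d_def by (rule sum.remove) auto
      also have "(\<Sum>i\<in>UNIV - {i0}. ((x - y) $ i)\<^sup>2) \<le> (\<Sum>i\<in>UNIV - {i0}. (2 * w)\<^sup>2)"
      proof (rule sum_mono)
        fix i assume "i \<in> UNIV - {i0}"
        then have "\<bar>(x - y) $ i\<bar> \<le> 2 * w" using F(4)[OF y, of i] G(4)[OF x, of i] by auto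
        then show "((x - y) $ i)\<^sup>2 \<le> (2 * w)\<^sup>2" using power_mono[of "\<bar>(x - y) $ i\<bar>" "2 * w" 2] by simp
      qed
      also have "\<dots> \<le> (\<Sum>i\<in>(UNIV :: 'n set). (2 * w)\<^sup>2)" by (intro sum_mono2) auto
      \<comment> \<open>\<open>n * (2 * w)\<^sup>2 = 4 * n * \<eta>\<^sup>2 * R\<close>, and
        \<open>n * \<eta> = 1 / 20\<close>. Next \<open>R \<le> d\<close> allows completing the
        square.\<close>
      also have "\<dots> = R * (\<eta> / 5)"
        using \<eta>(3) R by (simp add: n_def[symmetric] w_def power_mult_distrib power2_eq_square[of \<eta>] mult.assoc[symmetric])
      also have "d\<^sup>2 + R * (\<eta> / 5) \<le> d\<^sup>2 + d * (\<eta> / 5)" using d(1) \<eta>(1) by (intro add_left_mono mult_right_mono) auto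
      also have "\<dots> \<le> (d + \<eta> / 5)\<^sup>2" using d(1) R \<eta>(1) by (simp add: power2_eq_square algebra_simps)
      finally have "norm (x - y) \<le> d + \<eta> / 5" by (rule power2_le_imp_le) (use d(1) R \<eta>(1) in auto)
      then have "\<bar>norm (x - y) - \<theta> - real_of_int (l - k)\<bar> \<le> 1 / 6" using d(2) Nd \<eta>(2) by argo
      then show ?thesis using d(1) Nd by (intro conjI exI[of _ "l - k"]) auto
    qed
    ultimately show ?thesis using F(1,2) G(1,2) by blast
  qed
  moreover have "c > 0" using \<eta> by (simp add: c_def)
  ultimately show ?thesis by blast
qed

text \<open>The exponent inequality is used for the powers \<open>(n, 0)\<close> and
  \<open>(0, n)\<close> of \<open>R\<close>, shells against a ball in both roles, and for
  \<open>(n + 1) / 2\<close> in both places, the planks.\<close>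

theorem sparse_norm_bochner_riesz_infinite:
  fixes p r s \<delta> :: real
  assumes dim: "CARD('n::finite) \<ge> 2" and \<delta>: "0 < \<delta>" "\<delta> < (real CARD('n) - 1) / 2"
    and p: "real CARD('n) / p = (real CARD('n) + 1) / 2 + \<delta>"
    and rs: "1 \<le> r" "1 \<le> s" "1 / r + 1 / s > 1"
    and out: "(1 / r, 1 / s) \<notin> closure (trapezoid CARD('n) p \<delta>)"
  shows "\<not> sparse_norm (bochner_riesz \<delta> :: (real ^ 'n \<Rightarrow> complex) \<Rightarrow> _) r s < \<infinity>"
proof
  assume fin: "sparse_norm (bochner_riesz \<delta> :: (real ^ 'n \<Rightarrow> complex) \<Rightarrow> _) r s < \<infinity>"
  define n where "n = real CARD('n)"
  define a where "a = \<delta> + real (CARD('n) - 1) / 2"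
  have n2: "n \<ge> 2" using dim by (simp add: n_def)
  have a: "a = \<delta> + (n - 1) / 2" using dim by (simp add: a_def n_def of_nat_diff)
  have a0: "a > 0" unfolding a using \<delta> n2 by (intro add_pos_pos) auto
  define x where "x = 1 / r"
  define y where "y = 1 / s"
  define t where "t = 2 * \<delta> / (n - 1)"
  define q where "q = 1 / p"
  \<comment> \<open>The critical value is the one for which \<open>n / p\<close> equals the decay
    exponent \<open>a + 1\<close> of the kernel. The range of \<open>\<delta>\<close> places it
    between \<open>n / 2\<close> and \<open>n\<close>, whence \<open>1 < p < 2\<close>.\<close>
  have nq: "n * q = a + 1" using p by (simp add: n_def[symmetric] q_def a field_simps)
  have q: "1 / 2 < q" "q < 1"
  proof -
    have "n * (1 / 2) < n * q" "n * q < n * 1" unfolding nq a using \<delta> by (auto simp: n_def[symmetric] field_simps)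
    then show "1 / 2 < q" "q < 1" using n2 by (simp_all only: mult_less_cancel_left_pos)
  qed
  have "0 < q" by (rule less_trans[OF _ q(1)]) simp
  then have "p > 0" by (simp add: q_def)
  with q have p12: "1 < p" "p < 2" unfolding q_def by (auto simp: field_simps)
  obtain \<theta> c1 \<rho>0 where osc: "c1 > 0" "\<And>\<rho> m. \<rho> \<ge> \<rho>0 \<Longrightarrow> \<bar>\<rho> - \<theta> - real_of_int m\<bar> \<le> 1 / 6 \<Longrightarrow> c1 * \<rho> powr - (a + 1) \<le> Re (osc a \<rho>)"
    using osc_lower_bound[OF a0] by blast
  note exponents = exponents_of_finite_sparse_norm[OF \<delta>(1) rs fin, folded a_def n_def, folded x_def y_def, OF osc(1)]
  obtain c R0 where c: "c > 0" and shell: "\<And>R. R \<ge> R0 \<Longrightarrow> \<exists>F G :: (real ^ 'n) set. F \<in> lmeasurable \<and> G \<in> lmeasurable \<and>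
      (\<forall>y\<in>F \<union> G. norm y \<le> 6 * R) \<and> c * R powr n \<le> measure lebesgue F \<and> c * R powr 0 \<le> measure lebesgue G \<and>
      (\<forall>x\<in>G. \<forall>y\<in>F. R \<le> norm (x - y) \<and> (\<exists>m::int. \<bar>norm (x - y) - \<theta> - real_of_int m\<bar> \<le> 1 / 6))"
    using shells[where 'n = 'n, of \<theta>] unfolding n_def by blast
  have swapped: "\<exists>F G :: (real ^ 'n) set. F \<in> lmeasurable \<and> G \<in> lmeasurable \<and>
      (\<forall>y\<in>F \<union> G. norm y \<le> 6 * R) \<and> c * R powr 0 \<le> measure lebesgue F \<and> c * R powr n \<le> measure lebesgue G \<and>
      (\<forall>x\<in>G. \<forall>y\<in>F. R \<le> norm (x - y) \<and> (\<exists>m::int. \<bar>norm (x - y) - \<theta> - real_of_int m\<bar> \<le> 1 / 6))" if R: "R \<ge> R0" for R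
  proof -
    obtain F G :: "(real ^ 'n) set" where FG: "F \<in> lmeasurable" "G \<in> lmeasurable"
      "\<forall>y\<in>F \<union> G. norm y \<le> 6 * R" "c * R powr n \<le> measure lebesgue F" "c * R powr 0 \<le> measure lebesgue G"
      "\<forall>x\<in>G. \<forall>y\<in>F. R \<le> norm (x - y) \<and> (\<exists>m::int. \<bar>norm (x - y) - \<theta> - real_of_int m\<bar> \<le> 1 / 6)"
      using shell[OF R] by blast
    have "R \<le> norm (x - y) \<and> (\<exists>m::int. \<bar>norm (x - y) - \<theta> - real_of_int m\<bar> \<le> 1 / 6)" if "x \<in> F" "y \<in> G" for x y
      using that FG(6) unfolding norm_minus_commute[of x y] by blast
    then show ?thesis
      using FG(1-5) by (rule_tac exI[of _ G], rule_tac exI[of _ F]) (simp only: Un_commute; blast)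
  qed
  have "n * (1 - x) + 0 * (1 - y) - (a + 1) \<le> n * (1 - (x + y))" by (rule exponents, fact osc(2), fact c, fact shell)
  then have "n * y \<le> n * q" unfolding nq by (simp add: algebra_simps)
  then have yq: "y \<le> q" using n2 by simp
  have "0 * (1 - x) + n * (1 - y) - (a + 1) \<le> n * (1 - (x + y))" by (rule exponents, fact osc(2), fact c, fact swapped)
  then have "n * x \<le> n * q" unfolding nq by (simp add: algebra_simps)
  then have xq: "x \<le> q" using n2 by simp
  obtain c' where c': "c' > 0" and plank: "\<And>R. R \<ge> 2 \<Longrightarrow> \<exists>F G :: (real ^ 'n) set. F \<in> lmeasurable \<and> G \<in> lmeasurable \<and>
      (\<forall>y\<in>F \<union> G. norm y \<le> 6 * R) \<and> c' * R powr ((n + 1) / 2) \<le> measure lebesgue F \<and> c' * R powr ((n + 1) / 2) \<le> measure lebesgue G \<and>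
      (\<forall>x\<in>G. \<forall>y\<in>F. R \<le> norm (x - y) \<and> (\<exists>m::int. \<bar>norm (x - y) - \<theta> - real_of_int m\<bar> \<le> 1 / 6))"
    using planks[where 'n = 'n, of \<theta>] unfolding n_def by blast
  have "(n + 1) / 2 * (1 - x) + (n + 1) / 2 * (1 - y) - (a + 1) \<le> n * (1 - (x + y))" by (rule exponents, fact osc(2), fact c', fact plank)
  then have "(x + y) * (n - 1) \<le> (n - 1) + 2 * \<delta>" unfolding a by (simp add: field_simps)
  then have xyt: "x + y \<le> 1 + t" using n2 by (simp add: t_def field_simps)
  have t0: "t > 0" using \<delta> n2 by (simp add: t_def)
  \<comment> \<open>The shells bound both coordinates by \<open>q\<close>, which is at most the
    value \<open>q + (1 - q) * t\<close> at the sides of the trapezoid.\<close>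
  have "q \<le> q + (1 - q) * t" using q t0 by simp
  then have "(x, y) \<in> closure (trapezoid CARD('n) p \<delta>)"
    using in_closure_trapezoid[OF p12 dim \<delta>, folded n_def, folded t_def, folded q_def, of x y] xq yq xyt rs(3)
    by (simp add: x_def y_def)
  then show False using out by (simp add: x_def y_def)
qed

theorem theorem2p6:
  fixes p0 :: real and chi :: "real \<Rightarrow> real"
  assumes dim: "CARD('n::finite) \<ge> 2"
    and p0: "1 < p0" "p0 < 2"
    and chi_schwartz: "schwartz chi"
    and chi_bounds: "\<And>t. indicator {-1/4..1/4} t \<le> chi t" "\<And>t. chi t \<le> indicator {-1/2..1/2} t"
    and S_bound: "\<And>\<epsilon>::real. 0 < \<epsilon> \<Longrightarrow> \<epsilon> < 1 \<Longrightarrow>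
      \<exists>C::real. \<forall>\<tau>. 0 < \<tau> \<and> \<tau> < 1 \<longrightarrow>
        Lp_op_norm p0 (annular_op chi \<tau> :: (real ^ 'n \<Rightarrow> complex) \<Rightarrow> real ^ 'n \<Rightarrow> complex)
          \<le> ennreal (C * \<tau> powr (- \<epsilon>))"
  shows "\<forall>\<delta>::real. 0 < \<delta> \<and> \<delta> < (real CARD('n) - 1) / 2 \<longrightarrow>
    (\<forall>r s :: real. 1 \<le> r \<and> 1 \<le> s \<and> (1 / r, 1 / s) \<in> trapezoid CARD('n) p0 \<delta> \<longrightarrow>
       sparse_norm (bochner_riesz \<delta> :: (real ^ 'n \<Rightarrow> complex) \<Rightarrow> real ^ 'n \<Rightarrow> complex) r s < \<infinity>) \<and>
    (\<forall>p\<^sub>\<delta> r s :: real. real CARD('n) / p\<^sub>\<delta> = (real CARD('n) + 1) / 2 + \<delta> \<and>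
         1 \<le> r \<and> 1 \<le> s \<and> 1 / r + 1 / s > 1 \<and>
         (1 / r, 1 / s) \<notin> closure (trapezoid CARD('n) p\<^sub>\<delta> \<delta>) \<longrightarrow>
       \<not> sparse_norm (bochner_riesz \<delta> :: (real ^ 'n \<Rightarrow> complex) \<Rightarrow> real ^ 'n \<Rightarrow> complex) r s < \<infinity>)"
proof (intro allI impI conjI; elim conjE)
  fix \<delta> r s :: real
  assume \<delta>0: "0 < \<delta>" and \<delta>n: "\<delta> < (real CARD('n) - 1) / 2" and rs: "1 \<le> r" "1 \<le> s"
    and tr: "(1 / r, 1 / s) \<in> trapezoid CARD('n) p0 \<delta>"
  interpret riesz_setup chi \<delta>
    by unfold_locales (use chi_schwartz chi_bounds \<delta>0 in auto)
  show "sparse_norm (bochner_riesz \<delta> :: (real ^ 'n \<Rightarrow> complex) \<Rightarrow> real ^ 'n \<Rightarrow> complex) r s < \<infinity>"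
    by (rule sparse_norm_bochner_riesz_finite[OF dim \<delta>n p0 S_bound rs tr])
next
  fix \<delta> p r s :: real
  assume "0 < \<delta>" "\<delta> < (real CARD('n) - 1) / 2" "real CARD('n) / p = (real CARD('n) + 1) / 2 + \<delta>"
    "1 \<le> r" "1 \<le> s" "1 / r + 1 / s > 1" "(1 / r, 1 / s) \<notin> closure (trapezoid CARD('n) p \<delta>)"
  then show "\<not> sparse_norm (bochner_riesz \<delta> :: (real ^ 'n \<Rightarrow> complex) \<Rightarrow> real ^ 'n \<Rightarrow> complex) r s < \<infinity>"
    by (rule sparse_norm_bochner_riesz_infinite[OF dim])
qed

end
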